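(* Let $(A,\mathfrak{m})$ be a Cohen–Macaulay local ring with $\dim A\ge3$. Let $I\subseteq J$ be $\mathfrak{m}$-primary ideals of $A$ with $I$ a reduction of $J$. Suppose $Gr_I(A)$ is Cohen–Macaulay and $J$ is asymptotically normal. Then $e_3^J(A)\ge e_3^I(A)$.
   Context: $Gr_I(A)=\bigoplus_{n\ge0}I^n/I^{n+1}$. $J$ is asymptotically normal if $J^n$ is integrally closed for all $n\gg0$. For an $\mathfrak{m}$-primary ideal $K$ and $d=\dim A$, the Hilbert coefficients $e_i^K(A)$ are the integers with $\lambda(A/K^{n+1})=\sum_{i=0}^d(-1)^ie_i^K(A)\binom{n+d-i}{d-i}$ for $n\gg0$. A reduction: $I J^n=J^{n+1}$ for large $n$. *)

theory Defs
  imports "HOL-Algebra.Algebra" "HOL-Library.Extended_Nat"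
begin

primrec ideal_pow :: "('a, 'b) ring_scheme \<Rightarrow> 'a set \<Rightarrow> nat \<Rightarrow> 'a set" where
  "ideal_pow R I 0 = carrier R"
| "ideal_pow R I (Suc n) = ideal_prod R I (ideal_pow R I n)"

definition ideal_radical :: "('a, 'b) ring_scheme \<Rightarrow> 'a set \<Rightarrow> 'a set" where
  "ideal_radical R I = {x \<in> carrier R. \<exists>n::nat. x [^]\<^bsub>R\<^esub> n \<in> I}"

definition primary_ideal :: "('a, 'b) ring_scheme \<Rightarrow> 'a set \<Rightarrow> bool" where
  "primary_ideal R Q \<longleftrightarrow> ideal Q R \<and> Q \<noteq> carrier R \<and>
     (\<forall>a\<in>carrier R. \<forall>b\<in>carrier R. a \<otimes>\<^bsub>R\<^esub> b \<in> Q \<longrightarrow> a \<in> Q \<or> b \<in> ideal_radical R Q)"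

definition m_primary :: "('a, 'b) ring_scheme \<Rightarrow> 'a set \<Rightarrow> 'a set \<Rightarrow> bool" where
  "m_primary R m Q \<longleftrightarrow> primary_ideal R Q \<and> ideal_radical R Q = m"

definition krull_dim :: "('a, 'b) ring_scheme \<Rightarrow> enat" where
  "krull_dim R = (SUP n \<in> {n. \<exists>P. (\<forall>i\<le>n. primeideal (P i) R) \<and> (\<forall>i<n. P i \<subset> P (Suc i))}. enat n)"

definition ideal_height :: "('a, 'b) ring_scheme \<Rightarrow> 'a set \<Rightarrow> enat" where
  "ideal_height R Q = (SUP n \<in> {n. \<exists>P. (\<forall>i\<le>n. primeideal (P i) R) \<and> (\<forall>i<n. P i \<subset> P (Suc i))
                                      \<and> P n = Q}. enat n)"

definition regular_seq :: "('a, 'b) ring_scheme \<Rightarrow> 'a set \<Rightarrow> 'a list \<Rightarrow> bool" where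
  "regular_seq R M xs \<longleftrightarrow> set xs \<subseteq> M \<and>
     (\<forall>i<length xs. \<forall>y\<in>carrier R.
        (xs ! i) \<otimes>\<^bsub>R\<^esub> y \<in> Idl\<^bsub>R\<^esub> (set (take i xs)) \<longrightarrow> y \<in> Idl\<^bsub>R\<^esub> (set (take i xs))) \<and>
     Idl\<^bsub>R\<^esub> (set xs) \<noteq> carrier R"

definition grade :: "('a, 'b) ring_scheme \<Rightarrow> 'a set \<Rightarrow> enat" where
  "grade R M = (SUP xs \<in> {xs. regular_seq R M xs}. enat (length xs))"

definition local_ring :: "('a, 'b) ring_scheme \<Rightarrow> 'a set \<Rightarrow> bool" where
  "local_ring R m \<longleftrightarrow> cring R \<and> noetherian_ring R \<and> maximalideal m R \<and>
     (\<forall>M. maximalideal M R \<longrightarrow> M = m)"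

definition cm_local :: "('a, 'b) ring_scheme \<Rightarrow> 'a set \<Rightarrow> bool" where
  "cm_local R m \<longleftrightarrow> local_ring R m \<and> grade R m = krull_dim R"

text \<open>Cohen--Macaulay (Noetherian, commutative) ring: all localizations at maximal ideals are
  CM, expressed as grade M = height M for every maximal ideal M.\<close>
definition cohen_macaulay_ring :: "('a, 'b) ring_scheme \<Rightarrow> bool" where
  "cohen_macaulay_ring R \<longleftrightarrow> cring R \<and> noetherian_ring R \<and>
     (\<forall>M. maximalideal M R \<longrightarrow> grade R M = ideal_height R M)"

definition gr_rep :: "'a set \<Rightarrow> 'a" where
  "gr_rep S = (SOME y. y \<in> S)"

definition assoc_graded :: "('a, 'b) ring_scheme \<Rightarrow> 'a set \<Rightarrow> (nat \<Rightarrow> 'a set) ring" where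
  "assoc_graded R I =
     \<lparr> partial_object.carrier = {f. (\<forall>n. f n \<in> (\<lambda>x. ideal_pow R I (Suc n) +>\<^bsub>R\<^esub> x) ` ideal_pow R I n)
                    \<and> finite {n. f n \<noteq> ideal_pow R I (Suc n)}},
       Group.monoid.mult = (\<lambda>f g n. ideal_pow R I (Suc n) +>\<^bsub>R\<^esub>
                 (\<Oplus>\<^bsub>R\<^esub>i\<in>{..n}. gr_rep (f i) \<otimes>\<^bsub>R\<^esub> gr_rep (g (n - i)))),
       Group.monoid.one = (\<lambda>n. ideal_pow R I (Suc n) +>\<^bsub>R\<^esub> (if n = 0 then \<one>\<^bsub>R\<^esub> else \<zero>\<^bsub>R\<^esub>)),
       ring.zero = (\<lambda>n. ideal_pow R I (Suc n)),
       ring.add = (\<lambda>f g n. f n <+>\<^bsub>R\<^esub> g n) \<rparr>"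

definition quotient_length :: "('a, 'b) ring_scheme \<Rightarrow> 'a set \<Rightarrow> enat" where
  "quotient_length R K = (SUP n \<in> {n. \<exists>C. C 0 = K \<and> C n = carrier R \<and> (\<forall>i\<le>n. ideal (C i) R)
                                        \<and> (\<forall>i<n. C i \<subset> C (Suc i))}. enat n)"

definition hilbert_coeff_seq :: "('a, 'b) ring_scheme \<Rightarrow> 'a set \<Rightarrow> (nat \<Rightarrow> int) \<Rightarrow> bool" where
  "hilbert_coeff_seq R K e \<longleftrightarrow>
     (let d = the_enat (krull_dim R) in
       (\<forall>i>d. e i = 0) \<and>
       (\<forall>\<^sub>F n in sequentially. \<exists>l. quotient_length R (ideal_pow R K (Suc n)) = enat l \<and>
           int l = (\<Sum>i\<le>d. (-1) ^ i * e i * int ((n + d - i) choose (d - i)))))"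

definition hilbert_coeff :: "('a, 'b) ring_scheme \<Rightarrow> 'a set \<Rightarrow> nat \<Rightarrow> int" where
  "hilbert_coeff R K i = (THE e. hilbert_coeff_seq R K e) i"

definition integral_over_ideal :: "('a, 'b) ring_scheme \<Rightarrow> 'a set \<Rightarrow> 'a \<Rightarrow> bool" where
  "integral_over_ideal R I x \<longleftrightarrow> x \<in> carrier R \<and>
     (\<exists>n::nat. n \<ge> 1 \<and> (\<exists>a. (\<forall>i\<in>{1..n}. a i \<in> ideal_pow R I i) \<and>
        x [^]\<^bsub>R\<^esub> n \<oplus>\<^bsub>R\<^esub> (\<Oplus>\<^bsub>R\<^esub>i\<in>{1..n}. a i \<otimes>\<^bsub>R\<^esub> x [^]\<^bsub>R\<^esub> (n - i)) = \<zero>\<^bsub>R\<^esub>))"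

definition integrally_closed_ideal :: "('a, 'b) ring_scheme \<Rightarrow> 'a set \<Rightarrow> bool" where
  "integrally_closed_ideal R I \<longleftrightarrow> (\<forall>x. integral_over_ideal R I x \<longrightarrow> x \<in> I)"

definition asymptotically_normal :: "('a, 'b) ring_scheme \<Rightarrow> 'a set \<Rightarrow> bool" where
  "asymptotically_normal R J \<longleftrightarrow>
     (\<forall>\<^sub>F n in sequentially. integrally_closed_ideal R (ideal_pow R J n))"

definition is_reduction :: "('a, 'b) ring_scheme \<Rightarrow> 'a set \<Rightarrow> 'a set \<Rightarrow> bool" where
  "is_reduction R I J \<longleftrightarrow> I \<subseteq> J \<and>
     (\<forall>\<^sub>F n in sequentially. ideal_prod R I (ideal_pow R J n) = ideal_pow R J (Suc n))"

end

theory Submission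
  imports Defs "HOL-Computational_Algebra.Formal_Laurent_Series"
begin

text \<open>
  Everything is read off the two filtrations \<open>F n = J^n\<close> and \<open>G n = I^n\<close>. Since \<open>Gr_I(A)\<close> is
  Cohen--Macaulay of dimension \<open>d\<close>, it has a homogeneous regular sequence of length \<open>d\<close>. In dimension
  three such a sequence \<open>x, y, z\<close> in one large degree \<open>r\<close> gives, by a Koszul count,
  \<open>h(3r) - 3 h(2r) + 3 h(r) = \<lambda>(A / (I^{3r} + (x, y, z)))\<close> for \<open>h(n) = \<lambda>(A / I^n)\<close>, and the same with
  \<open>\<le>\<close> for \<open>J\<close>: the syzygies \<open>a\<^sub>i x\<^sub>j - a\<^sub>j x\<^sub>i \<in> J^{2r}\<close> force \<open>a\<^sub>i \<in> J^r\<close>, because the asymptotic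
  order of the \<open>a\<^sub>i\<close> along \<open>G\<close> cannot be smaller than \<open>r\<close> and \<open>J^r\<close> is integrally closed. As \<open>e\<^sub>0\<close>
  agrees for \<open>I\<close> and \<open>J\<close>, the third-order combination \<open>g(3r) - 3 g(2r) + 3 g(r)\<close> of
  \<open>g(n) = \<lambda>(A / I^n) - \<lambda>(A / J^n)\<close> equals \<open>e\<^sub>3(J) - e\<^sub>3(I)\<close>, which is therefore nonnegative. Higher
  dimensions are reduced to three by dividing by generic elements \<open>b + T b'\<close> over a localized
  polynomial extension; asymptotic normality survives because \<open>b + T b'\<close> is linear in \<open>T\<close>.
\<close>

section \<open>Ideals and lengths\<close>

text \<open>No quotient ring is formed: dividing by an element means enlarging every ideal by it,
  and all lengths are lengths of ideals modulo smaller ideals. The obstacle is the cut down to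
  dimension three. Over a finite residue field sufficiently general elements of I may be missing,
  and a cut must also preserve normality; hence an indeterminate T is adjoined for each cut. The
  number of cuts depends on d, so the induction needs a type closed under this extension. A form
  linear in T is chosen because T can then be eliminated as -b/b', which turns a condition on powers
  modulo b + T b' into one in the base ring. The membership of the a_i in J^r rests on growth: a
  syzygy with some a_i outside J^r acts like a fraction of negative degree, whose powers embed high
  graded pieces into lower ones, whereas two regular elements make the lengths of these pieces
  unbounded. The coefficients 1, -3, 3 come from the Koszul complex on three elements of degree r,
  whose last term h(0) is 0; they annihilate n and n^2 and preserve constants.\<close>

definition idealp :: "'r::comm_ring_1 set => bool" where
  "idealp U \<longleftrightarrow> 0 \<in> U \<and> (\<forall>x\<in>U. \<forall>y\<in>U. x + y \<in> U) \<and> (\<forall>r. \<forall>x\<in>U. r * x \<in> U)"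

definition isum :: "'r::comm_ring_1 set => 'r set => 'r set" where
  "isum U V = {u + v | u v. u \<in> U \<and> v \<in> V}"

text \<open>Adjoining \<open>x\<close> to an ideal stands for dividing by \<open>x\<close>: regular
  sequences, induced filtrations and hyperplane sections are all written with
  \<open>adj\<close>.\<close>

definition adj :: "'r::comm_ring_1 set => 'r => 'r set" where
  "adj U x = {u + c * x | u c. u \<in> U}"

lemma idealpI:
  assumes "0 \<in> U" "\<And>x y. x \<in> U ==> y \<in> U ==> x + y \<in> U" "\<And>r x. x \<in> U ==> r * x \<in> U"
  shows "idealp U"
  using assms unfolding idealp_def by blast

lemma idealp_zero: "idealp U ==> 0 \<in> U" by (auto simp: idealp_def)
lemma idealp_add: "idealp U ==> x \<in> U ==> y \<in> U ==> x + y \<in> U" by (auto simp: idealp_def)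
lemma idealp_mult: "idealp U ==> x \<in> U ==> r * x \<in> U" by (auto simp: idealp_def)
lemma idealp_mult2: "idealp U ==> x \<in> U ==> x * r \<in> U" by (auto simp: idealp_def mult.commute)
lemma idealp_neg: "idealp U ==> x \<in> U ==> - x \<in> U"
  using idealp_mult[of U x "-1"] by simp
lemma idealp_diff: "idealp U ==> x \<in> U ==> y \<in> U ==> x - y \<in> U"
  using idealp_add[of U x "-y"] idealp_neg[of U y] by simp
lemma idealp_sum: "idealp U ==> (\<And>i. i \<in> I ==> f i \<in> U) ==> sum f I \<in> U"
  by (induction I rule: infinite_finite_induct) (auto simp: idealp_zero idealp_add)
lemma idealp_cancel: "idealp U ==> x - y \<in> U ==> y \<in> U ==> x \<in> U"
  using idealp_add[of U "x - y" y] by simp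
lemma idealp_cancel': "idealp U ==> x - y \<in> U ==> x \<in> U ==> y \<in> U"
  using idealp_diff[of U x "x - y"] by simp
lemma idealp_UNIV [simp]: "idealp UNIV" by (simp add: idealp_def)
lemma idealp_Int: "idealp U ==> idealp V ==> idealp (U \<inter> V)" by (simp add: idealp_def)
lemma idealp_one: "idealp U ==> 1 \<in> U ==> U = UNIV"
  using idealp_mult[of U 1] by auto

lemma isumI: "u \<in> U ==> v \<in> V ==> u + v \<in> isum U V" by (auto simp: isum_def)
lemma isumE: "x \<in> isum U V ==> (\<And>u v. x = u + v ==> u \<in> U ==> v \<in> V ==> P) ==> P"
  by (auto simp: isum_def)

lemma idealp_isum:
  assumes "idealp U" "idealp V" shows "idealp (isum U V)"
proof (rule idealpI)
  show "0 \<in> isum U V" using isumI[OF idealp_zero[OF assms(1)] idealp_zero[OF assms(2)]] by simp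
next
  fix x y assume "x \<in> isum U V" "y \<in> isum U V"
  then obtain u v u' v' where "x = u + v" "y = u' + v'" "u \<in> U" "v \<in> V" "u' \<in> U" "v' \<in> V"
    by (auto simp: isum_def)
  thus "x + y \<in> isum U V"
    using isumI[OF idealp_add[OF assms(1), of u u'] idealp_add[OF assms(2), of v v']]
    by (simp add: algebra_simps)
next
  fix r x assume "x \<in> isum U V"
  thus "r * x \<in> isum U V"
    using isumI[OF idealp_mult[OF assms(1)] idealp_mult[OF assms(2)]]
    by (auto simp: isum_def distrib_left)
qed

lemma isum_subset1: "idealp V ==> U <= isum U V"
  using isumI[of _ U 0 V] by (auto dest: idealp_zero)
lemma isum_subset2: "idealp U ==> V <= isum U V"
  using isumI[of 0 U _ V] by (auto dest: idealp_zero)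
lemma isum_least: "idealp Y ==> U <= Y ==> V <= Y ==> isum U V <= Y"
  by (auto simp: isum_def intro: idealp_add)

lemma adjI: "u \<in> U ==> u + c * x \<in> adj U x" by (auto simp: adj_def)
lemma adj_iff: "y \<in> adj U x \<longleftrightarrow> (\<exists>c. y - c * x \<in> U)"
proof
  assume "\<exists>c. y - c * x \<in> U"
  then obtain c where "y - c * x \<in> U" by blast
  from adjI[OF this, of c x] show "y \<in> adj U x" by simp
next
  assume "y \<in> adj U x"
  then obtain u c where "u \<in> U" "y = u + c * x" by (auto simp: adj_def)
  hence "y - c * x \<in> U" by simp
  thus "\<exists>c. y - c * x \<in> U" ..
qed
lemma adj_isum: "adj U x = isum U (range (\<lambda>c. c * x))" by (auto simp: adj_def isum_def)
lemma idealp_range: "idealp (range (\<lambda>c. c * (x::'r::comm_ring_1)))"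
proof (rule idealpI)
  show "0 \<in> range (\<lambda>c. c * x)" using rangeI[of "\<lambda>c. c * x" 0] by simp
  show "y + z \<in> range (\<lambda>c. c * x)" if "y \<in> range (\<lambda>c. c * x)" "z \<in> range (\<lambda>c. c * x)" for y z
    using that by (auto simp: distrib_right[symmetric])
  show "r * y \<in> range (\<lambda>c. c * x)" if "y \<in> range (\<lambda>c. c * x)" for r y
    using that by (auto simp: mult.assoc[symmetric])
qed
lemma idealp_adj: "idealp U ==> idealp (adj U x)"
  by (simp add: adj_isum idealp_isum idealp_range)
lemma adj_subset: "U <= adj U x"
  using isum_subset1[OF idealp_range] by (simp add: adj_isum)
lemma adj_mem: "idealp U ==> c * x \<in> adj U x"
  using adjI[OF idealp_zero, of U c x] by simp
lemma adj_self: "idealp U ==> x \<in> adj U x"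
  using adj_mem[of U 1 x] by simp
lemma adj_least: "idealp V ==> U <= V ==> x \<in> V ==> adj U x <= V"
  by (auto simp: adj_def intro: idealp_add idealp_mult)
lemma adj_mono: "U <= V ==> adj U x <= adj V x" by (auto simp: adj_def)
lemma adj_absorb: "idealp U ==> x \<in> U ==> adj U x = U"
  by (simp add: adj_least adj_subset subset_antisym)
lemma adj_commute: "adj (adj U x) y = adj (adj U y) x"
proof -
  have "adj (adj U x) y <= adj (adj U y) x" for x y
  proof
    fix z assume "z \<in> adj (adj U x) y"
    then obtain u c d where "z = u + c * x + d * y" "u \<in> U" by (auto simp: adj_def)
    thus "z \<in> adj (adj U y) x"
      using adjI[OF adjI, of u U d y c x] by (simp add: algebra_simps)
  qed
  thus ?thesis by blast
qed

section \<open>Lengths of chains of ideals\<close>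

definition ichain :: "'r::comm_ring_1 set => 'r set => nat => (nat => 'r set) => bool" where
  "ichain W V n C \<longleftrightarrow> C 0 = W \<and> C n = V \<and> (\<forall>i\<le>n. idealp (C i)) \<and> (\<forall>i<n. C i \<subset> C (Suc i))"

text \<open>The length of \<open>V / W\<close> as a supremum over strict chains, infinite when their
  lengths are unbounded. Additivity is recovered in \<open>ilen_add\<close>.\<close>

definition ilen :: "'r::comm_ring_1 set => 'r set => enat" where
  "ilen W V = (SUP n \<in> {n. \<exists>C. ichain W V n C}. enat n)"

lemma enat_le_SUP:
  assumes "enat n \<le> (SUP k \<in> S. enat k)" "S \<noteq> {}"
  shows "\<exists>k\<in>S. n \<le> k"
proof (rule ccontr)
  assume a: "\<not> (\<exists>k\<in>S. n \<le> k)"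
  obtain k where "k \<in> S" using assms(2) by blast
  with a have n: "n > 0" by fastforce
  have "(SUP k \<in> S. enat k) \<le> enat (n - 1)"
    by (rule SUP_least) (use a in \<open>auto simp: not_le\<close>)
  with assms(1) have "enat n \<le> enat (n - 1)" by (rule order_trans)
  with n show False by simp
qed

lemma ichain_exists:
  assumes "idealp W" "idealp V" "W <= V" shows "\<exists>n C. ichain W V n C"
proof (cases "W = V")
  case True thus ?thesis using assms by (intro exI[of _ 0] exI[of _ "\<lambda>_. W"]) (auto simp: ichain_def)
next
  case False
  hence "ichain W V 1 (\<lambda>i. if i = 0 then W else V)"
    using assms by (auto simp: ichain_def)
  thus ?thesis by blast
qed

lemma enat_le_ilen_iff:
  assumes "idealp W" "idealp V" "W <= V"
  shows "enat n \<le> ilen W V \<longleftrightarrow> (\<exists>k C. n \<le> k \<and> ichain W V k C)"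
proof
  assume "enat n \<le> ilen W V"
  thus "\<exists>k C. n \<le> k \<and> ichain W V k C"
    using enat_le_SUP[of n "{n. \<exists>C. ichain W V n C}"] ichain_exists[OF assms] unfolding ilen_def by blast
next
  assume "\<exists>k C. n \<le> k \<and> ichain W V k C"
  then obtain k C where k: "n \<le> k" "ichain W V k C" by blast
  have "enat k \<le> ilen W V" unfolding ilen_def by (rule SUP_upper) (use k in auto)
  with k(1) show "enat n \<le> ilen W V" using order_trans enat_ord_simps(1) by metis
qed

lemma ilen_leI:
  assumes "\<And>n C. ichain W V n C ==> enat n \<le> b"
  shows "ilen W V \<le> b"
  unfolding ilen_def by (rule SUP_least) (use assms in auto)

lemma ilen_self [simp]: "ilen W W = 0"
proof -
  have "n = 0" if "ichain W W n C" for n C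
  proof (rule ccontr)
    assume "n \<noteq> 0"
    have "C 0 \<subset> C (Suc i)" if "i < n" for i
      using that
    proof (induction i)
      case 0 thus ?case using \<open>ichain W W n C\<close> by (auto simp: ichain_def)
    next
      case (Suc i) thus ?case using \<open>ichain W W n C\<close> unfolding ichain_def by (meson Suc_lessD psubset_trans)
    qed
    from this[of "n - 1"] \<open>n \<noteq> 0\<close> \<open>ichain W W n C\<close> show False by (auto simp: ichain_def)
  qed
  hence "ilen W W \<le> 0" by (intro ilen_leI) (metis zero_enat_def order_refl)
  thus ?thesis by simp
qed

lemma enat_add_leI:
  assumes "\<And>n m. enat n \<le> a ==> enat m \<le> b ==> enat (n + m) \<le> c"
  shows "a + b \<le> c"
proof (cases c)
  case (enat k)
  have a: "a \<noteq> \<infinity>"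
    using assms[of "Suc k" 0] enat by (intro notI) (simp add: zero_enat_def[symmetric])
  have b: "b \<noteq> \<infinity>"
    using assms[of 0 "Suc k"] enat by (intro notI) (simp add: zero_enat_def[symmetric])
  from a b obtain n m where nm: "a = enat n" "b = enat m" by auto
  thus ?thesis using assms[of n m] by simp
qed simp

lemma ilen_superadd:
  assumes "idealp W" "idealp V" "idealp Y" "W <= V" "V <= Y"
  shows "ilen W V + ilen V Y \<le> ilen W Y"
proof (rule enat_add_leI)
  fix n m assume "enat n \<le> ilen W V" "enat m \<le> ilen V Y"
  then obtain k C l D where C: "n \<le> k" "ichain W V k C" and D: "m \<le> l" "ichain V Y l D"
    using assms by (auto simp: enat_le_ilen_iff)
  define E where "E i = (if i \<le> k then C i else D (i - k))" for i
  have "ichain W Y (k + l) E"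
    unfolding ichain_def
  proof (intro conjI allI impI)
    show "E 0 = W" using C by (simp add: E_def ichain_def)
    show "E (k + l) = Y" using C D by (cases l) (auto simp: E_def ichain_def)
    show "idealp (E i)" if "i \<le> k + l" for i
      using that C D by (auto simp: E_def ichain_def)
    show "E i \<subset> E (Suc i)" if "i < k + l" for i
    proof -
      consider "i < k" | "i = k" | "i > k" by linarith
      thus ?thesis
      proof cases
        case 1 thus ?thesis using C by (auto simp: E_def ichain_def)
      next
        case 2
        hence "0 < l" using that by simp
        hence "D 0 \<subset> D (Suc 0)" using D(2) unfolding ichain_def by metis
        moreover have "C k = D 0" using C D by (simp add: ichain_def)
        ultimately show ?thesis using 2 by (simp add: E_def)
      next
        case 3
        hence "D (i - k) \<subset> D (Suc (i - k))" using that D by (simp add: ichain_def)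
        thus ?thesis using 3 by (simp add: E_def Suc_diff_le)
      qed
    qed
  qed
  thus "enat (n + m) \<le> ilen W Y"
    using enat_le_ilen_iff[of W Y "n + m"] assms C(1) D(1) by (metis add_mono order_trans)
qed

lemma ilen_mono:
  assumes "idealp W" "idealp V" "idealp W'" "idealp V'" "W <= W'" "W' <= V'" "V' <= V"
  shows "ilen W' V' \<le> ilen W V"
proof -
  have "ilen W' V' \<le> ilen W' V' + ilen V' V" by simp
  also have "\<dots> \<le> ilen W' V" using assms by (intro ilen_superadd) auto
  also have "\<dots> \<le> ilen W W' + ilen W' V" by simp
  also have "\<dots> \<le> ilen W V" using assms by (intro ilen_superadd) auto
  finally show ?thesis .
qed

lemma ilen_pos:
  assumes "idealp W" "idealp V" "W \<subset> V" shows "1 \<le> ilen W V"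
proof -
  have "ichain W V 1 (\<lambda>i. if i = 0 then W else V)" using assms by (auto simp: ichain_def)
  thus ?thesis using enat_le_ilen_iff[of W V 1] assms by (auto simp: one_enat_def)
qed

lemma ilen_eq_0:
  assumes "idealp W" "idealp V" "W <= V" "ilen W V = 0" shows "W = V"
proof (rule ccontr)
  assume "W \<noteq> V"
  hence "1 \<le> ilen W V" using assms by (intro ilen_pos) auto
  with assms(4) show False by simp
qed

text \<open>Intersecting a strict chain with an ideal, or adding an ideal to it, leaves only a weak
  chain; the number of its proper steps is what can still be compared with a length.\<close>

lemma weak_chain_le_ilen:
  assumes "\<And>i. i \<le> n ==> idealp (C i)" "\<And>i. i < n ==> C i <= C (Suc i)"
  shows "C 0 <= C n \<and> enat (card {i. i < n \<and> C i \<noteq> C (Suc i)}) \<le> ilen (C 0) (C n)"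
  using assms
proof (induction n)
  case 0 thus ?case by (simp add: zero_enat_def[symmetric])
next
  case (Suc n)
  hence IH: "C 0 <= C n" "enat (card {i. i < n \<and> C i \<noteq> C (Suc i)}) \<le> ilen (C 0) (C n)" by auto
  have st: "C n <= C (Suc n)" using Suc.prems by simp
  have *: "ilen (C 0) (C n) + ilen (C n) (C (Suc n)) \<le> ilen (C 0) (C (Suc n))"
    using Suc.prems IH st by (intro ilen_superadd) auto
  have "{i. i < Suc n \<and> C i \<noteq> C (Suc i)}
      = (if C n = C (Suc n) then {i. i < n \<and> C i \<noteq> C (Suc i)} else insert n {i. i < n \<and> C i \<noteq> C (Suc i)})"
    by (auto simp: less_Suc_eq)
  hence card: "card {i. i < Suc n \<and> C i \<noteq> C (Suc i)}
      = card {i. i < n \<and> C i \<noteq> C (Suc i)} + (if C n = C (Suc n) then 0 else 1)" by auto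
  have "enat (if C n = C (Suc n) then 0 else 1) \<le> ilen (C n) (C (Suc n))"
    using ilen_pos[of "C n" "C (Suc n)"] Suc.prems st by (auto simp: zero_enat_def[symmetric] one_enat_def)
  hence "enat (card {i. i < n \<and> C i \<noteq> C (Suc i)}) + enat (if C n = C (Suc n) then 0 else 1)
      \<le> ilen (C 0) (C n) + ilen (C n) (C (Suc n))"
    by (intro add_mono IH)
  hence "enat (card {i. i < Suc n \<and> C i \<noteq> C (Suc i)}) \<le> ilen (C 0) (C n) + ilen (C n) (C (Suc n))"
    unfolding card by simp
  hence "enat (card {i. i < Suc n \<and> C i \<noteq> C (Suc i)}) \<le> ilen (C 0) (C (Suc n))"
    using * by (rule order_trans)
  thus ?case using IH(1) st by blast
qed

lemma strict_chain_le_ilen: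
  assumes "idealp W" "idealp V" "\<And>i. i \<le> n ==> idealp (C i)" "\<And>i. i < n ==> C i \<subset> C (Suc i)" "W <= C 0" "C n <= V"
  shows "enat n \<le> ilen W V"
proof -
  have "C 0 <= C n \<and> enat (card {i. i < n \<and> C i \<noteq> C (Suc i)}) \<le> ilen (C 0) (C n)"
    using assms by (intro weak_chain_le_ilen) auto
  moreover have "{i. i < n \<and> C i \<noteq> C (Suc i)} = {..<n}" using assms(4) by auto
  ultimately have "enat n \<le> ilen (C 0) (C n)" "C 0 <= C n" by auto
  moreover have "ilen (C 0) (C n) \<le> ilen W V" using assms \<open>C 0 <= C n\<close> by (intro ilen_mono) auto
  ultimately show ?thesis by (meson order_trans)
qed

lemma modular_strict:
  assumes "idealp D" "idealp E" "idealp V" "D <= E" "D \<inter> V = E \<inter> V" "isum D V = isum E V"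
  shows "D = E"
proof -
  have "E <= D"
  proof
    fix e assume e: "e \<in> E"
    hence "e \<in> isum D V" using assms isum_subset1[of V E] by auto
    then obtain d v where dv: "e = d + v" "d \<in> D" "v \<in> V" by (auto simp: isum_def)
    hence "v = e - d" by simp
    hence "v \<in> E \<inter> V" using idealp_diff[OF assms(2), of e d] e dv assms(4) by auto
    hence "v \<in> D" using assms by blast
    thus "e \<in> D" using dv assms by (auto intro: idealp_add)
  qed
  thus ?thesis using assms by blast
qed

text \<open>For the upper bound a chain from \<open>W\<close> to \<open>Y\<close> is cut by
  \<open>V\<close>. By the modular law each strict step stays strict in the intersections with
  \<open>V\<close> or in the sums with \<open>V\<close>, so the chain is no longer than the proper
  steps of these two weak chains together.\<close>

lemma ilen_add:
  assumes "idealp W" "idealp V" "idealp Y" "W <= V" "V <= Y"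
  shows "ilen W Y = ilen W V + ilen V Y"
proof (rule antisym)
  show "ilen W V + ilen V Y \<le> ilen W Y" using assms by (rule ilen_superadd)
  show "ilen W Y \<le> ilen W V + ilen V Y"
  proof (rule ilen_leI)
    fix n D assume "ichain W Y n D"
    hence D: "D 0 = W" "D n = Y" "\<And>i. i \<le> n ==> idealp (D i)" "\<And>i. i < n ==> D i \<subset> D (Suc i)"
      by (auto simp: ichain_def)
    let ?A = "\<lambda>i. D i \<inter> V" and ?B = "\<lambda>i. isum (D i) V"
    have A: "enat (card {i. i < n \<and> ?A i \<noteq> ?A (Suc i)}) \<le> ilen (?A 0) (?A n)"
      using D assms by (intro conjunct2[OF weak_chain_le_ilen]) (auto intro: idealp_Int)
    have B: "enat (card {i. i < n \<and> ?B i \<noteq> ?B (Suc i)}) \<le> ilen (?B 0) (?B n)"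
    proof (intro conjunct2[OF weak_chain_le_ilen])
      show "idealp (isum (D i) V)" if "i \<le> n" for i using D that assms by (intro idealp_isum) auto
      show "isum (D i) V <= isum (D (Suc i)) V" if "i < n" for i
        using D(4)[OF that] by (auto simp: isum_def)
    qed
    have B0: "?B 0 = V" using D assms by (intro subset_antisym isum_least isum_subset2) auto
    have B1: "?B n = Y" using D assms by (intro subset_antisym isum_least) (auto intro!: isum_subset1)
    have A0: "?A 0 = W" "?A n = V" using D assms by auto
    have "{..<n} <= {i. i < n \<and> ?A i \<noteq> ?A (Suc i)} \<union> {i. i < n \<and> ?B i \<noteq> ?B (Suc i)}"
    proof
      fix i assume "i \<in> {..<n}"
      hence i: "i < n" by simp
      hence "D i \<noteq> D (Suc i)" "D i <= D (Suc i)" using D(4) by auto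
      hence "?A i \<noteq> ?A (Suc i) \<or> ?B i \<noteq> ?B (Suc i)"
        using modular_strict[of "D i" "D (Suc i)" V] D(3) i assms by auto
      thus "i \<in> {i. i < n \<and> ?A i \<noteq> ?A (Suc i)} \<union> {i. i < n \<and> ?B i \<noteq> ?B (Suc i)}"
        using i by blast
    qed
    hence "card {..<n} \<le> card ({i. i < n \<and> ?A i \<noteq> ?A (Suc i)} \<union> {i. i < n \<and> ?B i \<noteq> ?B (Suc i)})"
      by (intro card_mono) auto
    also have "\<dots> \<le> card {i. i < n \<and> ?A i \<noteq> ?A (Suc i)} + card {i. i < n \<and> ?B i \<noteq> ?B (Suc i)}"
      by (rule card_Un_le)
    finally have "enat n \<le> enat (card {i. i < n \<and> ?A i \<noteq> ?A (Suc i)}) + enat (card {i. i < n \<and> ?B i \<noteq> ?B (Suc i)})"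
      by simp
    also have "\<dots> \<le> ilen W V + ilen V Y" using A B unfolding A0 B0 B1 by (rule add_mono)
    finally show "enat n \<le> ilen W V + ilen V Y" .
  qed
qed

text \<open>A linear relation that is total on \<open>U\<close> and reflects \<open>W'\<close> into \<open>W\<close> plays the role of an
  injection \<open>U / W \<rightarrow> U' / W'\<close>; it need not be single valued.\<close>

lemma ilen_le_rel:
  fixes rel :: "'r::comm_ring_1 => 'r => bool"
  assumes id: "idealp W" "idealp U" "idealp W'" "idealp U'" and sub: "W' <= U'"
    and add: "\<And>x y x' y'. rel x y ==> rel x' y' ==> rel (x + x') (y + y')"
    and scale: "\<And>c x y. rel x y ==> rel (c * x) (c * y)"
    and total: "\<And>x. x \<in> U ==> \<exists>y\<in>U'. rel x y"
    and refl: "\<And>x y. x \<in> U ==> rel x y ==> y \<in> W' ==> x \<in> W"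
  shows "ilen W U \<le> ilen W' U'"
proof (rule ilen_leI)
  fix n D assume "ichain W U n D"
  hence D: "D 0 = W" "D n = U" "\<And>i. i \<le> n ==> idealp (D i)" "\<And>i. i < n ==> D i \<subset> D (Suc i)"
    by (auto simp: ichain_def)
  have le: "D i <= U" if "i \<le> n" for i
    using that
  proof (induction rule: inc_induct)
    case (step k) thus ?case using D(4)[of k] by auto
  qed (simp add: D)
  have leW: "W <= D i" if "i \<le> n" for i
    using that
  proof (induction i)
    case (Suc k) thus ?case using D(4)[of k] by auto
  qed (simp add: D)
  define T where "T i = {y \<in> U'. \<exists>x\<in>D i. \<exists>w\<in>W'. rel x (y - w)}" for i
  have r0: "rel 0 0"
  proof -
    obtain y where "rel 0 y" using total[of 0] idealp_zero[OF id(2)] by auto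
    from scale[OF this, of 0] show ?thesis by simp
  qed
  have Tid: "idealp (T i)" if "i \<le> n" for i
  proof (rule idealpI)
    show "0 \<in> T i" unfolding T_def
      using r0 id D(3)[OF that] by (auto intro!: bexI[of _ 0] idealp_zero)
  next
    fix y y' assume "y \<in> T i" "y' \<in> T i"
    then obtain x w x' w' where *: "y \<in> U'" "y' \<in> U'" "x \<in> D i" "w \<in> W'" "rel x (y - w)" "x' \<in> D i" "w' \<in> W'" "rel x' (y' - w')"
      by (auto simp: T_def)
    have "rel (x + x') ((y + y') - (w + w'))" using add[OF *(5,8)] by (simp add: algebra_simps)
    moreover have "x + x' \<in> D i" "w + w' \<in> W'" "y + y' \<in> U'"
      using * id D(3)[OF that] by (auto intro: idealp_add)
    ultimately show "y + y' \<in> T i" unfolding T_def by blast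
  next
    fix r y assume "y \<in> T i"
    then obtain x w where *: "y \<in> U'" "x \<in> D i" "w \<in> W'" "rel x (y - w)" by (auto simp: T_def)
    have "rel (r * x) (r * y - r * w)" using scale[OF *(4), of r] by (simp add: right_diff_distrib)
    moreover have "r * x \<in> D i" "r * w \<in> W'" "r * y \<in> U'"
      using * id D(3)[OF that] by (auto intro: idealp_mult)
    ultimately show "r * y \<in> T i" unfolding T_def by blast
  qed
  have strict: "T i \<subset> T (Suc i)" if i: "i < n" for i
  proof
    show "T i <= T (Suc i)" using D(4)[OF i] by (auto simp: T_def)
    obtain x where x: "x \<in> D (Suc i)" "x \<notin> D i" using D(4)[OF i] by auto
    have xU: "x \<in> U" using le[of "Suc i"] x i by auto
    obtain y where y: "y \<in> U'" "rel x y" using total[OF xU] by auto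
    have "rel x (y - 0)" using y by simp
    hence "y \<in> T (Suc i)" unfolding T_def using y x idealp_zero[OF id(3)] by blast
    moreover have "y \<notin> T i"
    proof
      assume "y \<in> T i"
      then obtain x' w where *: "x' \<in> D i" "w \<in> W'" "rel x' (y - w)" by (auto simp: T_def)
      have "rel (- x') (- (y - w))" using scale[OF *(3), of "-1"] by simp
      from add[OF y(2) this] have "rel (x - x') w" by simp
      moreover have "x - x' \<in> U" using xU le[of i] i *(1) id(2) by (auto intro: idealp_diff)
      ultimately have "x - x' \<in> W" using refl *(2) by blast
      hence "x - x' \<in> D i" using leW[of i] i by auto
      thus False using x *(1) D(3)[of i] i idealp_cancel by (metis less_imp_le)
    qed
    ultimately show "T i \<noteq> T (Suc i)" by blast
  qed
  show "enat n \<le> ilen W' U'"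
  proof (rule strict_chain_le_ilen[where C = T and n = n, OF id(3,4)])
    show "\<And>i. i \<le> n ==> idealp (T i)" by (rule Tid)
    show "\<And>i. i < n ==> T i \<subset> T (Suc i)" by (rule strict)
    show "W' <= T 0"
    proof
      fix y assume y: "y \<in> W'"
      have "rel 0 (y - y)" using r0 by simp
      thus "y \<in> T 0" unfolding T_def D(1) using y sub idealp_zero[OF id(1)] by blast
    qed
    show "T n <= U'" by (auto simp: T_def)
  qed
qed

definition colon :: "'r::comm_ring_1 set => 'r => 'r set" where
  "colon W x = {c. c * x \<in> W}"

lemma idealp_colon: "idealp W ==> idealp (colon W x)"
  by (rule idealpI) (auto simp: colon_def distrib_right mult.assoc intro: idealp_zero idealp_add idealp_mult)

text \<open>The relation \<open>y - c * x \<in> W\<close>, read from \<open>y\<close> to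
  \<open>c\<close> and from \<open>c\<close> to \<open>y\<close>, gives the two inequalities. It
  plays the role of the isomorphism induced by multiplication by \<open>x\<close>.\<close>

lemma ilen_mult_image:
  assumes "idealp W" "idealp U"
  shows "ilen W (isum W ((\<lambda>c. c * x) ` U)) = ilen (U \<inter> colon W x) U"
proof -
  let ?Y = "isum W ((\<lambda>c. c * x) ` U)"
  have idx: "idealp ((\<lambda>c. c * x) ` U)"
  proof (rule idealpI)
    show "0 \<in> (\<lambda>c. c * x) ` U" using idealp_zero[OF assms(2)] by force
    show "y + z \<in> (\<lambda>c. c * x) ` U" if "y \<in> (\<lambda>c. c * x) ` U" "z \<in> (\<lambda>c. c * x) ` U" for y z
      using that idealp_add[OF assms(2)] by (auto simp: distrib_right[symmetric])
    show "r * y \<in> (\<lambda>c. c * x) ` U" if "y \<in> (\<lambda>c. c * x) ` U" for r y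
      using that idealp_mult[OF assms(2)] by (auto simp: mult.assoc[symmetric])
  qed
  have Y: "idealp ?Y" using assms(1) idx by (rule idealp_isum)
  have WX: "W <= ?Y" using idx by (rule isum_subset1)
  have c: "idealp (U \<inter> colon W x)" using assms by (intro idealp_Int idealp_colon)
  show ?thesis
  proof (rule antisym)
    show "ilen W ?Y \<le> ilen (U \<inter> colon W x) U"
    proof (rule ilen_le_rel[where rel = "\<lambda>y c. c \<in> U \<and> y - c * x \<in> W"])
      show "\<exists>c\<in>U. c \<in> U \<and> y - c * x \<in> W" if "y \<in> ?Y" for y
      proof -
        obtain u c where "y = u + c * x" "u \<in> W" "c \<in> U" using \<open>y \<in> ?Y\<close> by (auto simp: isum_def)
        thus ?thesis by (intro bexI[of _ c]) auto
      qed
      show "y \<in> W" if "y \<in> ?Y" "c \<in> U \<and> y - c * x \<in> W" "c \<in> U \<inter> colon W x" for y c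
        using that assms(1) by (auto simp: colon_def intro: idealp_cancel)
      show "y + y' \<in> U \<and> xa + x' - (y + y') * x \<in> W"
        if "y \<in> U \<and> xa - y * x \<in> W" "y' \<in> U \<and> x' - y' * x \<in> W" for xa y x' y'
      proof -
        have eq: "xa + x' - (y + y') * x = (xa - y * x) + (x' - y' * x)" by (simp add: algebra_simps)
        show ?thesis unfolding eq using that assms by (blast intro: idealp_add)
      qed
      show "c * y \<in> U \<and> c * xa - c * y * x \<in> W" if "y \<in> U \<and> xa - y * x \<in> W" for c xa y
      proof -
        have eq: "c * xa - c * y * x = c * (xa - y * x)" by (simp add: algebra_simps)
        show ?thesis unfolding eq using that assms by (blast intro: idealp_mult)
      qed
    qed (use assms Y c in auto)
    show "ilen (U \<inter> colon W x) U \<le> ilen W ?Y"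
    proof (rule ilen_le_rel[where rel = "\<lambda>c y. y - c * x \<in> W"])
      show "\<exists>y\<in>?Y. y - c * x \<in> W" if "c \<in> U" for c
        using that isum_subset2[OF assms(1), of "(\<lambda>c. c * x) ` U"] idealp_zero[OF assms(1)]
        by (intro bexI[of _ "c * x"]) auto
      show "c \<in> U \<inter> colon W x" if "c \<in> U" "y - c * x \<in> W" "y \<in> W" for y c
        using that assms(1) by (auto simp: colon_def intro: idealp_cancel')
      show "(y + y') - (xa + x') * x \<in> W"
        if "y - xa * x \<in> W" "y' - x' * x \<in> W" for xa y x' y'
      proof -
        have eq: "(y + y') - (xa + x') * x = (y - xa * x) + (y' - x' * x)" by (simp add: algebra_simps)
        show ?thesis unfolding eq using that assms by (blast intro: idealp_add)
      qed
      show "c * y - c * xa * x \<in> W" if "y - xa * x \<in> W" for c xa y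
      proof -
        have eq: "c * y - c * xa * x = c * (y - xa * x)" by (simp add: algebra_simps)
        show ?thesis unfolding eq using that assms by (blast intro: idealp_mult)
      qed
    qed (use assms Y c WX in auto)
  qed
qed

lemma ilen_adj: "idealp W ==> ilen W (adj W x) = ilen (colon W x) UNIV"
  using ilen_mult_image[of W UNIV x] by (simp add: adj_isum)

abbreviation colen :: "'r::comm_ring_1 set => enat" where "colen W \<equiv> ilen W UNIV"

text \<open>Lengths in the exact sequence 0 -> A/(W:x) -> A/W -> A/(W+(x)) -> 0; this is the basic
  tool for counting after division by an element.\<close>

lemma colen_adj: "idealp W ==> colen W = colen (colon W x) + colen (adj W x)"
  using ilen_add[of W "adj W x" UNIV] by (simp add: ilen_adj idealp_adj adj_subset)

lemma colen_antimono: "idealp W ==> idealp V ==> W <= V ==> colen V \<le> colen W"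
  by (rule ilen_mono) auto

text \<open>Finite colength of \<open>W\<close> is the source of the chain condition: the colengths
  of the \<open>H i\<close> are bounded by that of \<open>W\<close>, and a member of least colength
  contains all the others.\<close>

lemma colen_acc:
  assumes "idealp W" "colen W \<noteq> \<infinity>" "\<And>i. idealp (H i)" "\<And>i. W <= H i" "\<And>i. H i <= H (Suc i)"
  shows "\<exists>k::nat. \<forall>j. H j <= H k"
proof -
  from assms(2) obtain N where N: "colen W = enat N" by auto
  define S where "S = (\<lambda>k. the_enat (colen (H k))) ` UNIV"
  have fin: "colen (H k) \<noteq> \<infinity>" for k
    using colen_antimono[OF assms(1) assms(3) assms(4), of k] N by (intro notI) simp
  obtain k where k: "\<And>j. the_enat (colen (H k)) \<le> the_enat (colen (H j))"
    by (metis ex_has_least_nat[of "\<lambda>_. True" _ "\<lambda>k. the_enat (colen (H k))"])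
  have mono: "H i <= H j" if "i \<le> j" for i j using assms(5) that by (rule lift_Suc_mono_le)
  have "H j <= H k" for j
  proof (cases "j \<le> k")
    case False
    hence sub: "H k <= H j" using mono by simp
    have "colen (H k) = ilen (H k) (H j) + colen (H j)"
      using assms sub by (intro ilen_add) auto
    moreover have "colen (H k) \<le> colen (H j)"
      using k[of j] fin[of j] fin[of k] by auto
    moreover obtain a b where "colen (H k) = enat a" "colen (H j) = enat b" using fin[of j] fin[of k] by auto
    ultimately have "ilen (H k) (H j) = 0"
      by (cases "ilen (H k) (H j)") (auto simp: zero_enat_def)
    hence "H k = H j" using assms sub by (intro ilen_eq_0) auto
    thus ?thesis by simp
  qed (use mono in simp)
  thus ?thesis by blast
qed

section \<open>The Artin--Rees lemma\<close>

text \<open>For an ideal \<open>S\<close> this is the product of \<open>S\<close> with the ideal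
  generated by the list \<open>as\<close>, in a form suited to induction on the generators.\<close>

primrec lcomb :: "'r::comm_ring_1 list => 'r set => 'r set" where
  "lcomb [] S = {0}"
| "lcomb (a # as) S = {a * s + t | s t. s \<in> S \<and> t \<in> lcomb as S}"

lemma idealp_lcomb: "idealp S ==> idealp (lcomb as S)"
proof (induction as)
  case Nil show ?case by (simp add: idealp_def)
next
  case (Cons a as)
  note S = Cons.prems and IH = Cons.IH[OF Cons.prems]
  show ?case
  proof (rule idealpI)
    show "0 \<in> lcomb (a # as) S" using idealp_zero[OF S] idealp_zero[OF IH] by force
  next
    fix x y assume "x \<in> lcomb (a # as) S" "y \<in> lcomb (a # as) S"
    then obtain s t s' t' where *: "x = a * s + t" "y = a * s' + t'" "s \<in> S" "s' \<in> S" "t \<in> lcomb as S" "t' \<in> lcomb as S"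
      by auto
    have "x + y = a * (s + s') + (t + t')" using * by (simp add: algebra_simps)
    thus "x + y \<in> lcomb (a # as) S" using idealp_add[OF S *(3,4)] idealp_add[OF IH *(5,6)] by auto
  next
    fix r x assume "x \<in> lcomb (a # as) S"
    then obtain s t where *: "x = a * s + t" "s \<in> S" "t \<in> lcomb as S" by auto
    have "r * x = a * (r * s) + r * t" using * by (simp add: algebra_simps)
    thus "r * x \<in> lcomb (a # as) S" using idealp_mult[OF S *(2)] idealp_mult[OF IH *(3)] by auto
  qed
qed

lemma lcomb_mono: "S <= T ==> lcomb as S <= lcomb as T"
  by (induction as) auto

lemma lcomb_least: "idealp T ==> (\<And>a s. a \<in> set as ==> s \<in> S ==> a * s \<in> T) ==> lcomb as S <= T"
proof (induction as)
  case (Cons a as)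
  have "lcomb as S <= T" using Cons by simp
  thus ?case using Cons.prems by (auto intro!: idealp_add)
qed (simp add: idealp_zero)

lemma lcomb_mem: "idealp S ==> a \<in> set as ==> s \<in> S ==> a * s \<in> lcomb as S"
proof (induction as)
  case (Cons b as)
  show ?case
  proof (cases "a = b")
    case True
    have "a * s = b * s + 0" using True by simp
    thus ?thesis using Cons.prems idealp_zero[OF idealp_lcomb[OF Cons.prems(1)]] by (auto simp del: add_0_right)
  next
    case False
    hence "a * s \<in> lcomb as S" using Cons by simp
    moreover have "a * s = b * 0 + a * s" by simp
    ultimately show ?thesis using idealp_zero[OF Cons.prems(1)] by force
  qed
qed simp

lemma isum_mono: "U <= U' ==> V <= V' ==> isum U V <= isum U' V'" by (auto simp: isum_def)

text \<open>Elements of degree \<open>n\<close> that are polynomials in \<open>b\<close> of degree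
  less than \<open>j\<close>, the coefficient of \<open>b ^ i\<close> being taken from degree
  \<open>n - i\<close>. The subtraction is truncated, which is why \<open>low_mult_a\<close> bounds
  \<open>j\<close>.\<close>

definition low :: "'r::comm_ring_1 => (nat => 'r set) => nat => nat => 'r set" where
  "low b U j n = {\<Sum>i<j. b ^ i * u i | u. \<forall>i<j. u i \<in> U (n - i)}"

lemma lowI: "x = (\<Sum>i<j. b ^ i * u i) ==> \<forall>i<j. u i \<in> U (n - i) ==> x \<in> low b U j n"
  unfolding low_def by blast

lemma idealp_low:
  assumes "\<And>n. idealp (U n)" shows "idealp (low b U j n)"
proof (rule idealpI)
  show "0 \<in> low b U j n" unfolding low_def
    using assms by (auto intro!: exI[of _ "\<lambda>_. 0"] idealp_zero)
next
  fix x y assume "x \<in> low b U j n" "y \<in> low b U j n"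
  then obtain u v where *: "x = (\<Sum>i<j. b ^ i * u i)" "y = (\<Sum>i<j. b ^ i * v i)"
    "\<forall>i<j. u i \<in> U (n - i)" "\<forall>i<j. v i \<in> U (n - i)" by (auto simp: low_def)
  have "x + y = (\<Sum>i<j. b ^ i * (u i + v i))" using * by (simp add: distrib_left sum.distrib)
  moreover have "\<forall>i<j. u i + v i \<in> U (n - i)" using * assms by (auto intro: idealp_add)
  ultimately show "x + y \<in> low b U j n" by (rule lowI)
next
  fix r x assume "x \<in> low b U j n"
  then obtain u where *: "x = (\<Sum>i<j. b ^ i * u i)" "\<forall>i<j. u i \<in> U (n - i)" by (auto simp: low_def)
  have "r * x = (\<Sum>i<j. b ^ i * (r * u i))" using * by (simp add: sum_distrib_left algebra_simps)
  moreover have "\<forall>i<j. r * u i \<in> U (n - i)" using * assms by (auto intro: idealp_mult)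
  ultimately show "r * x \<in> low b U j n" by (rule lowI)
qed

lemma low_0 [simp]: "low b U 0 n = {0}" by (auto simp: low_def)

lemma low_SucI: "x \<in> low b U j n ==> c \<in> U (n - j) ==> b ^ j * c + x \<in> low b U (Suc j) n"
proof -
  assume "x \<in> low b U j n" and c: "c \<in> U (n - j)"
  then obtain u where *: "x = (\<Sum>i<j. b ^ i * u i)" "\<forall>i<j. u i \<in> U (n - i)" by (auto simp: low_def)
  have "b ^ j * c + x = (\<Sum>i<Suc j. b ^ i * (u(j := c)) i)" using * by (simp add: add.commute)
  moreover have "\<forall>i<Suc j. (u(j := c)) i \<in> U (n - i)" using * c by (auto simp: less_Suc_eq)
  ultimately show ?thesis by (rule lowI)
qed

lemma low_SucE:
  assumes "x \<in> low b U (Suc j) n"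
  obtains c y where "x = b ^ j * c + y" "c \<in> U (n - j)" "y \<in> low b U j n"
proof -
  obtain u where *: "x = (\<Sum>i<Suc j. b ^ i * u i)" "\<forall>i<Suc j. u i \<in> U (n - i)"
    using assms by (auto simp: low_def)
  have "(\<Sum>i<j. b ^ i * u i) \<in> low b U j n" unfolding low_def using * by auto
  moreover have "x = b ^ j * u j + (\<Sum>i<j. b ^ i * u i)" using * by (simp add: add.commute)
  ultimately show thesis using * that by blast
qed

lemma low_mono_j: "(\<And>n. idealp (U n)) ==> j \<le> k ==> low b U j n <= low b U k n"
proof (induction k)
  case (Suc k)
  show ?case
  proof (cases "j = Suc k")
    case False
    hence "low b U j n <= low b U k n" using Suc by simp
    moreover have "low b U k n <= low b U (Suc k) n"
      using low_SucI[of _ b U k n 0] idealp_zero[OF Suc.prems(1)] by force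
    ultimately show ?thesis by blast
  qed simp
qed simp

lemma low_mult_b:
  assumes "\<And>n. idealp (U n)" "x \<in> low b U j n"
  shows "b ^ k * x \<in> low b U (j + k) (n + k)"
  using assms(2)
proof (induction j arbitrary: x)
  case 0 thus ?case using idealp_zero[OF idealp_low[OF assms(1)]] by simp
next
  case (Suc j)
  then obtain c y where *: "x = b ^ j * c + y" "c \<in> U (n - j)" "y \<in> low b U j n" by (elim low_SucE)
  have "b ^ (j + k) * c + b ^ k * y \<in> low b U (Suc (j + k)) (n + k)"
    using * Suc.IH[OF *(3)] by (intro low_SucI) auto
  moreover have "b ^ k * x = b ^ (j + k) * c + b ^ k * y" by (simp add: * power_add algebra_simps)
  ultimately show ?case by simp
qed

lemma low_mult_a:
  assumes "x \<in> low b U j n" "\<And>n u. u \<in> U n ==> a * u \<in> U (Suc n)" "j \<le> Suc n"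
  shows "a * x \<in> low b U j (Suc n)"
proof -
  obtain u where *: "x = (\<Sum>i<j. b ^ i * u i)" "\<forall>i<j. u i \<in> U (n - i)" using assms(1) by (auto simp: low_def)
  have "a * x = (\<Sum>i<j. b ^ i * (a * u i))" using * by (simp add: sum_distrib_left algebra_simps)
  moreover have "\<forall>i<j. a * u i \<in> U (Suc n - i)"
  proof (intro allI impI)
    fix i assume "i < j"
    hence "a * u i \<in> U (Suc (n - i))" using assms(2) * by blast
    thus "a * u i \<in> U (Suc n - i)" using \<open>i < j\<close> assms(3) by (simp add: Suc_diff_le)
  qed
  ultimately show ?thesis by (rule lowI)
qed

text \<open>Hilbert's basis theorem for the graded modules with pieces \<open>E n\<close> modulo
  \<open>V n\<close> over the polynomial ring in indeterminates for \<open>as\<close>: a submodule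
  of a module generated in bounded degrees is generated in bounded degrees. The list is shortened by
  one element \<open>b\<close>, which becomes the polynomial variable; the ideals of leading
  coefficients are treated by the induction hypothesis. The chain condition is asked for in each
  degree separately.\<close>

theorem artin_rees:
  fixes as :: "'r::comm_ring_1 list"
  assumes "\<And>n. idealp (U n)" "\<And>n. idealp (V n)" "\<And>n. idealp (E n)"
    and "\<And>n. V n <= E n" "\<And>n. E n <= U n"
    and "\<And>a n x. a \<in> set as ==> x \<in> U n ==> a * x \<in> U (Suc n)"
    and "\<And>a n x. a \<in> set as ==> x \<in> V n ==> a * x \<in> V (Suc n)"
    and "\<And>a n x. a \<in> set as ==> x \<in> E n ==> a * x \<in> E (Suc n)"
    and "\<And>n. n \<ge> n0 ==> U (Suc n) <= isum (lcomb as (U n)) (V (Suc n))"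
    and "\<And>n H. (\<And>i::nat. idealp (H i)) ==> (\<And>i. V n <= H i) ==> (\<And>i. H i <= U n) ==> (\<And>i. H i <= H (Suc i))
          ==> \<exists>k. \<forall>j. H j <= H k"
  shows "\<exists>n1. \<forall>n\<ge>n1. E (Suc n) <= isum (lcomb as (E n)) (V (Suc n))"
  using assms
proof (induction as arbitrary: U V E n0)
  case Nil
  have "E (Suc n) <= isum {0} (V (Suc n))" if "n \<ge> n0" for n
    using Nil(9)[OF that] Nil(5)[of "Suc n"] by auto
  thus ?case by auto
next
  case (Cons b as)
  note idU = Cons.prems(1) and idV = Cons.prems(2) and idE = Cons.prems(3) and VE = Cons.prems(4) and EU = Cons.prems(5)
    and aU = Cons.prems(6) and aV = Cons.prems(7) and aE = Cons.prems(8) and gen = Cons.prems(9) and acc = Cons.prems(10)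
  have bpow: "b ^ k * x \<in> Z (n + k)" if "x \<in> Z n" "\<And>n x. x \<in> Z n ==> b * x \<in> Z (Suc n)" for Z :: "nat => 'r set" and k n x
    using that by (induction k) (auto simp: mult.assoc)
  \<comment> \<open>The submodule generated from degree \<open>n0\<close> on without
    \<open>b\<close>; \<open>W k\<close> sits in degree \<open>n0 + k\<close>.\<close>
  define W where "W = rec_nat (U n0) (\<lambda>k S. isum (lcomb as S) (V (Suc (n0 + k))))"
  have W0: "W 0 = U n0" and WS: "W (Suc k) = isum (lcomb as (W k)) (V (Suc (n0 + k)))" for k
    by (simp_all add: W_def)
  have idW: "idealp (W k)" for k
    by (induction k) (auto simp: W0 WS idU idV intro!: idealp_isum idealp_lcomb)
  have WU: "W k <= U (n0 + k)" for k
  proof (induction k)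
    case (Suc k)
    have "lcomb as (W k) <= U (Suc (n0 + k))"
      using Suc aU by (intro lcomb_least idU) auto
    moreover have "V (Suc (n0 + k)) <= U (Suc (n0 + k))" using VE EU by blast
    ultimately show ?case unfolding WS using isum_least[OF idU] by simp
  qed (simp add: W0)
  have VW: "V (n0 + k) <= W k" for k
  proof (cases k)
    case 0 thus ?thesis using VE EU W0 by auto
  next
    case (Suc l) thus ?thesis using isum_subset2[OF idealp_lcomb[OF idW]] by (simp add: WS)
  qed
  define U' where "U' n = (if n \<le> n0 then U n else W (n - n0))" for n
  have U'W: "U' (n0 + k) = W k" for k by (cases k) (auto simp: U'_def W0)
  have U'W': "U' n = W (n - n0)" if "n \<ge> n0" for n using U'W[of "n - n0"] that by simp
  have idU': "idealp (U' n)" for n using idU idW by (simp add: U'_def)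
  have U'U: "U' n <= U n" for n using WU[of "n - n0"] by (auto simp: U'_def)
  have VU': "V n <= U' n" for n using VW[of "n - n0"] VE[of n] EU[of n] by (auto simp: U'_def)
  have genU': "U' (Suc n) <= isum (lcomb as (U' n)) (V (Suc n))" if "n \<ge> n0" for n
    using that WS[of "n - n0"] by (simp add: U'W' Suc_diff_le)
  have aU': "a * x \<in> U' (Suc n)" if "a \<in> set as" "x \<in> U' n" for a n x
  proof (cases "n < n0")
    case True thus ?thesis using that aU[of a x n] by (simp add: U'_def)
  next
    case False
    hence "W (Suc (n - n0)) = U' (Suc n)" by (simp add: U'W' Suc_diff_le)
    moreover have "a * x \<in> lcomb as (W (n - n0))"
      using that False by (intro lcomb_mem idW) (auto simp: U'W')
    ultimately show ?thesis using WS[of "n - n0"] isum_subset1[OF idV] by (metis subsetD)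
  qed
  \<comment> \<open>In degrees from \<open>n0\<close> on, \<open>U\<close> consists of polynomials
    in \<open>b\<close> with coefficients in \<open>U'\<close>, so leading coefficients with respect
    to \<open>b\<close> make sense.\<close>
  have Ulow: "U (n0 + k) <= low b U' (Suc k) (n0 + k)" for k
  proof (induction k)
    case 0
    show ?case
    proof
      fix x assume "x \<in> U (n0 + 0)"
      hence "b ^ 0 * x + 0 \<in> low b U' (Suc 0) n0" by (intro low_SucI) (auto simp: U'_def)
      thus "x \<in> low b U' (Suc 0) (n0 + 0)" by simp
    qed
  next
    case (Suc k)
    let ?L = "low b U' (Suc (Suc k)) (Suc (n0 + k))"
    have idL: "idealp ?L" by (rule idealp_low[OF idU'])
    have "lcomb (b # as) (U (n0 + k)) <= ?L"
    proof (rule lcomb_least[OF idL])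
      fix a s assume a: "a \<in> set (b # as)" and s: "s \<in> U (n0 + k)"
      hence s': "s \<in> low b U' (Suc k) (n0 + k)" using Suc by auto
      show "a * s \<in> ?L"
      proof (cases "a = b")
        case True
        thus ?thesis using low_mult_b[OF idU' s', of 1] by simp
      next
        case False
        hence "a * s \<in> low b U' (Suc k) (Suc (n0 + k))"
          using a aU' by (intro low_mult_a[OF s']) auto
        thus ?thesis using low_mono_j[of U', OF idU', of "Suc k" "Suc (Suc k)"] by auto
      qed
    qed
    moreover have "V (Suc (n0 + k)) <= ?L"
    proof
      fix x assume "x \<in> V (Suc (n0 + k))"
      hence "b ^ 0 * x + 0 \<in> low b U' (Suc 0) (Suc (n0 + k))"
        using VU' by (intro low_SucI) auto
      thus "x \<in> ?L" using low_mono_j[of U', OF idU', of "Suc 0" "Suc (Suc k)"] by auto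
    qed
    ultimately have "isum (lcomb (b # as) (U (n0 + k))) (V (Suc (n0 + k))) <= ?L" by (rule isum_least[OF idL])
    moreover have "U (Suc (n0 + k)) <= isum (lcomb (b # as) (U (n0 + k))) (V (Suc (n0 + k)))"
      by (rule gen) simp
    ultimately have "U (Suc (n0 + k)) <= ?L" by (rule order_trans[rotated])
    thus ?case by simp
  qed
  have idlow: "idealp (low b U' j n)" for j n by (rule idealp_low[OF idU'])
  \<comment> \<open>Coefficients of \<open>b ^ j\<close> in elements of \<open>E\<close> of degree
    \<open>k + j\<close> whose other terms are lower in \<open>b\<close>. They grow with
    \<open>j\<close> because \<open>E\<close> is stable under \<open>b\<close>.\<close>
  define L where "L j k = {c \<in> U' k. \<exists>d\<in>low b U' j (k + j). b ^ j * c + d \<in> E (k + j)}" for j k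
  have idL: "idealp (L j k)" for j k
  proof (rule idealpI)
    show "0 \<in> L j k" unfolding L_def
      using idealp_zero[OF idU'] idealp_zero[OF idE] by (auto intro!: bexI[of _ 0] idealp_zero[OF idlow])
  next
    fix x y assume "x \<in> L j k" "y \<in> L j k"
    then obtain d e where *: "x \<in> U' k" "y \<in> U' k" "d \<in> low b U' j (k + j)" "e \<in> low b U' j (k + j)"
      "b ^ j * x + d \<in> E (k + j)" "b ^ j * y + e \<in> E (k + j)" by (auto simp: L_def)
    have "b ^ j * (x + y) + (d + e) = (b ^ j * x + d) + (b ^ j * y + e)" by (simp add: algebra_simps)
    hence "b ^ j * (x + y) + (d + e) \<in> E (k + j)" using idealp_add[OF idE *(5,6)] by (simp only:)
    thus "x + y \<in> L j k" unfolding L_def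
      using idealp_add[OF idU' *(1,2)] idealp_add[OF idlow *(3,4)] by blast
  next
    fix r x assume "x \<in> L j k"
    then obtain d where *: "x \<in> U' k" "d \<in> low b U' j (k + j)" "b ^ j * x + d \<in> E (k + j)" by (auto simp: L_def)
    have "b ^ j * (r * x) + r * d = r * (b ^ j * x + d)" by (simp add: algebra_simps)
    hence "b ^ j * (r * x) + r * d \<in> E (k + j)" using idealp_mult[OF idE *(3)] by (simp only:)
    thus "r * x \<in> L j k" unfolding L_def
      using idealp_mult[OF idU' *(1)] idealp_mult[OF idlow *(2)] by blast
  qed
  have VL: "V k <= L j k" for j k
  proof
    fix c assume c: "c \<in> V k"
    have "b ^ j * c \<in> V (k + j)" using bpow[of c V k j] c aV by simp
    hence "b ^ j * c + 0 \<in> E (k + j)" using subsetD[OF VE] by simp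
    thus "c \<in> L j k" unfolding L_def using VU' c idealp_zero[OF idlow] by blast
  qed
  have LU': "L j k <= U' k" for j k by (auto simp: L_def)
  have aL: "a * c \<in> L j (Suc k)" if a: "a \<in> set as" and c: "c \<in> L j k" for a c j k
  proof -
    obtain d where *: "c \<in> U' k" "d \<in> low b U' j (k + j)" "b ^ j * c + d \<in> E (k + j)" using c by (auto simp: L_def)
    have "b ^ j * (a * c) + a * d = a * (b ^ j * c + d)" by (simp add: algebra_simps)
    hence "b ^ j * (a * c) + a * d \<in> E (Suc k + j)" using aE[OF _ *(3), of a] a by (simp only: add_Suc list.set_intros)
    moreover have "a * d \<in> low b U' j (Suc k + j)" using low_mult_a[OF *(2), of a] aU' a by simp
    ultimately show ?thesis unfolding L_def using aU'[OF a *(1)] by blast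
  qed
  have Lmono: "L j k <= L (Suc j) k" for j k
  proof
    fix c assume "c \<in> L j k"
    then obtain d where *: "c \<in> U' k" "d \<in> low b U' j (k + j)" "b ^ j * c + d \<in> E (k + j)" by (auto simp: L_def)
    have "b ^ Suc j * c + b * d = b * (b ^ j * c + d)" by (simp add: algebra_simps)
    hence "b ^ Suc j * c + b * d \<in> E (k + Suc j)" using aE[OF _ *(3), of b] by (simp only: add_Suc_right list.set_intros)
    moreover have "b * d \<in> low b U' (Suc j) (k + Suc j)" using low_mult_b[OF idU' *(2), of 1] by simp
    ultimately show "c \<in> L (Suc j) k" unfolding L_def using *(1) by blast
  qed
  have Lmono': "i \<le> j ==> L i k <= L j k" for i j k by (rule lift_Suc_mono_le[of "\<lambda>j. L j k"]) (use Lmono in auto)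
  have acc': "\<exists>k. \<forall>j. H j <= H k" if "\<And>i::nat. idealp (H i)" "\<And>i. V n <= H i" "\<And>i. H i <= U' n" "\<And>i. H i <= H (Suc i)" for n H
    using acc[of H n] that U'U[of n] by (meson order_trans)
  have "\<exists>n1. \<forall>n\<ge>n1. L j (Suc n) <= isum (lcomb as (L j n)) (V (Suc n))" for j
  proof (rule Cons.IH[where U = U' and V = V and E = "L j" and ?n0.0 = n0])
    show "\<exists>k. \<forall>j. H j <= H k" if "\<And>i::nat. idealp (H i)" "\<And>i. V n <= H i" "\<And>i. H i <= U' n" "\<And>i. H i <= H (Suc i)" for n H
      using that by (rule acc')
  qed (use idU' idV idL VL LU' aU' aV aL genU' in auto)
  then obtain N where N: "\<And>j n. n \<ge> N j ==> L j (Suc n) <= isum (lcomb as (L j n)) (V (Suc n))" by metis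
  define Li where "Li k = (\<Union>j. L j k)" for k
  have idLi: "idealp (Li k)" for k
  proof (rule idealpI)
    show "0 \<in> Li k" using idealp_zero[OF idL] by (auto simp: Li_def)
    show "x + y \<in> Li k" if xy: "x \<in> Li k" "y \<in> Li k" for x y
    proof -
      obtain i j where "x \<in> L i k" "y \<in> L j k" using xy by (auto simp: Li_def)
      hence "x \<in> L (max i j) k" "y \<in> L (max i j) k" using Lmono'[of i "max i j" k] Lmono'[of j "max i j" k] by auto
      hence "x + y \<in> L (max i j) k" by (rule idealp_add[OF idL])
      thus ?thesis by (auto simp: Li_def)
    qed
    show "r * x \<in> Li k" if "x \<in> Li k" for r x using that unfolding Li_def by (blast intro: idealp_mult[OF idL])
  qed
  have "\<exists>n1. \<forall>n\<ge>n1. Li (Suc n) <= isum (lcomb as (Li n)) (V (Suc n))"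
  proof (rule Cons.IH[where U = U' and V = V and E = Li and ?n0.0 = n0])
    show "V n <= Li n" for n using VL[of n 0] by (auto simp: Li_def)
    show "Li n <= U' n" for n using LU' by (auto simp: Li_def)
    show "a * x \<in> Li (Suc n)" if "a \<in> set as" "x \<in> Li n" for a n x
      using that unfolding Li_def by (blast intro: aL)
    show "\<exists>k. \<forall>j. H j <= H k" if "\<And>i::nat. idealp (H i)" "\<And>i. V n <= H i" "\<And>i. H i <= U' n" "\<And>i. H i <= H (Suc i)" for n H
      using that by (rule acc')
  qed (use idU' idV idLi aU' aV genU' in auto)
  then obtain n1 where n1: "\<And>n. n \<ge> n1 ==> Li (Suc n) <= isum (lcomb as (Li n)) (V (Suc n))" by blast
  \<comment> \<open>Stabilisation in each single degree \<open>k\<close> comes from the chain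
    condition. It becomes uniform because the union \<open>Li\<close> is generated from degree
    \<open>n1\<close> on, so that only the finitely many \<open>k\<close> up to \<open>n1\<close>
    have to be compared.\<close>
  have "\<exists>j. \<forall>i. L i k <= L j k" for k
    using idL VL LU' Lmono by (intro acc'[of "\<lambda>j. L j k" k]) auto
  then obtain jk where jk: "\<And>k i. L i k <= L (jk k) k" by metis
  define J where "J = Max (jk ` {..n1})"
  have LiJ1: "Li k <= L J k" if "k \<le> n1" for k
  proof -
    have "jk k \<le> J" unfolding J_def using that by (intro Max_ge) auto
    thus ?thesis using jk[of _ k] Lmono'[of "jk k" J k] by (auto simp: Li_def)
  qed
  have LiJ2: "Li (n1 + l) <= L J (n1 + l)" for l
  proof (induction l)
    case (Suc l)
    have "Li (Suc (n1 + l)) <= isum (lcomb as (Li (n1 + l))) (V (Suc (n1 + l)))" by (rule n1) simp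
    also have "\<dots> <= isum (lcomb as (L J (n1 + l))) (V (Suc (n1 + l)))"
      using lcomb_mono[OF Suc] by (intro isum_mono) auto
    also have "\<dots> <= L J (Suc (n1 + l))"
      using aL VL by (intro isum_least lcomb_least idL) auto
    finally show ?case by simp
  qed (use LiJ1 in simp)
  have LiJ: "L j k <= L J k" for j k
  proof -
    have "Li k <= L J k"
    proof (cases "k \<le> n1")
      case False thus ?thesis using LiJ2[of "k - n1"] by simp
    qed (rule LiJ1)
    thus ?thesis by (auto simp: Li_def)
  qed
  \<comment> \<open>A combination of leading coefficients is realised by the same combination of
    elements of \<open>E\<close>, up to terms of lower degree in \<open>b\<close>.\<close>
  have lift: "\<exists>e\<in>lcomb as (E (k + j)). e - b ^ j * t \<in> low b U' j (Suc (k + j))"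
    if "t \<in> lcomb cs (L j k)" "set cs <= set as" for t cs j k
  proof -
    have "\<exists>e\<in>lcomb as (E (k + j)). e - b ^ j * t \<in> low b U' j (Suc (k + j))"
      using that
    proof (induction cs arbitrary: t)
      case Nil
      thus ?case using idealp_zero[OF idealp_lcomb[OF idE]] idealp_zero[OF idlow] by force
    next
      case (Cons a cs)
      then obtain c t' where t: "t = a * c + t'" "c \<in> L j k" "t' \<in> lcomb cs (L j k)" by auto
      obtain e where e: "e \<in> lcomb as (E (k + j))" "e - b ^ j * t' \<in> low b U' j (Suc (k + j))"
        using Cons.IH[OF t(3)] Cons.prems by auto
      obtain d where d: "d \<in> low b U' j (k + j)" "b ^ j * c + d \<in> E (k + j)" using t by (auto simp: L_def)
      have ad: "a * d \<in> low b U' j (Suc (k + j))"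
        using low_mult_a[OF d(1), of a] aU' Cons.prems by simp
      have mem: "a * (b ^ j * c + d) + e \<in> lcomb as (E (k + j))"
        using idealp_add[OF idealp_lcomb[OF idE] lcomb_mem[OF idE _ d(2)] e(1)] Cons.prems by simp
      have eq: "a * (b ^ j * c + d) + e - b ^ j * t = a * d + (e - b ^ j * t')"
        by (simp add: t algebra_simps)
      show ?case using mem idealp_add[OF idlow ad e(2)] unfolding eq[symmetric] by blast
    qed
    thus ?thesis .
  qed
  define M where "M = n0 + J + Max (N ` {..J}) + 1"
  have "E (Suc n) <= isum (lcomb (b # as) (E n)) (V (Suc n))" if n: "n \<ge> M" for n
  proof -
    let ?R = "isum (lcomb (b # as) (E n)) (V (Suc n))"
    have idR: "idealp ?R" by (intro idealp_isum idealp_lcomb idE idV)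
    have RE: "b * e \<in> ?R" if "e \<in> E n" for e
      using lcomb_mem[OF idE _ that, of b "b # as"] isum_subset1[OF idV, of "lcomb (b # as) (E n)"] by auto
    have Ra: "e \<in> ?R" if "e \<in> lcomb as (E n)" for e
    proof -
      have "b * 0 + e \<in> lcomb (b # as) (E n)" using that idealp_zero[OF idE[of n]] unfolding lcomb.simps by blast
      thus ?thesis using isum_subset1[OF idV, of "lcomb (b # as) (E n)"] by auto
    qed
    have RV: "V (Suc n) <= ?R" by (rule isum_subset2[OF idealp_lcomb[OF idE]])
    \<comment> \<open>Induction on the degree in \<open>b\<close>. If the top exponent is at most
      \<open>J\<close>, its coefficient comes from one degree lower through \<open>as\<close>.
      Otherwise the coefficient already occurs for the exponent \<open>J\<close>, and the
      corresponding element of \<open>E\<close> times a positive power of \<open>b\<close> removes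
      it.\<close>
    have "x \<in> E (Suc n) ==> x \<in> low b U' j (Suc n) ==> j \<le> Suc (Suc n) ==> x \<in> ?R" for j x
    proof (induction j arbitrary: x)
      case 0 thus ?case using idealp_zero[OF idR] by simp
    next
      case (Suc j)
      from Suc.prems(2) obtain c y where x: "x = b ^ j * c + y" "c \<in> U' (Suc n - j)" "y \<in> low b U' j (Suc n)"
        by (rule low_SucE)
      define k where "k = Suc n - j"
      have kj: "k + j = Suc n" using Suc.prems(3) by (simp add: k_def)
      have cL: "c \<in> L j k" unfolding L_def using x Suc.prems(1) kj k_def by auto
      show ?case
      proof (cases "j \<le> J")
        case True
        have "N j \<le> Max (N ` {..J})" using True by (intro Max_ge) auto
        moreover have "n0 + J + Max (N ` {..J}) + 1 \<le> n" using n by (simp only: M_def)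
        ultimately have "N j < k" using kj True by linarith
        then obtain k' where k': "k = Suc k'" "k' \<ge> N j" by (cases k) auto
        hence k'j: "k' + j = n" using kj by simp
        have "c \<in> isum (lcomb as (L j k')) (V k)" using N[OF k'(2)] cL k' by auto
        then obtain t v where tv: "c = t + v" "t \<in> lcomb as (L j k')" "v \<in> V k" by (auto simp: isum_def)
        obtain e where e: "e \<in> lcomb as (E n)" "e - b ^ j * t \<in> low b U' j (Suc n)"
          using lift[OF tv(2)] k'j by auto
        have bv: "b ^ j * v \<in> V (Suc n)" using bpow[of v V k j] tv(3) aV kj by auto
        have eE: "e \<in> E (Suc n)" using e(1) lcomb_least[OF idE, of as "E n" "Suc n"] aE by auto
        let ?z = "x - e - b ^ j * v"
        have z: "?z = y - (e - b ^ j * t)" by (simp add: x tv algebra_simps)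
        have "?z \<in> E (Suc n)" using Suc.prems(1) eE bv VE idE by (blast intro: idealp_diff)
        moreover have "?z \<in> low b U' j (Suc n)" unfolding z by (rule idealp_diff[OF idlow x(3) e(2)])
        ultimately have "?z \<in> ?R" using Suc.IH Suc.prems(3) by simp
        moreover have "e + b ^ j * v \<in> ?R" using Ra[OF e(1)] bv RV idR by (blast intro: idealp_add)
        ultimately have "?z + (e + b ^ j * v) \<in> ?R" by (rule idealp_add[OF idR])
        thus ?thesis by simp
      next
        case False
        hence "c \<in> L J k" using LiJ cL by blast
        then obtain d where d: "d \<in> low b U' J (k + J)" "b ^ J * c + d \<in> E (k + J)" by (auto simp: L_def)
        let ?e = "b ^ J * c + d" and ?m = "j - J - 1"
        have jJ: "j - J = Suc ?m" using False by simp
        have "b ^ ?m * ?e \<in> E (k + J + ?m)" using d(2) aE by (intro bpow[where Z = E]) auto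
        moreover have "k + J + ?m = n" using kj False by simp
        ultimately have e1: "b ^ ?m * ?e \<in> E n" by simp
        have eq: "b ^ (j - J) * ?e = b * (b ^ ?m * ?e)" by (subst jJ) (simp only: power_Suc mult.assoc)
        have e2: "b ^ (j - J) * ?e \<in> ?R" unfolding eq by (rule RE[OF e1])
        have e3: "b ^ (j - J) * ?e \<in> E (Suc n)" unfolding eq by (rule aE[OF _ e1]) simp
        have "b ^ (j - J) * d \<in> low b U' (J + (j - J)) (k + J + (j - J))" by (rule low_mult_b[OF idU' d(1)])
        moreover have "J + (j - J) = j" "k + J + (j - J) = Suc n" using False kj by auto
        ultimately have bd: "b ^ (j - J) * d \<in> low b U' j (Suc n)" by simp
        let ?z = "x - b ^ (j - J) * ?e"
        have "b ^ (j - J) * b ^ J = b ^ j" using False by (simp add: power_add[symmetric])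
        hence "b ^ (j - J) * ?e = b ^ j * c + b ^ (j - J) * d" by (simp add: distrib_left mult.assoc[symmetric])
        hence z: "?z = y - b ^ (j - J) * d" by (simp add: x)
        have "?z \<in> E (Suc n)" by (rule idealp_diff[OF idE Suc.prems(1) e3])
        moreover have "?z \<in> low b U' j (Suc n)" unfolding z by (rule idealp_diff[OF idlow x(3) bd])
        ultimately have "?z \<in> ?R" using Suc.IH Suc.prems(3) by simp
        thus ?thesis using e2 by (rule idealp_cancel[OF idR])
      qed
    qed
    moreover have "x \<in> low b U' (Suc (Suc n - n0)) (Suc n)" if "x \<in> E (Suc n)" for x
    proof -
      have "n0 + (Suc n - n0) = Suc n" using n by (simp add: M_def)
      thus ?thesis using Ulow[of "Suc n - n0"] EU[of "Suc n"] that by auto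
    qed
    ultimately show ?thesis by (meson Suc_le_mono diff_le_self subsetI)
  qed
  thus ?case by blast
qed

section \<open>Filtrations and regular elements\<close>

definition filt :: "(nat => 'r::comm_ring_1 set) => bool" where
  "filt F \<longleftrightarrow> F 0 = UNIV \<and> (\<forall>n. idealp (F n)) \<and> (\<forall>n. F (Suc n) <= F n) \<and>
     (\<forall>m n x y. x \<in> F m --> y \<in> F n --> x * y \<in> F (m + n))"

definition fadj :: "(nat => 'r::comm_ring_1 set) => 'r => nat => 'r set" where
  "fadj F x n = adj (F n) x"

text \<open>For \<open>x\<close> in \<open>G e\<close> this says that the class of \<open>x\<close>
  in degree \<open>e\<close> is a nonzerodivisor on the associated graded ring of \<open>G\<close>,
  written without that ring.\<close>

definition Reg :: "(nat => 'r::comm_ring_1 set) => 'r => nat => bool" where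
  "Reg G x e \<longleftrightarrow> (\<forall>n f. x * f \<in> G (n + e) --> f \<in> G n)"

text \<open>A homogeneous regular sequence on the associated graded ring: once \<open>Reg\<close>
  holds for the first element, the induced filtration \<open>fadj\<close> has the quotient by the
  class of that element as its graded ring.\<close>

primrec regs :: "(nat => 'r::comm_ring_1 set) => ('r \<times> nat) list => bool" where
  "regs G [] = True"
| "regs G (p # ps) = (Reg G (fst p) (snd p) \<and> regs (fadj G (fst p)) ps)"

definition in_filt :: "(nat => 'r::comm_ring_1 set) => ('r \<times> nat) list => bool" where
  "in_filt G ps \<longleftrightarrow> (\<forall>(x, e) \<in> set ps. x \<in> G e \<and> 0 < e)"

lemma filt_0: "filt F ==> F 0 = UNIV" by (simp add: filt_def)
lemma filt_ideal: "filt F ==> idealp (F n)" by (simp add: filt_def)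
lemma filt_mult: "filt F ==> x \<in> F m ==> y \<in> F n ==> x * y \<in> F (m + n)" by (simp add: filt_def)
lemma filt_antimono: "filt F ==> m \<le> n ==> F n <= F m"
  using lift_Suc_antimono_le[of F m n] by (simp add: filt_def)
lemma filt_down: "filt F ==> x \<in> F n ==> m \<le> n ==> x \<in> F m"
  using filt_antimono by blast
lemma filt_pow: "filt F ==> x \<in> F e ==> x ^ k \<in> F (k * e)"
  by (induction k) (auto simp: filt_0 intro: filt_mult)

lemma filt_fadj:
  assumes "filt F" shows "filt (fadj F x)"
  unfolding filt_def
proof (intro conjI allI impI)
  show "fadj F x 0 = UNIV" using adj_subset[of "F 0" x] filt_0[OF assms] by (auto simp: fadj_def)
  show "idealp (fadj F x n)" for n by (simp add: fadj_def idealp_adj filt_ideal[OF assms])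
  show "fadj F x (Suc n) <= fadj F x n" for n
    using filt_antimono[OF assms, of n "Suc n"] by (simp add: fadj_def adj_mono)
  show "y * z \<in> fadj F x (m + n)" if yz: "y \<in> fadj F x m" "z \<in> fadj F x n" for m n y z
  proof -
    obtain u c v d where *: "y = u + c * x" "z = v + d * x" "u \<in> F m" "v \<in> F n"
      using yz by (auto simp: fadj_def adj_def)
    have "y * z = u * v + (u * d + c * v + c * d * x) * x" by (simp add: * algebra_simps)
    thus ?thesis using filt_mult[OF assms *(3,4)] adjI[of "u * v" "F (m + n)"] by (simp add: fadj_def)
  qed
qed

lemma fadj_sub: "F n <= fadj F x n" by (simp add: fadj_def adj_subset)
lemma fadj_mem: "x \<in> F n ==> x \<in> fadj F y n" using fadj_sub by blast
lemma fadj_commute: "fadj (fadj F x) y = fadj (fadj F y) x"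
  by (rule ext) (simp add: fadj_def adj_commute)
lemma in_filt_fadj: "in_filt G ps ==> in_filt (fadj G x) ps"
  by (auto simp: in_filt_def intro: fadj_mem)

lemma in_filt_Nil [simp]: "in_filt G []" by (simp add: in_filt_def)
lemma in_filt_Cons [simp]: "in_filt G (p # ps) \<longleftrightarrow> fst p \<in> G (snd p) \<and> 0 < snd p \<and> in_filt G ps"
  by (auto simp: in_filt_def)
lemma in_filt_append [simp]: "in_filt G (ps @ qs) \<longleftrightarrow> in_filt G ps \<and> in_filt G qs"
  by (auto simp: in_filt_def)

lemma RegD: "Reg G x e ==> x * f \<in> G (n + e) ==> f \<in> G n" by (auto simp: Reg_def)
lemma Reg_pow: "Reg G x e ==> Reg G (x ^ k) (k * e)"
proof (induction k)
  case 0 thus ?case by (simp add: Reg_def)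
next
  case (Suc k)
  show ?case unfolding Reg_def
  proof (intro allI impI)
    fix n f assume "x ^ Suc k * f \<in> G (n + Suc k * e)"
    hence "x * (x ^ k * f) \<in> G ((n + k * e) + e)" by (simp add: algebra_simps)
    hence "x ^ k * f \<in> G (n + k * e)" using RegD[OF Suc.prems] by blast
    thus "f \<in> G n" by (rule RegD[OF Suc.IH[OF Suc.prems]])
  qed
qed

text \<open>Modulo \<open>x\<close> the assumption gives \<open>f = g * x\<close> up to
  \<open>G n\<close>, and \<open>g\<close> satisfies the hypothesis \<open>e\<close> degrees lower.
  The positive degree of \<open>x\<close> makes the descent end, playing the part that Nakayama's
  lemma has in a local ring.\<close>

lemma Reg_of_fadj:
  assumes G: "filt G" and x: "x \<in> G e" "0 < e" "Reg G x e" and b: "b \<in> G e'" "Reg (fadj G x) b e'"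
  shows "Reg G b e'"
proof -
  have "b * f \<in> G (n + e') ==> f \<in> G n" for n f
  proof (induction n arbitrary: f rule: less_induct)
    case (less n)
    hence "b * f \<in> fadj G x (n + e')" using fadj_sub by blast
    hence "f \<in> fadj G x n" using b(2) by (auto simp: Reg_def)
    then obtain g where g: "f - g * x \<in> G n" by (auto simp: fadj_def adj_iff)
    have "g * x \<in> G n"
    proof (cases "n < e")
      case True
      thus ?thesis using filt_down[OF G idealp_mult[OF filt_ideal[OF G] x(1)]] by simp
    next
      case False
      then obtain k where k: "n = k + e" "k < n" using x(2) by (metis add.commute le_add_diff_inverse linorder_not_less less_add_same_cancel1)
      have "b * (f - g * x) \<in> G (e' + n)" by (rule filt_mult[OF G b(1) g])
      hence "b * f - b * (f - g * x) \<in> G (n + e')" using less.prems by (metis add.commute idealp_diff filt_ideal[OF G])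
      moreover have "b * f - b * (f - g * x) = x * (b * g)" by (simp add: algebra_simps)
      ultimately have "x * (b * g) \<in> G ((k + e') + e)" using k by (simp add: algebra_simps)
      hence "b * g \<in> G (k + e')" by (rule RegD[OF x(3)])
      hence "g \<in> G k" by (rule less.IH[OF k(2)])
      thus ?thesis using filt_mult[OF G _ x(1)] k by blast
    qed
    thus "f \<in> G n" using g idealp_cancel[OF filt_ideal[OF G]] by blast
  qed
  thus ?thesis by (auto simp: Reg_def)
qed

lemma Reg_swap:
  assumes G: "filt G" and x: "x \<in> G e" "0 < e" "Reg G x e" and b: "b \<in> G e'" "Reg (fadj G x) b e'"
  shows "Reg (fadj G b) x e"
  unfolding Reg_def
proof (intro allI impI)
  fix n f assume "x * f \<in> fadj G b (n + e)"
  then obtain g where g: "x * f - g * b \<in> G (n + e)" by (auto simp: fadj_def adj_iff)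
  show "f \<in> fadj G b n"
  proof (cases "n + e < e'")
    case True
    have "g * b \<in> G (n + e)" using True filt_down[OF G idealp_mult[OF filt_ideal[OF G] b(1)]] by simp
    hence "x * f \<in> G (n + e)" using g idealp_cancel[OF filt_ideal[OF G]] by blast
    thus ?thesis using RegD[OF x(3)] fadj_sub by blast
  next
    case False
    define k where "k = n + e - e'"
    have k: "n + e = k + e'" using False by (simp add: k_def)
    have "b * g \<in> fadj G x (k + e')"
    proof -
      have "- (x * f - g * b) + f * x \<in> adj (G (n + e)) x"
        using idealp_neg[OF filt_ideal[OF G] g] by (rule adjI)
      moreover have "- (x * f - g * b) + f * x = b * g" by (simp add: algebra_simps)
      ultimately show ?thesis unfolding fadj_def k[symmetric] by metis
    qed
    hence "g \<in> fadj G x k" by (rule RegD[OF b(2)])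
    then obtain h where h: "g - h * x \<in> G k" by (auto simp: fadj_def adj_iff)
    have "(g - h * x) * b \<in> G (n + e)" using filt_mult[OF G h b(1)] k by simp
    hence "(x * f - g * b) + (g - h * x) * b \<in> G (n + e)" using g idealp_add[OF filt_ideal[OF G]] by blast
    moreover have "(x * f - g * b) + (g - h * x) * b = x * (f - h * b)" by (simp add: algebra_simps)
    ultimately have "f - h * b \<in> G n" using RegD[OF x(3)] by metis
    thus ?thesis by (auto simp: fadj_def adj_iff)
  qed
qed

text \<open>Homogeneous regular sequences of positive degree can be permuted as in a local ring;
  \<open>Reg_of_fadj\<close> and \<open>Reg_swap\<close> are the two halves for neighbours.\<close>

lemma regs_swap:
  assumes G: "filt G" and "in_filt G (p # q # ps)" and "regs G (p # q # ps)"
  shows "regs G (q # p # ps)"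
proof -
  obtain x e b e' where pq: "p = (x, e)" "q = (b, e')" by (cases p, cases q)
  have x: "x \<in> G e" "0 < e" "Reg G x e" and b: "b \<in> G e'" "Reg (fadj G x) b e'"
    using assms by (auto simp: pq)
  show ?thesis
    using Reg_of_fadj[OF G x b] Reg_swap[OF G x b] assms(3) fadj_commute[of G x b] by (simp add: pq)
qed

lemma regs_rotate:
  assumes "filt G" "in_filt G (ps @ [q])" "regs G (ps @ [q])"
  shows "regs G (q # ps)"
  using assms
proof (induction ps arbitrary: G)
  case (Cons p ps)
  have "regs (fadj G (fst p)) (q # ps)"
    using Cons.prems by (rule_tac Cons.IH; (intro filt_fadj in_filt_fadj)?) (auto intro: fadj_mem)
  hence "regs G (p # q # ps)" using Cons.prems by simp
  thus ?case using Cons.prems by (rule_tac regs_swap) (auto intro: fadj_mem)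
qed simp

text \<open>Replacing the first element also changes the condition on all later ones. It is
  therefore moved behind its neighbour, treated there by induction, and moved back.\<close>

lemma regs_pow_head:
  assumes "filt G" "in_filt G ((x, e) # ps)" "regs G ((x, e) # ps)" "0 < k"
  shows "regs G ((x ^ k, k * e) # ps)"
  using assms
proof (induction ps arbitrary: G)
  case Nil thus ?case by (simp add: Reg_pow)
next
  case (Cons q ps)
  have inf: "in_filt G ((x ^ k, k * e) # q # ps)"
    using Cons.prems filt_pow[OF Cons.prems(1), of x e k] by simp
  have 1: "regs G (q # (x, e) # ps)" using Cons.prems by (rule_tac regs_swap) auto
  have "regs (fadj G (fst q)) ((x ^ k, k * e) # ps)"
    using Cons.prems 1 by (rule_tac Cons.IH; (intro filt_fadj in_filt_fadj)?) (auto intro: fadj_mem)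
  hence "regs G (q # (x ^ k, k * e) # ps)" using 1 by simp
  thus ?case using Cons.prems(1) inf by (rule_tac regs_swap) (auto intro: fadj_mem)
qed

lemma regs_pow:
  assumes "filt G" "in_filt G ps" "regs G ps" "\<And>p. p \<in> set ps ==> 0 < k p"
  shows "regs G (map (\<lambda>p. (fst p ^ k p, k p * snd p)) ps)"
  using assms
proof (induction ps arbitrary: G)
  case (Cons p ps)
  have "regs G ((fst p ^ k p, k p * snd p) # ps)"
    using Cons.prems by (rule_tac regs_pow_head) auto
  moreover have "regs (fadj G (fst p ^ k p)) (map (\<lambda>p. (fst p ^ k p, k p * snd p)) ps)"
    using Cons.prems calculation by (rule_tac Cons.IH; (intro filt_fadj in_filt_fadj)?) (auto intro: fadj_mem)
  ultimately show ?case by simp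
qed simp

lemma in_filt_pow:
  assumes "filt G" "in_filt G ps" "\<And>p. p \<in> set ps ==> 0 < k p"
  shows "in_filt G (map (\<lambda>p. (fst p ^ k p, k p * snd p)) ps)"
  using assms filt_pow[OF assms(1)] by (fastforce simp: in_filt_def)

text \<open>Modulo \<open>x\<close> the element is \<open>y ^ k\<close>. The lemma serves for forms
  that are monic in \<open>y\<close>.\<close>

lemma Reg_monic:
  assumes G: "filt G" and x: "x \<in> G e" "0 < e" "Reg G x e" and y: "y \<in> G e'" "Reg (fadj G x) y e'"
    and z: "y ^ k + x * h \<in> G (k * e')"
  shows "Reg G (y ^ k + x * h) (k * e')"
proof (rule Reg_of_fadj[OF G x z])
  show "Reg (fadj G x) (y ^ k + x * h) (k * e')"
    unfolding Reg_def
  proof (intro allI impI)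
    fix n f assume a: "(y ^ k + x * h) * f \<in> fadj G x (n + k * e')"
    have "(h * f) * x \<in> fadj G x (n + k * e')"
      unfolding fadj_def by (rule adj_mem[OF filt_ideal[OF G]])
    from idealp_diff[OF filt_ideal[OF filt_fadj[OF G]] a this]
    have "y ^ k * f \<in> fadj G x (n + k * e')" by (simp add: algebra_simps)
    thus "f \<in> fadj G x n" by (rule RegD[OF Reg_pow[OF y(2)]])
  qed
qed

section \<open>The asymptotic order\<close>

text \<open>The asymptotic order of \<open>f\<close> along \<open>G\<close>, the limit of (order of
  \<open>f ^ m\<close>)/m, is at least \<open>t\<close>. Quantifying over all \<open>s\<close> below
  \<open>t\<close> makes the condition closed in \<open>t\<close>; for negative \<open>s\<close> the
  degree is truncated to 0.\<close>

definition wge :: "(nat => 'r::comm_ring_1 set) => 'r => real => bool" where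
  "wge G f t \<longleftrightarrow> (\<forall>s<t. \<exists>M. \<forall>m\<ge>M. f ^ m \<in> G (nat \<lceil>s * real m\<rceil>))"

lemma wgeI: "(\<And>s. s < t ==> \<exists>M. \<forall>m\<ge>M. f ^ m \<in> G (nat \<lceil>s * real m\<rceil>)) ==> wge G f t"
  by (simp add: wge_def)

lemma wge_mono: "wge G f t ==> t' \<le> t ==> wge G f t'"
  unfolding wge_def by (meson less_le_trans)

lemma wge_closed: "(\<And>t'. t' < t ==> wge G f t') ==> wge G f t"
  unfolding wge_def by (meson dense)

lemma nat_ceil_le: "s \<le> real n ==> nat \<lceil>s\<rceil> \<le> n" by linarith

lemma wge_neg: "filt G ==> t \<le> 0 ==> wge G f t"
proof (rule wgeI)
  fix s assume "filt G" "t \<le> 0" "s < t"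
  hence "f ^ m \<in> G (nat \<lceil>s * real m\<rceil>)" for m
  proof -
    have "s * real m \<le> 0" using \<open>t \<le> 0\<close> \<open>s < t\<close> by (simp add: mult_nonpos_nonneg)
    hence "nat \<lceil>s * real m\<rceil> = 0" by simp
    thus ?thesis using filt_0[OF \<open>filt G\<close>] by simp
  qed
  thus "\<exists>M. \<forall>m\<ge>M. f ^ m \<in> G (nat \<lceil>s * real m\<rceil>)" by blast
qed

lemma wge_mult:
  assumes "filt G" "wge G f t" "wge G g u" shows "wge G (f * g) (t + u)"
proof (rule wgeI)
  fix s assume s: "s < t + u"
  define d where "d = (t + u - s) / 2"
  have d: "t - d < t" "u - d < u" "s = (t - d) + (u - d)" using s by (auto simp: d_def field_simps)
  obtain M N where M: "\<And>m. m \<ge> M ==> f ^ m \<in> G (nat \<lceil>(t - d) * real m\<rceil>)"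
    and N: "\<And>m. m \<ge> N ==> g ^ m \<in> G (nat \<lceil>(u - d) * real m\<rceil>)"
    using assms d unfolding wge_def by metis
  have "(f * g) ^ m \<in> G (nat \<lceil>s * real m\<rceil>)" if "m \<ge> max M N" for m
  proof -
    have 1: "f ^ m * g ^ m \<in> G (nat \<lceil>(t - d) * real m\<rceil> + nat \<lceil>(u - d) * real m\<rceil>)"
      using that M N by (intro filt_mult[OF assms(1)]) auto
    have "s * real m = (t - d) * real m + (u - d) * real m" by (subst d(3)) (simp add: algebra_simps)
    hence "nat \<lceil>s * real m\<rceil> \<le> nat \<lceil>(t - d) * real m\<rceil> + nat \<lceil>(u - d) * real m\<rceil>" by linarith
    thus ?thesis using filt_down[OF assms(1) 1] by (simp add: power_mult_distrib)
  qed
  thus "\<exists>M. \<forall>m\<ge>M. (f * g) ^ m \<in> G (nat \<lceil>s * real m\<rceil>)" by blast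
qed

text \<open>In the binomial expansion either both exponents are large enough for both orders to be
  used, or one is below \<open>K\<close> and its factor is dropped. The loss \<open>s' * K\<close>
  is bounded and is absorbed by the distance from \<open>s\<close> to \<open>s'\<close>.\<close>

lemma wge_add:
  assumes "filt G" "wge G f t" "wge G g t" shows "wge G (f + g) t"
proof (cases "t \<le> 0")
  case True thus ?thesis using wge_neg[OF assms(1)] by blast
next
  case False
  show ?thesis
  proof (rule wgeI)
    fix s assume s: "s < t"
    obtain s' where s': "s < s'" "0 < s'" "s' < t" using dense[of "max s 0" t] False s by auto
    obtain M N where M: "\<And>m. m \<ge> M ==> f ^ m \<in> G (nat \<lceil>s' * real m\<rceil>)"
      and N: "\<And>m. m \<ge> N ==> g ^ m \<in> G (nat \<lceil>s' * real m\<rceil>)"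
      using assms s' unfolding wge_def by metis
    define K where "K = M + N"
    define L where "L = nat \<lceil>s' * real K / (s' - s)\<rceil> + 2 * K"
    have "(f + g) ^ m \<in> G (nat \<lceil>s * real m\<rceil>)" if m: "m \<ge> L" for m
    proof -
      have "nat \<lceil>s' * real K / (s' - s)\<rceil> \<le> m" using m unfolding L_def by (rule add_leD1)
      hence "s' * real K / (s' - s) \<le> real m" by (meson of_nat_le_iff order_trans real_nat_ceiling_ge)
      hence key: "s * real m \<le> s' * (real m - real K)" using s' by (simp add: field_simps)
      have "f ^ i * g ^ (m - i) \<in> G (nat \<lceil>s * real m\<rceil>)" if i: "i \<le> m" for i
      proof -
        consider "i < K" | "m - i < K" | "i \<ge> K" "m - i \<ge> K" by linarith
        thus ?thesis
        proof cases
          case 1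
          hence "m - i \<ge> N" using m by (simp add: L_def K_def)
          hence g: "g ^ (m - i) \<in> G (nat \<lceil>s' * real (m - i)\<rceil>)" by (rule N)
          have "s' * (real m - real K) \<le> s' * real (m - i)" using 1 i s' by (intro mult_left_mono) auto
          hence "nat \<lceil>s * real m\<rceil> \<le> nat \<lceil>s' * real (m - i)\<rceil>" using key by linarith
          thus ?thesis using filt_down[OF assms(1) g] idealp_mult[OF filt_ideal[OF assms(1)]] by blast
        next
          case 2
          hence "i \<ge> M" using m by (simp add: L_def K_def)
          hence g: "f ^ i \<in> G (nat \<lceil>s' * real i\<rceil>)" by (rule M)
          have "s' * (real m - real K) \<le> s' * real i" using 2 i s' by (intro mult_left_mono) auto
          hence "nat \<lceil>s * real m\<rceil> \<le> nat \<lceil>s' * real i\<rceil>" using key by linarith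
          thus ?thesis using filt_down[OF assms(1) g] idealp_mult2[OF filt_ideal[OF assms(1)]] by blast
        next
          case 3
          hence g: "f ^ i * g ^ (m - i) \<in> G (nat \<lceil>s' * real i\<rceil> + nat \<lceil>s' * real (m - i)\<rceil>)"
            by (intro filt_mult[OF assms(1)] M N) (auto simp: K_def)
          have "s' * real m = s' * real i + s' * real (m - i)" using i by (simp add: of_nat_diff algebra_simps)
          moreover have "s * real m \<le> s' * real m" using s' by (intro mult_right_mono) auto
          ultimately have "nat \<lceil>s * real m\<rceil> \<le> nat \<lceil>s' * real i\<rceil> + nat \<lceil>s' * real (m - i)\<rceil>" by linarith
          thus ?thesis by (rule filt_down[OF assms(1) g])
        qed
      qed
      hence "(\<Sum>i\<le>m. of_nat (m choose i) * (f ^ i * g ^ (m - i))) \<in> G (nat \<lceil>s * real m\<rceil>)"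
        by (intro idealp_sum[OF filt_ideal[OF assms(1)]] idealp_mult[OF filt_ideal[OF assms(1)], of "f ^ _ * g ^ _"]) auto
      thus ?thesis by (simp add: binomial_ring mult.assoc)
    qed
    thus "\<exists>M. \<forall>m\<ge>M. (f + g) ^ m \<in> G (nat \<lceil>s * real m\<rceil>)" by blast
  qed
qed

lemma wge_zero: assumes "filt G" shows "wge G 0 t"
proof (rule wgeI)
  fix s assume "s < t"
  have "(0::'a) ^ m \<in> G (nat \<lceil>s * real m\<rceil>)" if "m \<ge> 1" for m
    using that idealp_zero[OF filt_ideal[OF assms]] by (simp add: zero_power)
  thus "\<exists>M. \<forall>m\<ge>M. (0::'a) ^ m \<in> G (nat \<lceil>s * real m\<rceil>)" by blast
qed

lemma wge_neg0: "filt G ==> wge G f 0" by (rule wge_neg) auto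

lemma wge_cmult: "filt G ==> wge G f t ==> wge G (r * f) t"
  using wge_mult[OF _ wge_neg0[of G r], of f t] by simp

lemma wge_uminus: "filt G ==> wge G f t ==> wge G (- f) t"
  using wge_cmult[of G f t "-1"] by simp

lemma wge_diff: "filt G ==> wge G f t ==> wge G g t ==> wge G (f - g) t"
  using wge_add[of G f t "- g"] wge_uminus[of G g t] by simp

text \<open>A bounded loss \<open>c\<close> is invisible in the limit; in this way the shift between
  two comparable filtrations disappears.\<close>

lemma wge_const:
  assumes "filt G" "\<And>m. f ^ m \<in> G (n * m - c)" shows "wge G f (real n)"
proof (rule wgeI)
  fix s assume s: "s < real n"
  define L where "L = nat \<lceil>real c / (real n - s)\<rceil>"
  have "f ^ m \<in> G (nat \<lceil>s * real m\<rceil>)" if m: "m \<ge> L" for m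
  proof -
    have "real c / (real n - s) \<le> real m" using m unfolding L_def by (meson of_nat_le_iff order_trans real_nat_ceiling_ge)
    hence "s * real m \<le> real n * real m - real c" using s by (simp add: field_simps)
    also have "\<dots> \<le> real (n * m - c)" by (cases "c \<le> n * m") (auto simp: of_nat_diff of_nat_mult[symmetric] simp del: of_nat_mult)
    finally have "s * real m \<le> real (n * m - c)" .
    hence "nat \<lceil>s * real m\<rceil> \<le> n * m - c" by (rule nat_ceil_le)
    thus ?thesis by (rule filt_down[OF assms])
  qed
  thus "\<exists>M. \<forall>m\<ge>M. f ^ m \<in> G (nat \<lceil>s * real m\<rceil>)" by blast
qed

lemma wge_mem: "filt G ==> f \<in> G n ==> wge G f (real n)"
  by (rule wge_const[where c = 0]) (auto simp: mult.commute intro: filt_pow)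

lemma wge_pow:
  assumes "filt G" "wge G f t" shows "wge G (f ^ k) (real k * t)"
proof (induction k)
  case 0 thus ?case using wge_neg0[OF assms(1)] by simp
next
  case (Suc k)
  thus ?case using wge_mult[OF assms(1,2) Suc] by (simp add: algebra_simps)
qed

text \<open>The exponent is divided by \<open>k\<close> with remainder. The factor with the
  remaining exponent is discarded, and the bounded loss is covered by passing from \<open>s'\<close>
  down to \<open>s\<close>.\<close>

lemma wge_root:
  assumes G: "filt G" and w: "wge G (f ^ k) (real k * t)" and k: "0 < k" shows "wge G f t"
proof (cases "t \<le> 0")
  case True thus ?thesis using wge_neg[OF G] by blast
next
  case False
  show ?thesis
  proof (rule wgeI)
    fix s assume "s < t"
    then obtain s' where s': "s < s'" "0 < s'" "s' < t" using dense[of "max s 0" t] False by auto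
    hence "real k * s' < real k * t" using k by simp
    then obtain M where M: "\<And>m. m \<ge> M ==> (f ^ k) ^ m \<in> G (nat \<lceil>real k * s' * real m\<rceil>)"
      using w unfolding wge_def by blast
    define L where "L = nat \<lceil>s' * real k / (s' - s)\<rceil> + k * M"
    have "f ^ n \<in> G (nat \<lceil>s * real n\<rceil>)" if n: "n \<ge> L" for n
    proof -
      define m where "m = n div k"
      have nm: "n = k * m + n mod k" by (simp add: m_def)
      have "M = k * M div k" using k by simp
      also have "\<dots> \<le> m" unfolding m_def by (rule div_le_mono) (use n in \<open>simp add: L_def\<close>)
      finally have "(f ^ k) ^ m \<in> G (nat \<lceil>real k * s' * real m\<rceil>)" by (rule M)
      hence 1: "f ^ n \<in> G (nat \<lceil>real k * s' * real m\<rceil>)"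
        by (subst nm) (simp add: power_add power_mult idealp_mult2[OF filt_ideal[OF G]])
      have "n < k * m + k" using k nm mod_less_divisor[of k n] by linarith
      hence "real n - real k \<le> real k * real m" by (metis diff_le_eq less_imp_le of_nat_add of_nat_le_iff of_nat_mult)
      hence "s' * (real n - real k) \<le> s' * (real k * real m)" using s' by (intro mult_left_mono) auto
      moreover have "nat \<lceil>s' * real k / (s' - s)\<rceil> \<le> n" using n unfolding L_def by (rule add_leD1)
      hence "s' * real k / (s' - s) \<le> real n" by (meson of_nat_le_iff order_trans real_nat_ceiling_ge)
      hence "s * real n \<le> s' * (real n - real k)" using s' by (simp add: field_simps)
      ultimately have "s * real n \<le> real k * s' * real m" by (simp add: mult.assoc mult.left_commute)
      hence "nat \<lceil>s * real n\<rceil> \<le> nat \<lceil>real k * s' * real m\<rceil>" by linarith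
      thus ?thesis by (rule filt_down[OF G 1])
    qed
    thus "\<exists>M. \<forall>m\<ge>M. f ^ m \<in> G (nat \<lceil>s * real m\<rceil>)" by blast
  qed
qed

lemma wge_Reg:
  assumes "filt G" "Reg G x e" "wge G (x * f) (t + real e)" shows "wge G f t"
proof (rule wgeI)
  fix s assume "s < t"
  hence "s + real e < t + real e" by simp
  then obtain M where M: "\<And>m. m \<ge> M ==> (x * f) ^ m \<in> G (nat \<lceil>(s + real e) * real m\<rceil>)"
    using assms(3) unfolding wge_def by blast
  have "f ^ m \<in> G (nat \<lceil>s * real m\<rceil>)" if m: "m \<ge> M" for m
  proof (cases "s * real m \<le> 0")
    case True thus ?thesis using filt_0[OF assms(1)] by simp
  next
    case False
    have "\<lceil>s * real m + real (m * e)\<rceil> = \<lceil>s * real m\<rceil> + int (m * e)" by (metis ceiling_add_of_int of_int_of_nat_eq)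
    moreover have "(s + real e) * real m = s * real m + real (m * e)" by (simp add: algebra_simps)
    ultimately have "nat \<lceil>(s + real e) * real m\<rceil> = nat \<lceil>s * real m\<rceil> + m * e" using False by (simp add: nat_add_distrib nat_mult_distrib)
    hence "x ^ m * f ^ m \<in> G (nat \<lceil>s * real m\<rceil> + m * e)" using M[OF m] by (simp add: power_mult_distrib)
    thus ?thesis by (rule RegD[OF Reg_pow[OF assms(2)]])
  qed
  thus "\<exists>M. \<forall>m\<ge>M. f ^ m \<in> G (nat \<lceil>s * real m\<rceil>)" by blast
qed

section \<open>Pairs of comparable filtrations\<close>

text \<open>The data that persist under generic extension and under division by an element: two
  filtrations that agree up to the shift \<open>c\<close>, generation by the degree-one elements
  \<open>as\<close> modulo the next filtration step (for \<open>F\<close> from \<open>n0\<close>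
  on), and finite colengths, which supply chain conditions. The powers of \<open>J\<close> and
  \<open>I\<close> are the initial instance.\<close>

locale stage =
  fixes F G :: "nat => 'r::comm_ring_1 set" and as :: "'r list" and c n0 :: nat
  assumes F: "filt F" and G: "filt G" and GF: "G n <= F n" and FG: "F (n + c) <= G n"
    and asG: "set as <= G 1"
    and genG: "G (Suc n) <= isum (lcomb as (G n)) (G (Suc (Suc n)))"
    and genF: "n0 \<le> n ==> F (Suc n) <= isum (lcomb as (F n)) (F (Suc (Suc n)))"
    and fin: "colen (F n) \<noteq> \<infinity>"

text \<open>An asymptotic form of integral closedness: the powers of \<open>f\<close> stay within a
  bounded distance \<open>C\<close> of the expected degree. In this form it can be tested on the
  coefficients of polynomials and carried to hyperplane sections.\<close>

definition closedf :: "(nat => 'r::comm_ring_1 set) => nat => bool" where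
  "closedf F n1 \<longleftrightarrow> (\<forall>n\<ge>n1. \<forall>f C. (\<forall>m. f ^ m \<in> F (n * m - C)) --> f \<in> F n)"

lemma idealp_wge: "filt G ==> idealp {f. wge G f t}"
  by (rule idealpI) (auto intro: wge_zero wge_add wge_cmult)

context stage
begin

lemma wgeF: "f \<in> F n ==> wge G f (real n)"
proof (rule wge_const[OF G, where c = c])
  fix m assume "f \<in> F n"
  hence "f ^ m \<in> F (m * n)" by (rule filt_pow[OF F])
  moreover have "F (m * n) <= G (n * m - c)"
  proof (cases "c \<le> n * m")
    case True thus ?thesis using FG[of "n * m - c"] by (simp add: mult.commute)
  next
    case False thus ?thesis using filt_0[OF G] by simp
  qed
  ultimately show "f ^ m \<in> G (n * m - c)" by blast
qed

lemma finG: "colen (G n) \<noteq> \<infinity>"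
  using colen_antimono[OF filt_ideal[OF F] filt_ideal[OF G] FG, of n] fin[of "n + c"] by (intro notI) simp

lemma closed_wge:
  assumes cl: "closedf F n1" and n: "n1 < n" and w: "wge G f (real n)"
  shows "f \<in> F n"
proof -
  have "f ^ k \<in> F (n * k - 1)" for k
  proof (cases "k = 0")
    case False
    \<comment> \<open>Order at least \<open>n\<close> controls only degrees strictly below
      \<open>n * k\<close>. One degree is given away: closedness in degree \<open>n * k - 1\<close>
      applies to \<open>f ^ k\<close>, and the loss of 1 then counts as the constant
      \<open>C\<close> for \<open>f\<close>.\<close>
    define p where "p = n * k - 1"
    have nk: "n \<le> n * k" "0 < n * k" using False n by auto
    have p: "n1 \<le> p" using n nk unfolding p_def by linarith
    have "p < k * n" using nk unfolding p_def by (simp add: mult.commute)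
    hence p2: "real p < real k * real n" by (metis of_nat_less_iff of_nat_mult)
    have "wge G (f ^ k) (real k * real n)" by (rule wge_pow[OF G w])
    then obtain M where M: "\<And>m. m \<ge> M ==> (f ^ k) ^ m \<in> G (nat \<lceil>real p * real m\<rceil>)"
      using p2 unfolding wge_def by blast
    have "(f ^ k) ^ m \<in> F (p * m - p * M)" for m
    proof (cases "m \<ge> M")
      case True
      have "real p * real m = real (p * m)" by simp
      hence "nat \<lceil>real p * real m\<rceil> = p * m" by (metis nat_int ceiling_of_nat)
      hence "(f ^ k) ^ m \<in> G (p * m)" using M[OF True] by simp
      thus ?thesis using GF filt_down[OF F, of _ "p * m"] by (meson diff_le_self subsetD)
    next
      case False
      hence "p * m - p * M = 0" by simp
      thus ?thesis using filt_0[OF F] by simp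
    qed
    thus ?thesis using cl p unfolding closedf_def p_def by blast
  qed (use filt_0[OF F] in simp)
  thus ?thesis using cl n unfolding closedf_def by (meson less_imp_le)
qed

text \<open>The elements of \<open>F n\<close> whose asymptotic order exceeds \<open>n\<close> form
  a graded submodule, generated from some degree \<open>n2\<close> on by Artin-Rees. In degree
  \<open>n2\<close> finite colength gives a common excess \<open>g\<close>, and products with
  \<open>as\<close> preserve it. Arbitrary \<open>f\<close> and \<open>k\<close> are moved into this
  range by a power of \<open>x\<close>.\<close>

lemma gap:
  assumes cl: "closedf F n1" and x: "x \<in> G e" "0 < e" "Reg G x e"
  shows "\<exists>g>0. \<forall>f (k::nat) t. real k < t --> wge G f t --> wge G f (real k + g)"
proof -
  define N where "N n = {f \<in> F n. \<exists>t>real n. wge G f t}" for n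
  have idN: "idealp (N n)" for n
  proof (rule idealpI)
    show "0 \<in> N n" unfolding N_def using idealp_zero[OF filt_ideal[OF F]] wge_zero[OF G]
      by (auto intro!: exI[of _ "real n + 1"])
    show "y + z \<in> N n" if yz: "y \<in> N n" "z \<in> N n" for y z
    proof -
      obtain t u where *: "y \<in> F n" "z \<in> F n" "t > real n" "u > real n" "wge G y t" "wge G z u"
        using yz by (auto simp: N_def)
      hence "wge G (y + z) (min t u)" by (intro wge_add[OF G]) (auto elim: wge_mono)
      thus ?thesis unfolding N_def using * idealp_add[OF filt_ideal[OF F] *(1,2)]
        by (auto intro!: exI[of _ "min t u"])
    qed
    show "r * y \<in> N n" if "y \<in> N n" for r y
      using that idealp_mult[OF filt_ideal[OF F]] wge_cmult[OF G] unfolding N_def by blast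
  qed
  have FN: "F (Suc n) <= N n" for n
  proof
    fix f assume f: "f \<in> F (Suc n)"
    thus "f \<in> N n" unfolding N_def using wgeF[OF f] filt_down[OF F f, of n]
      by (auto intro!: exI[of _ "real (Suc n)"])
  qed
  have asF: "a \<in> F 1" if "a \<in> set as" for a using that asG GF by blast
  have "\<exists>n2. \<forall>n\<ge>n2. N (Suc n) <= isum (lcomb as (N n)) (F (Suc (Suc n)))"
  proof (rule artin_rees[where U = F and V = "\<lambda>n. F (Suc n)" and E = N and ?n0.0 = n0])
    show "a * f \<in> F (Suc n)" if "a \<in> set as" "f \<in> F n" for a n f
      using filt_mult[OF F asF[OF that(1)] that(2)] by simp
    show "a * f \<in> F (Suc (Suc n))" if "a \<in> set as" "f \<in> F (Suc n)" for a n f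
      using filt_mult[OF F asF[OF that(1)] that(2)] by simp
    show "a * f \<in> N (Suc n)" if a: "a \<in> set as" and f: "f \<in> N n" for a n f
    proof -
      obtain t where t: "f \<in> F n" "t > real n" "wge G f t" using f by (auto simp: N_def)
      have "wge G (a * f) (real 1 + t)"
        using a asG by (intro wge_mult[OF G] t(3) wge_mem[OF G]) auto
      thus ?thesis unfolding N_def using t filt_mult[OF F asF[OF a] t(1)]
        by (auto intro!: exI[of _ "real 1 + t"])
    qed
    show "\<exists>k. \<forall>j. H j <= H k"
      if "\<And>i::nat. idealp (H i)" "\<And>i. F (Suc n) <= H i" "\<And>i. H i <= F n" "\<And>i. H i <= H (Suc i)" for n H
      using that by (intro colen_acc[OF filt_ideal[OF F] fin[of "Suc n"]]) auto
    show "N n <= F n" for n by (auto simp: N_def)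
    show "F (Suc n) <= isum (lcomb as (F n)) (F (Suc (Suc n)))" if "n0 \<le> n" for n using genF[OF that] .
  qed (use filt_ideal[OF F] idN FN in auto)
  then obtain n2 where n2: "\<And>n. n \<ge> n2 ==> N (Suc n) <= isum (lcomb as (N n)) (F (Suc (Suc n)))" by blast
  \<comment> \<open>The ideals of elements with excess \<open>1 / Suc k\<close> increase with
    \<open>k\<close> and contain \<open>F (Suc n2)\<close>, so they stabilise at some
    \<open>K\<close>; every positive excess is then at least \<open>1 / Suc K\<close>.\<close>
  define H where "H k = F n2 \<inter> {f. wge G f (real n2 + 1 / real (Suc k))}" for k
  have "\<exists>k. \<forall>j. H j <= H k"
  proof (rule colen_acc[OF filt_ideal[OF F] fin[of "Suc n2"]])
    show "idealp (H i)" for i unfolding H_def by (intro idealp_Int idealp_wge filt_ideal F G)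
    show "F (Suc n2) <= H i" for i
    proof
      fix f assume f: "f \<in> F (Suc n2)"
      have "1 / real (Suc i) \<le> 1" by simp
      hence "wge G f (real n2 + 1 / real (Suc i))" using wge_mono[OF wgeF[OF f]] by simp
      thus "f \<in> H i" unfolding H_def using filt_down[OF F f, of n2] by simp
    qed
    show "H i <= H (Suc i)" for i
    proof
      fix f assume f: "f \<in> H i"
      have "1 / real (Suc (Suc i)) \<le> 1 / real (Suc i)" by (intro divide_left_mono) auto
      thus "f \<in> H (Suc i)" using f wge_mono[of G f "real n2 + 1 / real (Suc i)" "real n2 + 1 / real (Suc (Suc i))"]
        unfolding H_def by auto
    qed
  qed
  then obtain K where K: "\<And>j. H j <= H K" by blast
  define g where "g = 1 / real (Suc K)"
  have g: "0 < g" "g \<le> 1" by (auto simp: g_def)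
  have N2: "wge G f (real n2 + g)" if "f \<in> N n2" for f
  proof -
    obtain t where t: "f \<in> F n2" "t > real n2" "wge G f t" using \<open>f \<in> N n2\<close> by (auto simp: N_def)
    then obtain j where "1 / real (Suc j) < t - real n2" using nat_approx_posE[of "t - real n2"] by auto
    hence "wge G f (real n2 + 1 / real (Suc j))" by (intro wge_mono[OF t(3)]) auto
    hence "f \<in> H j" using t(1) by (simp add: H_def)
    thus ?thesis using K[of j] by (auto simp: H_def g_def)
  qed
  have N': "f \<in> N n ==> n \<ge> n2 ==> wge G f (real n + g)" for n f
  proof (induction n arbitrary: f)
    case 0 thus ?case using N2 by simp
  next
    case (Suc n)
    show ?case
    proof (cases "Suc n = n2")
      case True thus ?thesis using N2 Suc.prems by simp
    next
      case False
      hence n: "n \<ge> n2" using Suc.prems by simp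
      let ?W = "{f. wge G f (real (Suc n) + g)}"
      have idW: "idealp ?W" by (rule idealp_wge[OF G])
      have "lcomb as (N n) <= ?W"
      proof (rule lcomb_least[OF idW])
        fix a s assume a: "a \<in> set as" and s: "s \<in> N n"
        have "wge G (a * s) (real 1 + (real n + g))"
          using a asG by (intro wge_mult[OF G] Suc.IH s n wge_mem[OF G]) auto
        thus "a * s \<in> ?W" by (simp add: algebra_simps)
      qed
      moreover have "F (Suc (Suc n)) <= ?W"
        using g wge_mono[OF wgeF] by force
      ultimately have "isum (lcomb as (N n)) (F (Suc (Suc n))) <= ?W" by (rule isum_least[OF idW])
      thus ?thesis using n2[OF n] Suc.prems(1) by blast
    qed
  qed
  have "wge G f (real k + g)" if kt: "real k < t" and w: "wge G f t" for f k t
  proof -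
    \<comment> \<open>The factor \<open>x ^ j\<close> lifts the degree beyond \<open>n2\<close>,
      where the gap is known, and beyond \<open>n1\<close>, where order implies membership.\<close>
    define j where "j = n2 + Suc n1"
    have j: "j \<le> j * e" using x(2) by simp
    let ?y = "x ^ j * f"
    have "wge G ?y (real (j * e) + t)" using wge_mult[OF G wge_mem[OF G filt_pow[OF G x(1), of j]] w] .
    hence w2: "wge G ?y (t + real (j * e))" by (simp add: add.commute)
    have "?y \<in> F (k + j * e)"
    proof (rule closed_wge[OF cl])
      show "n1 < k + j * e" using j by (simp add: j_def)
      show "wge G ?y (real (k + j * e))" by (rule wge_mono[OF w2]) (use kt in simp)
    qed
    hence "?y \<in> N (k + j * e)" unfolding N_def using w2 kt by (auto intro!: exI[of _ "t + real (j * e)"])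
    hence "wge G ?y (real (k + j * e) + g)" by (rule N') (use j in \<open>simp add: j_def\<close>)
    hence "wge G ?y ((real k + g) + real (j * e))" by (simp add: algebra_simps)
    thus ?thesis by (rule wge_Reg[OF G Reg_pow[OF x(3)]])
  qed
  with g(1) show ?thesis by blast
qed

end

text \<open>By the pigeonhole principle two multiples of \<rho> have fractional parts closer than
  \<open>g\<close>. Their difference, or a multiple of it when it lies just below an integer, has a
  fractional part below \<open>g\<close>.\<close>

lemma exists_integer_multiple:
  fixes \<rho> g :: real
  assumes g: "0 < g" and gapp: "\<And>m. m \<ge> 1 ==> frac (real m * \<rho>) = 0 \<or> g \<le> frac (real m * \<rho>)"
  shows "\<exists>m\<ge>1::nat. frac (real m * \<rho>) = 0"
proof (rule ccontr)
  assume "\<not> ?thesis"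
  with gapp have big: "\<And>m. m \<ge> 1 ==> g \<le> frac (real m * \<rho>)" by blast
  obtain N :: nat where N: "1 / g < real N" using reals_Archimedean2 by blast
  hence N0: "N > 0" using g by (metis less_numeral_extra(3) not_gr_zero of_nat_0 order_less_trans zero_less_divide_1_iff)
  have Ng: "1 / real N < g" using N N0 g by (simp add: field_simps)
  define b where "b m = nat \<lfloor>real N * frac (real m * \<rho>)\<rfloor>" for m :: nat
  have b: "b m < N" for m
  proof -
    have "real N * frac (real m * \<rho>) < real N" using frac_lt_1[of "real m * \<rho>"] N0 by simp
    thus ?thesis unfolding b_def by (simp add: N0 nat_less_iff floor_less_iff)
  qed
  have "\<not> inj_on b {..N}"
  proof
    assume "inj_on b {..N}"
    hence "card (b ` {..N}) = Suc N" by (simp add: card_image)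
    moreover have "b ` {..N} <= {..<N}" using b by auto
    hence "card (b ` {..N}) \<le> N" by (metis card_lessThan card_mono finite_lessThan)
    ultimately show False by simp
  qed
  then obtain m1 m2 where m: "m1 < m2" "b m1 = b m2" unfolding inj_on_def by (metis linorder_neqE_nat)
  define a1 a2 where "a1 = frac (real m1 * \<rho>)" and "a2 = frac (real m2 * \<rho>)"
  have nn: "0 \<le> real N * a1" "0 \<le> real N * a2" by (auto simp: a1_def a2_def)
  have "\<lfloor>real N * a1\<rfloor> = \<lfloor>real N * a2\<rfloor>" using m(2) nn unfolding b_def a1_def a2_def by (simp add: nat_eq_iff)
  hence "\<bar>real N * a1 - real N * a2\<bar> < 1" by linarith
  hence "real N * \<bar>a1 - a2\<bar> < 1" by (simp add: abs_mult flip: right_diff_distrib)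
  hence close: "\<bar>a1 - a2\<bar> < g" using Ng N0 by (smt (verit) divide_less_eq mult.commute of_nat_0_less_iff less_divide_eq)
  define d where "d = m2 - m1"
  define z where "z = \<lfloor>real m2 * \<rho>\<rfloor> - \<lfloor>real m1 * \<rho>\<rfloor>"
  have d1: "d \<ge> 1" using m by (simp add: d_def)
  have dr: "real d * \<rho> = of_int z + (a2 - a1)"
    using m by (simp add: d_def z_def a1_def a2_def frac_def of_nat_diff algebra_simps)
  have a01: "0 \<le> a1" "a1 < 1" "0 \<le> a2" "a2 < 1" by (auto simp: a1_def a2_def frac_lt_1)
  show False
  proof (cases "a1 \<le> a2")
    case True
    have "frac (real d * \<rho>) = a2 - a1" unfolding dr using True a01 by (simp add: frac_eq add.commute)
    thus False using big[OF d1] close True by simp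
  next
    case False
    define \<eta> where "\<eta> = a1 - a2"
    have \<eta>: "0 < \<eta>" "\<eta> < g" using False close by (auto simp: \<eta>_def)
    have g1: "g < 1" using big[OF d1] frac_lt_1[of "real d * \<rho>"] by linarith
    \<comment> \<open>The fractional parts of the multiples of \<open>d\<close> move downwards in
      steps of \<eta>, which is smaller than \<open>g\<close>. They cannot jump over the interval
      between 0 and \<open>g\<close>, and this \<open>j\<close> hits it.\<close>
    define j where "j = Suc (nat \<lfloor>(1 - g) / \<eta>\<rfloor>)"
    have "(1 - g) / \<eta> < real j" "real j \<le> (1 - g) / \<eta> + 1" using g1 \<eta> unfolding j_def by (auto simp: of_nat_nat) linarith+
    hence j: "1 - g < real j * \<eta>" "real j * \<eta> \<le> 1 - g + \<eta>" using \<eta> by (auto simp: field_simps)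
    have e: "real (j * d) * \<rho> = of_int (int j * z - 1) + (1 - real j * \<eta>)"
    proof -
      have "real (j * d) * \<rho> = real j * (real d * \<rho>)" by simp
      thus ?thesis unfolding dr by (simp add: \<eta>_def algebra_simps)
    qed
    have "frac (real (j * d) * \<rho>) = 1 - real j * \<eta>"
      unfolding e frac_unique_iff using j \<eta> g1 by (simp only: add_diff_cancel_right' Ints_of_int) auto
    moreover have "j * d \<ge> 1" using d1 by (simp add: j_def)
    ultimately show False using big[of "j * d"] j by simp
  qed
qed

section \<open>Vanishing of sections of negative degree\<close>

context stage
begin

text \<open>The relations say that the fractions \<open>\<alpha> i / x i\<close> agree to high
  order, and \<open>y'\<close> is \<open>y\<close> times the \<open>k\<close>-th power of this
  common fraction: \<open>y\<close> is expanded along the \<open>x j\<close>, and each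
  \<open>x j\<close> is replaced by \<open>\<alpha> j\<close>. The constant \<kappa> measures how
  far the error lies above the expected order: 1 comes from the remainder \<open>v\<close> and
  \<open>r - \<rho>\<close> from the relations.\<close>

lemma syzygy_partner:
  fixes x \<alpha> :: "nat => 'r" and \<rho> \<kappa> :: real
  assumes x: "\<And>i. i < d ==> x i \<in> G r"
    and genx: "\<And>n y. N \<le> n ==> y \<in> F (n + r) ==>
      \<exists>u v. (\<forall>j<d. u j \<in> F n) \<and> v \<in> F (Suc (n + r)) \<and> y = (\<Sum>j<d. x j * u j) + v"
    and syz: "\<And>i j. i < d ==> j < d ==> \<alpha> j * x i - \<alpha> i * x j \<in> F (2 * r)"
    and w: "\<And>i. i < d ==> wge G (\<alpha> i) \<rho>" and k: "\<kappa> \<le> 1" "\<kappa> \<le> real r - \<rho>" and n: "N \<le> n"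
  shows "y \<in> F (n + k * r) ==> \<exists>y'. wge G y' (real n + real k * \<rho>) \<and>
      (\<forall>i<d. wge G (x i ^ k * y' - \<alpha> i ^ k * y) (real n + real k * (real r + \<rho>) + \<kappa>))"
proof (induction k arbitrary: y)
  case 0
  thus ?case using wgeF[of y n] wge_zero[OF G] by (intro exI[of _ y]) auto
next
  case (Suc k)
  have "N \<le> n + k * r" using n by simp
  moreover have "y \<in> F ((n + k * r) + r)" using Suc.prems by (simp add: algebra_simps)
  ultimately obtain u v where u: "\<And>j. j < d ==> u j \<in> F (n + k * r)" and v: "v \<in> F (Suc (n + k * r + r))"
    and y: "y = (\<Sum>j<d. x j * u j) + v" using genx by metis
  have "\<exists>y'. wge G y' (real n + real k * \<rho>) \<and>
      (\<forall>i<d. wge G (x i ^ k * y' - \<alpha> i ^ k * u j) (real n + real k * (real r + \<rho>) + \<kappa>))" if "j < d" for j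
    using Suc.IH[OF u[OF that]] .
  then obtain u' where u': "\<And>j. j < d ==> wge G (u' j) (real n + real k * \<rho>)"
    "\<And>j i. j < d ==> i < d ==> wge G (x i ^ k * u' j - \<alpha> i ^ k * u j) (real n + real k * (real r + \<rho>) + \<kappa>)"
    by metis
  define y' where "y' = (\<Sum>j<d. \<alpha> j * u' j)"
  have sumI: "wge G (sum f {..<d}) t" if "\<And>j. j < d ==> wge G (f j) t" for f t
    using idealp_sum[OF idealp_wge[OF G], of "{..<d}" f t] that by simp
  have "wge G y' (real n + real (Suc k) * \<rho>)"
    unfolding y'_def
  proof (rule sumI)
    fix j assume j: "j < d"
    have "wge G (\<alpha> j * u' j) (\<rho> + (real n + real k * \<rho>))" by (rule wge_mult[OF G w[OF j] u'(1)[OF j]])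
    thus "wge G (\<alpha> j * u' j) (real n + real (Suc k) * \<rho>)" by (simp add: algebra_simps)
  qed
  moreover have "wge G (x i ^ Suc k * y' - \<alpha> i ^ Suc k * y) (real n + real (Suc k) * (real r + \<rho>) + \<kappa>)" if i: "i < d" for i
  proof -
    let ?t = "real n + real (Suc k) * (real r + \<rho>) + \<kappa>"
    have eq: "x i ^ Suc k * y' - \<alpha> i ^ Suc k * y
      = (\<Sum>j<d. x i * \<alpha> j * (x i ^ k * u' j - \<alpha> i ^ k * u j) + \<alpha> i ^ k * u j * (\<alpha> j * x i - \<alpha> i * x j)) - \<alpha> i ^ Suc k * v"
    proof -
      have "x i ^ Suc k * y' - \<alpha> i ^ Suc k * (\<Sum>j<d. x j * u j)
        = (\<Sum>j<d. x i ^ Suc k * (\<alpha> j * u' j) - \<alpha> i ^ Suc k * (x j * u j))"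
        by (simp only: y'_def sum_distrib_left sum_subtractf)
      also have "\<dots> = (\<Sum>j<d. x i * \<alpha> j * (x i ^ k * u' j - \<alpha> i ^ k * u j) + \<alpha> i ^ k * u j * (\<alpha> j * x i - \<alpha> i * x j))"
        by (intro sum.cong refl) (simp add: algebra_simps)
      finally show ?thesis unfolding y by (simp add: algebra_simps)
    qed
    have wx: "wge G (x i) (real r)" using x[OF i] by (rule wge_mem[OF G])
    have wak: "wge G (\<alpha> i ^ k) (real k * \<rho>)" for k by (rule wge_pow[OF G w[OF i]])
    show ?thesis unfolding eq
    proof (intro wge_diff[OF G] sumI wge_add[OF G])
      fix j assume j: "j < d"
      have "wge G (x i * \<alpha> j * (x i ^ k * u' j - \<alpha> i ^ k * u j)) ((real r + \<rho>) + (real n + real k * (real r + \<rho>) + \<kappa>))"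
        by (intro wge_mult[OF G] wx w[OF j] u'(2)[OF j i])
      thus "wge G (x i * \<alpha> j * (x i ^ k * u' j - \<alpha> i ^ k * u j)) ?t" by (simp add: algebra_simps)
      have "wge G (\<alpha> i ^ k * u j * (\<alpha> j * x i - \<alpha> i * x j)) ((real k * \<rho> + real (n + k * r)) + real (2 * r))"
        by (intro wge_mult[OF G] wak wgeF u[OF j] syz i j)
      thus "wge G (\<alpha> i ^ k * u j * (\<alpha> j * x i - \<alpha> i * x j)) ?t"
        by (rule wge_mono) (use k in \<open>simp add: algebra_simps\<close>)
    next
      have "wge G (\<alpha> i ^ Suc k * v) (real (Suc k) * \<rho> + real (Suc (n + k * r + r)))"
        by (intro wge_mult[OF G] wak wgeF v)
      thus "wge G (\<alpha> i ^ Suc k * v) ?t" by (rule wge_mono) (use k in \<open>simp add: algebra_simps\<close>)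
    qed
  qed
  ultimately show ?case by blast
qed

text \<open>Suppose the least asymptotic order \<rho> of the \<open>\<alpha> i\<close> is below
  \<open>r\<close>, so that the common fraction \<open>\<alpha> i / x i\<close> has negative degree.
  Its \<open>m\<close>-th power, with \<open>m * \<rho> = e\<close> an integer, maps
  \<open>F\<close> in degree \<open>n + m * r\<close>, modulo what it kills, injectively to degree
  \<open>n + e\<close>. The lengths of these quotients are thus bounded along an arithmetic
  progression, while monomials in \<open>x 0\<close> and \<open>x 1\<close> show that they are
  not.\<close>

lemma syzygy_closed:
  fixes x \<alpha> :: "nat => 'r"
  assumes cl: "closedf F n1" and r: "n1 < r" and d: "2 \<le> d"
    and x: "\<And>i. i < d ==> x i \<in> G r" "\<And>i. i < d ==> Reg G (x i) r" and x1: "Reg (fadj G (x 0)) (x 1) r"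
    and genx: "\<And>n y. N \<le> n ==> y \<in> F (n + r) ==>
      \<exists>u v. (\<forall>j<d. u j \<in> F n) \<and> v \<in> F (Suc (n + r)) \<and> y = (\<Sum>j<d. x j * u j) + v"
    and syz: "\<And>i j. i < d ==> j < d ==> \<alpha> j * x i - \<alpha> i * x j \<in> F (2 * r)"
    and i: "i < d"
  shows "\<alpha> i \<in> F r"
proof (rule ccontr)
  assume "\<alpha> i \<notin> F r"
  hence nw: "\<not> wge G (\<alpha> i) (real r)" using closed_wge[OF cl r] by blast
  have r0: "0 < r" using r by simp
  have x0: "x 0 \<in> G r" "Reg G (x 0) r" "x 1 \<in> G r" using x d by auto
  obtain g where g: "g > 0" and gap: "\<And>f (k::nat) t. real k < t ==> wge G f t ==> wge G f (real k + g)"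
    using gap[OF cl x0(1) r0 x0(2)] by blast
  define S where "S = {t. \<forall>i<d. wge G (\<alpha> i) t}"
  have S0: "0 \<in> S" using wge_neg0[OF G] by (auto simp: S_def)
  have Sr: "t \<le> real r" if "t \<in> S" for t
  proof (rule ccontr)
    assume "\<not> t \<le> real r"
    thus False using that i nw wge_mono[of G "\<alpha> i" t "real r"] by (auto simp: S_def)
  qed
  hence bdd: "bdd_above S" by (auto simp: bdd_above_def)
  define \<rho> where "\<rho> = Sup S"
  have \<rho>0: "0 \<le> \<rho>" unfolding \<rho>_def by (rule cSup_upper[OF S0 bdd])
  have upper: "t \<le> \<rho>" if "\<And>i. i < d ==> wge G (\<alpha> i) t" for t
    unfolding \<rho>_def by (rule cSup_upper[OF _ bdd]) (use that in \<open>simp add: S_def\<close>)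
  have w: "wge G (\<alpha> i) \<rho>" if "i < d" for i
  proof (rule wge_closed)
    fix t' assume "t' < \<rho>"
    then obtain t where "t \<in> S" "t' < t" using less_cSup_iff[OF _ bdd] S0 unfolding \<rho>_def by blast
    thus "wge G (\<alpha> i) t'" using that wge_mono[of G "\<alpha> i" t t'] by (auto simp: S_def)
  qed
  have "\<rho> \<le> real r" unfolding \<rho>_def using S0 Sr by (intro cSup_least) auto
  moreover have "\<rho> \<noteq> real r" using w[OF i] nw by auto
  ultimately have \<rho>r: "\<rho> < real r" by simp
  have "\<exists>m\<ge>1::nat. frac (real m * \<rho>) = 0"
  proof (rule exists_integer_multiple[OF g])
    \<comment> \<open>If \<open>m * \<rho>\<close> lay only slightly above an integer
      \<open>k\<close>, the gap would raise the order of every \<open>\<alpha> i ^ m\<close> to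
      \<open>k + g\<close>, and taking roots would exceed the supremum \<rho>.\<close>
    fix m :: nat assume m: "m \<ge> 1"
    define k where "k = nat \<lfloor>real m * \<rho>\<rfloor>"
    have mr0: "0 \<le> real m * \<rho>" using \<rho>0 by simp
    hence k: "real k = of_int \<lfloor>real m * \<rho>\<rfloor>" by (simp add: k_def)
    have fk: "frac (real m * \<rho>) = real m * \<rho> - real k" by (simp add: frac_def k)
    show "frac (real m * \<rho>) = 0 \<or> g \<le> frac (real m * \<rho>)"
    proof (cases "frac (real m * \<rho>) = 0")
      case False
      hence lt: "real k < real m * \<rho>" using frac_ge_0[of "real m * \<rho>"] fk by linarith
      have "wge G (\<alpha> i) ((real k + g) / real m)" if "i < d" for i
      proof (rule wge_root[OF G])
        show "wge G (\<alpha> i ^ m) (real m * ((real k + g) / real m))"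
          using gap[OF lt wge_pow[OF G w[OF that]]] m by simp
      qed (use m in simp)
      hence "(real k + g) / real m \<le> \<rho>" by (rule upper)
      hence "real k + g \<le> real m * \<rho>" using m by (simp add: field_simps)
      thus ?thesis using fk by simp
    qed simp
  qed
  then obtain m :: nat where m: "m \<ge> 1" "frac (real m * \<rho>) = 0" by blast
  define e where "e = nat \<lfloor>real m * \<rho>\<rfloor>"
  have "0 \<le> real m * \<rho>" using \<rho>0 by simp
  hence e: "real e = real m * \<rho>" using m(2) by (simp add: e_def frac_def)
  have "real e < real (m * r)" using e \<rho>r m(1) by simp
  hence er: "e < m * r" by linarith
  have "\<exists>i<d. \<not> wge G (\<alpha> i ^ m) (real e + g)"
  proof (rule ccontr)
    assume "\<not> ?thesis"
    hence all: "\<And>i. i < d ==> wge G (\<alpha> i ^ m) (real e + g)" by blast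
    have "wge G (\<alpha> i) ((real e + g) / real m)" if "i < d" for i
    proof (rule wge_root[OF G])
      show "wge G (\<alpha> i ^ m) (real m * ((real e + g) / real m))" using all[OF that] m by simp
    qed (use m in simp)
    hence "(real e + g) / real m \<le> \<rho>" by (rule upper)
    thus False using e g m(1) by (simp add: field_simps)
  qed
  then obtain i0 where i0: "i0 < d" "\<not> wge G (\<alpha> i0 ^ m) (real e + g)" by blast
  \<comment> \<open>The numerator of the \<open>m\<close>-th power of the fraction, with denominator
    \<open>x i0 ^ m\<close>; its order is at least \<open>e\<close> but not
    \<open>e + g\<close>.\<close>
  define \<beta> where "\<beta> = \<alpha> i0 ^ m"
  have w\<beta>: "wge G \<beta> (real e)" unfolding \<beta>_def e by (rule wge_pow[OF G w[OF i0(1)]])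
  define \<kappa> where "\<kappa> = min 1 (real r - \<rho>)"
  have \<kappa>: "\<kappa> \<le> 1" "\<kappa> \<le> real r - \<rho>" "0 < \<kappa>" using \<rho>r by (auto simp: \<kappa>_def)
  \<comment> \<open>The annihilator, in degree \<open>a\<close>, of the leading part of \<beta>: the
    order of \<open>\<beta> * y\<close> is at least \<open>a + e\<close>, and by the gap any excess
    is at least \<open>g\<close>.\<close>
  define Z where "Z a = F a \<inter> {y. wge G (\<beta> * y) (real a + real e + g)}" for a
  have idZ: "idealp (Z a)" for a
  proof -
    have "{y. wge G (\<beta> * y) (real a + real e + g)} = colon {f. wge G f (real a + real e + g)} \<beta>"
      by (auto simp: colon_def mult.commute)
    thus ?thesis unfolding Z_def by (simp add: idealp_Int idealp_colon idealp_wge G filt_ideal F)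
  qed
  have ZF: "Z a <= F a" for a by (auto simp: Z_def)
  have step: "ilen (Z (n + m * r)) (F (n + m * r)) \<le> ilen (Z (n + e)) (F (n + e))" if n: "N \<le> n" "n1 < n" for n
  proof (rule ilen_le_rel[where rel = "\<lambda>y y'. wge G (x i0 ^ m * y' - \<beta> * y) (real (n + m * r + e) + \<kappa>)"])
    show "\<exists>y'\<in>F (n + e). wge G (x i0 ^ m * y' - \<beta> * y) (real (n + m * r + e) + \<kappa>)" if y: "y \<in> F (n + m * r)" for y
    proof -
      obtain y' where y': "wge G y' (real n + real m * \<rho>)"
        "wge G (x i0 ^ m * y' - \<alpha> i0 ^ m * y) (real n + real m * (real r + \<rho>) + \<kappa>)"
        using syzygy_partner[OF x(1) genx syz w \<kappa>(1,2) n(1) y] i0(1) by blast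
      have "y' \<in> F (n + e)" using y'(1) n(2) e by (intro closed_wge[OF cl]) auto
      thus ?thesis using y'(2) e by (intro bexI[of _ y']) (auto simp: \<beta>_def algebra_simps)
    qed
    show "y \<in> Z (n + m * r)" if y: "y \<in> F (n + m * r)"
      "wge G (x i0 ^ m * y' - \<beta> * y) (real (n + m * r + e) + \<kappa>)" "y' \<in> Z (n + e)" for y y'
    proof -
      let ?q = "min g \<kappa>" and ?t = "real (n + m * r) + 2 * real e"
      have "wge G (x i0 ^ m * (\<beta> * y')) (real (m * r) + (real (n + e) + real e + g))"
        using y(3) by (intro wge_mult[OF G wge_mem[OF G filt_pow[OF G x(1)[OF i0(1)]]]]) (simp add: Z_def)
      hence 1: "wge G (x i0 ^ m * (\<beta> * y')) (?t + ?q)" by (rule wge_mono) simp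
      have "wge G (\<beta> * (x i0 ^ m * y' - \<beta> * y)) (real e + (real (n + m * r + e) + \<kappa>))"
        by (rule wge_mult[OF G w\<beta> y(2)])
      hence 2: "wge G (\<beta> * (x i0 ^ m * y' - \<beta> * y)) (?t + ?q)" by (rule wge_mono) simp
      have "wge G (x i0 ^ m * (\<beta> * y') - \<beta> * (x i0 ^ m * y' - \<beta> * y)) (?t + ?q)" by (rule wge_diff[OF G 1 2])
      hence "wge G (\<beta> * \<beta> * y) (?t + ?q)" by (simp add: algebra_simps)
      \<comment> \<open>So far \<open>\<beta> * \<beta> * y\<close> is controlled. One more factor
        \<open>y\<close> produces the square of \<open>\<beta> * y\<close>; the square root halves
        the excess, and the gap restores it to \<open>g\<close>.\<close>
      from wge_mult[OF G this wgeF[OF y(1)]]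
      have "wge G (\<beta> * \<beta> * y * y) (?t + ?q + real (n + m * r))" .
      moreover have "\<beta> * \<beta> * y * y = (\<beta> * y) ^ 2" by (simp add: power2_eq_square algebra_simps)
      moreover have "?t + ?q + real (n + m * r) = real 2 * (real (n + m * r + e) + ?q / 2)" by simp
      ultimately have "wge G ((\<beta> * y) ^ 2) (real 2 * (real (n + m * r + e) + ?q / 2))" by (simp only:)
      hence "wge G (\<beta> * y) (real (n + m * r + e) + ?q / 2)" by (rule wge_root[OF G]) simp
      hence "wge G (\<beta> * y) (real (n + m * r + e) + g)"
        by (rule gap[rotated]) (use g \<kappa> in simp)
      thus ?thesis using y(1) by (simp add: Z_def)
    qed
    let ?R = "\<lambda>y y'. wge G (x i0 ^ m * y' - \<beta> * y) (real (n + m * r + e) + \<kappa>)"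
    show "?R (y + z) (y' + z')" if "?R y y'" "?R z z'" for y y' z z'
      using wge_add[OF G that] by (simp add: algebra_simps)
    show "?R (b * y) (b * y')" if "?R y y'" for b y y'
      using wge_cmult[OF G that, of b] by (simp add: algebra_simps)
  qed (use idZ ZF filt_ideal[OF F] in auto)
  define \<delta> where "\<delta> = m * r - e"
  have \<delta>: "\<delta> > 0" "m * r = e + \<delta>" using er by (auto simp: \<delta>_def)
  have dec: "ilen (Z (a + j * \<delta>)) (F (a + j * \<delta>)) \<le> ilen (Z a) (F a)" if "N + n1 + 1 + e \<le> a" for a j
  proof (induction j)
    case (Suc j)
    define n where "n = a + j * \<delta> - e"
    have n: "a + j * \<delta> = n + e" "N \<le> n" "n1 < n" using that by (auto simp: n_def)
    have "a + Suc j * \<delta> = n + m * r" using n \<delta> by simp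
    thus ?case using step[OF n(2,3)] Suc n(1) by simp
  qed simp
  \<comment> \<open>With \<open>a = K * r\<close> the power \<open>x 0 ^ K\<close> lies in
    \<open>G a\<close>, and \<open>K\<close> is large enough for the monotonicity \<open>dec\<close>
    to start at \<open>a\<close>.\<close>
  define K where "K = N + n1 + 1 + e"
  define a where "a = K * r"
  have a: "N + n1 + 1 + e \<le> a" unfolding a_def K_def using r0 by (metis Suc_leI mult.right_neutral mult_le_mono2 One_nat_def)
  \<comment> \<open>The first \<open>k\<close> monomials \<open>q j\<close> of degree
    \<open>a + k * r\<close> are independent modulo \<open>Z\<close>: a relation would give too high
    an order to the product of \<beta> with powers of \<open>x 0\<close> and a form monic in
    \<open>x 1\<close>, all of which are regular factors.\<close>
  have lower: "enat k \<le> ilen (Z (a + k * r)) (F (a + k * r))" for k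
  proof -
    define q where "q j = x 1 ^ j * x 0 ^ (k - j) * x 0 ^ K" for j
    have qG: "q j \<in> G (a + k * r)" if "j \<le> k" for j
    proof -
      have "q j \<in> G ((j * r + (k - j) * r) + K * r)"
        unfolding q_def by (intro filt_mult[OF G] filt_pow[OF G] x0)
      moreover have "(j * r + (k - j) * r) + K * r = a + k * r" using that by (simp add: a_def add_mult_distrib[symmetric])
      ultimately show ?thesis by simp
    qed
    define D where "D = rec_nat (Z (a + k * r)) (\<lambda>j S. adj S (q j))"
    have D0: "D 0 = Z (a + k * r)" and DS: "D (Suc j) = adj (D j) (q j)" for j by (simp_all add: D_def)
    have idD: "idealp (D j)" for j by (induction j) (auto simp: D0 DS idZ idealp_adj)
    have mem: "\<exists>b. y - (\<Sum>j<i. b j * q j) \<in> Z (a + k * r)" if "y \<in> D i" for i y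
      using that
    proof (induction i arbitrary: y)
      case 0 thus ?case by (simp add: D0)
    next
      case (Suc i)
      then obtain b0 where "y - b0 * q i \<in> D i" by (auto simp: DS adj_iff)
      then obtain b where "y - b0 * q i - (\<Sum>j<i. b j * q j) \<in> Z (a + k * r)" using Suc.IH by blast
      hence "y - (\<Sum>j<Suc i. (b(i := b0)) j * q j) \<in> Z (a + k * r)" by (simp add: algebra_simps)
      thus ?case by blast
    qed
    have DF: "D j <= F (a + k * r)" if "j \<le> k" for j
      using that
    proof (induction j)
      case (Suc j)
      thus ?case unfolding DS using qG[of j] GF by (intro adj_least filt_ideal[OF F]) auto
    qed (simp add: D0 ZF)
    have notin: "q i \<notin> D i" if ik: "i < k" for i
    proof
      assume "q i \<in> D i"
      then obtain b where b: "q i - (\<Sum>j<i. b j * q j) \<in> Z (a + k * r)" using mem by blast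
      define h where "h = - (\<Sum>j<i. b j * (x 1 ^ j * x 0 ^ (i - Suc j)))"
      define f where "f = x 1 ^ i + x 0 * h"
      have x0h: "x 0 * h = - (\<Sum>j<i. b j * (x 1 ^ j * x 0 ^ (i - j)))"
      proof -
        have "x 0 * (b j * (x 1 ^ j * x 0 ^ (i - Suc j))) = b j * (x 1 ^ j * x 0 ^ (i - j))" if "j < i" for j
        proof -
          have "x 0 ^ (i - j) = x 0 * x 0 ^ (i - Suc j)" using that by (metis Suc_diff_Suc power_Suc)
          thus ?thesis by (simp add: algebra_simps)
        qed
        thus ?thesis by (simp add: h_def sum_distrib_left)
      qed
      have "x 0 * h \<in> G (i * r)" unfolding x0h
      proof (rule idealp_neg[OF filt_ideal[OF G]], rule idealp_sum[OF filt_ideal[OF G]], rule idealp_mult[OF filt_ideal[OF G]])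
        fix j assume j: "j \<in> {..<i}"
        have "x 1 ^ j * x 0 ^ (i - j) \<in> G (j * r + (i - j) * r)" by (intro filt_mult[OF G] filt_pow[OF G] x0)
        moreover have "j * r + (i - j) * r = i * r" using j by (simp add: add_mult_distrib[symmetric])
        ultimately show "x 1 ^ j * x 0 ^ (i - j) \<in> G (i * r)" by simp
      qed
      hence fG: "f \<in> G (i * r)" unfolding f_def using filt_pow[OF G x0(3), of i] by (intro idealp_add filt_ideal[OF G])
      have Rf: "Reg G f (i * r)" using fG unfolding f_def by (intro Reg_monic[OF G x0(1) r0 x0(2) x0(3) x1])
      have eq: "q i - (\<Sum>j<i. b j * q j) = x 0 ^ (k - i) * (f * x 0 ^ K)"
      proof -
        have "b j * q j = x 0 ^ (k - i) * (b j * (x 1 ^ j * x 0 ^ (i - j)) * x 0 ^ K)" if "j < i" for j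
        proof -
          have "x 0 ^ (k - j) = x 0 ^ (k - i) * x 0 ^ (i - j)" using that ik by (simp add: power_add[symmetric])
          thus ?thesis by (simp add: q_def algebra_simps)
        qed
        hence "(\<Sum>j<i. b j * q j) = x 0 ^ (k - i) * ((\<Sum>j<i. b j * (x 1 ^ j * x 0 ^ (i - j))) * x 0 ^ K)"
          by (simp add: sum_distrib_left sum_distrib_right)
        thus ?thesis unfolding f_def x0h by (simp add: q_def algebra_simps)
      qed
      have "wge G (\<beta> * (x 0 ^ (k - i) * (f * x 0 ^ K))) (real (a + k * r) + real e + g)"
        using b unfolding eq by (simp add: Z_def)
      moreover have "real (a + k * r) + real e + g = (((real e + g) + real (K * r)) + real (i * r)) + real ((k - i) * r)"
        using ik by (simp add: a_def of_nat_diff algebra_simps)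
      moreover have "\<beta> * (x 0 ^ (k - i) * (f * x 0 ^ K)) = x 0 ^ (k - i) * (f * (x 0 ^ K * \<beta>))" by (simp add: algebra_simps)
      ultimately have "wge G (x 0 ^ (k - i) * (f * (x 0 ^ K * \<beta>))) ((((real e + g) + real (K * r)) + real (i * r)) + real ((k - i) * r))"
        by (simp only:)
      hence "wge G (f * (x 0 ^ K * \<beta>)) (((real e + g) + real (K * r)) + real (i * r))"
        by (rule wge_Reg[OF G Reg_pow[OF x0(2)]])
      hence "wge G (x 0 ^ K * \<beta>) ((real e + g) + real (K * r))" by (rule wge_Reg[OF G Rf])
      hence "wge G \<beta> (real e + g)" by (rule wge_Reg[OF G Reg_pow[OF x0(2)]])
      thus False using i0(2) by (simp add: \<beta>_def)
    qed
    show ?thesis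
    proof (rule strict_chain_le_ilen[where C = D])
      show "D i \<subset> D (Suc i)" if "i < k" for i
        using notin[OF that] adj_subset[of "D i" "q i"] adj_self[OF idD, of "q i" i] unfolding DS by blast
      show "D k <= F (a + k * r)" by (rule DF) simp
    qed (use idZ idD D0 filt_ideal[OF F] in auto)
  qed
  have "ilen (Z a) (F a) \<le> colen (Z a)" by (rule ilen_mono) (use idZ ZF filt_ideal[OF F] in auto)
  also have "\<dots> \<le> colen (F (Suc (a + e) + nat \<lceil>g\<rceil>))"
  proof (rule colen_antimono[OF filt_ideal[OF F] idZ])
    show "F (Suc (a + e) + nat \<lceil>g\<rceil>) <= Z a"
    proof
      fix y assume y: "y \<in> F (Suc (a + e) + nat \<lceil>g\<rceil>)"
      have "wge G y (real a + real e + g)" by (rule wge_mono[OF wgeF[OF y]]) (use g in \<open>simp add: le_nat_iff\<close>, linarith)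
      thus "y \<in> Z a" using filt_down[OF F y, of a] wge_cmult[OF G, of y _ \<beta>] by (simp add: Z_def)
    qed
  qed
  finally obtain B where B: "ilen (Z a) (F a) = enat B"
    using fin[of "Suc (a + e) + nat \<lceil>g\<rceil>"] by (metis enat_ord_simps(5) not_infinity_eq)
  \<comment> \<open>For \<open>k = \<delta> * j\<close> the degree \<open>a + k * r\<close> lies on
    the progression with step \<delta>, where the length is at most \<open>B\<close>; it is also at
    least \<open>k\<close>, which exceeds \<open>B\<close>.\<close>
  define j where "j = Suc B"
  have "enat (\<delta> * j) \<le> ilen (Z (a + (\<delta> * j) * r)) (F (a + (\<delta> * j) * r))" by (rule lower)
  also have "a + (\<delta> * j) * r = a + (j * r) * \<delta>" by simp
  also have "ilen (Z (a + (j * r) * \<delta>)) (F (a + (j * r) * \<delta>)) \<le> ilen (Z a) (F a)" by (rule dec[OF a])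
  finally have "\<delta> * j \<le> B" using B by simp
  moreover have "j \<le> \<delta> * j" using \<delta>(1) by simp
  ultimately show False by (simp add: j_def)
qed

end

section \<open>The length inequality in dimension three\<close>

primrec adjs :: "'r::comm_ring_1 set => 'r list => 'r set" where
  "adjs U [] = U"
| "adjs U (x # xs) = adjs (adj U x) xs"

lemma idealp_adjs: "idealp U ==> idealp (adjs U xs)"
  by (induction xs arbitrary: U) (auto simp: idealp_adj)
lemma adjs_mono: "U <= V ==> adjs U xs <= adjs V xs"
  by (induction xs arbitrary: U V) (auto simp: adj_mono)
lemma adjs_subset: "U <= adjs U xs"
  by (induction xs arbitrary: U) (use adj_subset in fastforce)+

lemma lcomb_adj: "idealp U ==> t \<in> lcomb xs (adj U x) ==> \<exists>h. t - h * x \<in> lcomb xs U"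
proof (induction xs arbitrary: t)
  case Nil thus ?case by (auto intro!: exI[of _ 0])
next
  case (Cons a xs)
  then obtain s t' where *: "t = a * s + t'" "s \<in> adj U x" "t' \<in> lcomb xs (adj U x)" by auto
  obtain h where h: "t' - h * x \<in> lcomb xs U" using Cons *(3) by blast
  obtain k where k: "s - k * x \<in> U" using *(2) by (auto simp: adj_iff)
  have "t - (h + a * k) * x = a * (s - k * x) + (t' - h * x)" by (simp add: * algebra_simps)
  hence "t - (h + a * k) * x \<in> lcomb (a # xs) U" using h k by auto
  thus ?case by blast
qed

text \<open>If an element of degree \<open>n\<close> lies in the ideal of the sequence up to higher
  order, then its class lies in the ideal of the classes of the sequence; regularity brings the
  coefficients into degree \<open>n - r\<close>.\<close>

lemma regs_initial:
  assumes "filt G" "in_filt G ps" "regs G ps" "\<And>p. p \<in> set ps ==> snd p = r" "r \<le> n"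
    "f \<in> G n" "f \<in> adjs (G (Suc n)) (map fst ps)"
  shows "f \<in> isum (lcomb (map fst ps) (G (n - r))) (G (Suc n))"
  using assms
proof (induction ps arbitrary: G)
  case Nil
  hence "0 + f \<in> isum (lcomb [] (G (n - r))) (G (Suc n))" by (intro isumI) auto
  thus ?case by simp
next
  case (Cons p ps)
  note G = Cons.prems(1)
  let ?x = "fst p" and ?xs = "map fst ps"
  have x: "?x \<in> G r" "Reg G ?x r" using Cons.prems by auto
  have "f \<in> isum (lcomb ?xs (fadj G ?x (n - r))) (fadj G ?x (Suc n))"
    using Cons.prems fadj_sub[of G n ?x]
    by (intro Cons.IH[of "fadj G ?x"]) (auto simp: fadj_def[of G ?x "Suc n"] intro: filt_fadj in_filt_fadj)
  then obtain t w where tw: "f = t + w" "t \<in> lcomb ?xs (adj (G (n - r)) ?x)" "w \<in> adj (G (Suc n)) ?x"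
    by (auto simp: isum_def fadj_def)
  obtain h where h: "t - h * ?x \<in> lcomb ?xs (G (n - r))" using lcomb_adj[OF filt_ideal[OF G] tw(2)] by blast
  obtain k where k: "w - k * ?x \<in> G (Suc n)" using tw(3) by (auto simp: adj_iff)
  have xsr: "a \<in> G r" if "a \<in> set ?xs" for a using that Cons.prems(2) Cons.prems(4) by (fastforce simp: in_filt_def)
  have "lcomb ?xs (G (n - r)) <= G n"
  proof (rule lcomb_least[OF filt_ideal[OF G]])
    show "a * s \<in> G n" if "a \<in> set ?xs" "s \<in> G (n - r)" for a s
      using filt_mult[OF G xsr[OF that(1)] that(2)] Cons.prems(5) by simp
  qed
  hence 1: "t - h * ?x \<in> G n" using h by blast
  have 2: "w - k * ?x \<in> G n" using filt_down[OF G k] by simp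
  have "f - (t - h * ?x) - (w - k * ?x) \<in> G n"
    using Cons.prems(6) 1 2 by (metis idealp_diff filt_ideal[OF G])
  moreover have "f - (t - h * ?x) - (w - k * ?x) = ?x * (h + k)" by (simp add: tw algebra_simps)
  ultimately have "?x * (h + k) \<in> G ((n - r) + r)" using Cons.prems(5) by simp
  hence "h + k \<in> G (n - r)" by (rule RegD[OF x(2)])
  hence "?x * (h + k) + (t - h * ?x) \<in> lcomb (map fst (p # ps)) (G (n - r))" using h by auto
  from isumI[OF this k] show ?case by (simp add: tw algebra_simps)
qed

context stage
begin

text \<open>A containment of \<open>E (n + k)\<close> modulo the next step of \<open>F\<close> can
  be tested on products of \<open>G k\<close> with \<open>E n\<close>. In the induction
  \<open>T\<close> is replaced by the elements that all of \<open>as\<close> multiply into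
  \<open>T\<close> plus that step.\<close>

lemma mult_gen:
  assumes gen: "\<And>k. E (Suc (n + k)) <= isum (lcomb as (E (n + k))) (F (Suc (Suc (n + k))))"
    and "idealp T" "\<And>g f. g \<in> G k ==> f \<in> E n ==> g * f \<in> T"
  shows "E (n + k) <= isum T (F (Suc (n + k)))"
  using assms(2,3)
proof (induction k arbitrary: T)
  case 0
  have "E n <= T" using 0(2)[of 1] filt_0[OF G] by auto
  thus ?case using isum_subset1[OF filt_ideal[OF F], of T] by auto
next
  case (Suc k)
  let ?S = "isum T (F (Suc (Suc (n + k))))"
  have idS: "idealp ?S" by (intro idealp_isum Suc.prems filt_ideal[OF F])
  define T' where "T' = {f. \<forall>a\<in>set as. a * f \<in> ?S}"
  have idT': "idealp T'"
  proof (rule idealpI)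
    show "0 \<in> T'" using idealp_zero[OF idS] by (simp add: T'_def)
    show "y + z \<in> T'" if "y \<in> T'" "z \<in> T'" for y z
      using that idealp_add[OF idS] by (simp add: T'_def distrib_left)
    show "b * y \<in> T'" if "y \<in> T'" for b y
      using that idealp_mult[OF idS, of _ b] by (simp add: T'_def mult.left_commute[of _ b])
  qed
  have "E (n + k) <= isum T' (F (Suc (n + k)))"
  proof (rule Suc.IH[OF idT'])
    fix g f assume g: "g \<in> G k" and f: "f \<in> E n"
    have "a * (g * f) \<in> ?S" if a: "a \<in> set as" for a
    proof -
      have "a * g \<in> G (1 + k)" using a asG by (intro filt_mult[OF G] g) auto
      hence "(a * g) * f \<in> T" using Suc.prems(2) f by simp
      thus ?thesis using isum_subset1[OF filt_ideal[OF F], of T] by (auto simp: mult.assoc)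
    qed
    thus "g * f \<in> T'" by (simp add: T'_def)
  qed
  moreover have "F (Suc (n + k)) <= T'"
  proof
    fix f assume f: "f \<in> F (Suc (n + k))"
    have "a * f \<in> ?S" if a: "a \<in> set as" for a
    proof -
      have "a * f \<in> F (1 + Suc (n + k))" using a asG GF by (intro filt_mult[OF F] f) auto
      thus ?thesis using isum_subset2[OF Suc.prems(1), of "F (Suc (Suc (n + k)))"] by auto
    qed
    thus "f \<in> T'" by (simp add: T'_def)
  qed
  ultimately have sub: "E (n + k) <= T'" using isum_least[OF idT' order_refl] by blast
  have "lcomb as (E (n + k)) <= ?S"
    by (rule lcomb_least[OF idS]) (use sub in \<open>auto simp: T'_def\<close>)
  moreover have "F (Suc (Suc (n + k))) <= ?S" by (rule isum_subset2[OF Suc.prems(1)])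
  ultimately have "isum (lcomb as (E (n + k))) (F (Suc (Suc (n + k)))) <= ?S" by (rule isum_least[OF idS])
  thus ?case using gen[of k] by auto
qed

lemma F_mult_gen:
  assumes "n0 \<le> n" "idealp T" "\<And>g f. g \<in> G k ==> f \<in> F n ==> g * f \<in> T"
  shows "F (n + k) <= isum T (F (Suc (n + k)))"
  using assms by (intro mult_gen genF) auto

text \<open>Bounded colength makes the ideals \<open>G n\<close> plus the sequence constant from
  some \<open>k\<close> on. From there \<open>G L\<close> lies in the ideal of the sequence modulo
  \<open>G (Suc L)\<close>, and \<open>regs_initial\<close> supplies the right degrees. The result
  passes to \<open>F\<close> because products with \<open>G L\<close> generate it from lower
  degrees.\<close>

lemma parameters_generate:
  assumes ps: "in_filt G ps" "regs G ps" "\<And>p. p \<in> set ps ==> snd p = r"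
    and bdd: "\<And>n. colen (adjs (G n) (map fst ps)) \<le> enat B"
  shows "\<exists>N. \<forall>n\<ge>N. F (n + r) <= isum (lcomb (map fst ps) (F n)) (F (Suc (n + r)))"
proof -
  let ?xs = "map fst ps"
  define A where "A n = adjs (G n) ?xs" for n
  have idA: "idealp (A n)" for n by (simp add: A_def idealp_adjs filt_ideal[OF G])
  have mono: "A n <= A m" if "m \<le> n" for m n
    unfolding A_def using filt_antimono[OF G that] by (rule adjs_mono)
  define q where "q n = the_enat (colen (A n))" for n
  have q: "colen (A n) = enat (q n)" "q n \<le> B" for n
  proof -
    have "colen (A n) \<le> enat B" using bdd by (simp add: A_def)
    thus "colen (A n) = enat (q n)" "q n \<le> B" unfolding q_def by (cases "colen (A n)"; simp)+
  qed
  have qmono: "q m \<le> q n" if "m \<le> n" for m n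
    using colen_antimono[OF idA idA mono[OF that]] q(1) by simp
  obtain k where k: "\<And>n. q n \<le> q k" using ex_has_greatest_nat[of "\<lambda>_. True" 0 q "Suc B"] q(2) by (auto simp: less_Suc_eq_le)
  have const: "A n = A (Suc n)" if "n \<ge> k" for n
  proof -
    have "q n = q (Suc n)" using k[of "Suc n"] qmono[OF that] qmono[of n "Suc n"] k[of n] by (simp add: antisym)
    moreover have "colen (A (Suc n)) = ilen (A (Suc n)) (A n) + colen (A n)"
      by (rule ilen_add) (use idA mono in auto)
    ultimately have "ilen (A (Suc n)) (A n) = 0" using q(1)[of n] q(1)[of "Suc n"]
      by (cases "ilen (A (Suc n)) (A n)") (auto simp: zero_enat_def)
    thus ?thesis using ilen_eq_0[OF idA idA] mono[of n "Suc n"] by auto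
  qed
  define L where "L = k + r"
  have GL: "G L <= isum (lcomb ?xs (G (L - r))) (G (Suc L))"
  proof
    fix f assume f: "f \<in> G L"
    hence "f \<in> A L" unfolding A_def using adjs_subset by blast
    hence "f \<in> A (Suc L)" using const[of L] by (simp add: L_def)
    thus "f \<in> isum (lcomb ?xs (G (L - r))) (G (Suc L))"
      using f ps by (intro regs_initial[OF G]) (auto simp: A_def L_def)
  qed
  have "F (n + r) <= isum (lcomb ?xs (F n)) (F (Suc (n + r)))" if n: "n \<ge> n0 + k" for n
  proof -
    define n' where "n' = n - k"
    have n': "n0 \<le> n'" "n' + L = n + r" "n = n' + (L - r)" using n by (auto simp: n'_def L_def)
    let ?T = "isum (lcomb ?xs (F n)) (F (Suc (n + r)))"
    have idT: "idealp ?T" by (intro idealp_isum idealp_lcomb filt_ideal[OF F])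
    have "F (n' + L) <= isum ?T (F (Suc (n' + L)))"
    proof (rule F_mult_gen[OF n'(1) idT])
      fix g f assume g: "g \<in> G L" and f: "f \<in> F n'"
      obtain t w where tw: "g = t + w" "t \<in> lcomb ?xs (G (L - r))" "w \<in> G (Suc L)" using g GL by (auto simp: isum_def)
      have "t * f \<in> lcomb ?xs (F n)"
      proof -
        have "lcomb ?xs (G (L - r)) <= colon (lcomb ?xs (F n)) f"
        proof (rule lcomb_least)
          show "idealp (colon (lcomb ?xs (F n)) f)" by (intro idealp_colon idealp_lcomb filt_ideal[OF F])
          fix a s assume a: "a \<in> set ?xs" and s: "s \<in> G (L - r)"
          have "s * f \<in> F ((L - r) + n')" using s GF by (intro filt_mult[OF F] f) auto
          hence "a * (s * f) \<in> lcomb ?xs (F n)" using a n' by (intro lcomb_mem filt_ideal[OF F]) (auto simp: add.commute)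
          thus "a * s \<in> colon (lcomb ?xs (F n)) f" by (simp add: colon_def mult.assoc)
        qed
        thus ?thesis using tw(2) by (auto simp: colon_def)
      qed
      moreover have "w * f \<in> F (Suc L + n')" using tw(3) GF by (intro filt_mult[OF F] f) auto
      hence "w * f \<in> F (Suc (n + r))" using n' by (simp add: add.commute)
      ultimately have "t * f + w * f \<in> ?T" by (rule isumI)
      thus "g * f \<in> ?T" by (simp add: tw distrib_right)
    qed
    moreover have "isum ?T (F (Suc (n' + L))) <= ?T"
      unfolding n'(2) by (intro isum_least[OF idT] order_refl isum_subset2 idealp_lcomb filt_ideal[OF F])
    ultimately show ?thesis unfolding n'(2) by (rule order_trans)
  qed
  thus ?thesis by blast
qed

lemma lcomb_eq_sum: "t \<in> lcomb xs S ==> \<exists>u. (\<forall>j<length xs. u j \<in> S) \<and> t = (\<Sum>j<length xs. xs ! j * u j)"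
proof (induction xs arbitrary: t)
  case Nil thus ?case by simp
next
  case (Cons a xs)
  then obtain s t' where *: "t = a * s + t'" "s \<in> S" "t' \<in> lcomb xs S" by auto
  obtain u where u: "\<forall>j<length xs. u j \<in> S" "t' = (\<Sum>j<length xs. xs ! j * u j)" using Cons.IH[OF *(3)] by blast
  define v where "v j = (case j of 0 => s | Suc i => u i)" for j
  have "\<forall>j<length (a # xs). v j \<in> S" using u *(2) by (auto simp: v_def split: nat.split)
  moreover have "t = (\<Sum>j<length (a # xs). (a # xs) ! j * v j)"
    unfolding *(1) u(2) by (subst list.size(4)) (simp add: sum.lessThan_Suc_shift v_def del: sum.lessThan_Suc)
  ultimately show ?case by blast
qed

text \<open>The Koszul complex with terms A/F(r), A/F(2r), A/F(3r) is counted by dividing by one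
  element at a time. The successive colon ideals are bounded from below by \<open>N1\<close>,
  \<open>N2\<close> and \<open>A2\<close>. The lengths of \<open>D2 / F r\<close>, of
  \<open>D / D2\<close> and of the ring modulo \<open>D\<close> add up to that of A/F(r), which
  yields the third copy of this term. The injection of \<open>D2 / F r\<close> into
  \<open>N1 / F (2 * r)\<close> is where \<open>syzygy_closed\<close> enters.\<close>

lemma colen_le_three:
  assumes cl: "closedf F n1" and r: "n1 < r"
    and reg: "regs G [(x, r), (y, r), (z, r)]" "in_filt G [(x, r), (y, r), (z, r)]"
    and gen: "\<And>n. n \<ge> N ==> F (n + r) <= isum (lcomb [x, y, z] (F n)) (F (Suc (n + r)))"
  shows "colen (F (3 * r)) + 3 * colen (F r) \<le> 3 * colen (F (2 * r)) + colen (adjs (F (3 * r)) [x, y, z])"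
proof -
  let ?K1 = "F r" and ?K2 = "F (2 * r)" and ?K3 = "F (3 * r)"
  note idF = filt_ideal[OF F] and idc = idealp_colon and ida = idealp_adj
  have xyzG: "x \<in> G r" "y \<in> G r" "z \<in> G r" and r0: "0 < r" using reg(2) by auto
  hence xyzF: "x \<in> F r" "y \<in> F r" "z \<in> F r" using GF by auto
  have regx: "Reg G x r" and regxy: "Reg (fadj G x) y r" using reg by auto
  have regy: "Reg G y r" using regs_swap[OF G reg(2,1)] by simp
  have "regs G [(z, r), (x, r), (y, r)]"
    using regs_rotate[OF G, of "[(x, r), (y, r)]" "(z, r)"] reg by simp
  hence regz: "Reg G z r" by simp
  have F2: "a * b \<in> F (2 * r)" if "a \<in> F r" "b \<in> F r" for a b using filt_mult[OF F that] by (simp add: mult_2)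
  have F3: "a * b \<in> F (3 * r)" if "a \<in> F (2 * r)" "b \<in> F r" for a b
    using filt_mult[OF F that] by (simp add: algebra_simps numeral_3_eq_3)
  have star: "b1 \<in> F r" if b: "b1 * y - b2 * x \<in> ?K2" "b1 * z - b3 * x \<in> ?K2" "b2 * z - b3 * y \<in> ?K2" for b1 b2 b3
  proof -
    define \<xi> where "\<xi> i = [x, y, z] ! i" for i
    define \<alpha> where "\<alpha> i = [b1, b2, b3] ! i" for i
    have "\<alpha> 0 \<in> F r"
    proof (rule syzygy_closed[OF cl r, where d = 3 and x = \<xi> and \<alpha> = \<alpha> and N = N])
      have i3: "i = 0 \<or> i = 1 \<or> i = 2" if "i < 3" for i :: nat using that by auto
      show "\<xi> i \<in> G r" if "i < 3" for i using i3[OF that] xyzG by (auto simp: \<xi>_def)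
      show "Reg G (\<xi> i) r" if "i < 3" for i using i3[OF that] regx regy regz by (auto simp: \<xi>_def)
      show "Reg (fadj G (\<xi> 0)) (\<xi> 1) r" using regxy by (simp add: \<xi>_def)
      show "\<exists>u v. (\<forall>j<3. u j \<in> F n) \<and> v \<in> F (Suc (n + r)) \<and> w = (\<Sum>j<3. \<xi> j * u j) + v"
        if n: "N \<le> n" and w: "w \<in> F (n + r)" for n w
      proof -
        obtain t v where tv: "w = t + v" "t \<in> lcomb [x, y, z] (F n)" "v \<in> F (Suc (n + r))"
          using subsetD[OF gen[OF n] w] by (rule isumE)
        obtain u where "\<forall>j<length [x, y, z]. u j \<in> F n" "t = (\<Sum>j<length [x, y, z]. [x, y, z] ! j * u j)"
          using lcomb_eq_sum[OF tv(2)] by blast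
        thus ?thesis using tv unfolding \<xi>_def by (intro exI[of _ u] exI[of _ v]) (simp add: numeral_3_eq_3)
      qed
      have n: "- (b1 * y - b2 * x) \<in> ?K2" "- (b1 * z - b3 * x) \<in> ?K2" "- (b2 * z - b3 * y) \<in> ?K2"
        using b idealp_neg[OF idF] by blast+
      show "\<alpha> j * \<xi> i - \<alpha> i * \<xi> j \<in> F (2 * r)" if "i < 3" "j < 3" for i j
        using i3[OF that(1)] i3[OF that(2)] b n idealp_zero[OF idF] by (auto simp: \<xi>_def \<alpha>_def)
    qed auto
    thus ?thesis by (simp add: \<alpha>_def)
  qed
  have colK2: "colon ?K2 x = ?K1"
  proof (intro subset_antisym subsetI)
    fix f assume "f \<in> colon ?K2 x"
    hence "x * f \<in> F (2 * r)" by (simp add: colon_def mult.commute)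
    hence "wge G (x * f) (real (2 * r))" by (rule wgeF)
    hence "wge G (x * f) (real r + real r)" by simp
    hence "wge G f (real r)" by (rule wge_Reg[OF G regx])
    thus "f \<in> ?K1" by (rule closed_wge[OF cl r])
  next
    fix f assume "f \<in> ?K1" thus "f \<in> colon ?K2 x" using F2 xyzF by (simp add: colon_def)
  qed
  define A1 A2 where "A1 = adj ?K2 x" and "A2 = adj A1 y"
  define D where "D = colon A1 y"
  define D2 where "D2 = D \<inter> colon A1 z"
  define N2 where "N2 = isum A1 ((\<lambda>c. c * z) ` D)"
  \<comment> \<open>Expressions \<open>b2 * z - b3 * y\<close> that arise when \<open>b1 * y\<close>
    and \<open>b1 * z\<close> equal \<open>b2 * x\<close> and \<open>b3 * x\<close> modulo
    \<open>F (2 * r)\<close>: the evident elements of the colon ideal of \<open>F (3 * r)\<close> by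
    \<open>x\<close>.\<close>
  define N1 where "N1 = {n. \<exists>b1 b2 b3. b1 * y - b2 * x \<in> ?K2 \<and> b1 * z - b3 * x \<in> ?K2 \<and> n - (b2 * z - b3 * y) \<in> ?K2}"
  have idA: "idealp A1" "idealp A2" by (simp_all add: A1_def A2_def ida idF)
  have idD: "idealp D" "idealp D2" by (simp_all add: D_def D2_def idc idA idealp_Int)
  have idDz: "idealp ((\<lambda>c. c * z) ` D)"
  proof (rule idealpI)
    show "0 \<in> (\<lambda>c. c * z) ` D" using idealp_zero[OF idD(1)] by force
    show "u + v \<in> (\<lambda>c. c * z) ` D" if "u \<in> (\<lambda>c. c * z) ` D" "v \<in> (\<lambda>c. c * z) ` D" for u v
      using that idealp_add[OF idD(1)] by (auto simp: distrib_right[symmetric])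
    show "b * u \<in> (\<lambda>c. c * z) ` D" if "u \<in> (\<lambda>c. c * z) ` D" for b u
      using that idealp_mult[OF idD(1)] by (auto simp: mult.assoc[symmetric])
  qed
  have idN2: "idealp N2" unfolding N2_def by (intro idealp_isum idA idDz)
  have idN1: "idealp N1"
  proof (rule idealpI)
    show "0 \<in> N1" unfolding N1_def using idealp_zero[OF idF] by (auto intro!: exI[of _ 0])
  next
    fix u v assume "u \<in> N1" "v \<in> N1"
    then obtain b1 b2 b3 e1 e2 e3 where *: "b1 * y - b2 * x \<in> ?K2" "b1 * z - b3 * x \<in> ?K2" "u - (b2 * z - b3 * y) \<in> ?K2"
      "e1 * y - e2 * x \<in> ?K2" "e1 * z - e3 * x \<in> ?K2" "v - (e2 * z - e3 * y) \<in> ?K2" unfolding N1_def by blast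
    have "(b1 + e1) * y - (b2 + e2) * x \<in> ?K2" using idealp_add[OF idF *(1,4)] by (simp add: algebra_simps)
    moreover have "(b1 + e1) * z - (b3 + e3) * x \<in> ?K2" using idealp_add[OF idF *(2,5)] by (simp add: algebra_simps)
    moreover have "(u + v) - ((b2 + e2) * z - (b3 + e3) * y) \<in> ?K2" using idealp_add[OF idF *(3,6)] by (simp add: algebra_simps)
    ultimately show "u + v \<in> N1" unfolding N1_def by blast
  next
    fix b u assume "u \<in> N1"
    then obtain b1 b2 b3 where *: "b1 * y - b2 * x \<in> ?K2" "b1 * z - b3 * x \<in> ?K2" "u - (b2 * z - b3 * y) \<in> ?K2" unfolding N1_def by blast
    have "(b * b1) * y - (b * b2) * x \<in> ?K2" using idealp_mult[OF idF *(1), of b] by (simp add: algebra_simps)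
    moreover have "(b * b1) * z - (b * b3) * x \<in> ?K2" using idealp_mult[OF idF *(2), of b] by (simp add: algebra_simps)
    moreover have "b * u - ((b * b2) * z - (b * b3) * y) \<in> ?K2" using idealp_mult[OF idF *(3), of b] by (simp add: algebra_simps)
    ultimately show "b * u \<in> N1" unfolding N1_def by blast
  qed
  have K2N1: "?K2 <= N1" unfolding N1_def using idealp_zero[OF idF] by (auto intro!: exI[of _ 0])
  have A1N2: "A1 <= N2" unfolding N2_def by (rule isum_subset1[OF idDz])
  have K1D2: "?K1 <= D2" unfolding D2_def D_def A1_def colon_def using F2 xyzF adj_subset[of ?K2 x] by blast
  have D2D: "D2 <= D" by (simp add: D2_def)
  have e1: "colen ?K3 = colen (colon ?K3 x) + colen (adj ?K3 x)" by (rule colen_adj[OF idF])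
  have e2: "colen (adj ?K3 x) = colen (colon (adj ?K3 x) y) + colen (adj (adj ?K3 x) y)" by (rule colen_adj[OF ida[OF idF]])
  have e3: "colen (adj (adj ?K3 x) y) = colen (colon (adj (adj ?K3 x) y) z) + colen (adjs ?K3 [x, y, z])"
    using colen_adj[OF ida[OF ida[OF idF]]] by simp
  have f1: "colen ?K2 = colen ?K1 + colen A1" using colen_adj[OF idF, of "2 * r" x] by (simp add: colK2 A1_def)
  have f2: "colen A1 = colen D + colen A2" using colen_adj[OF idA(1), of y] by (simp add: D_def A2_def)
  have f3: "colen A1 = ilen D2 D + colen N2"
    using ilen_add[OF idA(1) idN2 idealp_UNIV A1N2] ilen_mult_image[OF idA(1) idD(1), of z] by (simp add: N2_def D2_def)
  have f4: "colen ?K2 = ilen ?K2 N1 + colen N1" using ilen_add[OF idF idN1 idealp_UNIV K2N1] by simp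
  have f5: "colen ?K1 = ilen ?K1 D2 + (ilen D2 D + colen D)"
    using ilen_add[OF idF idD(2) idealp_UNIV K1D2] ilen_add[OF idD(2,1) idealp_UNIV D2D] by simp
  have g1: "ilen ?K1 D2 \<le> ilen ?K2 N1"
  proof (rule ilen_le_rel[where rel = "\<lambda>b1 n. \<exists>b2 b3. b1 * y - b2 * x \<in> ?K2 \<and> b1 * z - b3 * x \<in> ?K2 \<and> n = b2 * z - b3 * y"])
    fix b1 assume "b1 \<in> D2"
    then obtain b2 b3 where b: "b1 * y - b2 * x \<in> ?K2" "b1 * z - b3 * x \<in> ?K2"
      by (auto simp: D2_def D_def A1_def colon_def adj_iff)
    have "(b2 * z - b3 * y) - (b2 * z - b3 * y) \<in> ?K2" using idealp_zero[OF idF] by simp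
    hence "b2 * z - b3 * y \<in> N1" unfolding N1_def using b by blast
    thus "\<exists>n\<in>N1. \<exists>b2 b3. b1 * y - b2 * x \<in> ?K2 \<and> b1 * z - b3 * x \<in> ?K2 \<and> n = b2 * z - b3 * y" using b by blast
  next
    fix b1 n assume "\<exists>b2 b3. b1 * y - b2 * x \<in> ?K2 \<and> b1 * z - b3 * x \<in> ?K2 \<and> n = b2 * z - b3 * y" "n \<in> ?K2"
    thus "b1 \<in> ?K1" using star by blast
  next
    fix b1 n c1 m
    assume "\<exists>b2 b3. b1 * y - b2 * x \<in> ?K2 \<and> b1 * z - b3 * x \<in> ?K2 \<and> n = b2 * z - b3 * y"
      "\<exists>b2 b3. c1 * y - b2 * x \<in> ?K2 \<and> c1 * z - b3 * x \<in> ?K2 \<and> m = b2 * z - b3 * y"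
    then obtain b2 b3 c2 c3 where *: "b1 * y - b2 * x \<in> ?K2" "b1 * z - b3 * x \<in> ?K2" "n = b2 * z - b3 * y"
      "c1 * y - c2 * x \<in> ?K2" "c1 * z - c3 * x \<in> ?K2" "m = c2 * z - c3 * y" by blast
    have "(b1 + c1) * y - (b2 + c2) * x \<in> ?K2" using idealp_add[OF idF *(1,4)] by (simp add: algebra_simps)
    moreover have "(b1 + c1) * z - (b3 + c3) * x \<in> ?K2" using idealp_add[OF idF *(2,5)] by (simp add: algebra_simps)
    moreover have "n + m = (b2 + c2) * z - (b3 + c3) * y" unfolding *(3,6) by (simp add: algebra_simps)
    ultimately show "\<exists>b2 b3. (b1 + c1) * y - b2 * x \<in> ?K2 \<and> (b1 + c1) * z - b3 * x \<in> ?K2 \<and> n + m = b2 * z - b3 * y" by blast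
  next
    fix c b1 n
    assume "\<exists>b2 b3. b1 * y - b2 * x \<in> ?K2 \<and> b1 * z - b3 * x \<in> ?K2 \<and> n = b2 * z - b3 * y"
    then obtain b2 b3 where *: "b1 * y - b2 * x \<in> ?K2" "b1 * z - b3 * x \<in> ?K2" "n = b2 * z - b3 * y" by blast
    have "(c * b1) * y - (c * b2) * x \<in> ?K2" using idealp_mult[OF idF *(1), of c] by (simp add: algebra_simps)
    moreover have "(c * b1) * z - (c * b3) * x \<in> ?K2" using idealp_mult[OF idF *(2), of c] by (simp add: algebra_simps)
    moreover have "c * n = (c * b2) * z - (c * b3) * y" unfolding *(3) by (simp add: algebra_simps)
    ultimately show "\<exists>b2 b3. (c * b1) * y - b2 * x \<in> ?K2 \<and> (c * b1) * z - b3 * x \<in> ?K2 \<and> c * n = b2 * z - b3 * y" by blast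
  qed (use idF idD idN1 K2N1 in auto)
  have h3: "colen (colon (adj (adj ?K3 x) y) z) \<le> colen A2"
  proof (rule colen_antimono[OF idA(2) idc[OF ida[OF ida[OF idF]]]])
    show "A2 <= colon (adj (adj ?K3 x) y) z"
    proof
      fix f assume "f \<in> A2"
      then obtain k c1 c2 where f: "f = k + c1 * x + c2 * y" "k \<in> ?K2" by (auto simp: A2_def A1_def adj_def)
      have "f * z = k * z + (c1 * z) * x + (c2 * z) * y" by (simp add: f algebra_simps)
      thus "f \<in> colon (adj (adj ?K3 x) y) z" using adjI[OF adjI[OF F3[OF f(2) xyzF(3)]]] by (simp add: colon_def)
    qed
  qed
  have h2: "colen (colon (adj ?K3 x) y) \<le> colen N2"
  proof (rule colen_antimono[OF idN2 idc[OF ida[OF idF]]])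
    show "N2 <= colon (adj ?K3 x) y"
    proof
      fix f assume "f \<in> N2"
      then obtain k c1 b where f: "f = k + c1 * x + b * z" "k \<in> ?K2" "b \<in> D"
        by (auto simp: N2_def A1_def isum_def adj_def)
      obtain b2 where b2: "b * y - b2 * x \<in> ?K2" using f(3) by (auto simp: D_def A1_def colon_def adj_iff)
      have "k * y + (b * y - b2 * x) * z \<in> ?K3" by (rule idealp_add[OF idF F3[OF f(2) xyzF(2)] F3[OF b2 xyzF(3)]])
      moreover have "f * y = (k * y + (b * y - b2 * x) * z) + (c1 * y + b2 * z) * x" by (simp add: f algebra_simps)
      ultimately show "f \<in> colon (adj ?K3 x) y" using adjI[of _ ?K3] by (simp add: colon_def)
    qed
  qed
  have h1: "colen (colon ?K3 x) \<le> colen N1"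
  proof (rule colen_antimono[OF idN1 idc[OF idF]])
    show "N1 <= colon ?K3 x"
    proof
      fix n assume "n \<in> N1"
      then obtain b1 b2 b3 where *: "b1 * y - b2 * x \<in> ?K2" "b1 * z - b3 * x \<in> ?K2" "n - (b2 * z - b3 * y) \<in> ?K2" unfolding N1_def by blast
      have "(n - (b2 * z - b3 * y)) * x - (b1 * y - b2 * x) * z + (b1 * z - b3 * x) * y \<in> ?K3"
        by (rule idealp_add[OF idF idealp_diff[OF idF F3[OF *(3) xyzF(1)] F3[OF *(1) xyzF(3)]] F3[OF *(2) xyzF(2)]])
      moreover have "(n - (b2 * z - b3 * y)) * x - (b1 * y - b2 * x) * z + (b1 * z - b3 * x) * y = n * x" by (simp add: algebra_simps)
      ultimately show "n \<in> colon ?K3 x" by (simp add: colon_def)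
    qed
  qed
  obtain p q s where pq: "colen ?K1 = enat p" "colen ?K2 = enat q" "colen ?K3 = enat s"
    using fin[of r] fin[of "2 * r"] fin[of "3 * r"] by auto
  obtain a1 where a1: "colen A1 = enat a1" using f1 pq by (cases "colen A1") auto
  obtain a2 d0 where a2: "colen A2 = enat a2" "colen D = enat d0" using f2 a1 by (cases "colen A2"; cases "colen D") auto
  obtain u2 l2 where u2: "ilen D2 D = enat l2" "colen N2 = enat u2" using f3 a1 by (cases "ilen D2 D"; cases "colen N2") auto
  obtain u1 l1 where u1: "ilen ?K2 N1 = enat l1" "colen N1 = enat u1" using f4 pq by (cases "ilen ?K2 N1"; cases "colen N1") auto
  obtain l0 where l0: "ilen ?K1 D2 = enat l0" using f5 pq by (cases "ilen ?K1 D2") auto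
  obtain v1 w1 where v1: "colen (colon ?K3 x) = enat v1" "colen (adj ?K3 x) = enat w1"
    using e1 pq by (cases "colen (colon ?K3 x)"; cases "colen (adj ?K3 x)") auto
  obtain v2 w2 where v2: "colen (colon (adj ?K3 x) y) = enat v2" "colen (adj (adj ?K3 x) y) = enat w2"
    using e2 v1 by (cases "colen (colon (adj ?K3 x) y)"; cases "colen (adj (adj ?K3 x) y)") auto
  obtain v3 w3 where v3: "colen (colon (adj (adj ?K3 x) y) z) = enat v3" "colen (adjs ?K3 [x, y, z]) = enat w3"
    using e3 v2 by (cases "colen (colon (adj (adj ?K3 x) y) z)"; cases "colen (adjs ?K3 [x, y, z])") auto
  have "s + 3 * p \<le> 3 * q + w3"
    using e1 e2 e3 f1 f2 f3 f4 f5 g1 h1 h2 h3 pq a1 a2 u2 u1 l0 v1 v2 v3 by simp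
  thus ?thesis using pq v3 by (simp add: numeral_eq_enat)
qed

end

text \<open>For a regular sequence all colon ideals are known exactly, so the count becomes an
  equality. It closes with \<open>?H r = G r\<close>, as \<open>x\<close> lies in
  \<open>G r\<close>: the Koszul term of degree 0 has length 0.\<close>

lemma colen_eq_three:
  assumes G: "filt G" and reg: "regs G [(x, r), (y, r), (z, r)]" "in_filt G [(x, r), (y, r), (z, r)]"
  shows "colen (G (3 * r)) + 3 * colen (G r) = 3 * colen (G (2 * r)) + colen (adjs (G (3 * r)) [x, y, z])"
proof -
  note idG = filt_ideal[OF G] and ida = idealp_adj
  have xyz: "x \<in> G r" "y \<in> G r" "z \<in> G r" using reg(2) by auto
  have col: "colon (H (n + r)) w = H n" if "filt H" "w \<in> H r" "Reg H w r" for H :: "nat => 'a set" and w n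
    using filt_mult[OF that(1) that(2)] RegD[OF that(3)] by (auto simp: colon_def mult.commute add.commute)
  let ?H = "fadj G x" and ?L = "fadj (fadj G x) y"
  have fH: "filt ?H" "filt ?L" using G by (auto intro: filt_fadj)
  have R: "Reg G x r" "Reg ?H y r" "Reg ?L z r" using reg(1) by auto
  have m: "y \<in> ?H r" "z \<in> ?L r" using xyz by (auto intro: fadj_mem)
  have r3: "3 * r = 2 * r + r" and r2: "2 * r = r + r" by auto
  have 1: "colen (G (3 * r)) = colen (G (2 * r)) + colen (?H (3 * r))"
    using colen_adj[OF idG, of "3 * r" x] col[OF G xyz(1) R(1), of "2 * r"] by (simp add: fadj_def r3[symmetric])
  have 2: "colen (?H (3 * r)) = colen (?H (2 * r)) + colen (?L (3 * r))"
    using colen_adj[OF filt_ideal[OF fH(1)], of "3 * r" y] col[OF fH(1) m(1) R(2), of "2 * r"]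
    unfolding r3[symmetric] by (simp add: fadj_def[of "fadj G x"])
  have 3: "colen (?L (3 * r)) = colen (?L (2 * r)) + colen (adjs (G (3 * r)) [x, y, z])"
    using colen_adj[OF filt_ideal[OF fH(2)], of "3 * r" z] col[OF fH(2) m(2) R(3), of "2 * r"]
    unfolding r3[symmetric] by (simp add: fadj_def)
  have 4: "colen (G (2 * r)) = colen (G r) + colen (?H (2 * r))"
    using colen_adj[OF idG, of "2 * r" x] col[OF G xyz(1) R(1), of r] by (simp add: fadj_def r2[symmetric])
  have 5: "colen (?H (2 * r)) = colen (?H r) + colen (?L (2 * r))"
    using colen_adj[OF filt_ideal[OF fH(1)], of "2 * r" y] col[OF fH(1) m(1) R(2), of r]
    unfolding r2[symmetric] by (simp add: fadj_def[of "fadj G x"])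
  have 6: "?H r = G r" using adj_absorb[OF idG xyz(1)] by (simp add: fadj_def)
  show ?thesis
    using 1 2 3 4 5 6
    by (cases "colen (G r)"; cases "colen (?H (2 * r))"; cases "colen (?L (2 * r))"; cases "colen (adjs (G (3 * r)) [x, y, z])")
       (simp_all add: numeral_eq_enat)
qed

section \<open>Generic extensions\<close>

abbreviation pc :: "'r::zero poly => nat => 'r" where "pc \<equiv> Polynomial.coeff"

definition polyin :: "'r::comm_ring_1 set => 'r poly => bool" where
  "polyin U p \<longleftrightarrow> (\<forall>i. pc p i \<in> U)"

lemma polyin_0: "idealp U ==> polyin U 0" by (simp add: polyin_def idealp_zero)
lemma polyin_add: "idealp U ==> polyin U p ==> polyin U q ==> polyin U (p + q)"
  by (simp add: polyin_def idealp_add)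
lemma polyin_diff: "idealp U ==> polyin U p ==> polyin U q ==> polyin U (p - q)"
  by (simp add: polyin_def idealp_diff)
lemma polyin_mult2:
  assumes "idealp W" "\<And>x y. x \<in> U ==> y \<in> V ==> x * y \<in> W" "polyin U p" "polyin V q"
  shows "polyin W (p * q)"
  using assms unfolding polyin_def coeff_mult by (auto intro!: idealp_sum)
lemma polyin_mult: "idealp U ==> polyin U p ==> polyin U (q * p)"
  by (rule polyin_mult2[where U = UNIV and V = U]) (auto simp: polyin_def intro: idealp_mult)
lemma polyin_const: "idealp U ==> c \<in> U ==> polyin U [:c:]"
  by (auto simp: polyin_def coeff_pCons idealp_zero split: nat.split)
lemma polyin_pCons: "polyin U (pCons a p) \<longleftrightarrow> a \<in> U \<and> polyin U p"
  unfolding polyin_def by (metis coeff_pCons_0 coeff_pCons_Suc not0_implies_Suc)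
lemma polyin_smult: "polyin V p ==> (\<And>x. x \<in> V ==> c * x \<in> U) ==> polyin U ([:c:] * p)"
  by (simp add: polyin_def)
lemma polyin_sum: "idealp U ==> (\<And>i. i \<in> I ==> polyin U (f i)) ==> polyin U (sum f I)"
  by (induction I rule: infinite_finite_induct) (auto simp: polyin_0 polyin_add)

lemma polyin_filt_mult: "filt U ==> polyin (U m) p ==> polyin (U n) q ==> polyin (U (m + n)) (p * q)"
  by (rule polyin_mult2[where U = "U m" and V = "U n"]) (auto intro: filt_mult filt_ideal)

text \<open>The denominators of the generic extension: polynomials whose lowest nonzero coefficient
  is 1. They are units in Laurent series and, by \<open>polyin_lowmonic_cancel\<close>,
  nonzerodivisors modulo the extension of every ideal, so membership can be read off
  numerators.\<close>

definition lowmonic :: "'r::comm_ring_1 poly => bool" where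
  "lowmonic w \<longleftrightarrow> (\<exists>k u. pc u 0 = 1 \<and> w = [:0, 1:] ^ k * u)"

lemma lowmonic_1: "lowmonic 1" unfolding lowmonic_def by (rule exI[of _ 0], rule exI[of _ 1]) simp

lemma lowmonic_mult: "lowmonic v ==> lowmonic w ==> lowmonic (v * w)"
proof -
  assume "lowmonic v" "lowmonic w"
  then obtain k u l t where *: "pc u 0 = 1" "v = [:0, 1:] ^ k * u" "pc t 0 = 1" "w = [:0, 1:] ^ l * t"
    unfolding lowmonic_def by blast
  have "v * w = [:0, 1:] ^ (k + l) * (u * t)" by (simp add: * power_add algebra_simps)
  moreover have "pc (u * t) 0 = 1" using * by (simp add: coeff_mult_0)
  ultimately show ?thesis unfolding lowmonic_def by blast
qed

lemma lowmonic_pow: "lowmonic w ==> lowmonic (w ^ k)"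
  by (induction k) (auto intro: lowmonic_1 lowmonic_mult)

lemma polyin_lowmonic_cancel:
  assumes U: "idealp U" and w: "lowmonic w" and p: "polyin U (w * p)"
  shows "polyin U p"
proof -
  obtain k u where u: "pc u 0 = 1" "w = [:0, 1:] ^ k * u" using w unfolding lowmonic_def by blast
  have "polyin U ([:0, 1:] ^ k * q) ==> polyin U q" for q
    by (induction k) (auto simp: polyin_pCons mult.assoc)
  hence up: "polyin U (u * p)" using p by (simp add: u mult.assoc)
  have "pc p i \<in> U" for i
  proof (induction i rule: less_induct)
    case (less i)
    have "pc (u * p) i = (\<Sum>j\<le>i. pc u j * pc p (i - j))" by (rule coeff_mult)
    also have "\<dots> = pc u 0 * pc p (i - 0) + (\<Sum>j\<in>{..i} - {0}. pc u j * pc p (i - j))"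
      by (rule sum.remove) auto
    finally have eq: "pc p i = pc (u * p) i - (\<Sum>j\<in>{..i} - {0}. pc u j * pc p (i - j))" using u by simp
    have "(\<Sum>j\<in>{..i} - {0}. pc u j * pc p (i - j)) \<in> U"
      using less by (intro idealp_sum[OF U] idealp_mult[OF U]) auto
    thus ?case unfolding eq using up by (intro idealp_diff[OF U]) (auto simp: polyin_def)
  qed
  thus ?thesis by (simp add: polyin_def)
qed

text \<open>The powers of the constant term of \<open>p\<close> are constant terms of powers of
  \<open>p\<close>, so the constant term lies in \<open>F n\<close>. Subtracting it and dividing by
  the indeterminate gives a shorter polynomial that satisfies the hypothesis with the same
  \<open>C\<close>.\<close>

lemma polyin_pow_closed:
  assumes F: "filt F" and cl: "closedf F n1" and n: "n1 \<le> n"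
  shows "(\<And>m. polyin (F (n * m - C)) (p ^ m)) ==> polyin (F n) p"
proof (induction p)
  case 0 thus ?case by (simp add: polyin_0 filt_ideal[OF F])
next
  case (pCons a p)
  have "a ^ m \<in> F (n * m - C)" for m
  proof -
    have "pc (pCons a p ^ m) 0 = a ^ m" by (simp add: coeff_0_power)
    thus ?thesis using pCons.prems[of m] unfolding polyin_def by metis
  qed
  hence a: "a \<in> F n" using cl n unfolding closedf_def by blast
  have "polyin (F (n * m - C)) (p ^ m)" for m
  proof -
    have eq: "[:0, 1:] * p = pCons a p + [:- a:]" by simp
    have "([:0, 1:] * p) ^ m = (\<Sum>i\<le>m. of_nat (m choose i) * (pCons a p ^ i * [:- a:] ^ (m - i)))"
      unfolding eq by (simp only: binomial_ring mult.assoc)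
    moreover have "polyin (F (n * m - C)) (pCons a p ^ i * [:- a:] ^ (m - i))" if i: "i \<le> m" for i
    proof -
      have "(- a) ^ (m - i) \<in> F ((m - i) * n)" by (rule filt_pow[OF F idealp_neg[OF filt_ideal[OF F] a]])
      hence 1: "polyin (F ((m - i) * n)) ([:- a:] ^ (m - i))"
        by (simp add: poly_const_pow polyin_const filt_ideal[OF F])
      have le: "n * m - C \<le> (n * i - C) + (m - i) * n"
      proof -
        have "n * m = n * i + (m - i) * n" using i by (metis le_add_diff_inverse mult.commute distrib_left)
        thus ?thesis by simp
      qed
      show ?thesis
        by (rule polyin_mult2[OF filt_ideal[OF F] _ pCons.prems[of i] 1])
           (rule filt_down[OF F filt_mult[OF F] le])
    qed
    ultimately have "polyin (F (n * m - C)) (([:0, 1:] * p) ^ m)"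
      by (simp only:) (rule polyin_sum[OF filt_ideal[OF F]], rule polyin_mult[OF filt_ideal[OF F]], simp)
    hence "polyin (F (n * m - C)) ([:0, 1:] ^ m * p ^ m)" by (simp only: power_mult_distrib)
    moreover have "lowmonic ([:0, 1:] ^ m :: 'a poly)" unfolding lowmonic_def by (rule exI[of _ m], rule exI[of _ 1]) simp
    ultimately show ?thesis using polyin_lowmonic_cancel[OF filt_ideal[OF F]] by blast
  qed
  hence "polyin (F n) p" by (rule pCons.IH)
  with a show ?case by (simp add: polyin_pCons)
qed

text \<open>A weak Dedekind-Mertens statement for the generic polynomial with coefficients
  \<open>as\<close>. The constant term \<open>b\<close> is handled from the lowest coefficient of
  \<open>p\<close> upwards; then \<open>b\<close> is removed by expanding a power of (generic
  polynomial minus \<open>b\<close>). This raises the exponent, hence the general \<open>M\<close>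
  in the statement.\<close>

lemma mccoy_pow:
  assumes U: "filt U"
  shows "set as <= U 1 ==> polyin (U (n + M)) (Poly as ^ M * p) ==> a \<in> set as ==> \<exists>N. polyin (U (n + N)) ([:a ^ N:] * p)"
proof (induction as arbitrary: M)
  case (Cons b as)
  let ?q = "Poly as" and ?e = "pCons b (Poly as) ^ M"
  note idU = filt_ideal[OF U]
  have Pin: "polyin (U 1) (Poly bs)" if "set bs <= U 1" for bs
    using that by (induction bs) (auto simp: polyin_pCons polyin_0 idU)
  have powin: "polyin (U k) (f ^ k)" if "polyin (U 1) f" for f k
  proof (induction k)
    case 0 thus ?case by (simp add: polyin_def filt_0[OF U])
  next
    case (Suc k)
    show ?case unfolding power_Suc
      by (rule polyin_mult2[OF idU _ that Suc]) (use filt_mult[OF U, of _ 1 _ k] in simp)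
  qed
  have ein: "polyin (U M) ?e" using powin[OF Pin[OF Cons.prems(1)], of M] by simp
  have e0: "pc ?e 0 = b ^ M" by (simp add: coeff_0_power)
  have ep: "polyin (U (n + M)) (?e * p)" using Cons.prems(2) by simp
  \<comment> \<open>Isolating the lowest term of the product costs a further factor
    \<open>b ^ M\<close> for each coefficient, so coefficient \<open>t\<close> needs the exponent
    \<open>M * Suc t\<close>.\<close>
  have claim: "b ^ (M * Suc t) * pc p t \<in> U (n + M * Suc t)" for t
  proof (induction t rule: less_induct)
    case (less t)
    have "pc (?e * p) t = pc ?e 0 * pc p (t - 0) + (\<Sum>j\<in>{..t} - {0}. pc ?e j * pc p (t - j))"
      unfolding coeff_mult by (rule sum.remove) auto
    hence eq: "b ^ M * pc p t = pc (?e * p) t - (\<Sum>j\<in>{..t} - {0}. pc ?e j * pc p (t - j))" using e0 by simp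
    have bM: "b ^ k \<in> U k" for k using filt_pow[OF U, of b 1 k] Cons.prems(1) by simp
    have "b ^ (M * t) * (b ^ M * pc p t) \<in> U (n + M * Suc t)"
      unfolding eq right_diff_distrib sum_distrib_left
    proof (intro idealp_diff[OF idU] idealp_sum[OF idU])
      have "b ^ (M * t) * pc (?e * p) t \<in> U (M * t + (n + M))" using ep by (intro filt_mult[OF U] bM) (simp add: polyin_def)
      thus "b ^ (M * t) * pc (?e * p) t \<in> U (n + M * Suc t)" by (simp add: algebra_simps)
    next
      fix j assume j: "j \<in> {..t} - {0}"
      hence "b ^ (M * Suc (t - j)) * pc p (t - j) \<in> U (n + M * Suc (t - j))" by (intro less) auto
      moreover have "b ^ (M * (j - 1)) * pc ?e j \<in> U (M * (j - 1) + M)" using ein by (intro filt_mult[OF U] bM) (simp add: polyin_def)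
      ultimately have "(b ^ (M * (j - 1)) * pc ?e j) * (b ^ (M * Suc (t - j)) * pc p (t - j)) \<in> U ((M * (j - 1) + M) + (n + M * Suc (t - j)))"
        by (rule filt_mult[OF U, rotated])
      moreover have "M * t = M * (j - 1) + M * Suc (t - j)" using j by (simp add: add_mult_distrib2[symmetric] del: mult_Suc_right)
      hence "b ^ (M * t) = b ^ (M * (j - 1)) * b ^ (M * Suc (t - j))" by (simp only: power_add)
      moreover have "(M * (j - 1) + M) + (n + M * Suc (t - j)) = n + M * Suc t"
        using \<open>M * t = M * (j - 1) + M * Suc (t - j)\<close> by simp
      ultimately show "b ^ (M * t) * (pc ?e j * pc p (t - j)) \<in> U (n + M * Suc t)" by (simp only: mult_ac)
    qed
    moreover have "b ^ (M * Suc t) = b ^ (M * t) * b ^ M" by (simp add: power_add[symmetric] add.commute)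
    ultimately show ?case by (simp add: mult.assoc)
  qed
  define N where "N = M * Suc (Polynomial.degree p)"
  have bN: "polyin (U (n + N)) ([:b ^ N:] * p)"
    unfolding polyin_def
  proof
    fix t
    show "pc ([:b ^ N:] * p) t \<in> U (n + N)"
    proof (cases "t \<le> Polynomial.degree p")
      case True
      hence le: "M * Suc t \<le> N" unfolding N_def by (intro mult_le_mono2) simp
      have "b ^ (N - M * Suc t) * (b ^ (M * Suc t) * pc p t) \<in> U ((N - M * Suc t) + (n + M * Suc t))"
        using filt_pow[OF U, of b 1 "N - M * Suc t"] Cons.prems(1) by (intro filt_mult[OF U] claim) simp
      moreover have "b ^ (N - M * Suc t) * (b ^ (M * Suc t) * pc p t) = b ^ N * pc p t"
        using le by (simp only: mult.assoc[symmetric] power_add[symmetric] le_add_diff_inverse2)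
      moreover have "(N - M * Suc t) + (n + M * Suc t) = n + N" using le by simp
      ultimately show ?thesis by (simp del: mult_Suc_right)
    next
      case False
      thus ?thesis by (simp add: coeff_eq_0 idealp_zero[OF idU])
    qed
  qed
  show ?case
  proof (cases "a = b")
    case True thus ?thesis using bN by blast
  next
    case False
    \<comment> \<open>Among \<open>L\<close> factors either the generic polynomial occurs at least
      \<open>M\<close> times or the constant \<open>b\<close> at least \<open>N\<close> times, and
      each case is already settled.\<close>
    define L where "L = M + N"
    have qeq: "[:0, 1:] * ?q = pCons b ?q + [:- b:]" by simp
    have bq: "polyin (U 1) (pCons b ?q)" using Pin[OF Cons.prems(1)] by simp
    have bb: "polyin (U 1) [:- b:]" using Cons.prems(1) idealp_neg[OF idU] by (intro polyin_const idU) auto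
    have "([:0, 1:] * ?q) ^ L = (\<Sum>i\<le>L. of_nat (L choose i) * (pCons b ?q ^ i * [:- b:] ^ (L - i)))"
      unfolding qeq by (simp only: binomial_ring mult.assoc)
    hence "([:0, 1:] * ?q) ^ L * p = (\<Sum>i\<le>L. of_nat (L choose i) * (pCons b ?q ^ i * [:- b:] ^ (L - i) * p))"
      by (simp only: sum_distrib_right mult.assoc)
    moreover have "polyin (U (n + L)) (pCons b ?q ^ i * [:- b:] ^ (L - i) * p)" if i: "i \<le> L" for i
    proof (cases "i \<ge> M")
      case True
      have "polyin (U (i - M)) (pCons b ?q ^ (i - M))" by (rule powin[OF bq])
      moreover have "polyin (U (L - i)) ([:- b:] ^ (L - i))" by (rule powin[OF bb])
      ultimately have "polyin (U ((i - M) + (L - i))) (pCons b ?q ^ (i - M) * [:- b:] ^ (L - i))"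
        by (rule polyin_filt_mult[OF U])
      hence "polyin (U (((i - M) + (L - i)) + (n + M))) ((pCons b ?q ^ (i - M) * [:- b:] ^ (L - i)) * (?e * p))"
        using ep by (rule polyin_filt_mult[OF U])
      moreover have "((i - M) + (L - i)) + (n + M) = n + L" using i True by simp
      moreover have "pCons b ?q ^ i = pCons b ?q ^ (i - M) * ?e" using True by (simp add: power_add[symmetric])
      ultimately show ?thesis by (simp only: mult_ac)
    next
      case False
      hence "N \<le> L - i" by (simp add: L_def)
      have "[:- b:] ^ (L - i) = [:- b:] ^ (L - i - N) * [:- b:] ^ N" using \<open>N \<le> L - i\<close> by (simp only: power_add[symmetric] le_add_diff_inverse2)
      moreover have "[:- b:] ^ N = (-1) ^ N * [:b ^ N:]"
      proof -
        have "[:- b:] = (- 1) * [:b:]" by simp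
        thus ?thesis by (simp only: power_mult_distrib poly_const_pow)
      qed
      ultimately have eq: "pCons b ?q ^ i * [:- b:] ^ (L - i) * p = (-1) ^ N * ((pCons b ?q ^ i * [:- b:] ^ (L - i - N)) * ([:b ^ N:] * p))"
        by (simp only: mult_ac)
      have "polyin (U (i + (L - i - N))) (pCons b ?q ^ i * [:- b:] ^ (L - i - N))"
        by (rule polyin_filt_mult[OF U powin[OF bq] powin[OF bb]])
      hence "polyin (U ((i + (L - i - N)) + (n + N))) ((pCons b ?q ^ i * [:- b:] ^ (L - i - N)) * ([:b ^ N:] * p))"
        using bN by (rule polyin_filt_mult[OF U])
      moreover have "(i + (L - i - N)) + (n + N) = n + L" using i \<open>N \<le> L - i\<close> by simp
      ultimately show ?thesis unfolding eq by (simp only: polyin_mult[OF idU])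
    qed
    ultimately have "polyin (U (n + L)) (([:0, 1:] * ?q) ^ L * p)"
      by (simp only:) (rule polyin_sum[OF idU], rule polyin_mult[OF idU], simp)
    hence "polyin (U (n + L)) ([:0, 1:] ^ L * (?q ^ L * p))" by (simp only: power_mult_distrib mult.assoc)
    moreover have "lowmonic ([:0, 1:] ^ L :: 'a poly)" unfolding lowmonic_def by (rule exI[of _ L], rule exI[of _ 1]) simp
    ultimately have "polyin (U (n + L)) (?q ^ L * p)" using polyin_lowmonic_cancel[OF idU] by blast
    thus ?thesis using Cons.IH[of L] Cons.prems(1,3) False by simp
  qed
qed simp

text \<open>The element lies in the colon ideal of \<open>U (n + L)\<close> by \<open>G L\<close>
  for all large \<open>L\<close>, as in the Ratliff-Rush closure. On the graded ring this is torsion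
  with respect to the ideal of positive degree.\<close>

definition tors :: "(nat => 'r::comm_ring_1 set) => (nat => 'r set) => nat => 'r => bool" where
  "tors G U n h \<longleftrightarrow> (\<exists>L0. \<forall>L\<ge>L0. \<forall>g\<in>G L. g * h \<in> U (n + L))"

primrec mons :: "'r::comm_ring_1 list => nat => 'r set" where
  "mons [] L = (if L = 0 then {1} else {})"
| "mons (b # bs) L = {b ^ i * m | i m. i \<le> L \<and> m \<in> mons bs (L - i)}"

lemma mons_mult: "a \<in> set bs ==> m \<in> mons bs L ==> a * m \<in> mons bs (Suc L)"
proof (induction bs arbitrary: L m)
  case (Cons b bs)
  then obtain i m' where *: "m = b ^ i * m'" "i \<le> L" "m' \<in> mons bs (L - i)" by auto
  show ?case
  proof (cases "a = b")
    case True
    have "a * m = b ^ Suc i * m'" by (simp add: * True mult.assoc)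
    thus ?thesis using * by (auto intro!: exI[of _ "Suc i"] exI[of _ m'] simp del: power_Suc)
  next
    case False
    hence "a * m' \<in> mons bs (Suc (L - i))" using Cons * by simp
    moreover have "a * m = b ^ i * (a * m')" by (simp add: * mult_ac)
    ultimately show ?thesis using *(2) by (auto simp: Suc_diff_le intro!: exI[of _ i] exI[of _ "a * m'"])
  qed
qed simp

lemma mons_mem: "filt U ==> set bs <= U 1 ==> m \<in> mons bs L ==> m \<in> U L"
proof (induction bs arbitrary: L m)
  case Nil thus ?case by (auto simp: filt_0 split: if_splits)
next
  case (Cons b bs)
  then obtain i m' where *: "m = b ^ i * m'" "i \<le> L" "m' \<in> mons bs (L - i)" by auto
  have "b ^ i * m' \<in> U (i * 1 + (L - i))"
    using Cons * by (intro filt_mult filt_pow) auto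
  thus ?case using * by simp
qed

text \<open>A monomial of large degree contains a high power of \<open>b\<close> or still has large
  degree in the remaining elements.\<close>

lemma mons_tors:
  assumes U: "filt U" and h: "\<And>a. a \<in> set bs ==> \<exists>N. a ^ N * h \<in> U (n + N)" and bs: "set bs <= U 1"
  shows "\<exists>L0. \<forall>L\<ge>L0. \<forall>m\<in>mons bs L. m * h \<in> U (n + L)"
  using h bs
proof (induction bs)
  case Nil thus ?case by (intro exI[of _ 1]) auto
next
  case (Cons b bs)
  obtain L0 where L0: "\<And>L m. L \<ge> L0 ==> m \<in> mons bs L ==> m * h \<in> U (n + L)" using Cons by auto
  obtain N where N: "b ^ N * h \<in> U (n + N)" using Cons.prems(1)[of b] by auto
  have bp: "b ^ k \<in> U k" for k using filt_pow[OF U, of b 1 k] Cons.prems by simp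
  have "m * h \<in> U (n + L)" if L: "L \<ge> L0 + N" and m: "m \<in> mons (b # bs) L" for L m
  proof -
    obtain i m' where *: "m = b ^ i * m'" "i \<le> L" "m' \<in> mons bs (L - i)" using m by auto
    show ?thesis
    proof (cases "i \<ge> N")
      case True
      have "(b ^ (i - N) * m') * (b ^ N * h) \<in> U (((i - N) + (L - i)) + (n + N))"
        using Cons.prems * by (intro filt_mult[OF U] bp N mons_mem[OF U]) auto
      moreover have "(b ^ (i - N) * m') * (b ^ N * h) = (b ^ (i - N) * b ^ N) * m' * h" by (simp only: mult_ac)
      moreover have "b ^ (i - N) * b ^ N = b ^ i" using True by (simp add: power_add[symmetric])
      moreover have "((i - N) + (L - i)) + (n + N) = n + L" using True * by simp
      ultimately show ?thesis by (simp only: *(1))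
    next
      case False
      hence "m' * h \<in> U (n + (L - i))" using L * by (intro L0) auto
      hence "b ^ i * (m' * h) \<in> U (i + (n + (L - i)))" by (rule filt_mult[OF U bp])
      thus ?thesis using * by (simp add: mult.assoc)
    qed
  qed
  thus ?case by blast
qed

context stage
begin

lemma G_mons_gen:
  assumes "idealp T" "mons as L <= T"
  shows "G L <= isum T (G (Suc L))"
  using assms
proof (induction L arbitrary: T)
  case 0
  have "1 \<in> mons as 0" by (induction as) auto
  hence "T = UNIV" using idealp_one 0 by blast
  thus ?case using isum_subset1[OF filt_ideal[OF G], of T] by auto
next
  case (Suc L)
  let ?S = "isum T (G (Suc (Suc L)))"
  have idS: "idealp ?S" by (intro idealp_isum Suc.prems filt_ideal[OF G])
  define T' where "T' = {f. \<forall>a\<in>set as. a * f \<in> ?S}"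
  have idT': "idealp T'"
  proof (rule idealpI)
    show "0 \<in> T'" using idealp_zero[OF idS] by (simp add: T'_def)
    show "y + z \<in> T'" if "y \<in> T'" "z \<in> T'" for y z
      using that idealp_add[OF idS] by (simp add: T'_def distrib_left)
    show "b * y \<in> T'" if "y \<in> T'" for b y
      using that idealp_mult[OF idS, of _ b] by (simp add: T'_def mult.left_commute[of _ b])
  qed
  have "mons as L <= T'"
    unfolding T'_def using mons_mult[of _ as _ L] Suc.prems isum_subset1[OF filt_ideal[OF G], of T] by blast
  hence "G L <= isum T' (G (Suc L))" by (rule Suc.IH[OF idT'])
  moreover have "G (Suc L) <= T'"
  proof
    fix f assume f: "f \<in> G (Suc L)"
    have "a * f \<in> ?S" if a: "a \<in> set as" for a
    proof -
      have "a * f \<in> G (1 + Suc L)" using a asG by (intro filt_mult[OF G] f) auto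
      thus ?thesis using isum_subset2[OF Suc.prems(1), of "G (Suc (Suc L))"] by auto
    qed
    thus "f \<in> T'" by (simp add: T'_def)
  qed
  ultimately have sub: "G L <= T'" using isum_least[OF idT' order_refl] by blast
  have "lcomb as (G L) <= ?S"
    by (rule lcomb_least[OF idS]) (use sub in \<open>auto simp: T'_def\<close>)
  moreover have "G (Suc (Suc L)) <= ?S" by (rule isum_subset2[OF Suc.prems(1)])
  ultimately have "isum (lcomb as (G L)) (G (Suc (Suc L))) <= ?S" by (rule isum_least[OF idS])
  thus ?case using genG[of L] by auto
qed

text \<open>Monomials of large degree in \<open>as\<close> multiply \<open>h\<close> into the
  required ideals and generate \<open>G L\<close> modulo \<open>G (Suc L)\<close>. Iteration pushes
  the remainder to \<open>G (L + n)\<close>, which lies in \<open>U (n + L)\<close> by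
  itself.\<close>

lemma tors_of_pow:
  assumes U: "filt U" and GU: "\<And>n. G n <= U n" and h: "\<And>a. a \<in> set as ==> \<exists>N. a ^ N * h \<in> U (n + N)"
  shows "tors G U n h"
proof -
  have asU: "set as <= U 1" using asG GU by blast
  obtain L0 where L0: "\<And>L m. L \<ge> L0 ==> m \<in> mons as L ==> m * h \<in> U (n + L)"
    using mons_tors[OF U h asU] by blast
  define T where "T L = colon (U (n + L)) h" for L
  have idT: "idealp (T L)" for L by (simp add: T_def idealp_colon filt_ideal[OF U])
  have 1: "G L <= isum (T L) (G (Suc L))" if "L \<ge> L0" for L
    using L0[OF that] by (intro G_mons_gen idT) (auto simp: T_def colon_def)
  have Tdec: "T (Suc L) <= T L" for L using filt_antimono[OF U, of "n + L" "n + Suc L"] by (auto simp: T_def colon_def)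
  have "G L <= T L" if L: "L \<ge> L0" for L
  proof -
    have 2: "G L <= isum (T L) (G (L + j))" for j
    proof (induction j)
      case 0 show ?case using isum_subset2[OF idT] by simp
    next
      case (Suc j)
      have Tle: "T (L + j) <= T L" by (induction j) (use Tdec in fastforce)+
      have "G (L + j) <= isum (T (L + j)) (G (Suc (L + j)))" by (rule 1) (use L in simp)
      also have "\<dots> <= isum (T L) (G (L + Suc j))" using Tle by (intro isum_mono) auto
      finally have "isum (T L) (G (L + j)) <= isum (T L) (G (L + Suc j))"
        by (intro isum_least idealp_isum idT filt_ideal[OF G] isum_subset1)
      thus ?case using Suc by blast
    qed
    have "G (L + n) <= T L"
    proof
      fix g assume "g \<in> G (L + n)"
      hence "g \<in> U (n + L)" using GU by (auto simp: add.commute)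
      thus "g \<in> T L" by (simp add: T_def colon_def idealp_mult2[OF filt_ideal[OF U]])
    qed
    hence "isum (T L) (G (L + n)) <= T L" by (intro isum_least idT order_refl)
    thus ?thesis using 2[of n] by blast
  qed
  thus ?thesis unfolding tors_def T_def colon_def by blast
qed

lemma tors_Reg:
  assumes "tors G U n h" "x \<in> G e" "0 < e" "Reg U x e"
  shows "h \<in> U n"
proof -
  obtain L0 where L0: "\<And>L g. L \<ge> L0 ==> g \<in> G L ==> g * h \<in> U (n + L)" using assms(1) unfolding tors_def by blast
  have "x ^ L0 * h \<in> U (n + L0 * e)" using assms(3) by (intro L0 filt_pow[OF G assms(2)]) simp
  thus ?thesis by (rule RegD[OF Reg_pow[OF assms(4)]])
qed

lemma tors_mono: "filt U ==> tors G U n h ==> m \<le> n ==> tors G U m h"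
  unfolding tors_def by (meson filt_down add_le_mono1)

text \<open>The elements of \<open>F n\<close> that are torsion relative to degree
  \<open>n + 1\<close> form a graded submodule. Artin-Rees and finite colength give one exponent
  \<open>K\<close> for its generators in degree \<open>n2\<close>, so from degree
  \<open>n2 + K\<close> on it lies in the next step of \<open>F\<close>. A general torsion element
  starts in \<open>F (n - c)\<close> and is lifted one degree at a time.\<close>

lemma tors_F_eventually:
  assumes x: "x \<in> G e" "0 < e" "Reg G x e"
  shows "\<exists>n1. \<forall>n\<ge>n1. \<forall>h. tors G F n h --> h \<in> F n"
proof -
  define E where "E n = {f \<in> F n. tors G F (Suc n) f}" for n
  have idt: "idealp {f. tors G F n f}" for n
  proof (rule idealpI)
    show "0 \<in> {f. tors G F n f}" by (simp add: tors_def idealp_zero[OF filt_ideal[OF F]])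
    show "y + z \<in> {f. tors G F n f}" if yz: "y \<in> {f. tors G F n f}" "z \<in> {f. tors G F n f}" for y z
    proof -
      obtain L1 L2 where L: "\<forall>L\<ge>L1. \<forall>g\<in>G L. g * y \<in> F (n + L)" "\<forall>L\<ge>L2. \<forall>g\<in>G L. g * z \<in> F (n + L)"
        using yz by (auto simp: tors_def)
      hence "\<forall>L\<ge>max L1 L2. \<forall>g\<in>G L. g * (y + z) \<in> F (n + L)"
        by (auto simp: distrib_left intro!: idealp_add[OF filt_ideal[OF F]])
      thus ?thesis unfolding tors_def by blast
    qed
    show "r * y \<in> {f. tors G F n f}" if y: "y \<in> {f. tors G F n f}" for r y
    proof -
      obtain L1 where L: "\<forall>L\<ge>L1. \<forall>g\<in>G L. g * y \<in> F (n + L)" using y by (auto simp: tors_def)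
      hence "\<forall>L\<ge>L1. \<forall>g\<in>G L. g * (r * y) \<in> F (n + L)"
        using idealp_mult[OF filt_ideal[OF F]] by (auto simp: mult.left_commute[of _ r])
      thus ?thesis unfolding tors_def by blast
    qed
  qed
  have idE: "idealp (E n)" for n
  proof -
    have "E n = F n \<inter> {f. tors G F (Suc n) f}" by (auto simp: E_def)
    thus ?thesis by (simp add: idealp_Int idt filt_ideal[OF F])
  qed
  have torsF: "tors G F n f" if "f \<in> F n" for n f
    unfolding tors_def using filt_mult[OF F _ that] GF by (auto simp: add.commute intro!: exI[of _ 0])
  have FE: "F (Suc n) <= E n" for n
    using torsF[of _ "Suc n"] filt_antimono[OF F, of n "Suc n"] by (auto simp: E_def)
  have asF: "a \<in> F 1" if "a \<in> set as" for a using that asG GF by blast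
  have "\<exists>n2. \<forall>n\<ge>n2. E (Suc n) <= isum (lcomb as (E n)) (F (Suc (Suc n)))"
  proof (rule artin_rees[where U = F and V = "\<lambda>n. F (Suc n)" and E = E and ?n0.0 = n0])
    show "a * f \<in> F (Suc n)" if "a \<in> set as" "f \<in> F n" for a n f
      using filt_mult[OF F asF[OF that(1)] that(2)] by simp
    show "a * f \<in> F (Suc (Suc n))" if "a \<in> set as" "f \<in> F (Suc n)" for a n f
      using filt_mult[OF F asF[OF that(1)] that(2)] by simp
    show "a * f \<in> E (Suc n)" if a: "a \<in> set as" and f: "f \<in> E n" for a n f
    proof -
      obtain L0 where L0: "\<And>L g. L \<ge> L0 ==> g \<in> G L ==> g * f \<in> F (Suc n + L)" using f by (auto simp: E_def tors_def)
      have "g * (a * f) \<in> F (Suc (Suc n) + L)" if "L \<ge> L0" "g \<in> G L" for L g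
      proof -
        have "a * (g * f) \<in> F (1 + (Suc n + L))" by (intro filt_mult[OF F] asF a L0 that)
        thus ?thesis by (simp add: mult.left_commute)
      qed
      hence "tors G F (Suc (Suc n)) (a * f)" unfolding tors_def by blast
      thus ?thesis using f filt_mult[OF F asF[OF a], of f n] by (simp add: E_def)
    qed
    show "\<exists>k. \<forall>j. H j <= H k"
      if "\<And>i::nat. idealp (H i)" "\<And>i. F (Suc n) <= H i" "\<And>i. H i <= F n" "\<And>i. H i <= H (Suc i)" for n H
      using that by (intro colen_acc[OF filt_ideal[OF F] fin[of "Suc n"]]) auto
    show "E n <= F n" for n by (auto simp: E_def)
    show "F (Suc n) <= isum (lcomb as (F n)) (F (Suc (Suc n)))" if "n0 \<le> n" for n using genF[OF that] .
  qed (use filt_ideal[OF F] idE FE in auto)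
  then obtain n2 where n2: "\<And>n. n \<ge> n2 ==> E (Suc n) <= isum (lcomb as (E n)) (F (Suc (Suc n)))" by blast
  define H where "H k = {f \<in> F n2. \<forall>L\<ge>k. \<forall>g\<in>G L. g * f \<in> F (Suc n2 + L)}" for k
  have "\<exists>k. \<forall>j. H j <= H k"
  proof (rule colen_acc[OF filt_ideal[OF F] fin[of "Suc n2"]])
    show "idealp (H i)" for i
    proof (rule idealpI)
      show "0 \<in> H i" by (simp add: H_def idealp_zero[OF filt_ideal[OF F]])
      show "y + z \<in> H i" if "y \<in> H i" "z \<in> H i" for y z
        using that by (simp add: H_def idealp_add[OF filt_ideal[OF F]] distrib_left)
      show "r * y \<in> H i" if "y \<in> H i" for r y
        using that by (simp add: H_def idealp_mult[OF filt_ideal[OF F]] mult.left_commute[of _ r])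
    qed
    show "F (Suc n2) <= H i" for i
    proof
      fix f assume f: "f \<in> F (Suc n2)"
      have "g * f \<in> F (Suc n2 + L)" if "g \<in> G L" for g L
        using filt_mult[OF F _ f, of g L] GF that by (auto simp: add.commute)
      thus "f \<in> H i" unfolding H_def using filt_down[OF F f, of n2] by simp
    qed
    show "H i <= H (Suc i)" for i by (auto simp: H_def)
  qed
  then obtain K where K: "\<And>j. H j <= H K" by blast
  have EK: "g * f \<in> F (Suc n2 + L)" if f: "f \<in> E n2" and L: "L \<ge> K" and g: "g \<in> G L" for f g L
  proof -
    obtain j where "f \<in> H j" using f by (auto simp: E_def tors_def H_def)
    hence "f \<in> H K" using K by blast
    thus ?thesis using L g by (simp add: H_def)
  qed
  have step: "E (n2 + j) <= F (Suc (n2 + j))" if j: "j \<ge> K" for j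
  proof -
    have "E (n2 + j) <= isum (F (Suc (n2 + j))) (F (Suc (n2 + j)))"
      using EK[OF _ j] by (intro mult_gen n2 filt_ideal[OF F]) auto
    thus ?thesis using isum_least[OF filt_ideal[OF F] order_refl order_refl] by blast
  qed
  have "h \<in> F n" if n: "n \<ge> n2 + K + c" and t: "tors G F n h" for n h
  proof -
    \<comment> \<open>The powers of \<open>x\<close> are regular along \<open>G\<close>; comparing
      \<open>F\<close> with \<open>G\<close> costs the shift \<open>c\<close>.\<close>
    have "h \<in> G (n - c)"
    proof -
      obtain L0 where L0: "\<And>L g. L \<ge> L0 ==> g \<in> G L ==> g * h \<in> F (n + L)" using t unfolding tors_def by blast
      have "x ^ L0 * h \<in> F (n + L0 * e)" using x(2) by (intro L0 filt_pow[OF G x(1)]) simp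
      moreover have "n + L0 * e = (n - c + L0 * e) + c" using n by simp
      ultimately have "x ^ L0 * h \<in> G ((n - c) + L0 * e)" using FG by (metis subsetD)
      thus ?thesis by (rule RegD[OF Reg_pow[OF x(3)]])
    qed
    hence start: "h \<in> F (n - c)" using GF by blast
    have "h \<in> F (n - c + i)" if "i \<le> c" for i
      using that
    proof (induction i)
      case 0 thus ?case using start by simp
    next
      case (Suc i)
      let ?k = "n - c + i"
      have "tors G F (Suc ?k) h" using Suc.prems n by (intro tors_mono[OF F t]) simp
      hence "h \<in> E ?k" using Suc by (simp add: E_def)
      moreover have "E ?k <= F (Suc ?k)" using step[of "?k - n2"] n by simp
      ultimately show ?case by auto
    qed
    from this[of c] show ?thesis using n by simp
  qed
  thus ?thesis by blast
qed

end

lemma polyin_adj_split: "idealp U ==> polyin (adj U c) p ==> \<exists>q. polyin U (p - [:c:] * q)"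
proof (induction p)
  case 0 thus ?case by (intro exI[of _ 0]) (simp add: polyin_0)
next
  case (pCons a p)
  then obtain q where q: "polyin U (p - [:c:] * q)" by (auto simp: polyin_pCons)
  obtain d where d: "a - d * c \<in> U" using pCons.prems by (auto simp: polyin_pCons adj_iff)
  have "pCons a p - [:c:] * pCons d q = pCons (a - d * c) (p - [:c:] * q)" by (simp add: mult.commute)
  thus ?case using q d by (metis polyin_pCons)
qed

lemma polyin_isum_split: "idealp U ==> idealp V ==> polyin (isum U V) p ==> \<exists>q r. p = q + r \<and> polyin U q \<and> polyin V r"
proof (induction p)
  case 0 thus ?case by (intro exI[of _ 0]) (simp add: polyin_0)
next
  case (pCons a p)
  then obtain q r where q: "p = q + r" "polyin U q" "polyin V r" by (auto simp: polyin_pCons)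
  obtain u v where "a = u + v" "u \<in> U" "v \<in> V" using pCons.prems by (auto simp: polyin_pCons isum_def)
  hence "pCons a p = pCons u q + pCons v r \<and> polyin U (pCons u q) \<and> polyin V (pCons v r)" using q by (simp add: polyin_pCons)
  thus ?case by blast
qed

lemma polyin_lcomb_split:
  "idealp U ==> polyin (lcomb (a # as) U) p ==> \<exists>s t. p = [:a:] * s + t \<and> polyin U s \<and> polyin (lcomb as U) t"
proof (induction p)
  case 0 thus ?case by (intro exI[of _ 0]) (simp add: polyin_0 idealp_lcomb)
next
  case (pCons b p)
  have "polyin (lcomb (a # as) U) p" "b \<in> lcomb (a # as) U" using pCons.prems(2) unfolding polyin_pCons by auto
  then obtain s t where st: "p = [:a:] * s + t" "polyin U s" "polyin (lcomb as U) t" using pCons by blast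
  obtain u v where "b = a * u + v" "u \<in> U" "v \<in> lcomb as U" using \<open>b \<in> lcomb (a # as) U\<close> by auto
  hence "pCons b p = [:a:] * pCons u s + pCons v t \<and> polyin U (pCons u s) \<and> polyin (lcomb as U) (pCons v t)"
    using st by (simp add: polyin_pCons)
  thus ?case by blast
qed

lemma colen_one_iff:
  assumes "idealp P"
  shows "colen P = 1 \<longleftrightarrow> P \<noteq> UNIV \<and> (\<forall>y. y \<notin> P --> 1 \<in> adj P y)"
proof
  assume one: "colen P = 1"
  hence "P \<noteq> UNIV" by auto
  moreover have "1 \<in> adj P y" if "y \<notin> P" for y
  proof -
    have lt: "P \<subset> adj P y" using that adj_subset[of P y] adj_self[OF assms] by blast
    have "colen P = ilen P (adj P y) + colen (adj P y)"
      by (rule ilen_add) (use assms lt in \<open>auto intro: idealp_adj\<close>)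
    moreover have "1 \<le> ilen P (adj P y)" using assms lt by (intro ilen_pos idealp_adj) auto
    ultimately have "colen (adj P y) = 0" using one
      by (cases "ilen P (adj P y)"; cases "colen (adj P y)") (auto simp: one_enat_def zero_enat_def)
    hence "adj P y = UNIV" by (intro ilen_eq_0 idealp_adj assms) auto
    thus ?thesis by simp
  qed
  ultimately show "P \<noteq> UNIV \<and> (\<forall>y. y \<notin> P --> 1 \<in> adj P y)" by blast
next
  assume a: "P \<noteq> UNIV \<and> (\<forall>y. y \<notin> P --> 1 \<in> adj P y)"
  have "colen P \<le> 1"
  proof (rule ilen_leI)
    fix n C assume C: "ichain P UNIV n C"
    show "enat n \<le> 1"
    proof (rule ccontr)
      assume "\<not> enat n \<le> 1"
      hence n: "n \<ge> 2" by (simp add: one_enat_def)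
      have 1: "C 0 = P" "C 0 \<subset> C 1" "C 1 \<subset> C 2" "idealp (C 1)" using C n unfolding ichain_def by (auto simp: numeral_2_eq_2)
      then obtain y where "y \<in> C 1" "y \<notin> P" by auto
      hence "1 \<in> C 1" using a adj_least[OF 1(4), of P y] 1 by blast
      hence "C 1 = UNIV" using idealp_one 1(4) by blast
      thus False using 1(3) by blast
    qed
  qed
  moreover have "1 \<le> colen P" using a assms by (intro ilen_pos) auto
  ultimately show "colen P = 1" by simp
qed

text \<open>A longest chain begins with a simple step, generated over \<open>W\<close> by any new
  element. This permits induction on the length by adjoining one element at a time.\<close>

lemma ilen_Suc_split:
  assumes "idealp W" "idealp V" "W <= V" "ilen W V = enat (Suc n)"
  shows "\<exists>v. v \<in> V \<and> ilen W (adj W v) = 1 \<and> ilen (adj W v) V = enat n"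
proof -
  obtain k C where C: "Suc n \<le> k" "ichain W V k C" using enat_le_ilen_iff[OF assms(1-3), of "Suc n"] assms(4) by auto
  have "enat k \<le> ilen W V" using enat_le_ilen_iff[OF assms(1-3), of k] C by blast
  hence k: "k = Suc n" using C(1) assms(4) by simp
  have c: "C 0 = W" "C k = V" "\<And>i. i \<le> k ==> idealp (C i)" "\<And>i. i < k ==> C i \<subset> C (Suc i)" using C(2) by (auto simp: ichain_def)
  obtain v where v: "v \<in> C 1" "v \<notin> W" using c(1) c(4)[of 0] k by auto
  have C1V: "C (Suc i) <= V" if "Suc i \<le> k" for i
    using that
  proof (induction rule: inc_induct)
    case base thus ?case using c by simp
  next
    case (step m) thus ?case using c(4)[of m] by auto
  qed
  have vV: "v \<in> V" using C1V[of 0] v k by auto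
  let ?A = "adj W v"
  have idA: "idealp ?A" by (rule idealp_adj[OF assms(1)])
  have WA: "W \<subset> ?A" using v adj_subset[of W v] adj_self[OF assms(1), of v] by blast
  have AV: "?A <= V" using vV assms by (intro adj_least) auto
  have AC: "?A <= C 1" using v c(3)[of 1] k c(1) c(4)[of 0] by (intro adj_least) auto
  have "enat n \<le> ilen ?A V"
  proof (rule strict_chain_le_ilen[where C = "\<lambda>i. C (Suc i)"])
    show "C (Suc n) <= V" using c k by simp
  qed (use idA assms c k AC in auto)
  moreover have "1 \<le> ilen W ?A" by (rule ilen_pos[OF assms(1) idA WA])
  moreover have "ilen W V = ilen W ?A + ilen ?A V" by (rule ilen_add) (use assms idA WA AV in auto)
  ultimately have "ilen W ?A = 1 \<and> ilen ?A V = enat n" using assms(4)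
    by (cases "ilen W ?A"; cases "ilen ?A V") (auto simp: one_enat_def)
  thus ?thesis using vV by blast
qed

text \<open>The image of \<open>ev\<close> is the polynomial ring over \<open>'r\<close> localized
  at \<open>lowmonic\<close>, inside \<open>'q\<close>. Working in a ring \<open>'s\<close> that
  maps onto this localization allows \<open>'s\<close> and \<open>'r\<close> to be the same type;
  the kernel of \<open>ev\<close> lies in \<open>Ext U\<close> for every ideal
  \<open>U\<close>.\<close>

locale gext =
  fixes ev :: "'s::comm_ring_1 => 'q::comm_ring_1" and emb :: "'r::comm_ring_1 poly => 'q"
  assumes ev_add: "ev (x + y) = ev x + ev y" and ev_mult: "ev (x * y) = ev x * ev y" and ev_1: "ev 1 = 1"
    and emb_add: "emb (p + q) = emb p + emb q" and emb_mult: "emb (p * q) = emb p * emb q" and emb_1: "emb 1 = 1"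
    and emb_inj: "emb p = emb q ==> p = q"
    and hit: "\<exists>y. ev y = emb p"
    and unit: "lowmonic w ==> \<exists>y. ev y * emb w = 1"
    and frac: "\<exists>w p. lowmonic w \<and> emb w * ev y = emb p"
begin

lemma ev_0: "ev 0 = 0" using ev_add[of 0 0] by simp
lemma emb_0: "emb 0 = 0" using emb_add[of 0 0] by simp
lemma ev_uminus: "ev (- x) = - ev x" using ev_add[of x "- x"] by (simp add: ev_0 eq_neg_iff_add_eq_0 add.commute)
lemma ev_diff: "ev (x - y) = ev x - ev y" using ev_add[of x "- y"] by (simp add: ev_uminus)
lemma emb_diff: "emb (p - q) = emb p - emb q" using emb_add[of "p - q" q] by simp
lemma ev_pow: "ev (x ^ k) = ev x ^ k" by (induction k) (auto simp: ev_1 ev_mult)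
lemma emb_pow: "emb (x ^ k) = emb x ^ k" by (induction k) (auto simp: emb_1 emb_mult)

definition lift :: "'r poly => 's" where "lift p = (SOME y. ev y = emb p)"
definition iota :: "'r => 's" where "iota c = lift [:c:]"
definition Ext :: "'r set => 's set" where
  "Ext U = {y. \<exists>w p. lowmonic w \<and> emb w * ev y = emb p \<and> polyin U p}"

lemma ev_lift: "ev (lift p) = emb p" unfolding lift_def by (rule someI_ex[OF hit])
lemma ev_iota: "ev (iota c) = emb [:c:]" by (simp add: iota_def ev_lift)

text \<open>Independence of the chosen fraction: two fractions are cross-multiplied, injectivity of
  \<open>emb\<close> brings the identity back to polynomials, and denominators cancel modulo
  \<open>U\<close>.\<close>

lemma Ext_iff:
  assumes "idealp U" "lowmonic w" "emb w * ev y = emb p"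
  shows "y \<in> Ext U \<longleftrightarrow> polyin U p"
proof
  assume "y \<in> Ext U"
  then obtain w' p' where *: "lowmonic w'" "emb w' * ev y = emb p'" "polyin U p'" unfolding Ext_def by blast
  have "emb (w' * p) = emb (w * p')" by (simp only: emb_mult *(2)[symmetric] assms(3)[symmetric] mult_ac)
  hence "w' * p = w * p'" by (rule emb_inj)
  hence "polyin U (w' * p)" using polyin_mult[OF assms(1) *(3)] by simp
  thus "polyin U p" using polyin_lowmonic_cancel[OF assms(1) *(1)] by blast
next
  assume "polyin U p" thus "y \<in> Ext U" using assms unfolding Ext_def by blast
qed

lemma frac2: "\<exists>w p q. lowmonic w \<and> emb w * ev y = emb p \<and> emb w * ev z = emb q"
proof -
  obtain w p v q where *: "lowmonic w" "emb w * ev y = emb p" "lowmonic v" "emb v * ev z = emb q" using frac by metis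
  have "emb (w * v) * ev y = emb (v * p)" by (simp only: emb_mult *(2)[symmetric] mult_ac)
  moreover have "emb (w * v) * ev z = emb (w * q)" by (simp only: emb_mult *(4)[symmetric] mult_ac)
  ultimately show ?thesis using lowmonic_mult[OF *(1,3)] by blast
qed

lemma Ext_lift: "idealp U ==> lift p \<in> Ext U \<longleftrightarrow> polyin U p"
  by (rule Ext_iff[OF _ lowmonic_1]) (simp_all add: emb_1 ev_lift)

lemma Ext_iota: "idealp U ==> iota c \<in> Ext U \<longleftrightarrow> c \<in> U"
  unfolding iota_def Ext_lift using polyin_const[of U c] by (auto simp: Ext_lift polyin_pCons)

lemma idealp_Ext: assumes "idealp U" shows "idealp (Ext U)"
proof (rule idealpI)
  show "0 \<in> Ext U" using Ext_iff[OF assms lowmonic_1, of 0 0] by (simp add: ev_0 emb_0 polyin_0 assms)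
next
  fix y z assume yz: "y \<in> Ext U" "z \<in> Ext U"
  obtain w p q where *: "lowmonic w" "emb w * ev y = emb p" "emb w * ev z = emb q" using frac2 by metis
  have "emb w * ev (y + z) = emb (p + q)" by (simp add: ev_add emb_add distrib_left *)
  thus "y + z \<in> Ext U" using yz * Ext_iff[OF assms *(1)] polyin_add[OF assms] by blast
next
  fix r y assume y: "y \<in> Ext U"
  obtain w p v q where *: "lowmonic w" "emb w * ev y = emb p" "lowmonic v" "emb v * ev r = emb q" using frac by metis
  have "emb (v * w) * ev (r * y) = emb (q * p)" by (simp only: ev_mult emb_mult *(2,4)[symmetric] mult_ac)
  thus "r * y \<in> Ext U"
    using y * Ext_iff[OF assms lowmonic_mult[OF *(3,1)]] Ext_iff[OF assms *(1,2)] polyin_mult[OF assms] by blast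
qed

lemma Ext_mono: "U <= V ==> Ext U <= Ext V" unfolding Ext_def polyin_def by blast

lemma Ext_UNIV: "Ext UNIV = UNIV"
  unfolding Ext_def polyin_def using frac by auto

lemma Ext_mult:
  assumes "idealp W" "\<And>x y. x \<in> U ==> y \<in> V ==> x * y \<in> W" "y \<in> Ext U" "z \<in> Ext V"
  shows "y * z \<in> Ext W"
proof -
  obtain w p v q where *: "lowmonic w" "emb w * ev y = emb p" "polyin U p" "lowmonic v" "emb v * ev z = emb q" "polyin V q"
    using assms(3,4) unfolding Ext_def by blast
  have "emb (w * v) * ev (y * z) = emb (p * q)" by (simp only: ev_mult emb_mult *(2,5)[symmetric] mult_ac)
  moreover have "polyin W (p * q)" by (rule polyin_mult2[OF assms(1,2) *(3,6)])
  ultimately show ?thesis using lowmonic_mult[OF *(1,4)] unfolding Ext_def by blast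
qed

lemma filt_Ext: assumes "filt F" shows "filt (\<lambda>n. Ext (F n))"
  unfolding filt_def
proof (intro conjI allI impI)
  show "Ext (F 0) = UNIV" by (simp add: filt_0[OF assms] Ext_UNIV)
  show "idealp (Ext (F n))" for n by (rule idealp_Ext[OF filt_ideal[OF assms]])
  show "Ext (F (Suc n)) <= Ext (F n)" for n by (rule Ext_mono) (rule filt_antimono[OF assms], simp)
  show "x * y \<in> Ext (F (m + n))" if "x \<in> Ext (F m)" "y \<in> Ext (F n)" for m n x y
    by (rule Ext_mult[OF filt_ideal[OF assms] filt_mult[OF assms] that])
qed

lemma Ext_adj: assumes "idealp U" shows "Ext (adj U c) = adj (Ext U) (iota c)"
proof (intro subset_antisym subsetI)
  fix y assume y: "y \<in> Ext (adj U c)"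
  obtain w p where *: "lowmonic w" "emb w * ev y = emb p" using frac by metis
  have "polyin (adj U c) p" using y Ext_iff[OF idealp_adj[OF assms] *] by blast
  then obtain q where q: "polyin U (p - [:c:] * q)" using polyin_adj_split[OF assms] by blast
  obtain z where z: "ev z * emb w = 1" using unit[OF *(1)] by blast
  have "emb w * ev (y - (z * lift q) * iota c) = emb w * ev y - (ev z * emb w) * (emb [:c:] * emb q)"
    by (simp only: ev_diff ev_mult ev_lift ev_iota right_diff_distrib mult_ac)
  also have "\<dots> = emb (p - [:c:] * q)" by (simp only: z *(2) mult_1 emb_diff emb_mult)
  finally have "y - (z * lift q) * iota c \<in> Ext U" using Ext_iff[OF assms *(1)] q by blast
  thus "y \<in> adj (Ext U) (iota c)" by (auto simp: adj_iff)
next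
  fix y assume "y \<in> adj (Ext U) (iota c)"
  moreover have "adj (Ext U) (iota c) <= Ext (adj U c)"
    by (intro adj_least idealp_Ext idealp_adj assms Ext_mono adj_subset) (simp add: Ext_iota idealp_adj assms adj_self)
  ultimately show "y \<in> Ext (adj U c)" by blast
qed

lemma Ext_fadj: "filt F ==> (\<lambda>n. Ext (fadj F c n)) = fadj (\<lambda>n. Ext (F n)) (iota c)"
  by (rule ext) (simp add: fadj_def Ext_adj filt_ideal)

lemma lift_lcomb: "idealp U ==> polyin (lcomb as U) q ==> \<exists>y\<in>lcomb (map iota as) (Ext U). ev y = emb q"
proof (induction as arbitrary: q)
  case Nil
  hence "q = 0" by (auto simp: polyin_def intro: poly_eqI)
  thus ?case by (simp add: ev_0 emb_0)
next
  case (Cons a as)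
  obtain s t where st: "q = [:a:] * s + t" "polyin U s" "polyin (lcomb as U) t" using polyin_lcomb_split[OF Cons.prems] by blast
  obtain y where y: "y \<in> lcomb (map iota as) (Ext U)" "ev y = emb t" using Cons.IH[OF Cons.prems(1) st(3)] by blast
  have "ev (iota a * lift s + y) = emb q" by (simp only: ev_add ev_mult ev_iota ev_lift y(2) st(1) emb_add emb_mult)
  moreover have "iota a * lift s + y \<in> lcomb (map iota (a # as)) (Ext U)"
    using y(1) st(2) Ext_lift[OF Cons.prems(1)] by auto
  ultimately show ?case by blast
qed

lemma Ext_isum_lcomb:
  assumes "idealp U" "idealp V"
  shows "Ext (isum (lcomb as U) V) <= isum (lcomb (map iota as) (Ext U)) (Ext V)"
proof
  fix y assume y: "y \<in> Ext (isum (lcomb as U) V)"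
  obtain w p where *: "lowmonic w" "emb w * ev y = emb p" using frac by metis
  have "polyin (isum (lcomb as U) V) p" using y Ext_iff[OF idealp_isum[OF idealp_lcomb[OF assms(1)] assms(2)] *] by blast
  then obtain q r where qr: "p = q + r" "polyin (lcomb as U) q" "polyin V r"
    using polyin_isum_split[OF idealp_lcomb[OF assms(1)] assms(2)] by blast
  obtain y1 where y1: "y1 \<in> lcomb (map iota as) (Ext U)" "ev y1 = emb q" using lift_lcomb[OF assms(1) qr(2)] by blast
  obtain z where z: "ev z * emb w = 1" using unit[OF *(1)] by blast
  have "emb w * ev (y - z * y1) = emb w * ev y - (ev z * emb w) * emb q"
    by (simp only: ev_diff ev_mult y1(2) right_diff_distrib mult_ac)
  also have "\<dots> = emb r" by (simp add: z *(2) qr(1) emb_add)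
  finally have "y - z * y1 \<in> Ext V" using Ext_iff[OF assms(2) *(1)] qr(3) by blast
  moreover have "z * y1 \<in> lcomb (map iota as) (Ext U)" using y1(1) by (intro idealp_mult idealp_lcomb idealp_Ext assms)
  ultimately have "z * y1 + (y - z * y1) \<in> isum (lcomb (map iota as) (Ext U)) (Ext V)" by (intro isumI)
  thus "y \<in> isum (lcomb (map iota as) (Ext U)) (Ext V)" by simp
qed

lemma Reg_Ext:
  assumes "filt G" "Reg G x e" shows "Reg (\<lambda>n. Ext (G n)) (iota x) e"
  unfolding Reg_def
proof (intro allI impI)
  fix n y assume y: "iota x * y \<in> Ext (G (n + e))"
  obtain w p where *: "lowmonic w" "emb w * ev y = emb p" using frac by metis
  have "emb w * ev (iota x * y) = emb ([:x:] * p)" by (simp only: ev_mult ev_iota emb_mult *(2)[symmetric] mult_ac)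
  hence "polyin (G (n + e)) ([:x:] * p)" using y Ext_iff[OF filt_ideal[OF assms(1)] *(1)] by blast
  hence "polyin (G n) p" using RegD[OF assms(2)] by (simp add: polyin_def)
  thus "y \<in> Ext (G n)" using Ext_iff[OF filt_ideal[OF assms(1)] *] by blast
qed

definition iotas :: "('r \<times> nat) list => ('s \<times> nat) list" where
  "iotas ps = map (\<lambda>p. (iota (fst p), snd p)) ps"

lemma iotas_simps [simp]: "iotas [] = []" "iotas (p # ps) = (iota (fst p), snd p) # iotas ps" "iotas (ps @ qs) = iotas ps @ iotas qs"
  "length (iotas ps) = length ps"
  by (simp_all add: iotas_def)

lemma regs_Ext: "filt G ==> regs G ps ==> regs (\<lambda>n. Ext (G n)) (iotas ps)"
proof (induction ps arbitrary: G)
  case (Cons p ps)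
  have "regs (\<lambda>n. Ext (fadj G (fst p) n)) (iotas ps)" using Cons by (intro Cons.IH filt_fadj) auto
  thus ?case using Cons.prems Reg_Ext[OF Cons.prems(1)] by (simp add: Ext_fadj)
qed simp

lemma in_filt_Ext: "filt G ==> in_filt G ps ==> in_filt (\<lambda>n. Ext (G n)) (iotas ps)"
  by (induction ps) (auto simp: Ext_iota filt_ideal)

lemma closedf_Ext:
  assumes "filt F" "closedf F n1" shows "closedf (\<lambda>n. Ext (F n)) n1"
  unfolding closedf_def
proof (intro allI impI)
  fix n y C assume n: "n1 \<le> n" and y: "\<forall>m. y ^ m \<in> Ext (F (n * m - C))"
  obtain w p where *: "lowmonic w" "emb w * ev y = emb p" using frac by metis
  have "polyin (F (n * m - C)) (p ^ m)" for m
  proof -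
    have "emb (w ^ m) * ev (y ^ m) = emb (p ^ m)" by (simp only: emb_pow ev_pow power_mult_distrib[symmetric] *(2))
    thus ?thesis using y Ext_iff[OF filt_ideal[OF assms(1)] lowmonic_pow[OF *(1)]] by blast
  qed
  hence "polyin (F n) p" by (rule polyin_pow_closed[OF assms n])
  thus "y \<in> Ext (F n)" using Ext_iff[OF filt_ideal[OF assms(1)] *] by blast
qed

text \<open>A polynomial outside the extension of \<open>P\<close> has a first coefficient outside
  \<open>P\<close>, invertible modulo \<open>P\<close>. Scaled to 1, it makes the polynomial
  \<open>lowmonic\<close> up to coefficients in \<open>P\<close>, hence invertible: the residue
  field is replaced by a larger field.\<close>

lemma colen_Ext_one:
  assumes P: "idealp P" and one: "colen P = 1" shows "colen (Ext P) = 1"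
  unfolding colen_one_iff[OF idealp_Ext[OF P]]
proof (intro conjI allI impI)
  have P': "P \<noteq> UNIV" "\<And>y. y \<notin> P ==> 1 \<in> adj P y" using one colen_one_iff[OF P] by auto
  hence "1 \<notin> P" using idealp_one[OF P] by blast
  thus "Ext P \<noteq> UNIV" using Ext_iota[OF P, of 1] by auto
  fix y assume y: "y \<notin> Ext P"
  obtain w p where *: "lowmonic w" "emb w * ev y = emb p" using frac by metis
  hence "\<not> polyin P p" using y Ext_iff[OF P *] by blast
  hence ex: "\<exists>k. pc p k \<notin> P" by (simp add: polyin_def)
  define k where "k = (LEAST k. pc p k \<notin> P)"
  have k: "pc p k \<notin> P" "\<And>i. i < k ==> pc p i \<in> P"
    unfolding k_def using LeastI_ex[OF ex] not_less_Least by blast+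
  obtain c where c: "1 - c * pc p k \<in> P" using P'(2)[OF k(1)] by (auto simp: adj_iff)
  have split: "\<exists>u. pc u 0 = 1 \<and> polyin P ([:c:] * p - [:0, 1:] ^ k * u)"
    if "1 - c * pc p k \<in> P" "\<And>i. i < k ==> pc p i \<in> P" for p k
    using that
  proof (induction k arbitrary: p)
    case 0
    \<comment> \<open>The added constant lies in \<open>P\<close> and makes the lowest coefficient
      exactly 1 rather than congruent to 1.\<close>
    define u where "u = [:c:] * p + [:1 - c * pc p 0:]"
    have "pc u 0 = 1" by (simp add: u_def)
    moreover have "[:c:] * p - [:0, 1:] ^ 0 * u = [:- (1 - c * pc p 0):]" by (simp add: u_def)
    hence "polyin P ([:c:] * p - [:0, 1:] ^ 0 * u)" using polyin_const[OF P idealp_neg[OF P 0(1)]] by simp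
    ultimately show ?case by blast
  next
    case (Suc k)
    obtain a q where p: "p = pCons a q" by (cases p)
    have a: "a \<in> P" using Suc.prems(2)[of 0] by (simp add: p)
    have "pc q i \<in> P" if "i < k" for i using Suc.prems(2)[of "Suc i"] that by (simp add: p)
    hence "\<exists>u. pc u 0 = 1 \<and> polyin P ([:c:] * q - [:0, 1:] ^ k * u)"
      using Suc.prems(1) by (intro Suc.IH) (auto simp: p)
    then obtain u where u: "pc u 0 = 1" "polyin P ([:c:] * q - [:0, 1:] ^ k * u)" by blast
    have "[:c:] * p - [:0, 1:] ^ Suc k * u = pCons (c * a) ([:c:] * q - [:0, 1:] ^ k * u)"
      by (simp add: p mult.assoc)
    thus ?case using u idealp_mult[OF P a, of c] by (metis polyin_pCons)
  qed
  obtain u where u: "pc u 0 = 1" "polyin P ([:c:] * p - [:0, 1:] ^ k * u)" using split[OF c k(2)] by blast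
  define v where "v = [:0, 1:] ^ k * u"
  have lv: "lowmonic v" unfolding lowmonic_def v_def using u(1) by blast
  obtain z where z: "ev z * emb v = 1" using unit[OF lv] by blast
  define d where "d = z * iota c * lift w"
  have "ev d * ev y = ev z * (emb [:c:] * (emb w * ev y))" by (simp only: d_def ev_mult ev_iota ev_lift mult_ac)
  hence dy: "ev d * ev y = ev z * emb ([:c:] * p)" by (simp only: * emb_mult)
  have "emb v * ev (1 - d * y) = emb v - (ev z * emb v) * emb ([:c:] * p)"
    by (simp only: ev_diff ev_1 ev_mult dy right_diff_distrib mult_1_right mult_1 mult_ac)
  hence "emb v * ev (1 - d * y) = emb (- ([:c:] * p - v))" by (simp add: z emb_diff)
  moreover have "polyin P (- ([:c:] * p - v))" using polyin_diff[OF P polyin_0[OF P] u(2)] by (simp add: v_def)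
  ultimately have "1 - d * y \<in> Ext P" using Ext_iff[OF P lv] by blast
  thus "1 \<in> adj (Ext P) y" by (auto simp: adj_iff)
qed

lemma colon_Ext: assumes "idealp W" shows "colon (Ext W) (iota v) = Ext (colon W v)"
proof (rule Set.set_eqI)
  fix y
  obtain w p where *: "lowmonic w" "emb w * ev y = emb p" using frac by metis
  have e: "emb w * ev (y * iota v) = emb ([:v:] * p)" by (simp only: ev_mult ev_iota emb_mult *(2)[symmetric] mult_ac)
  show "y \<in> colon (Ext W) (iota v) \<longleftrightarrow> y \<in> Ext (colon W v)"
    using Ext_iff[OF assms *(1) e] Ext_iff[OF idealp_colon[OF assms] *, of v]
    by (simp add: colon_def polyin_def mult.commute)
qed

text \<open>Induction along a composition series: each simple factor is the ring modulo a maximal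
  colon ideal, and both \<open>colon\<close> and \<open>adj\<close> commute with
  \<open>Ext\<close>.\<close>

lemma colen_Ext_aux: "idealp W ==> colen W = enat n ==> colen (Ext W) = enat n"
proof (induction n arbitrary: W)
  case 0
  hence "W = UNIV" by (intro ilen_eq_0) (auto simp: zero_enat_def)
  thus ?case using 0 Ext_UNIV by (simp add: zero_enat_def[symmetric])
next
  case (Suc n)
  obtain v where v: "ilen W (adj W v) = 1" "colen (adj W v) = enat n"
    using ilen_Suc_split[OF Suc.prems(1) idealp_UNIV _ Suc.prems(2)] by auto
  have "colen (colon W v) = 1" using v(1) ilen_adj[OF Suc.prems(1)] by simp
  hence "colen (colon (Ext W) (iota v)) = 1"
    unfolding colon_Ext[OF Suc.prems(1)] by (intro colen_Ext_one idealp_colon Suc.prems)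
  moreover have "colen (adj (Ext W) (iota v)) = enat n"
    using Suc.IH[OF idealp_adj[OF Suc.prems(1)] v(2)] by (simp add: Ext_adj Suc.prems)
  ultimately show ?case using colen_adj[OF idealp_Ext[OF Suc.prems(1)], of "iota v"] by (simp add: one_enat_def)
qed

lemma colen_Ext: "idealp W ==> colen W \<noteq> \<infinity> ==> colen (Ext W) = colen W"
  using colen_Ext_aux by fastforce

lemma stage_Ext:
  assumes "stage F G as c n0"
  shows "stage (\<lambda>n. Ext (F n)) (\<lambda>n. Ext (G n)) (map iota as) c n0"
proof -
  interpret stage F G as c n0 by fact
  show ?thesis
  proof
    show "filt (\<lambda>n. Ext (F n))" "filt (\<lambda>n. Ext (G n))" using F G by (auto intro: filt_Ext)
    show "Ext (G n) <= Ext (F n)" for n by (rule Ext_mono[OF GF])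
    show "Ext (F (n + c)) <= Ext (G n)" for n by (rule Ext_mono[OF FG])
    show "set (map iota as) <= Ext (G 1)" using asG by (auto simp: Ext_iota filt_ideal[OF G])
    show "Ext (G (Suc n)) <= isum (lcomb (map iota as) (Ext (G n))) (Ext (G (Suc (Suc n))))" for n
      using Ext_mono[OF genG] Ext_isum_lcomb[OF filt_ideal[OF G] filt_ideal[OF G]] by blast
    show "Ext (F (Suc n)) <= isum (lcomb (map iota as) (Ext (F n))) (Ext (F (Suc (Suc n))))" if "n0 \<le> n" for n
      using Ext_mono[OF genF[OF that]] Ext_isum_lcomb[OF filt_ideal[OF F] filt_ideal[OF F]] by blast
    show "colen (Ext (F n)) \<noteq> \<infinity>" for n using fin[of n] by (simp add: colen_Ext filt_ideal[OF F])
  qed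
qed

text \<open>The generic element is the polynomial with coefficient list \<open>as\<close>. If it
  sends \<open>y\<close> into degree \<open>n + 1\<close>, then by \<open>mccoy_pow\<close> some
  power of each generator sends every coefficient of the numerator to the corresponding degree, and
  these coefficients are torsion.\<close>

lemma generic_tors:
  assumes st: "stage F G as c n0" and U: "filt U" and GU: "\<And>n. G n <= U n"
    and y: "lift (Poly as) * y \<in> Ext (U (Suc n))" and p: "lowmonic w" "emb w * ev y = emb p"
  shows "tors G U n (pc p i)"
proof -
  interpret stage F G as c n0 by fact
  have "emb w * ev (lift (Poly as) * y) = emb (Poly as * p)" by (simp only: ev_mult ev_lift emb_mult p(2)[symmetric] mult_ac)
  hence pin: "polyin (U (n + 1)) (Poly as ^ 1 * p)" using y Ext_iff[OF filt_ideal[OF U] p(1)] by simp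
  show ?thesis
  proof (rule tors_of_pow[OF U GU])
    fix a assume "a \<in> set as"
    then obtain N where "polyin (U (n + N)) ([:a ^ N:] * p)" using mccoy_pow[OF U _ pin] asG GU by blast
    hence "a ^ N * pc p i \<in> U (n + N)" by (simp add: polyin_def)
    thus "\<exists>N. a ^ N * pc p i \<in> U (n + N)" by blast
  qed
qed

lemma generic_Reg:
  assumes st: "stage F G as c n0" and U: "filt U" and GU: "\<And>n. G n <= U n" and x: "x \<in> G e" "0 < e" "Reg U x e"
  shows "Reg (\<lambda>n. Ext (U n)) (lift (Poly as)) 1"
  unfolding Reg_def
proof (intro allI impI)
  fix n y assume y: "lift (Poly as) * y \<in> Ext (U (n + 1))"
  obtain w p where *: "lowmonic w" "emb w * ev y = emb p" using frac by metis
  have "pc p i \<in> U n" for i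
    using generic_tors[OF st U GU _ *, of n i] y by (intro stage.tors_Reg[OF st _ x]) simp
  thus "y \<in> Ext (U n)" using Ext_iff[OF filt_ideal[OF U] *] by (simp add: polyin_def)
qed

text \<open>The regular element is given for \<open>G\<close>; for \<open>F\<close> the torsion is
  known to vanish in high degrees, and there the generic element cancels.\<close>

lemma generic_F:
  assumes st: "stage F G as c n0" and x: "x \<in> G e" "0 < e" "Reg G x e"
  shows "\<exists>n1. \<forall>n\<ge>n1. \<forall>y. lift (Poly as) * y \<in> Ext (F (Suc n)) --> y \<in> Ext (F n)"
proof -
  interpret stage F G as c n0 by fact
  obtain n1 where n1: "\<And>n h. n \<ge> n1 ==> tors G F n h ==> h \<in> F n" using tors_F_eventually[OF x] by blast
  have "y \<in> Ext (F n)" if "n \<ge> n1" "lift (Poly as) * y \<in> Ext (F (Suc n))" for n y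
  proof -
    obtain w p where *: "lowmonic w" "emb w * ev y = emb p" using frac by metis
    have "pc p i \<in> F n" for i using n1[OF that(1)] generic_tors[OF st F GF that(2) *] by blast
    thus ?thesis using Ext_iff[OF filt_ideal[OF F] *] by (simp add: polyin_def)
  qed
  thus ?thesis by blast
qed

lemma generic_mem: "stage F G as c n0 ==> lift (Poly as) \<in> Ext (G 1)"
proof -
  assume "stage F G as c n0"
  then interpret stage F G as c n0 .
  have "polyin (G 1) (Poly bs)" if "set bs <= G 1" for bs
    using that by (induction bs) (auto simp: polyin_pCons polyin_0 filt_ideal[OF G])
  thus ?thesis using asG by (simp add: Ext_lift filt_ideal[OF G])
qed

end

section \<open>Generic hyperplane sections\<close>

primrec fadjs :: "(nat => 'r::comm_ring_1 set) => ('r \<times> nat) list => nat => 'r set" where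
  "fadjs G [] = G"
| "fadjs G (p # ps) = fadjs (fadj G (fst p)) ps"

lemma filt_fadjs: "filt G ==> filt (fadjs G ps)"
  by (induction ps arbitrary: G) (auto intro: filt_fadj)
lemma fadjs_sub: "G n <= fadjs G ps n"
  by (induction ps arbitrary: G) (use fadj_sub in fastforce)+
lemma regs_append: "regs G (ps @ qs) \<longleftrightarrow> regs G ps \<and> regs (fadjs G ps) qs"
  by (induction ps arbitrary: G) auto
lemma fadjs_adjs: "fadjs G ps n = adjs (G n) (map fst ps)"
  by (induction ps arbitrary: G) (auto simp: fadj_def)

lemma stage_fadj:
  assumes "stage F G as c n0" shows "stage (fadj F b) (fadj G b) as c n0"
proof -
  interpret stage F G as c n0 by fact
  have gen: "fadj H b (Suc n) <= isum (lcomb as (fadj H b n)) (fadj H b (Suc (Suc n)))"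
    if H: "filt H" and sub: "H (Suc n) <= isum (lcomb as (H n)) (H (Suc (Suc n)))" for H n
  proof -
    let ?R = "isum (lcomb as (fadj H b n)) (fadj H b (Suc (Suc n)))"
    note idf = filt_ideal[OF filt_fadj[OF H]]
    have idR: "idealp ?R" by (intro idealp_isum idealp_lcomb idf)
    have "isum (lcomb as (H n)) (H (Suc (Suc n))) <= ?R" by (intro isum_mono lcomb_mono fadj_sub)
    hence 1: "H (Suc n) <= ?R" using sub by blast
    have "b \<in> fadj H b (Suc (Suc n))" unfolding fadj_def by (rule adj_self[OF filt_ideal[OF H]])
    hence "b \<in> ?R" using isum_subset2[OF idealp_lcomb[OF idf]] by blast
    thus ?thesis using 1 unfolding fadj_def[of H b "Suc n"] by (intro adj_least idR)
  qed
  show ?thesis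
  proof
    show "filt (fadj F b)" "filt (fadj G b)" using F G by (auto intro: filt_fadj)
    show "fadj G b n <= fadj F b n" for n unfolding fadj_def by (rule adj_mono[OF GF])
    show "fadj F b (n + c) <= fadj G b n" for n unfolding fadj_def by (rule adj_mono[OF FG])
    show "set as <= fadj G b 1" using asG fadj_sub by blast
    show "fadj G b (Suc n) <= isum (lcomb as (fadj G b n)) (fadj G b (Suc (Suc n)))" for n by (rule gen[OF G genG])
    show "fadj F b (Suc n) <= isum (lcomb as (fadj F b n)) (fadj F b (Suc (Suc n)))" if "n0 \<le> n" for n
      by (rule gen[OF F genF[OF that]])
    show "colen (fadj F b n) \<noteq> \<infinity>" for n
    proof -
      have "colen (fadj F b n) \<le> colen (F n)"
        by (rule colen_antimono[OF filt_ideal[OF F] filt_ideal[OF filt_fadj[OF F]] fadj_sub])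
      thus ?thesis using fin[of n] by (intro notI) simp
    qed
  qed
qed

section \<open>Linear forms in the indeterminate and elimination along a line\<close>

lemma polyin_linear:
  assumes B: "idealp B" and b: "\<And>f. b * f \<in> B ==> f \<in> A" and b': "\<And>f. f \<in> A ==> b' * f \<in> B"
    and p: "polyin B ([:b, b':] * p)"
  shows "polyin A p"
proof -
  have "pc p i \<in> A" for i
  proof (induction i)
    case 0
    have "pc ([:b, b':] * p) 0 = b * pc p 0" by simp
    thus ?case using p b unfolding polyin_def by metis
  next
    case (Suc i)
    have "pc ([:b, b':] * p) (Suc i) = b * pc p (Suc i) + b' * pc p i" by simp
    hence "b * pc p (Suc i) + b' * pc p i \<in> B" using p unfolding polyin_def by metis
    hence "b * pc p (Suc i) \<in> B" using idealp_diff[OF B _ b'[OF Suc]] by fastforce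
    thus ?case by (rule b)
  qed
  thus ?thesis by (simp add: polyin_def)
qed

text \<open>The value of the degree \<open>D\<close> homogenization of \<open>q\<close> at \<open>(a, e)\<close>.\<close>

definition th :: "'r::comm_ring_1 => 'r => nat => 'r poly => 'r" where
  "th a e D q = (\<Sum>i\<le>D. pc q i * a ^ i * e ^ (D - i))"

lemma th_add: "th a e D (p + q) = th a e D p + th a e D q"
  by (simp add: th_def distrib_right sum.distrib)
lemma th_0: "th a e D 0 = 0" by (simp add: th_def)
lemma th_smult: "th a e D (smult c q) = c * th a e D q"
  by (simp add: th_def sum_distrib_left mult.assoc)

lemma th_pCons: "th a e (Suc D) (pCons c q) = c * e ^ Suc D + a * th a e D q"
  unfolding th_def sum.atMost_Suc_shift by (simp add: sum_distrib_left mult_ac)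

lemma th_pad: "Polynomial.degree q \<le> D ==> th a e (D + k) q = e ^ k * th a e D q"
proof (induction k)
  case (Suc k)
  have "th a e (Suc (D + k)) q = e * th a e (D + k) q"
  proof -
    have "th a e (Suc (D + k)) q = (\<Sum>i\<le>D + k. pc q i * a ^ i * e ^ (Suc (D + k) - i))"
      unfolding th_def using Suc.prems by (simp add: coeff_eq_0)
    also have "\<dots> = (\<Sum>i\<le>D + k. e * (pc q i * a ^ i * e ^ (D + k - i)))"
      by (rule sum.cong) (auto simp: Suc_diff_le mult_ac)
    finally show ?thesis by (simp add: th_def sum_distrib_left)
  qed
  thus ?case using Suc by (simp add: mult_ac)
qed simp

lemma th_mult: "Polynomial.degree q \<le> D ==> Polynomial.degree r \<le> E ==> th a e (D + E) (q * r) = th a e D q * th a e E r"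
proof (induction q arbitrary: D)
  case 0 thus ?case by (simp add: th_0)
next
  case (pCons c q)
  have pad: "th a e (D + E) r = e ^ D * th a e E r" for D using th_pad[OF pCons.prems(2), of a e D] by (simp add: add.commute)
  have eq: "pCons c q * r = smult c r + pCons 0 (q * r)" by simp
  show ?case
  proof (cases "q = 0")
    case True
    hence "th a e D (pCons c q) = c * e ^ D"
      using th_pad[of "[:c:]" 0 a e D] by (simp add: th_def)
    thus ?thesis using True pad by (simp add: th_smult mult_ac)
  next
    case False
    then obtain D' where D': "D = Suc D'" "Polynomial.degree q \<le> D'" using pCons.prems(1) by (cases D) auto
    have "th a e (D + E) (pCons c q * r) = c * th a e (D + E) r + th a e (Suc (D' + E)) (pCons 0 (q * r))"
      unfolding eq th_add th_smult by (simp add: D')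
    also have "\<dots> = c * (e ^ D * th a e E r) + a * (th a e D' q * th a e E r)"
      unfolding pad th_pCons using pCons.IH[OF D'(2) pCons.prems(2)] by simp
    finally show ?thesis unfolding D' th_pCons by (simp add: algebra_simps)
  qed
qed

lemma th_pow: "Polynomial.degree q \<le> D ==> th a e (D * m) (q ^ m) = th a e D q ^ m"
proof (induction m)
  case 0 show ?case by (simp add: th_def)
next
  case (Suc m)
  have "Polynomial.degree (q ^ m) \<le> D * m"
    using degree_power_le[of q m] Suc.prems by (meson le_trans mult_le_mono1)
  hence "th a e (D + D * m) (q * q ^ m) = th a e D q * th a e (D * m) (q ^ m)" by (rule th_mult[OF Suc.prems])
  thus ?case using Suc by simp
qed

text \<open>Modulo the linear form \<open>b + e T\<close> the indeterminate equals
  \<open>- b / e\<close>; the factor \<open>e ^ D\<close> clears denominators and leaves the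
  constant \<open>th (- b) e D q\<close>.\<close>

lemma th_mod: "Polynomial.degree q \<le> D ==> \<exists>s. [:e ^ D:] * q = [:th (- b) e D q:] + [:b, e:] * s"
proof (induction q arbitrary: D)
  case 0 thus ?case by (intro exI[of _ 0]) (simp add: th_0)
next
  case (pCons c q)
  show ?case
  proof (cases "q = 0")
    case True
    hence "th (- b) e D (pCons c q) = c * e ^ D"
      using th_pad[of "[:c:]" 0 "- b" e D] by (simp add: th_def)
    thus ?thesis using True by (intro exI[of _ 0]) (simp add: mult.commute)
  next
    case False
    then obtain D' where D': "D = Suc D'" "Polynomial.degree q \<le> D'" using pCons.prems(1) by (cases D) auto
    obtain s where s: "[:e ^ D':] * q = [:th (- b) e D' q:] + [:b, e:] * s" using pCons.IH[OF D'(2)] by blast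
    have "[:e ^ D:] * pCons c q = [:c * e ^ D:] + [:0, e:] * ([:e ^ D':] * q)"
      by (simp add: D' mult_ac)
    also have "[:0, e:] = [:b, e:] - [:b:]" by simp
    also have "([:b, e:] - [:b:]) * ([:e ^ D':] * q) = [:b, e:] * ([:e ^ D':] * q) - [:b:] * ([:th (- b) e D' q:] + [:b, e:] * s)"
      unfolding left_diff_distrib using s by (simp only:)
    also have "[:c * e ^ D:] + ([:b, e:] * ([:e ^ D':] * q) - [:b:] * ([:th (- b) e D' q:] + [:b, e:] * s))
      = ([:c * e ^ D:] - [:b:] * [:th (- b) e D' q:]) + [:b, e:] * ([:e ^ D':] * q - [:b:] * s)" by (simp only: algebra_simps)
    also have "[:c * e ^ D:] - [:b:] * [:th (- b) e D' q:] = [:th (- b) e D (pCons c q):]"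
      by (simp add: D' th_pCons)
    finally show ?thesis by blast
  qed
qed

lemma th_in:
  assumes "filt F" "filt G" "\<And>n. G n <= F n" "a \<in> G 1" "e \<in> G 1" "polyin (F k) q"
  shows "th a e D q \<in> F (k + D)"
  unfolding th_def
proof (rule idealp_sum[OF filt_ideal[OF assms(1)]])
  fix i assume i: "i \<in> {..D}"
  have "a ^ i * e ^ (D - i) \<in> G (i * 1 + (D - i) * 1)" by (intro filt_mult[OF assms(2)] filt_pow[OF assms(2)] assms)
  hence "a ^ i * e ^ (D - i) \<in> F D" using i assms(3) by auto
  hence "pc q i * (a ^ i * e ^ (D - i)) \<in> F (k + D)" using assms(6) by (intro filt_mult[OF assms(1)]) (auto simp: polyin_def)
  thus "pc q i * a ^ i * e ^ (D - i) \<in> F (k + D)" by (simp add: mult.assoc)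
qed

text \<open>The substitution turns the power of the indeterminate into a power of
  \<open>- b\<close>, and a factor with constant term 1 into a power of \<open>e\<close> plus a
  multiple of \<open>b\<close>, which is regular by \<open>Reg_monic\<close>. So denominators remain
  cancellable after the indeterminate is eliminated.\<close>

lemma th_lowmonic_Reg:
  assumes G: "filt G" and b: "b \<in> G 1" "Reg G b 1" and e: "e \<in> G 1" "Reg (fadj G b) e 1"
    and v: "lowmonic v"
  shows "\<exists>D. Polynomial.degree v \<le> D \<and> Reg G (th (- b) e D v) D"
proof -
  obtain k u where u: "pc u 0 = 1" "v = [:0, 1:] ^ k * u" using v unfolding lowmonic_def by blast
  obtain q where q: "u = pCons 1 q" using u(1) by (metis coeff_pCons_0 pCons_cases)
  define d where "d = Suc (Polynomial.degree q)"
  have du: "Polynomial.degree u \<le> d" using q degree_pCons_le[of 1 q] by (simp add: d_def)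
  have 1: "th (- b) e d u = e ^ d + b * (- th (- b) e (Polynomial.degree q) q)" by (simp add: q d_def th_pCons)
  have uG: "th (- b) e d u \<in> G d"
    using th_in[OF G G order_refl _ e(1), of "- b" 0 u d] idealp_neg[OF filt_ideal[OF G] b(1)] by (simp add: polyin_def filt_0[OF G])
  have Ru: "Reg G (th (- b) e d u) d"
    using Reg_monic[OF G b(1) _ b(2) e, of d "- th (- b) e (Polynomial.degree q) q"] uG unfolding 1 by simp
  have "th (- b) e (1 * k) ([:0, 1:] ^ k) = th (- b) e 1 [:0, 1:] ^ k" by (rule th_pow) simp
  moreover have "th (- b) e 1 [:0, 1:] = - b" by (simp add: th_def)
  ultimately have 2: "th (- b) e k ([:0, 1:] ^ k) = (- b) ^ k" by simp
  have dk: "Polynomial.degree ([:0, 1:] ^ k :: 'a poly) \<le> k" using degree_power_le[of "[:0, 1:] :: 'a poly" k]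
    by (metis degree_pCons_le degree_0 le_trans mult_1 mult_le_mono1 One_nat_def degree_pCons_eq_if not_one_le_zero nle_le)
  have "th (- b) e (k + d) v = (- b) ^ k * th (- b) e d u" unfolding u(2) th_mult[OF dk du] 2 ..
  moreover have "Reg G ((- b) ^ k * th (- b) e d u) (k + d)"
    unfolding Reg_def
  proof (intro allI impI)
    fix n f assume "(- b) ^ k * th (- b) e d u * f \<in> G (n + (k + d))"
    hence "(-1) ^ k * ((- b) ^ k * th (- b) e d u * f) \<in> G (n + (k + d))" by (rule idealp_mult[OF filt_ideal[OF G]])
    moreover have "(-1) ^ k * ((- b) ^ k * th (- b) e d u * f) = b ^ k * (th (- b) e d u * f)"
      by (simp add: mult.assoc[symmetric] power_mult_distrib[symmetric])
    ultimately have "b ^ k * (th (- b) e d u * f) \<in> G ((n + d) + k * 1)" by (simp add: add_ac)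
    hence "th (- b) e d u * f \<in> G (n + d)" by (rule RegD[OF Reg_pow[OF b(2)]])
    thus "f \<in> G n" by (rule RegD[OF Ru])
  qed
  moreover have "Polynomial.degree v \<le> k + d"
    unfolding u(2) using degree_mult_le[of "[:0, 1:] ^ k" u] dk du by linarith
  ultimately show ?thesis by metis
qed

text \<open>Regularity along \<open>G\<close> passes to \<open>F\<close> beyond \<open>n1\<close>,
  because there the asymptotic order along \<open>G\<close> decides membership in
  \<open>F n\<close>.\<close>

lemma (in stage) cancel_eventually:
  assumes cl: "closedf F n1" and b: "Reg G b 1" and n: "n1 < n" and f: "b * f \<in> F (Suc n)"
  shows "f \<in> F n"
proof (rule closed_wge[OF cl n])
  have "wge G (b * f) (real (Suc n))" by (rule wgeF[OF f])
  hence "wge G (b * f) (real n + real 1)" by (simp add: add.commute)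
  thus "wge G f (real n)" by (rule wge_Reg[OF G b])
qed

context gext
begin

lemma Ext_adj_lift_iff:
  assumes "idealp U" "lowmonic w" "emb w * ev y = emb p"
  shows "y \<in> adj (Ext U) (lift l) \<longleftrightarrow> (\<exists>v s. lowmonic v \<and> polyin U (v * p - s * l))"
proof
  assume "y \<in> adj (Ext U) (lift l)"
  then obtain d where d: "y - d * lift l \<in> Ext U" by (auto simp: adj_iff)
  obtain v q where v: "lowmonic v" "emb v * ev d = emb q" using frac by metis
  have "emb (v * w) * ev (y - d * lift l) = emb v * (emb w * ev y) - emb w * (emb v * ev d) * emb l"
    by (simp only: emb_mult ev_diff ev_mult ev_lift right_diff_distrib mult_ac)
  also have "\<dots> = emb (v * p - w * q * l)" by (simp only: assms(3) v(2) emb_diff emb_mult)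
  finally have "polyin U (v * p - w * q * l)" using d Ext_iff[OF assms(1) lowmonic_mult[OF v(1) assms(2)]] by blast
  thus "\<exists>v s. lowmonic v \<and> polyin U (v * p - s * l)" using v(1) by blast
next
  assume "\<exists>v s. lowmonic v \<and> polyin U (v * p - s * l)"
  then obtain v s where v: "lowmonic v" "polyin U (v * p - s * l)" by blast
  obtain z where z: "ev z * emb (v * w) = 1" using unit[OF lowmonic_mult[OF v(1) assms(2)]] by blast
  have "emb (v * w) * ev (y - (z * lift s) * lift l) = emb v * (emb w * ev y) - (ev z * emb (v * w)) * (emb s * emb l)"
    by (simp only: emb_mult ev_diff ev_mult ev_lift right_diff_distrib mult_ac)
  also have "\<dots> = emb (v * p - s * l)" by (simp only: z assms(3) emb_diff mult_1) (simp only: emb_mult)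
  finally have "y - (z * lift s) * lift l \<in> Ext U" using v(2) Ext_iff[OF assms(1) lowmonic_mult[OF v(1) assms(2)]] by blast
  thus "y \<in> adj (Ext U) (lift l)" by (auto simp: adj_iff)
qed

text \<open>After clearing denominators, \<open>b'\<close> times the numerator is \<open>s\<close>
  times the linear form up to \<open>F (Suc n)\<close>. Modulo \<open>b'\<close> this says that
  \<open>b * s\<close> vanishes to that order, so \<open>s\<close> is a multiple of
  \<open>b'\<close> up to \<open>F n\<close> by the assumption \<open>S\<close>, and
  \<open>b'\<close> can be cancelled from the whole relation.\<close>

lemma line_saturated:
  assumes st: "stage F G as c n0" and cl: "closedf F n1" and b: "b \<in> G 1" and b': "b' \<in> G 1" "Reg G b' 1"
    and S: "\<And>n f. n \<ge> n3 ==> b * f \<in> adj (F (Suc n)) b' ==> f \<in> adj (F n) b'"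
    and n: "n1 < n" "n3 \<le> n" and y: "iota b' * y \<in> adj (Ext (F (Suc n))) (lift [:b, b':])"
  shows "y \<in> adj (Ext (F n)) (lift [:b, b':])"
proof -
  interpret stage F G as c n0 by fact
  note idF = filt_ideal[OF F]
  obtain w p where w: "lowmonic w" "emb w * ev y = emb p" using frac by metis
  have "emb w * ev (iota b' * y) = emb ([:b':] * p)" by (simp only: ev_mult ev_iota emb_mult w(2)[symmetric] mult_ac)
  then obtain v s where v: "lowmonic v" "polyin (F (Suc n)) (v * ([:b':] * p) - s * [:b, b':])"
    using y Ext_adj_lift_iff[OF idF w(1)] by blast
  let ?q = "v * p" and ?\<phi> = "v * ([:b':] * p) - s * [:b, b':]"
  have xs: "[:b, b':] = [:b:] + [:b':] * [:0, 1:]" by simp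
  have bF: "b \<in> F 1" "b' \<in> F 1" using b b' GF by auto
  have bs: "[:b:] * s = [:b':] * (?q - [:0, 1:] * s) - ?\<phi>"
    unfolding xs by (simp only: algebra_simps)
  have "polyin (adj (F n) b') s"
    unfolding polyin_def
  proof
    fix i
    have "b * pc s i = b' * pc (?q - [:0, 1:] * s) i - pc ?\<phi> i"
    proof -
      have cm: "pc ([:c:] * q) i = c * pc q i" for c :: 'r and q by simp
      have "pc ([:b:] * s) i = pc ([:b':] * (?q - [:0, 1:] * s) - ?\<phi>) i" using bs by (simp only:)
      thus ?thesis by (simp only: cm coeff_diff)
    qed
    hence "b * pc s i = - pc ?\<phi> i + pc (?q - [:0, 1:] * s) i * b'" by (simp only: mult.commute[of b'] diff_conv_add_uminus add.commute)
    moreover have "- pc ?\<phi> i \<in> F (Suc n)" using v(2) idealp_neg[OF idF] unfolding polyin_def by blast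
    ultimately have "b * pc s i \<in> adj (F (Suc n)) b'" using adjI by metis
    thus "pc s i \<in> adj (F n) b'" by (rule S[OF n(2)])
  qed
  then obtain t where t: "polyin (F n) (s - [:b':] * t)" using polyin_adj_split[OF idF] by blast
  let ?\<psi> = "s - [:b':] * t"
  have "polyin (F (Suc n)) (?\<phi> + [:b:] * ?\<psi>)"
    using v(2) t filt_mult[OF F bF(1), of _ n] by (intro polyin_add idF polyin_smult[of "F n"]) auto
  moreover have "?\<phi> + [:b:] * ?\<psi> = [:b':] * (?q - [:0, 1:] * s - [:b:] * t)"
    unfolding xs by (simp only: algebra_simps)
  ultimately have "polyin (F (Suc n)) ([:b':] * (?q - [:0, 1:] * s - [:b:] * t))" by simp
  hence "polyin (F n) (?q - [:0, 1:] * s - [:b:] * t)"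
    using cancel_eventually[OF cl b'(2) n(1)] by (simp add: polyin_def)
  hence "polyin (F n) ((?q - [:0, 1:] * s - [:b:] * t) + [:0, 1:] * ?\<psi>)"
    using t by (intro polyin_add polyin_mult idF)
  moreover have "(?q - [:0, 1:] * s - [:b:] * t) + [:0, 1:] * ?\<psi> = v * p - t * [:b, b':]"
    unfolding xs by (simp only: algebra_simps)
  ultimately show ?thesis using Ext_adj_lift_iff[OF idF w] v(1) by metis
qed

text \<open>Substituting \<open>- b / b'\<close> for the indeterminate kills the linear form. The
  hypothesis on powers of \<open>y\<close> becomes one on powers of a single element
  \<open>t\<close> of the base ring, and closedness of \<open>F\<close> puts \<open>t\<close> into
  degree \<open>n + D\<close>. Conversely \<open>b' ^ D\<close> times the numerator equals
  \<open>t\<close> modulo the form, and the factors \<open>b'\<close> are removed by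
  \<open>line_saturated\<close>. The elimination depends on linearity of the form.\<close>

lemma line_closed:
  assumes st: "stage F G as c n0" and cl: "closedf F n1"
    and b: "b \<in> G 1" "Reg G b 1" and b': "b' \<in> G 1" "Reg G b' 1" "Reg (fadj G b) b' 1"
    and S: "\<And>n f. n \<ge> n3 ==> b * f \<in> adj (F (Suc n)) b' ==> f \<in> adj (F n) b'"
  shows "closedf (fadj (\<lambda>n. Ext (F n)) (lift [:b, b':])) (Suc (max n1 n3))"
  unfolding closedf_def
proof (intro allI impI)
  interpret stage F G as c n0 by fact
  note idF = filt_ideal[OF F]
  let ?l = "[:b, b':]"
  fix n y C assume n: "Suc (max n1 n3) \<le> n" and y: "\<forall>m. y ^ m \<in> fadj (\<lambda>n. Ext (F n)) (lift ?l) (n * m - C)"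
  obtain w p where w: "lowmonic w" "emb w * ev y = emb p" using frac by metis
  define D where "D = Polynomial.degree p"
  define t where "t = th (- b) b' D p"
  have nb: "- b \<in> G 1" by (rule idealp_neg[OF filt_ideal[OF G] b(1)])
  have tm: "t ^ m \<in> F ((n + D) * m - (C + c))" for m
  proof -
    have "emb (w ^ m) * ev (y ^ m) = emb (p ^ m)" by (simp only: emb_pow ev_pow power_mult_distrib[symmetric] w(2))
    then obtain v s where v: "lowmonic v" "polyin (F (n * m - C)) (v * p ^ m - s * ?l)"
      using y Ext_adj_lift_iff[OF idF lowmonic_pow[OF w(1)]] unfolding fadj_def by metis
    obtain dv where dv: "Polynomial.degree v \<le> dv" "Reg G (th (- b) b' dv v) dv"
      using th_lowmonic_Reg[OF G b b'(1,3) v(1)] by blast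
    \<comment> \<open>A common homogenization degree: it accommodates the denominator
      \<open>v\<close>, the power \<open>p ^ m\<close>, and the product of \<open>s\<close> with the
      linear form, which adds one to the degree of \<open>s\<close>.\<close>
    define E where "E = dv + D * m + Suc (Polynomial.degree s)"
    have Dm: "Polynomial.degree (p ^ m) \<le> D * m" using degree_power_le[of p m] by (simp add: D_def)
    have "th (- b) b' E (v * p ^ m - s * ?l) \<in> F ((n * m - C) + E)"
      by (rule th_in[OF F G GF nb b'(1) v(2)])
    moreover have "th (- b) b' E (s * ?l) = 0"
    proof -
      define a where "a = dv + D * m + Polynomial.degree s"
      have "th (- b) b' (a + 1) (s * ?l) = th (- b) b' a s * th (- b) b' 1 ?l"
        by (rule th_mult) (auto simp: a_def)
      moreover have "th (- b) b' 1 ?l = 0" by (simp add: th_def)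
      moreover have "E = a + 1" by (simp add: E_def a_def)
      ultimately show ?thesis by simp
    qed
    moreover have "th (- b) b' E (v * p ^ m) = b' ^ Suc (Polynomial.degree s) * (th (- b) b' dv v * t ^ m)"
    proof -
      have "Polynomial.degree (v * p ^ m) \<le> dv + D * m" using degree_mult_le[of v "p ^ m"] dv Dm by linarith
      hence "th (- b) b' E (v * p ^ m) = b' ^ Suc (Polynomial.degree s) * th (- b) b' (dv + D * m) (v * p ^ m)"
        unfolding E_def by (rule th_pad)
      also have "th (- b) b' (dv + D * m) (v * p ^ m) = th (- b) b' dv v * t ^ m"
        unfolding th_mult[OF dv(1) Dm] t_def by (subst th_pow) (simp_all add: D_def)
      finally show ?thesis .
    qed
    moreover have "th (- b) b' E (v * p ^ m) = th (- b) b' E (v * p ^ m - s * ?l) + th (- b) b' E (s * ?l)"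
      by (simp add: th_add[symmetric])
    ultimately have *: "b' ^ Suc (Polynomial.degree s) * (th (- b) b' dv v * t ^ m) \<in> F ((n * m - C) + E)" by simp
    \<comment> \<open>The regular factors cancel along \<open>G\<close>; the passage from
      \<open>F\<close> to \<open>G\<close> costs \<open>c\<close>, which is added to the constant
      \<open>C\<close>.\<close>
    have tG: "t ^ m \<in> G ((n + D) * m - (C + c))"
    proof (cases "C + c \<le> (n + D) * m")
      case False thus ?thesis using filt_0[OF G] by simp
    next
      case True
      define k where "k = (n + D) * m - (C + c)"
      have km: "k + (C + c) = n * m + D * m" using True by (simp add: k_def add_mult_distrib)
      have "k + dv + Suc (Polynomial.degree s) * 1 + c \<le> (n * m - C) + E" using km by (simp add: E_def)
      hence "b' ^ Suc (Polynomial.degree s) * (th (- b) b' dv v * t ^ m) \<in> F (k + dv + Suc (Polynomial.degree s) * 1 + c)"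
        by (rule filt_down[OF F *])
      hence "b' ^ Suc (Polynomial.degree s) * (th (- b) b' dv v * t ^ m) \<in> G (k + dv + Suc (Polynomial.degree s) * 1)"
        using FG by blast
      hence "th (- b) b' dv v * t ^ m \<in> G (k + dv)" by (rule RegD[OF Reg_pow[OF b'(2)]])
      thus ?thesis unfolding k_def by (rule RegD[OF dv(2)])
    qed
    thus ?thesis using GF by blast
  qed
  have t: "t \<in> F (n + D)" 
  proof -
    have "n1 \<le> n + D" using n by simp
    thus ?thesis using cl tm unfolding closedf_def by blast
  qed
  obtain s where s: "[:b' ^ D:] * p = [:t:] + ?l * s" using th_mod[of p D b' b] by (auto simp: t_def D_def)
  have "emb w * ev (iota b' ^ D * y) = emb ([:b' ^ D:] * p)"
    by (simp only: ev_mult ev_pow ev_iota emb_mult w(2)[symmetric] emb_pow[symmetric] poly_const_pow mult_ac)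
  moreover have "polyin (F (n + D)) (1 * ([:b' ^ D:] * p) - s * ?l)"
  proof -
    have "1 * ([:b' ^ D:] * p) - s * ?l = [:t:]" unfolding s by (simp only: mult_1 mult.commute[of s]) simp
    thus ?thesis using polyin_const[OF idF t] by simp
  qed
  ultimately have "iota b' ^ D * y \<in> adj (Ext (F (n + D))) (lift ?l)"
    using Ext_adj_lift_iff[OF idF w(1)] lowmonic_1 by blast
  moreover have "iota b' ^ k * y \<in> adj (Ext (F (n + k))) (lift ?l) ==> y \<in> adj (Ext (F n)) (lift ?l)" for k
  proof (induction k)
    case (Suc k)
    have "iota b' * (iota b' ^ k * y) \<in> adj (Ext (F (Suc (n + k)))) (lift ?l)" using Suc.prems by (simp add: mult.assoc)
    hence "iota b' ^ k * y \<in> adj (Ext (F (n + k))) (lift ?l)"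
    proof (rule line_saturated[OF st cl b(1) b'(1,2), where ?n3.0 = n3, rotated 3])
      show "b * f \<in> adj (F (Suc n)) b' ==> f \<in> adj (F n) b'" if "n3 \<le> n" for n f using S[OF that] .
    qed (use n in auto)
    thus ?case by (rule Suc.IH)
  qed simp
  ultimately show "y \<in> fadj (\<lambda>n. Ext (F n)) (lift ?l) n" by (simp add: fadj_def)
qed

lemma Reg_line:
  assumes "filt U" "Reg U b 1" "b' \<in> U 1" shows "Reg (\<lambda>n. Ext (U n)) (lift [:b, b':]) 1"
  unfolding Reg_def
proof (intro allI impI)
  fix n y assume y: "lift [:b, b':] * y \<in> Ext (U (n + 1))"
  obtain w p where w: "lowmonic w" "emb w * ev y = emb p" using frac by metis
  have "emb w * ev (lift [:b, b':] * y) = emb ([:b, b':] * p)" by (simp only: ev_mult ev_lift emb_mult w(2)[symmetric] mult_ac)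
  hence "polyin (U (n + 1)) ([:b, b':] * p)" using y Ext_iff[OF filt_ideal[OF assms(1)] w(1)] by blast
  hence "polyin (U n) p"
  proof (rule polyin_linear[OF filt_ideal[OF assms(1)], rotated 2])
    show "f \<in> U n" if "b * f \<in> U (n + 1)" for f by (rule RegD[OF assms(2) that])
    show "b' * f \<in> U (n + 1)" if "f \<in> U n" for f using filt_mult[OF assms(1,3) that] by simp
  qed
  thus "y \<in> Ext (U n)" using Ext_iff[OF filt_ideal[OF assms(1)] w] by blast
qed

lemma line_cancel:
  assumes st: "stage F G as c n0" and cl: "closedf F n1" and b: "Reg G b 1" and b': "b' \<in> G 1"
    and n: "n1 < n" and y: "lift [:b, b':] * y \<in> Ext (F (Suc n))"
  shows "y \<in> Ext (F n)"
proof -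
  interpret stage F G as c n0 by fact
  obtain w p where w: "lowmonic w" "emb w * ev y = emb p" using frac by metis
  have "emb w * ev (lift [:b, b':] * y) = emb ([:b, b':] * p)" by (simp only: ev_mult ev_lift emb_mult w(2)[symmetric] mult_ac)
  hence "polyin (F (Suc n)) ([:b, b':] * p)" using y Ext_iff[OF filt_ideal[OF F] w(1)] by blast
  moreover have "b' \<in> F 1" using b' GF by blast
  hence "b' * f \<in> F (Suc n)" if "f \<in> F n" for f using filt_mult[OF F _ that, of b' 1] by simp
  ultimately have "polyin (F n) p"
    using cancel_eventually[OF cl b n] by (rule_tac polyin_linear[OF filt_ideal[OF F], rotated 2]) blast+
  thus "y \<in> Ext (F n)" using Ext_iff[OF filt_ideal[OF F] w] by blast
qed

lemma Ext_fadjs: "filt G ==> (\<lambda>n. Ext (fadjs G ps n)) = fadjs (\<lambda>n. Ext (G n)) (iotas ps)"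
proof (induction ps arbitrary: G)
  case (Cons p ps)
  show ?case using Cons.IH[OF filt_fadj[OF Cons.prems], of "fst p"] by (simp add: Ext_fadj[OF Cons.prems])
qed simp

end

section \<open>Hilbert functions and their differences\<close>

definition hl :: "(nat => 'r::comm_ring_1 set) => nat => int" where
  "hl F n = int (the_enat (colen (F n)))"

definition dl :: "(nat => int) => nat => int" where "dl f n = f (Suc n) - f n"

definition ev_const :: "(nat => int) => int => bool" where
  "ev_const f k \<longleftrightarrow> (\<exists>N. \<forall>n\<ge>N. f n = k)"

lemma hl_nonneg: "0 \<le> hl F n" by (simp add: hl_def)

lemma hl_mono:
  assumes "filt F" "colen (F n) \<noteq> \<infinity>" "m \<le> n" shows "hl F m \<le> hl F n"
proof -
  have "colen (F m) \<le> colen (F n)"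
    by (rule colen_antimono[OF filt_ideal filt_ideal filt_antimono]) (use assms in auto)
  thus ?thesis using assms(2) by (cases "colen (F n)"; cases "colen (F m)") (auto simp: hl_def)
qed

lemma fadj_fin: "filt F ==> colen (F n) \<noteq> \<infinity> ==> colen (fadj F b n) \<noteq> \<infinity>"
  using colen_antimono[OF filt_ideal[of F n] idealp_adj adj_subset, of b, OF _ filt_ideal[of F n]]
  by (intro notI) (simp add: fadj_def)

text \<open>Only the colon ideal in this one degree enters, so the identity is available for
  \<open>F\<close> in high degrees, where cancellation holds.\<close>

lemma hl_Reg_step:
  assumes F: "filt F" and fin: "colen (F (n + e)) \<noteq> \<infinity>" and b: "b \<in> F e" and R: "\<And>y. b * y \<in> F (n + e) ==> y \<in> F n"
  shows "hl F (n + e) - hl F n = hl (fadj F b) (n + e)"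
proof -
  have "colon (F (n + e)) b = F n"
    using R filt_mult[OF F _ b, of _ n] unfolding colon_def by (auto simp: mult.commute)
  hence "colen (F (n + e)) = colen (F n) + colen (fadj F b (n + e))"
    using colen_adj[OF filt_ideal[OF F], of "n + e" b] by (simp add: fadj_def)
  thus ?thesis using fin by (cases "colen (F n)"; cases "colen (fadj F b (n + e))") (auto simp: hl_def)
qed

lemma dl_shift: "(dl ^^ d) (\<lambda>n. f (n + k)) n = (dl ^^ d) f (n + k)"
  by (induction d arbitrary: n) (auto simp: dl_def)

lemma dl_cong: "(\<And>n. N \<le> n ==> f n = g n) ==> N \<le> n ==> (dl ^^ d) f n = (dl ^^ d) g n"
  by (induction d arbitrary: n) (auto simp: dl_def)

lemma dl_Suc: "(dl ^^ Suc d) f = (dl ^^ d) (dl f)" by (simp add: funpow_swap1)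

lemma binomial_growth:
  "(\<And>j n. j < d ==> 0 \<le> (dl ^^ j) f n) ==> (\<And>n. n1 \<le> n ==> B \<le> (dl ^^ d) f n) ==> 0 \<le> B ==>
    B * int (k choose d) \<le> f (n1 + k)"
proof (induction d arbitrary: f k)
  case (Suc d)
  note IH = Suc.IH and prems = Suc.prems
  show ?case
  proof (induction k)
    case 0 thus ?case using prems(1)[of 0 n1] by simp
  next
    case (Suc k)
    have "B * int (k choose d) \<le> dl f (n1 + k)"
    proof (rule IH)
      show "0 \<le> (dl ^^ j) (dl f) n" if "j < d" for j n using prems(1)[of "Suc j" n] that by (simp add: dl_Suc del: funpow.simps)
      show "B \<le> (dl ^^ d) (dl f) n" if "n1 \<le> n" for n using prems(2)[OF that] by (simp add: dl_Suc del: funpow.simps)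
    qed (rule prems)
    thus ?case using Suc.IH by (simp add: dl_def algebra_simps)
  qed
qed simp

text \<open>With nonnegative lower differences and a \<open>d\<close>-th difference at least
  \<open>B\<close> from \<open>n1\<close> on, the function grows like \<open>B\<close> times a
  binomial coefficient of order \<open>d\<close>. The bound of the same order on \<open>f\<close>
  limits \<open>B\<close>.\<close>

lemma growth_bounded:
  fixes f :: "nat => int"
  assumes nn: "\<And>j n. j < d ==> 0 \<le> (dl ^^ j) f n" and mono: "\<And>m n. m \<le> n ==> (dl ^^ d) f m \<le> (dl ^^ d) f n"
    and gr: "\<And>n. f n \<le> C * int (Suc n) ^ d" and C: "0 \<le> C"
  shows "(dl ^^ d) f n1 \<le> C * 2 ^ d * int d ^ d"
proof (cases "0 \<le> (dl ^^ d) f n1")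
  case False
  moreover have "0 \<le> C * 2 ^ d * int d ^ d" using C by simp
  ultimately show ?thesis by linarith
next
  case True
  define B where "B = (dl ^^ d) f n1"
  \<comment> \<open>Large enough for \<open>Suc (n1 + k)\<close> to be at most \<open>2 * k\<close>,
    the source of the factor \<open>2 ^ d\<close>, and for the binomial coefficient to be at least
    \<open>(k / d) ^ d\<close>.\<close>
  define k where "k = n1 + d + 1"
  have k: "Suc (n1 + k) \<le> 2 * k" "d \<le> k" "0 < k" by (auto simp: k_def)
  have i: "B * int (k choose d) \<le> f (n1 + k)"
    by (rule binomial_growth[OF nn]) (use mono True in \<open>auto simp: B_def\<close>)
  have ii: "C * int (Suc (n1 + k)) ^ d \<le> C * int (2 * k) ^ d" using k C by (intro mult_left_mono power_mono) auto
  have "B * int (k choose d) \<le> C * int (2 * k) ^ d" using i gr[of "n1 + k"] ii by linarith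
  hence "real_of_int (B * int (k choose d)) \<le> real_of_int (C * int (2 * k) ^ d)" by (simp only: of_int_le_iff)
  hence 1: "real_of_int B * real (k choose d) \<le> real_of_int C * (2 * real k) ^ d" by simp
  have "(real k / real d) ^ d \<le> real (k choose d)" by (rule binomial_ge_n_over_k_pow_k[OF k(2)])
  hence "real_of_int B * (real k / real d) ^ d \<le> real_of_int B * real (k choose d)"
    using True by (intro mult_left_mono) (auto simp: B_def)
  with 1 have "real_of_int B * (real k ^ d / real d ^ d) \<le> real_of_int C * 2 ^ d * real k ^ d"
    by (simp add: power_divide power_mult_distrib mult.assoc)
  moreover have "0 < real d ^ d" by (cases d) auto
  ultimately have "real_of_int B * real k ^ d \<le> (real_of_int C * 2 ^ d * real d ^ d) * real k ^ d"
    by (simp add: field_simps)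
  hence "real_of_int B \<le> real_of_int C * 2 ^ d * real d ^ d" using k(3) by simp
  hence "real_of_int B \<le> real_of_int (C * 2 ^ d * int d ^ d)" by simp
  thus ?thesis unfolding B_def by (simp only: of_int_le_iff)
qed

lemma mono_bounded_ev_const:
  fixes f :: "nat => int"
  assumes "\<And>m n. m \<le> n ==> f m \<le> f n" "\<And>n. f n \<le> B"
  shows "\<exists>k. ev_const f k"
proof -
  have "\<exists>m. \<forall>y. (\<exists>n. y = n) --> nat (B - f m) \<le> nat (B - f y)"
    using ex_has_least_nat[of "\<lambda>n. True" 0 "\<lambda>n. nat (B - f n)"] by blast
  then obtain m where m: "\<And>y. nat (B - f m) \<le> nat (B - f y)" by blast
  have "f n = f m" if "m \<le> n" for n using assms(1)[OF that] assms(2)[of n] assms(2)[of m] m[of n] by linarith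
  thus ?thesis unfolding ev_const_def by blast
qed

lemma (in stage) hl_FG: "hl F n \<le> hl G n" "hl G n \<le> hl F (n + c)"
proof -
  have "colen (F n) \<le> colen (G n)" "colen (G n) \<le> colen (F (n + c))"
    using colen_antimono[OF filt_ideal[OF G] filt_ideal[OF F] GF] colen_antimono[OF filt_ideal[OF F] filt_ideal[OF G] FG] by auto
  thus "hl F n \<le> hl G n" "hl G n \<le> hl F (n + c)"
    using fin[of n] fin[of "n + c"] finG[of n] by (auto simp: hl_def)
qed

text \<open>Dividing by a regular element of degree \<open>e\<close> lowers the order of the
  constant difference by one and multiplies the constant by \<open>e\<close>, since
  \<open>hl G (n + e) - hl G n\<close> is a sum of \<open>e\<close> consecutive differences. At the
  end the Hilbert function itself is eventually constant.\<close>

lemma regs_fadjs_ev_const: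
  assumes "filt G" "\<And>n. colen (G n) \<noteq> \<infinity>" "in_filt G ps" "regs G ps" "ev_const ((dl ^^ length ps) (hl G)) k"
  shows "\<exists>k. ev_const (hl (fadjs G ps)) k"
  using assms
proof (induction ps arbitrary: G k)
  case Nil thus ?case by auto
next
  case (Cons p ps)
  obtain x e where p: "p = (x, e)" by force
  let ?G = "fadj G x"
  obtain N where N: "\<And>n. N \<le> n ==> (dl ^^ Suc (length ps)) (hl G) n = k" using Cons.prems(5) by (auto simp: ev_const_def)
  have st: "hl ?G (n + e) = hl G (n + e) - hl G n" for n
    by (rule hl_Reg_step[symmetric]) (use Cons.prems p in \<open>auto simp: Reg_def\<close>)
  have step: "(dl ^^ length ps) (hl ?G) (n + e) = (dl ^^ length ps) (hl G) (n + e) - (dl ^^ length ps) (hl G) n" for n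
  proof -
    have "(dl ^^ d) (\<lambda>n. hl ?G (n + e)) n = (dl ^^ d) (hl G) (n + e) - (dl ^^ d) (hl G) n" for d n
    proof (induction d arbitrary: n)
      case 0 thus ?case by (simp add: st)
    next
      case (Suc d)
      show ?case by (simp add: dl_def[of "(dl ^^ d) _"] Suc)
    qed
    thus ?thesis using dl_shift by simp
  qed
  have tel: "(dl ^^ length ps) (hl G) (n + j) - (dl ^^ length ps) (hl G) n = int j * k" if "N \<le> n" for n j
  proof (induction j)
    case (Suc j)
    have "(dl ^^ length ps) (hl G) (Suc (n + j)) - (dl ^^ length ps) (hl G) (n + j) = k"
      using N[of "n + j"] that by (simp add: dl_def)
    thus ?case using Suc by (simp add: algebra_simps)
  qed simp
  have "(dl ^^ length ps) (hl ?G) n = int e * k" if "N + e \<le> n" for n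
    using step[of "n - e"] tel[of "n - e" e] that by simp
  hence ec: "ev_const ((dl ^^ length ps) (hl ?G)) (int e * k)" unfolding ev_const_def by blast
  show ?case using Cons.IH[OF filt_fadj _ _ _ ec] Cons.prems p
    by (simp add: in_filt_fadj fadj_fin)
qed

lemma (in stage) three_step_inequality:
  assumes cl: "closedf F n1" and ps: "in_filt G ps" "regs G ps" "length ps = 3"
    and ec: "ev_const ((dl ^^ 3) (hl G)) k"
  shows "\<exists>r\<ge>R. hl F (3 * r) - 3 * hl F (2 * r) + 3 * hl F r \<le> hl G (3 * r) - 3 * hl G (2 * r) + 3 * hl G r"
proof -
  \<comment> \<open>Powers bring the three elements to a common degree \<open>r\<close>, a multiple
    of all their degrees; the factor \<open>R + n1 + 1\<close> makes \<open>r\<close> larger than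
    \<open>n1\<close> and at least \<open>R\<close>.\<close>
  define P where "P = (\<Prod>p\<leftarrow>ps. snd p)"
  define r where "r = (R + n1 + 1) * P"
  define k' where "k' p = (R + n1 + 1) * (P div snd p)" for p :: "'r \<times> nat"
  have pos: "0 < snd p" if "p \<in> set ps" for p using ps(1) that by (auto simp: in_filt_def)
  have dvd: "snd p dvd P" if "p \<in> set ps" for p
    using that unfolding P_def by (induction ps) auto
  have Pp: "0 < P" unfolding P_def using pos by (induction ps) auto
  have kr: "k' p * snd p = r" "0 < k' p" if "p \<in> set ps" for p
  proof -
    show *: "k' p * snd p = r" using dvd[OF that] by (simp only: k'_def r_def mult.assoc dvd_div_mult_self)
    have "0 < r" using Pp by (simp add: r_def)
    thus "0 < k' p" using * by (cases "k' p") auto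
  qed
  define qs where "qs = map (\<lambda>p. (fst p ^ k' p, k' p * snd p)) ps"
  have q: "regs G qs" "in_filt G qs" "length qs = 3"
    using regs_pow[OF G ps(1,2) kr(2)] in_filt_pow[OF G ps(1) kr(2)] ps(3) by (auto simp: qs_def)
  have sr: "snd p = r" if "p \<in> set qs" for p using that kr by (auto simp: qs_def)
  obtain p1 p2 p3 where "qs = [p1, p2, p3]" using q(3) by (auto simp: length_Suc_conv numeral_3_eq_3)
  then obtain x y z where xyz: "qs = [(x, r), (y, r), (z, r)]" using sr[of p1] sr[of p2] sr[of p3] by (cases p1; cases p2; cases p3) auto
  have rr: "n1 < r" "R \<le> r"
    using mult_le_mono2[of 1 P "R + n1 + 1"] Pp by (auto simp: r_def)
  obtain k2 where "ev_const (hl (fadjs G qs)) k2"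
    using regs_fadjs_ev_const[OF G finG q(2,1), unfolded q(3), OF ec] by blast
  then obtain N where N: "\<And>n. N \<le> n ==> hl (fadjs G qs) n = k2" by (auto simp: ev_const_def)
  have fq: "filt (fadjs G qs)" by (rule filt_fadjs[OF G])
  have finq: "colen (fadjs G qs n) \<noteq> \<infinity>" for n
    using colen_antimono[OF filt_ideal[OF G] filt_ideal[OF fq] fadjs_sub, of n] finG[of n] by (intro notI) simp
  have bd: "colen (adjs (G n) (map fst qs)) \<le> enat (nat k2)" for n
  proof -
    have "hl (fadjs G qs) n \<le> hl (fadjs G qs) (max n N)" by (rule hl_mono[OF fq finq]) simp
    also have "\<dots> = k2" by (rule N) simp
    finally show ?thesis using finq[of n] by (cases "colen (fadjs G qs n)") (auto simp: hl_def fadjs_adjs)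
  qed
  obtain M where M: "\<And>n. M \<le> n ==> F (n + r) <= isum (lcomb [x, y, z] (F n)) (F (Suc (n + r)))"
    using parameters_generate[OF q(2,1) sr bd] by (auto simp: xyz)
  have 1: "colen (F (3 * r)) + 3 * colen (F r) \<le> 3 * colen (F (2 * r)) + colen (adjs (F (3 * r)) [x, y, z])"
    by (rule colen_le_three[OF cl rr(1) q(1,2)[unfolded xyz] M])
  have 2: "colen (G (3 * r)) + 3 * colen (G r) = 3 * colen (G (2 * r)) + colen (adjs (G (3 * r)) [x, y, z])"
    by (rule colen_eq_three[OF G q(1,2)[unfolded xyz]])
  have 3: "colen (adjs (F (3 * r)) [x, y, z]) \<le> colen (adjs (G (3 * r)) [x, y, z])"
    by (intro colen_antimono idealp_adjs adjs_mono GF filt_ideal[OF F] filt_ideal[OF G])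
  have 4: "colen (adjs (G (3 * r)) [x, y, z]) \<noteq> \<infinity>" using bd[of "3 * r"] by (intro notI) (simp add: xyz)
  have e: "\<exists>i. colen (F n) = enat i" "\<exists>i. colen (G n) = enat i" for n using fin[of n] finG[of n] by auto
  obtain f1 f2 f3 g1 g2 g3 where h: "colen (F r) = enat f1" "colen (F (2 * r)) = enat f2" "colen (F (3 * r)) = enat f3"
     "colen (G r) = enat g1" "colen (G (2 * r)) = enat g2" "colen (G (3 * r)) = enat g3" using e by metis
  obtain a b where ab: "colen (adjs (F (3 * r)) [x, y, z]) = enat a" "colen (adjs (G (3 * r)) [x, y, z]) = enat b"
    using 3 4 by (metis enat_ord_simps(5) not_infinity_eq)
  have "f3 + 3 * f1 \<le> 3 * f2 + a" "g3 + 3 * g1 = 3 * g2 + b" "a \<le> b"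
    using 1 2 3 unfolding h ab by (simp_all add: numeral_eq_enat)
  hence "hl F (3 * r) - 3 * hl F (2 * r) + 3 * hl F r \<le> hl G (3 * r) - 3 * hl G (2 * r) + 3 * hl G r"
    by (simp add: hl_def h)
  thus ?thesis using rr(2) by blast
qed

text \<open>Coefficient ring and extended ring have the same type, so extensions can be iterated a
  number of times that depends on the dimension.\<close>

locale sext = gext ev emb for ev :: "'r::comm_ring_1 => 'q::comm_ring_1" and emb :: "'r poly => 'q"
begin

lemma hl_Ext: "filt F ==> (\<And>n. colen (F n) \<noteq> \<infinity>) ==> hl (\<lambda>n. Ext (F n)) = hl F"
  by (rule ext) (simp add: hl_def colen_Ext filt_ideal)

text \<open>The last element \<open>x\<close> certifies that one more regular element fits. The
  generic element of degree one takes its place, and permutability moves it to the front.\<close>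

lemma generic_regs:
  assumes st: "stage (F :: nat => 'r set) G as c n0" and ps: "in_filt G (qs @ [(x, e)])" "regs G (qs @ [(x, e)])"
  shows "Reg (fadjs (\<lambda>n. Ext (G n)) (iotas qs)) (lift (Poly as)) 1"
    and "Reg (\<lambda>n. Ext (G n)) (lift (Poly as)) 1"
    and "regs (fadj (\<lambda>n. Ext (G n)) (lift (Poly as))) (iotas qs)"
proof -
  interpret stage F G as c n0 by fact
  have fE: "filt (\<lambda>n. Ext (G n))" by (rule filt_Ext[OF G])
  have x: "x \<in> G e" "0 < e" "Reg (fadjs G qs) x e" using ps by (auto simp: regs_append)
  have "Reg (\<lambda>n. Ext (fadjs G qs n)) (lift (Poly as)) 1"
    by (rule generic_Reg[OF st filt_fadjs[OF G] fadjs_sub x])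
  thus 1: "Reg (fadjs (\<lambda>n. Ext (G n)) (iotas qs)) (lift (Poly as)) 1" unfolding Ext_fadjs[OF G] .
  have "regs G qs" "in_filt G qs" using ps by (auto simp: regs_append)
  hence "regs (\<lambda>n. Ext (G n)) (iotas qs @ [(lift (Poly as), 1)])" "in_filt (\<lambda>n. Ext (G n)) (iotas qs @ [(lift (Poly as), 1)])"
    using 1 regs_Ext[OF G] in_filt_Ext[OF G] generic_mem[OF st] by (auto simp: regs_append)
  hence "regs (\<lambda>n. Ext (G n)) ((lift (Poly as), 1) # iotas qs)" by (rule_tac regs_rotate[OF fE])
  thus "Reg (\<lambda>n. Ext (G n)) (lift (Poly as)) 1" "regs (fadj (\<lambda>n. Ext (G n)) (lift (Poly as))) (iotas qs)" by auto
qed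

lemma generic_step:
  assumes st: "stage (F :: nat => 'r set) G as c n0" and ps: "in_filt G ps" "regs G ps" "length ps = Suc d"
  shows "\<exists>(F' :: nat => 'r set) G' as' ps'. stage F' G' as' c n0 \<and> in_filt G' ps' \<and> regs G' ps' \<and> length ps' = d \<and>
    (\<forall>n. dl (hl G) n = hl G' (Suc n)) \<and> (\<exists>N. \<forall>n\<ge>N. dl (hl F) n = hl F' (Suc n))"
proof -
  interpret stage F G as c n0 by fact
  obtain qs x e where qs: "ps = qs @ [(x, e)]" using ps(3) by (metis length_Suc_conv_rev prod.exhaust)
  note ps' = ps(1,2)[unfolded qs]
  let ?b = "lift (Poly as)" and ?F = "\<lambda>n. Ext (F n)" and ?G = "\<lambda>n. Ext (G n)"
  have st1: "stage ?F ?G (map iota as) c n0" by (rule stage_Ext[OF st])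
  interpret S: stage ?F ?G "map iota as" c n0 by fact
  have bG: "?b \<in> ?G 1" by (rule generic_mem[OF st])
  note gr = generic_regs[OF st ps']
  have x: "x \<in> G e" "0 < e" "Reg G x e" using ps' regs_rotate[OF G ps'] by auto
  obtain N where N: "\<And>n y. N \<le> n ==> ?b * y \<in> Ext (F (Suc n)) ==> y \<in> Ext (F n)" using generic_F[OF st x] by blast
  have "dl (hl G) n = hl (fadj ?G ?b) (Suc n)" for n
    using hl_Reg_step[OF S.G S.finG bG, of n] gr(2) by (simp add: Reg_def dl_def hl_Ext[OF G finG])
  moreover have "dl (hl F) n = hl (fadj ?F ?b) (Suc n)" if "N \<le> n" for n
    using hl_Reg_step[OF S.F S.fin, of ?b 1 n] bG S.GF N[OF that] by (auto simp: dl_def hl_Ext[OF F fin])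
  moreover have "in_filt (fadj ?G ?b) (iotas qs)" using in_filt_fadj in_filt_Ext[OF G] ps' by auto
  ultimately show ?thesis using stage_fadj[OF st1, of ?b] gr(3) ps(3) qs by (metis iotas_simps(4) length_append_singleton nat.inject)
qed

text \<open>After \<open>d\<close> generic cuts the \<open>d\<close>-th differences are again
  Hilbert functions of filtrations, for \<open>F\<close> in high degrees: they are monotone and
  comparable with the same shift \<open>c\<close>. Each cut moves the argument by one, whence
  \<open>n + d\<close>.\<close>

lemma hilbert_differences:
  "stage (F :: nat => 'r set) G as c n0 ==> in_filt G ps ==> regs G ps ==> length ps = d ==>
   \<exists>g gF. (\<forall>m n. m \<le> n --> g m \<le> g n) \<and> (\<forall>m n. m \<le> n --> gF m \<le> gF n) \<and> (\<forall>n. gF n \<le> g n \<and> g n \<le> gF (n + c)) \<and>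
     (\<forall>n. (dl ^^ d) (hl G) n = g (n + d)) \<and> (\<exists>N. \<forall>n\<ge>N. (dl ^^ d) (hl F) n = gF (n + d)) \<and>
     (\<forall>j\<le>d. \<forall>n. 0 \<le> (dl ^^ j) (hl G) n)"
proof (induction d arbitrary: F G as ps)
  case 0
  interpret stage F G as c n0 by fact
  show ?case
    by (rule exI[of _ "hl G"], rule exI[of _ "hl F"]) (auto simp: hl_FG hl_nonneg intro: hl_mono[OF G finG] hl_mono[OF F fin])
next
  case (Suc d)
  obtain F' G' :: "nat => 'r set" and as' ps' N where st: "stage F' G' as' c n0" "in_filt G' ps'" "regs G' ps'" "length ps' = d"
    and G': "\<And>n. dl (hl G) n = hl G' (Suc n)" and F': "\<And>n. N \<le> n ==> dl (hl F) n = hl F' (Suc n)"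
    using generic_step[OF Suc.prems] by metis
  obtain g gF M where g: "\<forall>m n. m \<le> n --> g m \<le> g n" "\<forall>m n. m \<le> n --> gF m \<le> gF n" "\<forall>n. gF n \<le> g n \<and> g n \<le> gF (n + c)"
    "\<And>n. (dl ^^ d) (hl G') n = g (n + d)" "\<And>n. M \<le> n ==> (dl ^^ d) (hl F') n = gF (n + d)"
    "\<And>j n. j \<le> d ==> 0 \<le> (dl ^^ j) (hl G') n" using Suc.IH[OF st] by metis
  have G2: "(dl ^^ Suc j) (hl G) n = (dl ^^ j) (hl G') (Suc n)" for j n
  proof -
    have "dl (hl G) = (\<lambda>n. hl G' (n + 1))" using G' by auto
    thus ?thesis unfolding dl_Suc using dl_shift[of j "hl G'" 1 n] by simp
  qed
  have F2: "(dl ^^ Suc d) (hl F) n = (dl ^^ d) (hl F') (Suc n)" if "N \<le> n" for n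
    unfolding dl_Suc using dl_cong[of N "dl (hl F)" "\<lambda>n. hl F' (n + 1)" n d, OF _ that] dl_shift[of d "hl F'" 1 n] F' by simp
  have 1: "\<forall>n. (dl ^^ Suc d) (hl G) n = g (n + Suc d)" using G2 g(4) by simp
  have 2: "\<forall>n\<ge>max N M. (dl ^^ Suc d) (hl F) n = gF (n + Suc d)" using F2 g(5) by simp
  have 3: "\<forall>j\<le>Suc d. \<forall>n. 0 \<le> (dl ^^ j) (hl G) n"
  proof (intro allI impI)
    fix j n assume "j \<le> Suc d"
    thus "0 \<le> (dl ^^ j) (hl G) n" using G2 g(6) hl_nonneg[of G] by (cases j) (auto simp del: funpow.simps(2))
  qed
  show ?case using g(1-3) 1 2 3 by blast
qed

text \<open>Monotonicity and the growth bound make both \<open>d\<close>-th differences eventually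
  constant, and the comparison with shift \<open>c\<close> forces the two constants to coincide.
  This is the equality of multiplicities.\<close>

lemma hilbert_leading_coefficient:
  assumes st: "stage (F :: nat => 'r set) G as c n0" and ps: "in_filt G ps" "regs G ps" "length ps = d"
    and gr: "\<And>n. hl G n \<le> C * int (Suc n) ^ d" and C: "0 \<le> C"
  shows "\<exists>k. ev_const ((dl ^^ d) (hl G)) k \<and> ev_const ((dl ^^ d) (hl F)) k"
proof -
  obtain g gF M where g: "\<And>m n. m \<le> n ==> g m \<le> g n" "\<And>m n. m \<le> n ==> gF m \<le> gF n" "\<And>n. gF n \<le> g n" "\<And>n. g n \<le> gF (n + c)"
    "\<And>n. (dl ^^ d) (hl G) n = g (n + d)" "\<And>n. M \<le> n ==> (dl ^^ d) (hl F) n = gF (n + d)"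
    "\<And>j n. j \<le> d ==> 0 \<le> (dl ^^ j) (hl G) n" using hilbert_differences[OF st ps] by metis
  have "g (n + d) \<le> C * 2 ^ d * int d ^ d" for n
    using growth_bounded[where f = "hl G" and d = d and C = C and ?n1.0 = n, OF _ _ gr C] g(1,5,7) by simp
  hence b: "g n \<le> C * 2 ^ d * int d ^ d" for n using g(1)[of n "n + d"] by (meson le_add1 order_trans)
  hence "gF n \<le> C * 2 ^ d * int d ^ d" for n using g(3)[of n] by (meson order_trans)
  then obtain k k' where "ev_const g k" "ev_const gF k'" using mono_bounded_ev_const g(1,2) b by metis
  then obtain N N' where N: "\<And>n. N \<le> n ==> g n = k" "\<And>n. N' \<le> n ==> gF n = k'" unfolding ev_const_def by metis
  have "k = k'" using g(3)[of "max N N'"] g(4)[of "max N N'"] N(1)[of "max N N'"] N(2)[of "max N N'"] N(2)[of "max N N' + c"] by simp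
  moreover have "ev_const ((dl ^^ d) (hl G)) k" using N(1) g(5) unfolding ev_const_def by (metis trans_le_add1)
  moreover have "ev_const ((dl ^^ d) (hl F)) k'" using N(2) g(6) unfolding ev_const_def
    by (intro exI[of _ "max M N'"]) simp
  ultimately show ?thesis by blast
qed

text \<open>Three extensions are made: the first provides a generic \<open>b'\<close>, the second a
  generic \<open>b\<close> relative to it, the third the indeterminate of the line through both. The
  sequence has length at least two so that \<open>b\<close> is still regular after division by
  \<open>b'\<close>, for \<open>G\<close> in all degrees and for \<open>F\<close> in high
  ones.\<close>

lemma closed_step:
  assumes st: "stage (F :: nat => 'r set) G as c n0" and cl: "closedf F n1" and ps: "in_filt G ps" "regs G ps" "length ps = Suc (Suc d)"
  shows "\<exists>(F' :: nat => 'r set) G' as' ps' n2 N. stage F' G' as' c n0 \<and> closedf F' n2 \<and> in_filt G' ps' \<and> regs G' ps' \<and> length ps' = Suc d \<and>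
    (\<forall>n\<ge>N. hl G' (Suc n) = dl (hl G) n \<and> hl F' (Suc n) = dl (hl F) n)"
proof -
  interpret stage F G as c n0 by fact
  obtain qs x e where qs: "ps = qs @ [(x, e)]" using ps(3) by (metis length_Suc_conv_rev prod.exhaust)
  note ps' = ps(1,2)[unfolded qs]
  have lq: "length qs = Suc d" using ps(3) qs by simp
  obtain x1 e1 qs' where q1: "qs = (x1, e1) # qs'" using lq by (metis length_Suc_conv prod.exhaust)
  define F1 where "F1 n = Ext (F n)" for n
  define G1 where "G1 n = Ext (G n)" for n
  define as1 where "as1 = map iota as"
  define b' where "b' = lift (Poly as)"
  define qs1 where "qs1 = iotas qs"
  have st1: "stage F1 G1 as1 c n0" using stage_Ext[OF st] unfolding F1_def G1_def as1_def .
  interpret S1: stage F1 G1 as1 c n0 by fact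
  have cl1: "closedf F1 n1" using closedf_Ext[OF F cl] unfolding F1_def .
  have b'1: "b' \<in> G1 1" using generic_mem[OF st] unfolding G1_def b'_def .
  have R1: "Reg (fadjs G1 qs1) b' 1" "Reg G1 b' 1" "regs (fadj G1 b') qs1"
    using generic_regs[OF st ps'] unfolding G1_def b'_def qs1_def by auto
  have q1f: "in_filt G1 qs1" "regs G1 qs1" using in_filt_Ext[OF G] regs_Ext[OF G] ps' unfolding G1_def qs1_def by (auto simp: regs_append)
  define y1 where "y1 = iota x1"
  have qs1': "qs1 = (y1, e1) # iotas qs'" by (simp add: qs1_def q1 y1_def)
  have y1: "y1 \<in> G1 e1" "0 < e1" "Reg (fadj G1 b') y1 e1" using q1f R1(3) by (auto simp: qs1')
  define F2 where "F2 n = Ext (F1 n)" for n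
  define G2 where "G2 n = Ext (G1 n)" for n
  define as2 where "as2 = map iota as1"
  define b where "b = lift (Poly as1)"
  define b2 where "b2 = iota b'"
  define qs2 where "qs2 = iotas qs1"
  have st2: "stage F2 G2 as2 c n0" using stage_Ext[OF st1] unfolding F2_def G2_def as2_def .
  interpret S2: stage F2 G2 as2 c n0 by fact
  have cl2: "closedf F2 n1" using closedf_Ext[OF S1.F cl1] unfolding F2_def .
  have q1b: "in_filt G1 (qs1 @ [(b', 1)])" "regs G1 (qs1 @ [(b', 1)])" using q1f b'1 R1 by (auto simp: regs_append)
  have b: "b \<in> G2 1" "Reg (fadjs G2 qs2) b 1" "Reg G2 b 1"
    using generic_mem[OF st1] generic_regs[OF st1 q1b] unfolding G2_def b_def qs2_def by auto
  have b2: "b2 \<in> G2 1" "Reg G2 b2 1"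
    using Ext_iota[OF filt_ideal[OF S1.G]] b'1 Reg_Ext[OF S1.G R1(2)] unfolding G2_def b2_def by auto
  have q2f: "in_filt G2 qs2" "regs G2 qs2" using in_filt_Ext[OF S1.G q1f(1)] regs_Ext[OF S1.G q1f(2)] unfolding G2_def qs2_def by auto
  have EG: "Ext (fadj G1 b' n) = fadj G2 b2 n" "Ext (fadj F1 b' n) = adj (F2 n) b2" for n
    using Ext_adj[OF filt_ideal[OF S1.G], of n b'] Ext_adj[OF filt_ideal[OF S1.F], of n b'] by (simp_all add: fadj_def G2_def F2_def b2_def)
  have "Reg (\<lambda>n. Ext (fadj G1 b' n)) b 1"
    unfolding b_def by (rule generic_Reg[OF st1 filt_fadj[OF S1.G] fadj_sub y1])
  hence "Reg (fadj G2 b2) b 1" unfolding EG by (simp add: fadj_def[abs_def])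
  hence bb: "Reg (fadj G2 b) b2 1" using Reg_swap[OF S2.G b2(1) _ b2(2) b(1)] by simp
  have y1': "y1 \<in> fadj G1 b' e1" using y1(1) fadj_mem by blast
  \<comment> \<open>The generic argument is applied to the section by \<open>b'\<close> inside the
    first extension, where \<open>y1\<close> is still a regular element; the result is the
    cancellation property that \<open>line_closed\<close> asks of \<open>b\<close>.\<close>
  obtain n3 where S: "\<And>n f. n3 \<le> n ==> b * f \<in> adj (F2 (Suc n)) b2 ==> f \<in> adj (F2 n) b2"
    using generic_F[OF stage_fadj[OF st1, of b'] y1' y1(2,3)] unfolding EG b_def[symmetric] by blast
  define F3 where "F3 n = Ext (F2 n)" for n
  define G3 where "G3 n = Ext (G2 n)" for n
  define l where "l = lift [:b, b2:]"
  define qs3 where "qs3 = iotas qs2"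
  have st3: "stage F3 G3 (map iota as2) c n0" using stage_Ext[OF st2] unfolding F3_def G3_def .
  interpret S3: stage F3 G3 "map iota as2" c n0 by fact
  have cl3: "closedf (fadj F3 l) (Suc (max n1 n3))"
    using line_closed[OF st2 cl2 b(1,3) b2(1,2) bb S] unfolding F3_def[abs_def, symmetric] l_def by simp
  have "Reg (\<lambda>n. Ext (fadjs G2 qs2 n)) l 1"
    unfolding l_def by (rule Reg_line[OF filt_fadjs[OF S2.G] b(2)]) (use b2(1) fadjs_sub in blast)
  hence R3: "Reg (fadjs G3 qs3) l 1" unfolding Ext_fadjs[OF S2.G] G3_def[abs_def] qs3_def .
  have l3: "l \<in> G3 1" unfolding G3_def l_def Ext_lift[OF filt_ideal[OF S2.G]]
    using b(1) b2(1) by (simp add: polyin_pCons polyin_0 filt_ideal[OF S2.G])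
  have q3f: "in_filt G3 qs3" "regs G3 qs3" using in_filt_Ext[OF S2.G q2f(1)] regs_Ext[OF S2.G q2f(2)] unfolding G3_def qs3_def by auto
  have "regs G3 ((l, 1) # qs3)" by (rule regs_rotate[OF S3.G]) (use q3f R3 l3 in \<open>auto simp: regs_append\<close>)
  hence R3': "Reg G3 l 1" "regs (fadj G3 l) qs3" by auto
  have h1: "hl F1 = hl F" "hl G1 = hl G" using hl_Ext[OF F fin] hl_Ext[OF G finG] by (simp_all add: F1_def[abs_def] G1_def[abs_def])
  have h2: "hl F2 = hl F" "hl G2 = hl G" using h1 hl_Ext[OF S1.F S1.fin] hl_Ext[OF S1.G S1.finG] by (simp_all add: F2_def[abs_def] G2_def[abs_def])
  have h3: "hl F3 = hl F" "hl G3 = hl G" using h2 hl_Ext[OF S2.F S2.fin] hl_Ext[OF S2.G S2.finG] by (simp_all add: F3_def[abs_def] G3_def[abs_def])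
  have "dl (hl G) n = hl (fadj G3 l) (Suc n)" for n
    using hl_Reg_step[OF S3.G S3.finG l3, of n] R3'(1) by (simp add: Reg_def dl_def h3)
  moreover have "dl (hl F) n = hl (fadj F3 l) (Suc n)" if "Suc n1 \<le> n" for n
    using hl_Reg_step[OF S3.F S3.fin, of l 1 n] l3 S3.GF line_cancel[OF st2 cl2 b(3) b2(1), of n] that
    unfolding l_def[symmetric] F3_def[symmetric] by (auto simp: dl_def h3)
  ultimately have "\<forall>n\<ge>Suc n1. hl (fadj G3 l) (Suc n) = dl (hl G) n \<and> hl (fadj F3 l) (Suc n) = dl (hl F) n" by metis
  moreover have "length qs3 = Suc d" by (simp add: qs3_def qs2_def qs1_def lq)
  ultimately show ?thesis using stage_fadj[OF st3, of l] cl3 in_filt_fadj[OF q3f(1), of l] R3'(2) by blast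
qed

end

text \<open>The section in degree \<open>Suc n\<close> has the forward difference at
  \<open>n\<close> as its length. With backward differences arguments stay in place, so
  \<open>3 * r\<close>, \<open>2 * r\<close> and \<open>r\<close> keep their meaning through all
  cuts. The value at 0 is 0 by truncation.\<close>

definition nb :: "(nat => int) => nat => int" where "nb f n = f n - f (n - 1)"

lemma nb_cong: "(\<And>n. N \<le> n ==> f n = g n) ==> N + c \<le> n ==> (nb ^^ c) f n = (nb ^^ c) g n"
  by (induction c arbitrary: n) (auto simp: nb_def)

text \<open>The freedom to ask for \<open>r\<close> beyond any \<open>R\<close> is what carries the
  inequality past the exceptional low degrees of each cut.\<close>

lemma (in sext) iterated_inequality:
  "stage (F :: nat => 'r set) G as c n0 ==> closedf F n1 ==> in_filt G ps ==> regs G ps ==> length ps = i + 3 ==>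
   ev_const ((dl ^^ (i + 3)) (hl G)) k ==>
   \<exists>r\<ge>R. let g = (nb ^^ i) (\<lambda>n. hl G n - hl F n) in 0 \<le> g (3 * r) - 3 * g (2 * r) + 3 * g r"
proof (induction i arbitrary: F G as n1 ps R)
  case 0
  interpret stage F G as c n0 by fact
  have "length ps = 3" "ev_const ((dl ^^ 3) (hl G)) k" using 0 by auto
  thus ?case using three_step_inequality[OF 0(2-4), of k R] by (auto simp: Let_def)
next
  case (Suc i)
  have len: "length ps = Suc (Suc (i + 2))" using Suc.prems by simp
  obtain F' G' :: "nat => 'r set" and as' ps' n2 N where st: "stage F' G' as' c n0" "closedf F' n2" "in_filt G' ps'" "regs G' ps'" "length ps' = Suc (i + 2)"
    and h: "\<And>n. N \<le> n ==> hl G' (Suc n) = dl (hl G) n" "\<And>n. N \<le> n ==> hl F' (Suc n) = dl (hl F) n"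
    using closed_step[OF Suc.prems(1-4) len] by (elim exE conjE) (rule that, assumption+, blast+)
  have l: "length ps' = i + 3" using st(5) by simp
  obtain M where M: "\<And>n. M \<le> n ==> (dl ^^ Suc (i + 3)) (hl G) n = k" using Suc.prems(6) by (auto simp: ev_const_def)
  have "(dl ^^ (i + 3)) (hl G') n = k" if nn: "Suc (max N M) \<le> n" for n
  proof -
    obtain m where m: "n = Suc m" "N \<le> m" "M \<le> m" using nn by (cases n) auto
    have "k = (dl ^^ (i + 3)) (dl (hl G)) m" using M[OF m(3)] unfolding dl_Suc by simp
    also have "\<dots> = (dl ^^ (i + 3)) (\<lambda>n. hl G' (n + 1)) m" by (rule dl_cong[OF _ m(2)]) (simp add: h)
    finally show ?thesis using dl_shift[of "i + 3" "hl G'" 1 m] m by simp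
  qed
  hence "ev_const ((dl ^^ (i + 3)) (hl G')) k" unfolding ev_const_def by blast
  note IH = Suc.IH[OF st(1-4) l this, of "max R (Suc N + i)"]
  obtain r where r: "max R (Suc N + i) \<le> r" "let g = (nb ^^ i) (\<lambda>n. hl G' n - hl F' n) in 0 \<le> g (3 * r) - 3 * g (2 * r) + 3 * g r"
    using IH by blast
  have eq: "(nb ^^ i) (\<lambda>n. hl G' n - hl F' n) n = (nb ^^ Suc i) (\<lambda>n. hl G n - hl F n) n" if "Suc N + i \<le> n" for n
  proof -
    have "(nb ^^ i) (\<lambda>n. hl G' n - hl F' n) n = (nb ^^ i) (nb (\<lambda>n. hl G n - hl F n)) n"
    proof (rule nb_cong[OF _ that])
      fix n assume "Suc N \<le> n"
      then obtain m where "n = Suc m" "N \<le> m" by (cases n) auto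
      thus "hl G' n - hl F' n = nb (\<lambda>n. hl G n - hl F n) n" using h by (simp add: nb_def dl_def)
    qed
    thus ?thesis by (simp add: funpow_swap1)
  qed
  have "(nb ^^ i) (\<lambda>n. hl G' n - hl F' n) (j * r) = (nb ^^ Suc i) (\<lambda>n. hl G n - hl F n) (j * r)" if "1 \<le> j" for j
    using r(1) mult_le_mono1[OF that, of r] by (intro eq) linarith
  from this[of 1] this[of 2] this[of 3] show ?case using r by (auto simp: Let_def)
qed

section \<open>A free ring closed under generic extensions\<close>

text \<open>The generators \<open>Frac ps ws\<close> stand for quotients of polynomials whose coefficients are
  themselves (classes of) terms. This makes one and the same ring map onto its own localized
  polynomial ring.\<close>

datatype 'a tm = Var 'a | Frac "'a tm list" "'a tm list" | Zero | One | Add "'a tm" "'a tm" | Mul "'a tm" "'a tm" | Neg "'a tm"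

inductive eqv :: "'a tm => 'a tm => bool" where
  eqv_refl: "eqv a a"
| eqv_sym: "eqv a b ==> eqv b a"
| eqv_trans: "eqv a b ==> eqv b c ==> eqv a c"
| eqv_Add: "eqv a a' ==> eqv b b' ==> eqv (Add a b) (Add a' b')"
| eqv_Mul: "eqv a a' ==> eqv b b' ==> eqv (Mul a b) (Mul a' b')"
| eqv_Neg: "eqv a a' ==> eqv (Neg a) (Neg a')"
| Add_assoc: "eqv (Add (Add a b) c) (Add a (Add b c))"
| Add_comm: "eqv (Add a b) (Add b a)"
| Add_Zero: "eqv (Add Zero a) a"
| Add_Neg: "eqv (Add (Neg a) a) Zero"
| Mul_assoc: "eqv (Mul (Mul a b) c) (Mul a (Mul b c))"
| Mul_comm: "eqv (Mul a b) (Mul b a)"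
| Mul_One: "eqv (Mul One a) a"
| Mul_Add: "eqv (Mul (Add a b) c) (Add (Mul a c) (Mul b c))"

quotient_type 'a fr = "'a tm" / eqv
  by (intro equivpI reflpI sympI transpI) (auto intro: eqv.intros)

primrec geval :: "('a => 'q::comm_ring_1) => ('a tm list => 'a tm list => 'q) => 'a tm => 'q" where
  "geval v f (Var a) = v a"
| "geval v f (Frac ps ws) = f ps ws"
| "geval v f Zero = 0"
| "geval v f One = 1"
| "geval v f (Add a b) = geval v f a + geval v f b"
| "geval v f (Mul a b) = geval v f a * geval v f b"
| "geval v f (Neg a) = - geval v f a"

lemma geval_eqv: "eqv a b ==> geval v f a = geval v f b"
  by (induction rule: eqv.induct) (auto simp: algebra_simps)

instantiation fr :: (type) comm_ring_1
begin

lift_definition zero_fr :: "'a fr" is Zero .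
lift_definition one_fr :: "'a fr" is One .
lift_definition plus_fr :: "'a fr => 'a fr => 'a fr" is Add by (rule eqv_Add)
lift_definition times_fr :: "'a fr => 'a fr => 'a fr" is Mul by (rule eqv_Mul)
lift_definition uminus_fr :: "'a fr => 'a fr" is Neg by (rule eqv_Neg)
lift_definition minus_fr :: "'a fr => 'a fr => 'a fr" is "\<lambda>a b. Add a (Neg b)" by (intro eqv_Add eqv_Neg)

instance
proof
  fix a b c :: "'a fr"
  show "a + b + c = a + (b + c)" by transfer (rule Add_assoc)
  show "a + b = b + a" by transfer (rule Add_comm)
  show "0 + a = a" by transfer (rule Add_Zero)
  show "- a + a = 0" by transfer (rule Add_Neg)
  show "a - b = a + - b" by transfer (rule eqv_refl)
  show "a * b * c = a * (b * c)" by transfer (rule Mul_assoc)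
  show "a * b = b * a" by transfer (rule Mul_comm)
  show "1 * a = a" by transfer (rule Mul_One)
  show "(a + b) * c = a * c + b * c" by transfer (rule Mul_Add)
  show "(0 :: 'a fr) \<noteq> 1"
  proof transfer
    show "\<not> eqv Zero (One :: 'a tm)"
      using geval_eqv[of Zero "One :: 'a tm" "\<lambda>_. 0 :: int" "\<lambda>_ _. 0"] by auto
  qed
qed

end

lift_definition feval :: "('a => 'q::comm_ring_1) => ('a tm list => 'a tm list => 'q) => 'a fr => 'q"
  is geval by (rule geval_eqv)

lemma feval_hom:
  "feval v f (x + y) = feval v f x + feval v f y" "feval v f (x * y) = feval v f x * feval v f y" "feval v f 1 = 1"
  by (transfer, simp)+

lemma fr_induct:
  assumes "\<And>a. P (abs_fr (Var a))" "\<And>ps ws. P (abs_fr (Frac ps ws))" "P 0" "P 1"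
    "\<And>x y. P x ==> P y ==> P (x + y)" "\<And>x y. P x ==> P y ==> P (x * y)" "\<And>x. P x ==> P (- x)"
  shows "P x"
proof -
  have "P (abs_fr t)" for t
    by (induction t) (use assms in \<open>auto simp flip: zero_fr.abs_eq one_fr.abs_eq plus_fr.abs_eq times_fr.abs_eq uminus_fr.abs_eq\<close>)
  thus ?thesis by (induction x rule: fr.abs_induct)
qed

section \<open>Localized polynomials inside Laurent series\<close>

definition pemb :: "'r::comm_ring_1 poly => 'r fls" where "pemb p = fps_to_fls (fps_of_poly p)"

lemma pemb_hom: "pemb (p + q) = pemb p + pemb q" "pemb (p * q) = pemb p * pemb q" "pemb 1 = 1" "pemb 0 = 0" "pemb (- p) = - pemb p"
  by (simp_all add: pemb_def fps_of_poly_add fps_of_poly_mult fps_to_fls_plus fls_times_fps_to_fls fps_of_poly_uminus fps_to_fls_uminus)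

lemma pemb_inj: "pemb p = pemb q ==> p = q"
  by (simp add: pemb_def fps_of_poly_eq_iff)

text \<open>Powers of the indeterminate are invertible as Laurent series, and a factor with constant
  term 1 is invertible as a power series over any coefficient ring.\<close>

lemma pemb_unit: assumes "lowmonic w" shows "\<exists>z. z * pemb w = 1"
proof -
  obtain k u where u: "pc u 0 = 1" "w = [:0, 1:] ^ k * u" using assms unfolding lowmonic_def by blast
  have "fps_left_inverse (fps_of_poly u) 1 * fps_of_poly u = 1"
    by (rule fps_left_inverse) (simp add: u)
  hence 1: "fps_to_fls (fps_left_inverse (fps_of_poly u) 1) * pemb u = 1"
    by (metis pemb_def fls_times_fps_to_fls fps_one_to_fls)
  have "pemb [:0, 1:] = (fls_X :: 'a fls)" by (simp add: pemb_def fps_of_poly_linear' fps_X_to_fls)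
  hence "pemb ([:0, 1:] ^ k) = (fls_X ^ k :: 'a fls)" by (induction k) (simp_all add: pemb_hom del: mult_pCons_left)
  moreover have "fls_X_inv ^ k * (fls_X ^ k :: 'a fls) = 1"
    by (simp add: fls_X_inv_power_times_conv_shift fls_X_power_conv_shift_1)
  ultimately have "(fls_X_inv ^ k * fps_to_fls (fps_left_inverse (fps_of_poly u) 1)) * pemb w = 1"
    unfolding u(2) pemb_hom using 1 by (metis (no_types, lifting) mult.assoc mult.left_commute mult_1_right)
  thus ?thesis by blast
qed

definition pinv :: "'r::comm_ring_1 poly => 'r fls" where "pinv w = (SOME z. z * pemb w = 1)"

lemma pinv: "lowmonic w ==> pinv w * pemb w = 1"
  unfolding pinv_def by (rule someI_ex[OF pemb_unit])

definition fr_poly :: "'a tm list => 'a fr poly" where "fr_poly ts = Poly (map abs_fr ts)"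

lemma fr_poly_surj: "\<exists>ts. fr_poly ts = p"
proof -
  have "p = fr_poly (map rep_fr (Polynomial.coeffs p))"
    by (simp add: fr_poly_def comp_def Quotient3_abs_rep[OF Quotient3_fr])
  thus ?thesis by metis
qed

text \<open>Coefficients \<open>c\<close> are reached through \<open>Frac\<close> with a constant
  numerator and not through \<open>Var\<close>, so all variables can be sent to 0. Quotients whose
  denominator is not \<open>lowmonic\<close> also take the default value 0.\<close>

definition fr_ev :: "'a fr => 'a fr fls" where
  "fr_ev = feval (\<lambda>_. 0) (\<lambda>ps ws. if lowmonic (fr_poly ws) then pinv (fr_poly ws) * pemb (fr_poly ps) else 0)"

interpretation fr: sext fr_ev pemb
proof unfold_locales
  fix x y :: "'a fr"
  show "fr_ev (x + y) = fr_ev x + fr_ev y" "fr_ev (x * y) = fr_ev x * fr_ev y" "fr_ev 1 = (1 :: 'a fr fls)"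
    by (simp_all add: fr_ev_def feval_hom)
next
  fix p q :: "'a fr poly"
  show "pemb (p + q) = pemb p + pemb q" "pemb (p * q) = pemb p * pemb q" "pemb 1 = (1 :: 'a fr fls)" by (simp_all add: pemb_hom)
  show "pemb p = pemb q ==> p = q" by (rule pemb_inj)
next
  have frac: "fr_ev (abs_fr (Frac ps ws)) = pinv (fr_poly ws) * pemb (fr_poly ps)" if "lowmonic (fr_poly ws)" for ps ws :: "'a tm list"
    using that by (simp add: fr_ev_def feval.abs_eq)
  {
    fix p :: "'a fr poly"
    obtain ps ws :: "'a tm list" where *: "fr_poly ps = p" "fr_poly ws = 1" using fr_poly_surj by metis
    have "pinv 1 = (1 :: 'a fr fls)" using pinv[OF lowmonic_1, where 'a = "'a fr"] by (simp add: pemb_hom)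
    thus "\<exists>y. fr_ev y = pemb p" using frac[of ws ps] * lowmonic_1 by (metis mult_1)
  next
    fix w :: "'a fr poly" assume w: "lowmonic w"
    obtain ps ws :: "'a tm list" where *: "fr_poly ps = 1" "fr_poly ws = w" using fr_poly_surj by metis
    hence "fr_ev (abs_fr (Frac ps ws)) * pemb w = 1" using frac[of ws ps] w pinv[OF w] by (simp add: pemb_hom)
    thus "\<exists>y. fr_ev y * pemb w = 1" by blast
  }
  fix y :: "'a fr"
  show "\<exists>w p. lowmonic w \<and> pemb w * fr_ev y = pemb p"
  proof (induction y rule: fr_induct)
    case (1 a)
    have "pemb 1 * fr_ev (abs_fr (Var a)) = pemb 0" by (simp add: fr_ev_def feval.abs_eq pemb_hom)
    thus ?case using lowmonic_1 by blast
  next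
    case (2 ps ws)
    show ?case
    proof (cases "lowmonic (fr_poly ws)")
      case True
      hence "pemb (fr_poly ws) * fr_ev (abs_fr (Frac ps ws)) = pemb (fr_poly ps)"
        using pinv[OF True] by (simp add: frac mult.assoc[symmetric] mult.commute[of "pemb (fr_poly ws)"])
      thus ?thesis using True by blast
    next
      case False
      hence "pemb 1 * fr_ev (abs_fr (Frac ps ws)) = pemb 0" by (simp add: fr_ev_def feval.abs_eq pemb_hom)
      thus ?thesis using lowmonic_1 by blast
    qed
  next
    case 3
    have "fr_ev 0 = (0 :: 'a fr fls)" by (simp add: fr_ev_def feval.abs_eq zero_fr.abs_eq)
    hence "pemb 1 * fr_ev 0 = (pemb 0 :: 'a fr fls)" by (simp add: pemb_hom)
    thus ?case using lowmonic_1 by blast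
  next
    case 4
    have "pemb 1 * fr_ev 1 = (pemb 1 :: 'a fr fls)" by (simp add: pemb_hom fr_ev_def feval_hom)
    thus ?case using lowmonic_1 by blast
  next
    case (5 x y)
    then obtain w p v q where *: "lowmonic w" "pemb w * fr_ev x = pemb p" "lowmonic v" "pemb v * fr_ev y = pemb q" by blast
    have "pemb (w * v) * fr_ev (x + y) = pemb v * (pemb w * fr_ev x) + pemb w * (pemb v * fr_ev y)"
      by (simp add: pemb_hom fr_ev_def feval_hom algebra_simps)
    hence "pemb (w * v) * fr_ev (x + y) = pemb (v * p + w * q)" unfolding * by (simp only: pemb_hom)
    thus ?case using lowmonic_mult[OF *(1,3)] by blast
  next
    case (6 x y)
    then obtain w p v q where *: "lowmonic w" "pemb w * fr_ev x = pemb p" "lowmonic v" "pemb v * fr_ev y = pemb q" by blast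
    have "pemb (w * v) * fr_ev (x * y) = (pemb w * fr_ev x) * (pemb v * fr_ev y)"
      by (simp add: pemb_hom fr_ev_def feval_hom algebra_simps)
    hence "pemb (w * v) * fr_ev (x * y) = pemb (p * q)" unfolding * by (simp only: pemb_hom)
    thus ?case using lowmonic_mult[OF *(1,3)] by blast
  next
    case (7 x)
    then obtain w p where *: "lowmonic w" "pemb w * fr_ev x = pemb p" by blast
    have "fr_ev (- x) = - fr_ev x"
      using feval_hom(1)[of _ _ "- x" x] unfolding fr_ev_def by (simp add: feval.abs_eq zero_fr.abs_eq eq_neg_iff_add_eq_0)
    hence "pemb w * fr_ev (- x) = pemb (- p)" using *(2) by (simp add: pemb_hom)
    thus ?case using *(1) by blast
  qed
qed

text \<open>The variables named by elements of the carrier make this evaluation surjective onto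
  \<open>R\<close>; the \<open>Frac\<close> generators and all other variables take the default
  value zero.\<close>

primrec reval :: "('a, 'c) ring_scheme => 'a tm => 'a" where
  "reval R (Var a) = (if a \<in> carrier R then a else \<zero>\<^bsub>R\<^esub>)"
| "reval R (Frac ps ws) = \<zero>\<^bsub>R\<^esub>"
| "reval R Zero = \<zero>\<^bsub>R\<^esub>"
| "reval R One = \<one>\<^bsub>R\<^esub>"
| "reval R (Add a b) = reval R a \<oplus>\<^bsub>R\<^esub> reval R b"
| "reval R (Mul a b) = reval R a \<otimes>\<^bsub>R\<^esub> reval R b"
| "reval R (Neg a) = \<ominus>\<^bsub>R\<^esub> reval R a"

text \<open>The ideals of \<open>R\<close> are handled through their preimages under this map. The
  representative chosen by \<open>rep_fr\<close> is immaterial by \<open>reval_eqv\<close>.\<close>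

definition cov :: "('a, 'c) ring_scheme => 'a fr => 'a" where "cov R x = reval R (rep_fr x)"

context cring
begin

lemma reval_closed: "reval R t \<in> carrier R" by (induction t) auto

lemma reval_eqv: "eqv s t ==> reval R s = reval R t"
proof (induction rule: eqv.induct)
qed (simp_all add: reval_closed a_assoc m_assoc l_distr l_neg, simp_all add: reval_closed a_comm m_comm)

lemma cov_abs: "cov R (abs_fr t) = reval R t"
  unfolding cov_def by (rule reval_eqv) (metis Quotient3_abs_rep[OF Quotient3_fr] fr.abs_eq_iff)

lemma cov_closed: "cov R x \<in> carrier R" by (simp add: cov_def reval_closed)

lemma cov_hom:
  "cov R (x + y) = cov R x \<oplus> cov R y" "cov R (x * y) = cov R x \<otimes> cov R y" "cov R 0 = \<zero>" "cov R 1 = \<one>" "cov R (- x) = \<ominus> cov R x"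
proof -
  obtain s t where st: "x = abs_fr s" "y = abs_fr t" by (metis Quotient3_abs_rep[OF Quotient3_fr])
  show "cov R (x + y) = cov R x \<oplus> cov R y" "cov R (x * y) = cov R x \<otimes> cov R y" "cov R 0 = \<zero>" "cov R 1 = \<one>" "cov R (- x) = \<ominus> cov R x"
    unfolding st by (simp_all add: cov_abs plus_fr.abs_eq times_fr.abs_eq uminus_fr.abs_eq zero_fr.abs_eq one_fr.abs_eq)
qed

lemma cov_surj: "a \<in> carrier R ==> \<exists>x. cov R x = a"
  by (rule exI[of _ "abs_fr (Var a)"]) (simp add: cov_abs)

end

section \<open>Graded primes, depth and prime chains\<close>

lemma acc_max:
  assumes "S \<noteq> {}" "\<And>f :: nat => 'b. (\<And>i. f i \<in> S) ==> (\<And>i. r (f i) (f (Suc i))) ==> False"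
  shows "\<exists>x\<in>S. \<forall>y\<in>S. \<not> r x y"
proof (rule ccontr)
  assume a: "\<not> ?thesis"
  have "\<exists>f. \<forall>n::nat. f n \<in> S \<and> r (f n) (f (Suc n))"
    by (rule dependent_nat_choice) (use assms(1) a in blast)+
  thus False using assms(2) by blast
qed

text \<open>The ascending chain condition for ideals above \<open>Z\<close>, that is, for the ring
  modulo \<open>Z\<close>. With \<open>Z\<close> the kernel of \<open>cov\<close> it expresses that
  \<open>R\<close> is Noetherian while staying in the free ring.\<close>

definition noeth :: "'r::comm_ring_1 set => bool" where
  "noeth Z \<longleftrightarrow> (\<forall>H::nat => 'r set. (\<forall>i. idealp (H i) \<and> Z <= H i \<and> H i <= H (Suc i)) --> (\<exists>k. \<forall>j. H j <= H k))"

lemma noethD: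
  assumes "noeth Z" "\<And>i. idealp (H i)" "\<And>i. Z <= H i" "\<And>i. H i <= H (Suc i)"
  shows "\<exists>k. \<forall>j. H j <= H k"
  using assms unfolding noeth_def by blast

lemma noeth_max:
  assumes "noeth Z" "S \<noteq> {}" "\<And>V. V \<in> S ==> idealp V \<and> Z <= V"
  shows "\<exists>V\<in>S. \<forall>W\<in>S. \<not> V \<subset> W"
proof (rule acc_max[OF assms(2)])
  fix f :: "nat => 'a set" assume f: "\<And>i. f i \<in> S" "\<And>i. f i \<subset> f (Suc i)"
  then obtain k where "\<forall>j. f j <= f k" using noethD[OF assms(1), of f] assms(3) by blast
  thus False using f(2)[of k] by blast
qed

lemma adjs_append: "adjs U (xs @ ys) = adjs (adjs U xs) ys"
  by (induction xs arbitrary: U) auto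

lemma adjs_mem: "idealp U ==> x \<in> set xs ==> x \<in> adjs U xs"
proof (induction xs arbitrary: U)
  case (Cons y ys)
  show ?case
  proof (cases "x = y")
    case True thus ?thesis using adjs_subset[of "adj U y" ys] adj_self[OF Cons.prems(1)] by auto
  next
    case False thus ?thesis using Cons idealp_adj by auto
  qed
qed simp

lemma adjs_least: "idealp V ==> U <= V ==> set xs <= V ==> adjs U xs <= V"
proof (induction xs arbitrary: U)
  case (Cons x xs) thus ?case using adj_least[of V U x] by auto
qed simp

lemma noeth_fg:
  assumes "noeth Z" "idealp Z" "idealp V" "Z <= V"
  shows "\<exists>xs. set xs <= V \<and> V = adjs Z xs"
proof -
  let ?S = "{adjs Z xs | xs. set xs <= V}"
  have ne: "?S \<noteq> {}" by (auto intro!: exI[of _ "[]"])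
  have "\<exists>W\<in>?S. \<forall>W'\<in>?S. \<not> W \<subset> W'"
    by (rule noeth_max[OF assms(1) ne]) (use idealp_adjs[OF assms(2)] adjs_subset[of Z] in blast)
  then obtain W where W: "W \<in> ?S" "\<forall>W'\<in>?S. \<not> W \<subset> W'" by (rule bexE)
  then obtain xs where xs: "set xs <= V" "W = adjs Z xs" by blast
  have mx: "\<not> adjs Z xs \<subset> adjs Z ys" if "set ys <= V" for ys using W(2) that xs(2) by blast
  have "V <= adjs Z xs"
  proof
    fix v assume "v \<in> V"
    hence "\<not> adjs Z xs \<subset> adjs Z (xs @ [v])" using xs(1) by (intro mx) simp
    moreover have "adjs Z xs <= adjs Z (xs @ [v])" by (simp add: adjs_append adj_subset)
    moreover have "v \<in> adjs Z (xs @ [v])" by (rule adjs_mem[OF assms(2)]) simp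
    ultimately show "v \<in> adjs Z xs" by blast
  qed
  thus ?thesis using xs(1) adjs_least[OF assms(3,4) xs(1)] by blast
qed

text \<open>A homogeneous prime of the graded ring with pieces \<open>S k\<close>, given by its own
  pieces; the last clause says that it misses something of positive degree.\<close>

definition pfam :: "(nat => 'r::comm_ring_1 set) => (nat => 'r set) => bool" where
  "pfam S Q \<longleftrightarrow> (\<forall>k. idealp (Q k) \<and> Q k <= S k) \<and>
     (\<forall>j k a b. a \<in> S j --> b \<in> S k --> (a * b \<in> Q (j + k) \<longleftrightarrow> a \<in> Q j \<or> b \<in> Q k)) \<and> (\<exists>L>0. \<not> S L <= Q L)"

locale scal =
  fixes S :: "nat => 'r::comm_ring_1 set"
  assumes S0: "S 0 = UNIV" and S_ideal: "idealp (S k)" and S_mult: "a \<in> S j ==> b \<in> S k ==> a * b \<in> S (j + k)"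
begin

lemma pfam_ideal: "pfam S Q ==> idealp (Q k)" by (simp add: pfam_def)
lemma pfam_sub: "pfam S Q ==> a \<in> Q k ==> a \<in> S k" by (auto simp: pfam_def)
lemma pfam_iff: "pfam S Q ==> a \<in> S j ==> b \<in> S k ==> a * b \<in> Q (j + k) \<longleftrightarrow> a \<in> Q j \<or> b \<in> Q k"
  by (auto simp: pfam_def)

lemma pfam_1: assumes "pfam S Q" shows "1 \<notin> Q 0"
proof
  assume 1: "1 \<in> Q 0"
  have "a \<in> Q L" if "a \<in> S L" for a L using pfam_iff[OF assms _ that, of 1 0] 1 S0 by simp
  thus False using assms by (auto simp: pfam_def)
qed

lemma S_pow: "x \<in> S e ==> x ^ k \<in> S (k * e)"
  by (induction k) (auto simp: S0 S_mult)

lemma pfam_pow: assumes "pfam S Q" "x \<in> S e" "0 < k" shows "x ^ k \<in> Q (k * e) \<longleftrightarrow> x \<in> Q e"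
  using assms(3)
proof (induction k)
  case (Suc k)
  show ?case
  proof (cases "k = 0")
    case False
    thus ?thesis using Suc pfam_iff[OF assms(1,2) S_pow[OF assms(2)], of k] by auto
  qed simp
qed simp

lemma pfam_product:
  assumes P: "pfam S P"
  shows "finite \<Q> ==> (\<And>Q. Q \<in> \<Q> ==> pfam S Q) ==> (\<And>Q. Q \<in> \<Q> ==> \<exists>k. \<exists>a\<in>Q k. a \<notin> P k) ==>
    \<exists>k. \<exists>a\<in>S k. a \<notin> P k \<and> (\<forall>Q\<in>\<Q>. a \<in> Q k)"
proof (induction \<Q> rule: finite_induct)
  case empty show ?case using pfam_1[OF P] S0 by auto
next
  case (insert Q \<Q>)
  obtain k a where a: "a \<in> S k" "a \<notin> P k" "\<forall>Q\<in>\<Q>. a \<in> Q k" using insert by blast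
  obtain j b where b: "b \<in> Q j" "b \<notin> P j" using insert.prems(2)[of Q] by blast
  have bS: "b \<in> S j" using pfam_sub[of Q b j] b(1) insert.prems(1)[of Q] by blast
  have "a * b \<in> S (k + j)" "a * b \<notin> P (k + j)" using a b bS pfam_iff[OF P] S_mult by auto
  moreover have "a * b \<in> Q' (k + j)" if "Q' \<in> insert Q \<Q>" for Q'
    using that a b bS pfam_iff[OF insert.prems(1)[OF that] a(1) bS] by auto
  ultimately show ?case by blast
qed

text \<open>For primes without inclusions, \<open>x\<close> avoids all of them except possibly
  \<open>P\<close>, and \<open>y\<close> lies in all of them except \<open>P\<close>. Only elements
  of equal degree may be added, so powers are taken, and \<open>x ^ j + y ^ e\<close> is homogeneous
  of degree \<open>j * e\<close>.\<close>

lemma graded_avoidance: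
  "finite \<Q> ==> (\<And>Q. Q \<in> \<Q> ==> pfam S Q) ==> \<exists>e>0. \<exists>x\<in>S e. \<forall>Q\<in>\<Q>. x \<notin> Q e"
proof (induction \<Q> rule: finite_psubset_induct)
  case (psubset \<Q>)
  show ?case
  proof (cases "\<exists>Q\<in>\<Q>. \<exists>Q'\<in>\<Q>. Q \<noteq> Q' \<and> Q \<le> Q'")
    case True
    then obtain Q Q' where Q: "Q \<in> \<Q>" "Q' \<in> \<Q>" "Q \<noteq> Q'" "Q \<le> Q'" by blast
    have "\<Q> - {Q} \<subset> \<Q>" using Q by blast
    then obtain e x where e: "0 < e" "x \<in> S e" "\<forall>Q'\<in>\<Q> - {Q}. x \<notin> Q' e" using psubset.IH[of "\<Q> - {Q}"] psubset.prems by blast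
    hence "x \<notin> Q e" using Q le_funD[OF Q(4), of e] by blast
    thus ?thesis using e by blast
  next
    case False
    show ?thesis
    proof (cases "\<Q> = {}")
      case True
      thus ?thesis using idealp_zero[OF S_ideal, of 1] by (intro exI[of _ 1]) auto
    next
      case ne: False
      then obtain P where P: "P \<in> \<Q>" by blast
      let ?R = "\<Q> - {P}"
      have R: "?R \<subset> \<Q>" "finite ?R" using P psubset.hyps by auto
      have pP: "pfam S P" using P psubset.prems by blast
      obtain e x where e: "0 < e" "x \<in> S e" "\<forall>Q\<in>?R. x \<notin> Q e" using psubset.IH[OF R(1)] psubset.prems by blast
      show ?thesis
      proof (cases "x \<in> P e")
        case False thus ?thesis using e by blast
      next
        case True
        have "\<exists>k. \<exists>a\<in>Q k. a \<notin> P k" if "Q \<in> ?R" for Q using that False P unfolding le_fun_def by blast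
        then obtain k a where a: "a \<in> S k" "a \<notin> P k" "\<forall>Q\<in>?R. a \<in> Q k"
          using pfam_product[OF pP R(2)] psubset.prems by blast
        \<comment> \<open>A factor of positive degree outside \<open>P\<close> is multiplied in
          because \<open>a\<close> may have degree 0.\<close>
        obtain L w where w: "0 < L" "w \<in> S L" "w \<notin> P L" using pP by (auto simp: pfam_def)
        define y j where "y = a * w" and "j = k + L"
        have y: "y \<in> S j" "y \<notin> P j" "0 < j" using a w pfam_iff[OF pP] S_mult by (auto simp: y_def j_def)
        have yQ: "y \<in> Q j" if "Q \<in> ?R" for Q
          using that a w pfam_iff[of Q a k w L] psubset.prems[of Q] by (auto simp: y_def j_def)
        let ?z = "x ^ j + y ^ e"
        have S: "x ^ j \<in> S (j * e)" "y ^ e \<in> S (j * e)" using S_pow[OF e(2), of j] S_pow[OF y(1), of e] by (auto simp: mult.commute)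
        have pow: "x ^ j \<in> Q (j * e) \<longleftrightarrow> x \<in> Q e" "y ^ e \<in> Q (j * e) \<longleftrightarrow> y \<in> Q j" if "Q \<in> \<Q>" for Q
          using pfam_pow[OF psubset.prems[OF that] e(2) y(3)] pfam_pow[OF psubset.prems[OF that] y(1) e(1)] by (auto simp: mult.commute)
        have "?z \<notin> Q (j * e)" if Q: "Q \<in> \<Q>" for Q
        proof
          assume z: "?z \<in> Q (j * e)"
          have id: "idealp (Q (j * e))" using psubset.prems[OF Q] by (rule pfam_ideal)
          show False
          proof (cases "Q = P")
            case T: True
            hence "x ^ j \<in> Q (j * e)" "y ^ e \<notin> Q (j * e)" using pow[OF Q] True y by auto
            thus False using idealp_diff[OF id z] by force
          next
            case False
            hence "x ^ j \<notin> Q (j * e)" "y ^ e \<in> Q (j * e)" using pow[OF Q] e yQ Q by auto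
            thus False using idealp_diff[OF id z] by force
          qed
        qed
        moreover have "0 < j * e" "?z \<in> S (j * e)" using e y S idealp_add[OF S_ideal] by auto
        ultimately show ?thesis by blast
      qed
    qed
  qed
qed

text \<open>\<open>T\<close> models the annihilators of nonzero elements: \<open>col\<close> closes
  it under colons, so that maximal members are prime; \<open>acc\<close> puts every member below a
  maximal one. By \<open>fin\<close> an infinite sequence of distinct maximal members would have one
  that contains the intersection of its predecessors, against \<open>pfam_product\<close>.\<close>

lemma finite_primes:
  assumes col: "\<And>Q a j. Q \<in> T ==> a \<in> S j ==> a \<notin> Q j ==> (\<lambda>k. {b \<in> S k. a * b \<in> Q (j + k)}) \<in> T"
    and acc: "\<And>q :: nat => nat => 'r set. (\<And>i. q i \<in> T) ==> (\<And>i. q i \<le> q (Suc i)) ==> \<exists>i. q (Suc i) \<le> q i"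
    and fin: "\<And>q :: nat => nat => 'r set. (\<And>i. q i \<in> T) ==> \<exists>i. \<forall>k. \<forall>a\<in>S k. (\<forall>j<i. a \<in> q j k) --> a \<in> q i k"
    and T: "\<And>Q k. Q \<in> T ==> idealp (Q k) \<and> Q k <= S k" "\<And>Q j k a b. Q \<in> T ==> a \<in> Q j ==> b \<in> S k ==> a * b \<in> Q (j + k)"
      "\<And>Q. Q \<in> T ==> \<exists>L>0. \<not> S L <= Q L"
  shows "\<exists>\<Q>. finite \<Q> \<and> (\<forall>P\<in>\<Q>. pfam S P) \<and> (\<forall>Q\<in>T. \<exists>P\<in>\<Q>. Q \<le> P)"
proof -
  define \<Q> where "\<Q> = {P \<in> T. \<forall>Q\<in>T. \<not> P < Q}"
  have below: "\<exists>P\<in>\<Q>. Q \<le> P" if Q: "Q \<in> T" for Q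
  proof -
    have "\<exists>P\<in>{P \<in> T. Q \<le> P}. \<forall>P'\<in>{P \<in> T. Q \<le> P}. \<not> P < P'"
    proof (rule acc_max)
      show "{P \<in> T. Q \<le> P} \<noteq> {}" using Q by blast
      fix f :: "nat => nat => 'r set" assume f: "\<And>i. f i \<in> {P \<in> T. Q \<le> P}" "\<And>i. f i < f (Suc i)"
      then obtain i where "f (Suc i) \<le> f i" using acc[of f] by (auto simp: less_le)
      thus False using f(2)[of i] by auto
    qed
    then obtain P where P: "P \<in> T" "Q \<le> P" "\<And>P'. P' \<in> T ==> Q \<le> P' ==> \<not> P < P'" by blast
    have "\<not> P < P'" if "P' \<in> T" for P' using P(3)[OF that] P(2) by (meson less_imp_le order_trans)
    thus ?thesis using P unfolding \<Q>_def by blast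
  qed
  have prime: "pfam S P" if P: "P \<in> \<Q>" for P
  proof -
    have PT: "P \<in> T" using P by (simp add: \<Q>_def)
    have "a \<in> P j \<or> b \<in> P k" if ab: "a \<in> S j" "b \<in> S k" "a * b \<in> P (j + k)" for a b j k
    proof (rule ccontr)
      assume n: "\<not> ?thesis"
      define C where "C k = {b \<in> S k. a * b \<in> P (j + k)}" for k
      have C: "C \<in> T" using col[OF PT ab(1)] n unfolding C_def[abs_def] by blast
      have leC: "P \<le> C" unfolding le_fun_def
      proof (intro allI subsetI)
        fix k x assume x: "x \<in> P k"
        hence "x * a \<in> P (k + j)" using T(2)[OF PT x ab(1)] by blast
        thus "x \<in> C k" using x T(1)[OF PT] by (auto simp: C_def mult.commute add.commute)
      qed
      have "\<not> P < C" using P C by (simp add: \<Q>_def)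
      hence "P = C" using leC order.not_eq_order_implies_strict[of P C] by blast
      moreover have "b \<in> C k" using ab by (simp add: C_def)
      ultimately have "b \<in> P k" by simp
      thus False using n by blast
    qed
    moreover have "a * b \<in> P (j + k)" if "a \<in> S j" "b \<in> S k" "a \<in> P j \<or> b \<in> P k" for a b j k
      using that T(2)[OF PT, of a j b k] T(2)[OF PT, of b k a j] by (auto simp: mult.commute add.commute)
    ultimately show ?thesis unfolding pfam_def using T(1,3)[OF PT] by blast
  qed
  have "finite \<Q>"
  proof (rule ccontr)
    assume "\<not> finite \<Q>"
    then obtain q :: "nat => nat => 'r set" where q: "inj q" "range q <= \<Q>" using infinite_countable_subset by blast
    have qT: "q i \<in> T" "q i \<in> \<Q>" for i using q(2) by (auto simp: \<Q>_def)
    obtain i where i: "\<And>k a. a \<in> S k ==> (\<forall>j<i. a \<in> q j k) ==> a \<in> q i k" using fin[of q] qT by blast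
    have "\<exists>k. \<exists>a\<in>Q k. a \<notin> q i k" if Qi: "Q \<in> q ` {..<i}" for Q
    proof (rule ccontr)
      assume "\<not> ?thesis"
      hence "Q \<le> q i" by (auto simp: le_fun_def)
      moreover obtain j where j: "Q = q j" "j < i" using Qi by blast
      moreover have "\<not> q j < q i" using qT[of j] qT(1)[of i] by (auto simp: \<Q>_def)
      ultimately have "q j = q i" by (simp add: order.order_iff_strict)
      thus False using q(1) j by (auto dest: injD)
    qed
    then obtain k a where a: "a \<in> S k" "a \<notin> q i k" "\<forall>Q\<in>q ` {..<i}. a \<in> Q k"
      using pfam_product[OF prime[OF qT(2)], of "q ` {..<i}" i] prime qT(2) by blast
    thus False using i[of a k] by auto
  qed
  thus ?thesis using prime below by blast
qed

end

section \<open>Regular sequences and depth\<close>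

abbreviation nzd :: "'r::comm_ring_1 set => 'r => bool" where
  "nzd B x \<equiv> \<forall>y. x * y \<in> B --> y \<in> B"

text \<open>By \<open>soc\<close> no nonzero class modulo \<open>B\<close> is killed by all of
  \<open>M\<close>, so no annihilator contains \<open>M\<close>. The element is found by avoiding
  the finitely many maximal annihilators for all \<open>B\<close> at once.\<close>

lemma nzd_exists:
  assumes Z: "noeth Z" and M: "idealp M" and fB: "finite \<B>" and B: "\<And>B. B \<in> \<B> ==> idealp B \<and> Z <= B"
    and soc: "\<And>B f. B \<in> \<B> ==> f \<notin> B ==> \<exists>a\<in>M. a * f \<notin> B"
  shows "\<exists>x\<in>M. \<forall>B\<in>\<B>. nzd B x"
proof -
  \<comment> \<open>With \<open>M\<close> itself in every positive degree, an element of positive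
    degree is just an element of \<open>M\<close>, and graded avoidance yields the ungraded
    statement.\<close>
  define S where "S k = (if k = 0 then UNIV else M)" for k :: nat
  interpret scal S by unfold_locales (auto simp: S_def M intro: idealp_mult[OF M] idealp_mult2[OF M])
  define q where "q B f k = {a \<in> S k. a * f \<in> B}" for B f k
  have ex: "\<exists>\<Q>. finite \<Q> \<and> (\<forall>P\<in>\<Q>. pfam S P) \<and> (\<forall>Q\<in>{q B f | f. f \<notin> B}. \<exists>P\<in>\<Q>. Q \<le> P)" if "B \<in> \<B>" for B
  proof (rule finite_primes)
    note id = B[OF that]
    fix Q a j assume Q: "Q \<in> {q B f | f. f \<notin> B}" "a \<in> S j" "a \<notin> Q j"
    then obtain f where f: "f \<notin> B" "Q = q B f" by blast
    have "a * f \<notin> B" using Q f by (auto simp: q_def)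
    moreover have "(\<lambda>k. {b \<in> S k. a * b \<in> Q (j + k)}) = q B (a * f)"
      unfolding f(2) q_def using S_mult[OF Q(2)] by (intro ext Collect_cong) (auto simp: mult_ac)
    ultimately show "(\<lambda>k. {b \<in> S k. a * b \<in> Q (j + k)}) \<in> {q B f | f. f \<notin> B}" by blast
  next
    note id = B[OF that]
    fix p :: "nat => nat => 'a set" assume p: "\<And>i. p i \<in> {q B f | f. f \<notin> B}" "\<And>i. p i \<le> p (Suc i)"
    have "\<forall>i. \<exists>f. f \<notin> B \<and> p i = q B f" using p(1) by blast
    from choice[OF this] obtain f where ff: "\<forall>i. f i \<notin> B \<and> p i = q B (f i)" ..
    have f: "f i \<notin> B" "p i = q B (f i)" for i using ff by blast+
    have p0: "p i 0 = colon B (f i)" for i by (auto simp: f q_def S_def colon_def)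
    have pk: "p i k = S k \<inter> p i 0" for i k by (auto simp: f q_def S_def)
    have "\<exists>i. \<forall>j. p j 0 <= p i 0"
    proof (rule noethD[OF Z])
      show "idealp (p i 0)" for i unfolding p0 using id by (intro idealp_colon) auto
      show "Z <= p i 0" for i unfolding p0 colon_def using id idealp_mult2 by blast
      show "p i 0 <= p (Suc i) 0" for i using p(2)[of i] by (auto simp: le_fun_def)
    qed
    then obtain i where i: "p (Suc i) 0 <= p i 0" by blast
    have "p (Suc i) k <= p i k" for k using i pk[of "Suc i" k] pk[of i k] by blast
    thus "\<exists>i. p (Suc i) \<le> p i" unfolding le_fun_def by blast
  next
    note id = B[OF that]
    fix p :: "nat => nat => 'a set" assume p: "\<And>i. p i \<in> {q B f | f. f \<notin> B}"
    have "\<forall>i. \<exists>f. f \<notin> B \<and> p i = q B f" using p by blast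
    from choice[OF this] obtain f where ff: "\<forall>i. f i \<notin> B \<and> p i = q B (f i)" ..
    have f: "f i \<notin> B" "p i = q B (f i)" for i using ff by blast+
    define H where "H i = adjs B (map f [0..<i])" for i
    have "\<exists>i. \<forall>j. H j <= H i"
    proof (rule noethD[OF Z])
      show "idealp (H i)" for i unfolding H_def using id by (intro idealp_adjs) auto
      show "Z <= H i" for i unfolding H_def using id adjs_subset by blast
      show "H i <= H (Suc i)" for i by (simp add: H_def adjs_append adj_subset)
    qed
    then obtain i where "H (Suc i) <= H i" by blast
    moreover have "f i \<in> H (Suc i)" unfolding H_def using id by (intro adjs_mem) auto
    ultimately have fi: "f i \<in> H i" by blast
    have "a * f i \<in> B" if a: "\<forall>j<i. a * f j \<in> B" for a
    proof -
      have "H i <= colon B a" unfolding H_def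
        by (rule adjs_least[OF idealp_colon]) (use id a in \<open>auto simp: colon_def mult.commute intro: idealp_mult2\<close>)
      thus ?thesis using fi by (auto simp: colon_def mult.commute)
    qed
    thus "\<exists>i. \<forall>k. \<forall>a\<in>S k. (\<forall>j<i. a \<in> p j k) --> a \<in> p i k" by (intro exI[of _ i]) (auto simp: f q_def)
  next
    note id = B[OF that]
    fix Q k assume "Q \<in> {q B f | f. f \<notin> B}"
    then obtain f where f: "f \<notin> B" "Q = q B f" by blast
    have "Q k = S k \<inter> colon B f" by (auto simp: f q_def colon_def)
    thus "idealp (Q k) \<and> Q k <= S k" using idealp_Int[OF S_ideal idealp_colon] id by auto
    fix j a b assume ab: "a \<in> Q j" "b \<in> S k"
    have "b * (a * f) \<in> B" using ab id by (rule_tac idealp_mult) (auto simp: f q_def)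
    thus "a * b \<in> Q (j + k)" using ab S_mult by (auto simp: f q_def mult_ac)
  next
    fix Q assume "Q \<in> {q B f | f. f \<notin> B}"
    then obtain f where f: "f \<notin> B" "Q = q B f" by blast
    thus "\<exists>L>0. \<not> S L <= Q L" using soc[OF that f(1)] by (intro exI[of _ 1]) (auto simp: S_def q_def)
  qed
  have "\<forall>B\<in>\<B>. \<exists>\<Q>. finite \<Q> \<and> (\<forall>P\<in>\<Q>. pfam S P) \<and> (\<forall>Q\<in>{q B f | f. f \<notin> B}. \<exists>P\<in>\<Q>. Q \<le> P)"
    by (intro ballI ex)
  from bchoice[OF this] obtain Qs
    where Q: "\<forall>B\<in>\<B>. finite (Qs B) \<and> (\<forall>P\<in>Qs B. pfam S P) \<and> (\<forall>Q\<in>{q B f | f. f \<notin> B}. \<exists>P\<in>Qs B. Q \<le> P)" ..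
  have Qs: "B \<in> \<B> ==> finite (Qs B)" "B \<in> \<B> ==> P \<in> Qs B ==> pfam S P"
    "B \<in> \<B> ==> f \<notin> B ==> \<exists>P\<in>Qs B. q B f \<le> P" for B P f using Q by blast+
  have "finite (\<Union>(Qs ` \<B>))" using fB Qs(1) by blast
  then obtain e x where e: "0 < e" "x \<in> S e" "\<forall>Q\<in>\<Union>(Qs ` \<B>). x \<notin> Q e" using graded_avoidance[of "\<Union>(Qs ` \<B>)"] Qs(2) by blast
  have xM: "x \<in> M" using e by (auto simp: S_def)
  moreover have "f \<in> B" if xf: "B \<in> \<B>" "x * f \<in> B" for B f
  proof (rule ccontr)
    assume "f \<notin> B"
    then obtain P where P: "P \<in> Qs B" "q B f \<le> P" using Qs(3) xf by blast
    have "x \<in> q B f e" using e xf by (auto simp: q_def)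
    thus False using le_funD[OF P(2), of e] P(1) xf e(3) by blast
  qed
  ultimately show ?thesis by blast
qed

primrec rseq :: "'r::comm_ring_1 set => 'r list => bool" where
  "rseq B [] = True"
| "rseq B (x # xs) = (nzd B x \<and> rseq (adj B x) xs)"

lemma rseq_append: "rseq B (xs @ ys) \<longleftrightarrow> rseq B xs \<and> rseq (adjs B xs) ys"
  by (induction xs arbitrary: B) auto

text \<open>Depth of the ring modulo \<open>B\<close> along \<open>M\<close>, as existence of a
  regular sequence of length \<open>n\<close>. The parameter \<open>B\<close> turns division by an
  element into \<open>adj\<close>.\<close>

definition dpt :: "'r::comm_ring_1 set => 'r set => nat => bool" where
  "dpt M B n \<longleftrightarrow> (\<exists>xs. length xs = n \<and> set xs <= M \<and> rseq B xs)"

lemma dpt_Suc: "dpt M B (Suc n) \<longleftrightarrow> (\<exists>x\<in>M. nzd B x \<and> dpt M (adj B x) n)"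
proof
  assume "dpt M B (Suc n)"
  then obtain xs where "length xs = Suc n" "set xs <= M" "rseq B xs" unfolding dpt_def by blast
  thus "\<exists>x\<in>M. nzd B x \<and> dpt M (adj B x) n" unfolding dpt_def by (cases xs) auto
next
  assume "\<exists>x\<in>M. nzd B x \<and> dpt M (adj B x) n"
  then obtain x xs where "x \<in> M" "nzd B x" "length xs = n" "set xs <= M" "rseq (adj B x) xs" unfolding dpt_def by blast
  thus "dpt M B (Suc n)" unfolding dpt_def by (intro exI[of _ "x # xs"]) auto
qed

lemma dpt_0: "dpt M B 0" by (simp add: dpt_def)

lemma nzd_swap:
  assumes B: "idealp B" and x: "nzd B x" and y: "nzd (adj B x) y" shows "nzd (adj B y) x"
proof (intro allI impI)
  fix s assume "x * s \<in> adj B y"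
  then obtain t where t: "x * s - t * y \<in> B" by (auto simp: adj_iff)
  have "y * t - s * x \<in> B" using idealp_neg[OF B t] by (simp add: mult.commute)
  hence "t \<in> adj B x" using y unfolding adj_iff by blast
  then obtain u where u: "t - u * x \<in> B" by (auto simp: adj_iff)
  have "x * (s - u * y) \<in> B"
    using idealp_add[OF B t idealp_mult[OF B u, of y]] by (simp add: algebra_simps)
  thus "s \<in> adj B y" using x unfolding adj_iff by blast
qed

text \<open>All maximal regular sequences have the same length: a common regular element \<open>y\<close> is found by
  prime avoidance, since a socle element modulo \<open>B + c\<close> would produce one modulo \<open>B + x\<close>.\<close>

lemma depth_exchange:
  assumes Z: "noeth Z" and M: "idealp M"
  shows "idealp B ==> Z <= B ==> c \<in> M ==> nzd B c ==> dpt M B (Suc n) ==> dpt M (adj B c) n"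
proof (induction n arbitrary: B c)
  case 0 thus ?case by (simp add: dpt_0)
next
  case (Suc n)
  note B = Suc.prems(1)
  obtain x where x: "x \<in> M" "nzd B x" "dpt M (adj B x) (Suc n)" using Suc.prems(5) unfolding dpt_Suc[of M B] by blast
  obtain x2 where x2: "x2 \<in> M" "nzd (adj B x) x2" using x(3) unfolding dpt_Suc[of M "adj B x"] by blast
  have socc: "\<exists>a\<in>M. a * s \<notin> adj B c" if s: "s \<notin> adj B c" for s
  proof (rule ccontr)
    assume "\<not> ?thesis"
    hence Ms: "a * s \<in> adj B c" if "a \<in> M" for a using that by blast
    obtain t where t: "x * s - t * c \<in> B" using Ms[OF x(1)] by (auto simp: adj_iff)
    have "x2 * t \<in> adj B x"
    proof -
      obtain v where v: "x2 * s - v * c \<in> B" using Ms[OF x2(1)] by (auto simp: adj_iff)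
      have "x * (x2 * s - v * c) - x2 * (x * s - t * c) \<in> B" by (intro idealp_diff idealp_mult B v t)
      moreover have "x * (x2 * s - v * c) - x2 * (x * s - t * c) = c * (x2 * t - v * x)" by (simp add: algebra_simps)
      ultimately have "c * (x2 * t - v * x) \<in> B" by (simp only:)
      thus ?thesis using Suc.prems(4) unfolding adj_iff by blast
    qed
    hence "t \<in> adj B x" using x2(2) by blast
    then obtain u where u: "t - u * x \<in> B" by (auto simp: adj_iff)
    have "x * (s - u * c) \<in> B" using idealp_add[OF B t idealp_mult[OF B u, of c]] by (simp add: algebra_simps)
    hence "s \<in> adj B c" using x(2) unfolding adj_iff by blast
    thus False using s by blast
  qed
  have "\<exists>y\<in>M. \<forall>B'\<in>{B, adj B x, adj B c}. nzd B' y"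
  proof (rule nzd_exists[OF Z M])
    fix B' assume "B' \<in> {B, adj B x, adj B c}"
    thus "idealp B' \<and> Z <= B'" using B Suc.prems(2) idealp_adj adj_subset by blast
  next
    fix B' f assume "B' \<in> {B, adj B x, adj B c}" "f \<notin> B'"
    thus "\<exists>a\<in>M. a * f \<notin> B'" using x x2 socc by blast
  qed simp
  then obtain y where y: "y \<in> M" "nzd B y" "nzd (adj B x) y" "nzd (adj B c) y" by blast
  have "dpt M (adj (adj B x) y) n"
    by (rule Suc.IH[OF idealp_adj[OF B] _ y(1) y(3) x(3)]) (use Suc.prems(2) adj_subset in blast)
  hence "dpt M (adj (adj B y) x) n" by (subst adj_commute)
  hence "dpt M (adj B y) (Suc n)" unfolding dpt_Suc using x(1) nzd_swap[OF B x(2) y(3)] by blast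
  hence "dpt M (adj (adj B y) c) n"
    by (rule_tac Suc.IH[OF idealp_adj[OF B] _ Suc.prems(3) nzd_swap[OF B Suc.prems(4) y(4)]]) (use Suc.prems(2) adj_subset in blast)
  hence "dpt M (adj (adj B c) y) n" by (subst adj_commute)
  thus ?case unfolding dpt_Suc using y by blast
qed

lemma depth_exchange_list:
  assumes Z: "noeth Z" and M: "idealp M"
  shows "idealp B ==> Z <= B ==> set xs <= M ==> rseq B xs ==> dpt M B (length xs + n) ==> dpt M (adjs B xs) n"
proof (induction xs arbitrary: B)
  case (Cons x xs)
  have "dpt M (adj B x) (length xs + n)"
    by (rule depth_exchange[OF Z M Cons.prems(1,2)]) (use Cons.prems in auto)
  thus ?case using Cons.IH[of "adj B x"] Cons.prems idealp_adj[OF Cons.prems(1)] adj_subset[of B x] by auto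
qed simp

text \<open>Among the ideals inside \<open>M\<close> that admit regular sequences of every length a
  maximal one \<open>B\<close> is taken. A regular element is not in \<open>B\<close>, and by
  \<open>depth_exchange\<close> adjoining it keeps all lengths available, against
  maximality.\<close>

lemma depth_finite:
  assumes Z: "noeth Z" "idealp Z" and M: "idealp M" "Z <= M" "M \<noteq> UNIV"
  shows "\<exists>n. \<not> dpt M Z n"
proof (rule ccontr)
  assume "\<not> ?thesis"
  hence a: "dpt M Z n" for n by blast
  let ?S = "{B. idealp B \<and> Z <= B \<and> B <= M \<and> (\<forall>n. dpt M B n)}"
  have ne: "?S \<noteq> {}" using a Z M by blast
  have "\<exists>B\<in>?S. \<forall>B'\<in>?S. \<not> B \<subset> B'" by (rule noeth_max[OF Z(1) ne]) blast
  then obtain B where B: "idealp B" "Z <= B" "B <= M" "\<And>n. dpt M B n" and mx: "\<forall>B'\<in>?S. \<not> B \<subset> B'" by blast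
  obtain x where x: "x \<in> M" "nzd B x" using B(4)[of "Suc 0"] unfolding dpt_Suc by blast
  have "x \<notin> B"
  proof
    assume "x \<in> B"
    hence "1 \<in> B" using x(2)[THEN spec, of 1] by simp
    thus False using idealp_one[OF B(1)] B(3) M by blast
  qed
  moreover have "adj B x \<in> ?S"
    using idealp_adj[OF B(1)] adj_subset[of B x] B adj_least[OF M(1) B(3) x(1)] depth_exchange[OF Z(1) M(1) B(1,2) x B(4)] by blast
  ultimately show False using mx adj_subset[of B x] adj_self[OF B(1), of x] by blast
qed

section \<open>Prime ideals, chains and finite colength\<close>

definition primep :: "'r::comm_ring_1 set => bool" where
  "primep P \<longleftrightarrow> idealp P \<and> P \<noteq> UNIV \<and> (\<forall>a b. a * b \<in> P --> a \<in> P \<or> b \<in> P)"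

text \<open>An ideal that is maximal among those above \<open>B\<close> and disjoint from the
  multiplicative set \<open>S\<close> is prime.\<close>

lemma prime_avoiding:
  assumes Z: "noeth Z" and B: "idealp B" "Z <= B" and S: "1 \<in> S" "\<And>a b. a \<in> S ==> b \<in> S ==> a * b \<in> S" "B \<inter> S = {}"
  shows "\<exists>P. primep P \<and> B <= P \<and> P \<inter> S = {}"
proof -
  let ?S = "{P. idealp P \<and> B <= P \<and> P \<inter> S = {}}"
  have ne: "?S \<noteq> {}" using B S by blast
  have "\<exists>P\<in>?S. \<forall>P'\<in>?S. \<not> P \<subset> P'" by (rule noeth_max[OF Z ne]) (use B in blast)
  then obtain P where P: "idealp P" "B <= P" "P \<inter> S = {}" and mx: "\<forall>P'\<in>?S. \<not> P \<subset> P'" by blast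
  have hit: "\<exists>s\<in>S. s \<in> adj P a" if "a \<notin> P" for a
  proof -
    have "P \<subset> adj P a" using that adj_subset adj_self[OF P(1)] by blast
    hence "adj P a \<notin> ?S" using mx by blast
    thus ?thesis using idealp_adj[OF P(1), of a] adj_subset[of P a] P(2) by blast
  qed
  have "a \<in> P \<or> b \<in> P" if ab: "a * b \<in> P" for a b
  proof (rule ccontr)
    assume "\<not> ?thesis"
    then obtain s t where st: "s \<in> S" "s \<in> adj P a" "t \<in> S" "t \<in> adj P b" using hit by metis
    obtain c d where cd: "s - c * a \<in> P" "t - d * b \<in> P" using st by (auto simp: adj_iff)
    have "t * (s - c * a) + c * a * (t - d * b) + c * d * (a * b) \<in> P" by (intro idealp_add idealp_mult P cd ab)
    moreover have "t * (s - c * a) + c * a * (t - d * b) + c * d * (a * b) = s * t" by (simp add: algebra_simps)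
    ultimately show False using S(2)[OF st(1,3)] P(3) by auto
  qed
  moreover have "P \<noteq> UNIV" using S(1) P(3) by blast
  ultimately show ?thesis using P unfolding primep_def by blast
qed

text \<open>A nonzerodivisor lies in no minimal prime: the multiplicative set of all
  \<open>s * y ^ k\<close> with \<open>s\<close> outside \<open>P\<close> misses \<open>B\<close>,
  so some prime above \<open>B\<close> avoids it; such a prime is contained in \<open>P\<close> and
  does not contain \<open>y\<close>.\<close>

lemma prime_below:
  assumes Z: "noeth Z" and B: "idealp B" "Z <= B" and P: "primep P" "B <= P" and y: "nzd B y" "y \<in> P"
  shows "\<exists>P'. primep P' \<and> B <= P' \<and> P' \<subset> P"
proof -
  let ?S = "{s * y ^ k | s k. s \<notin> P}"
  have pw: "s \<in> B" if "s * y ^ k \<in> B" for s k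
    using that
  proof (induction k)
    case (Suc k)
    hence "y * (s * y ^ k) \<in> B" by (simp add: mult_ac)
    thus ?case using y(1) Suc.IH by blast
  qed simp
  have "\<exists>P'. primep P' \<and> B <= P' \<and> P' \<inter> ?S = {}"
  proof (rule prime_avoiding[OF Z B])
    have "1 \<notin> P" using P(1) idealp_one[of P] unfolding primep_def by blast
    thus "1 \<in> ?S" by (intro CollectI exI[of _ 1] exI[of _ 0]) auto
    fix a b assume "a \<in> ?S" "b \<in> ?S"
    then obtain s k t j where st: "a = s * y ^ k" "s \<notin> P" "b = t * y ^ j" "t \<notin> P" by blast
    have "a * b = (s * t) * y ^ (k + j)" by (simp add: st power_add mult_ac)
    moreover have "s * t \<notin> P" using P(1) st unfolding primep_def by blast
    ultimately show "a * b \<in> ?S" by blast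
  next
    show "B \<inter> ?S = {}" using pw P(2) by blast
  qed
  then obtain P' where P': "primep P'" "B <= P'" "P' \<inter> ?S = {}" by blast
  have "P' <= P"
  proof
    fix a assume a: "a \<in> P'"
    show "a \<in> P"
    proof (rule ccontr)
      assume n: "a \<notin> P"
      have "a * y ^ 0 \<in> ?S" using n by blast
      thus False using P'(3) a by auto
    qed
  qed
  moreover have "y \<notin> P'"
  proof -
    have "1 \<notin> P" using P(1) idealp_one[of P] unfolding primep_def by blast
    hence "1 * y ^ 1 \<in> ?S" by blast
    thus ?thesis using P'(3) by auto
  qed
  ultimately show ?thesis using P' y(2) by blast
qed

text \<open>Depth is at most height: reading the sequence from its end, each element forces a
  strictly smaller prime.\<close>

lemma rseq_prime_chain:
  assumes Z: "noeth Z" and B: "idealp B" "Z <= B"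
  shows "rseq B xs ==> primep P ==> B <= P ==> set xs <= P ==>
    \<exists>C. (\<forall>i\<le>length xs. primep (C i) \<and> B <= C i) \<and> (\<forall>i<length xs. C i \<subset> C (Suc i)) \<and> C (length xs) = P"
proof (induction xs arbitrary: P rule: rev_induct)
  case Nil thus ?case by (intro exI[of _ "\<lambda>_. P"]) auto
next
  case (snoc x xs)
  have P: "idealp P" using snoc.prems by (simp add: primep_def)
  have "\<exists>P'. primep P' \<and> adjs B xs <= P' \<and> P' \<subset> P"
    by (rule prime_below[OF Z, where y = x])
       (use snoc.prems B adjs_subset[of B xs] adjs_least[OF P snoc.prems(3), of xs] in \<open>auto simp: rseq_append idealp_adjs\<close>)
  then obtain P' where P': "primep P'" "adjs B xs <= P'" "P' \<subset> P" by blast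
  have "B <= P'" "set xs <= P'" using P'(2) adjs_subset[of B xs] adjs_mem[OF B(1), of _ xs] by blast+
  then obtain C where C: "\<forall>i\<le>length xs. primep (C i) \<and> B <= C i" "\<forall>i<length xs. C i \<subset> C (Suc i)" "C (length xs) = P'"
    using snoc.IH[OF _ P'(1)] snoc.prems by (auto simp: rseq_append)
  let ?C = "C(Suc (length xs) := P)"
  have "\<forall>i\<le>length (xs @ [x]). primep (?C i) \<and> B <= ?C i" using C(1) snoc.prems by (auto simp: le_Suc_eq)
  moreover have "\<forall>i<length (xs @ [x]). ?C i \<subset> ?C (Suc i)" using C(2,3) P'(3) by (auto simp: less_Suc_eq)
  ultimately show ?case by (intro exI[of _ ?C]) auto
qed

text \<open>Let \<open>V\<close> be maximal above \<open>Y\<close> with infinite colength. For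
  \<open>z\<close> in \<open>m\<close> outside \<open>V\<close> with a power in \<open>V\<close>,
  both \<open>colon V z\<close> and \<open>adj V z\<close> are strictly larger, and their finite
  colengths would add up to that of \<open>V\<close>.\<close>

lemma nil_colen_finite:
  assumes Z: "noeth Z" and m: "idealp m" "colen m \<noteq> \<infinity>" and Y: "idealp Y" "Z <= Y" "\<And>z. z \<in> m ==> \<exists>N. z ^ N \<in> Y"
  shows "colen Y \<noteq> \<infinity>"
proof
  assume inf: "colen Y = \<infinity>"
  let ?S = "{V. idealp V \<and> Y <= V \<and> colen V = \<infinity>}"
  have ne: "?S \<noteq> {}" using inf Y by blast
  have "\<exists>V\<in>?S. \<forall>W\<in>?S. \<not> V \<subset> W" by (rule noeth_max[OF Z ne]) (use Y in blast)
  then obtain V where VS: "V \<in> ?S" and mxS: "\<forall>W\<in>?S. \<not> V \<subset> W" by (rule bexE)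
  have V: "idealp V" "Y <= V" "colen V = \<infinity>" using VS by auto
  have mx: "colen W \<noteq> \<infinity>" if "idealp W" "V \<subset> W" for W
  proof
    assume "colen W = \<infinity>"
    hence "W \<in> ?S" using that V(2) by auto
    thus False using mxS that(2) by blast
  qed
  have "\<not> m <= V" using colen_antimono[OF m(1) V(1)] V(3) m(2) by auto
  then obtain z where z: "z \<in> m" "z \<notin> V" by blast
  have ex: "\<exists>N. z ^ N \<in> V" using Y(3)[OF z(1)] V(2) by blast
  define N where "N = (LEAST N. z ^ N \<in> V)"
  have N: "z ^ N \<in> V" unfolding N_def by (rule LeastI_ex[OF ex])
  have V1: "V \<noteq> UNIV" using V(3) by auto
  have "N \<noteq> 0" using N idealp_one[OF V(1)] V1 by (cases N) auto
  then obtain k where k: "N = Suc k" by (cases N) auto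
  have "z ^ k \<notin> V" using not_less_Least[of k "\<lambda>N. z ^ N \<in> V"] k unfolding N_def by simp
  moreover have "z ^ k \<in> colon V z" using N k by (simp add: colon_def mult.commute)
  moreover have "V <= colon V z" unfolding colon_def using idealp_mult2[OF V(1)] by blast
  ultimately have "colen (colon V z) \<noteq> \<infinity>" by (intro mx idealp_colon V) blast
  moreover have "colen (adj V z) \<noteq> \<infinity>" by (intro mx idealp_adj V) (use z adj_subset adj_self[OF V(1)] in blast)
  ultimately show False using colen_adj[OF V(1), of z] V(3) by (cases "colen (colon V z)"; cases "colen (adj V z)") auto
qed

lemma colen_adj_pow:
  assumes W: "idealp W" shows "colen (adj W (z ^ n)) \<le> enat n * colen (adj W z)"
proof (induction n)
  case 0
  have "adj W 1 = UNIV" using adj_self[OF W, of 1] idealp_one[OF idealp_adj[OF W]] by blast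
  thus ?case by simp
next
  case (Suc n)
  let ?V = "adj W (z ^ Suc n)"
  have V: "idealp ?V" by (rule idealp_adj[OF W])
  have "adj ?V (z ^ n) = adj W (z ^ n)"
  proof (rule subset_antisym)
    show "adj ?V (z ^ n) <= adj W (z ^ n)"
      using adj_mem[OF W, of z "z ^ n"] by (intro adj_least idealp_adj W adj_subset adj_self) simp
    show "adj W (z ^ n) <= adj ?V (z ^ n)" by (intro adj_mono adj_subset)
  qed
  moreover have "adj W z <= colon ?V (z ^ n)"
    by (rule adj_least[OF idealp_colon[OF V]])
      (use adj_subset[of W "z ^ Suc n"] idealp_mult2[OF W] adj_self[OF W, of "z ^ Suc n"] in \<open>auto simp: colon_def\<close>)
  hence "colen (colon ?V (z ^ n)) \<le> colen (adj W z)" by (intro colen_antimono idealp_adj idealp_colon W V)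
  ultimately have "colen ?V \<le> colen (adj W z) + enat n * colen (adj W z)"
    using colen_adj[OF V, of "z ^ n"] Suc.IH by (metis add_mono)
  thus ?case by (simp add: eSuc_enat[symmetric] mult_eSuc)
qed

lemma adjs_adj: "adjs (adj U x) xs = adj (adjs U xs) x"
proof (induction xs arbitrary: U)
  case (Cons y ys) thus ?case by (simp add: adj_commute[of U x y])
qed simp

lemma colen_adjs_pow:
  assumes "idealp W" shows "colen (adjs W (map (\<lambda>z. z ^ n) zs)) \<le> enat (n ^ length zs) * colen (adjs W zs)"
  using assms
proof (induction zs arbitrary: W)
  case (Cons z zs)
  have "colen (adjs (adj W (z ^ n)) (map (\<lambda>z. z ^ n) zs)) \<le> enat (n ^ length zs) * colen (adjs (adj W (z ^ n)) zs)"
    by (rule Cons.IH[OF idealp_adj[OF Cons.prems]])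
  moreover have "colen (adjs (adj W (z ^ n)) zs) \<le> enat n * colen (adjs (adj W z) zs)"
    unfolding adjs_adj by (rule colen_adj_pow[OF idealp_adjs[OF Cons.prems]])
  ultimately have "colen (adjs (adj W (z ^ n)) (map (\<lambda>z. z ^ n) zs)) \<le> enat (n ^ length zs) * (enat n * colen (adjs (adj W z) zs))"
    by (meson mult_left_mono order_trans zero_le)
  thus ?case by (simp add: mult.assoc[symmetric] times_enat_simps mult.commute)
qed (simp add: flip: one_enat_def One_nat_def)

text \<open>A ring that is local modulo \<open>Z\<close>: elements outside \<open>m\<close> are
  invertible up to \<open>Z\<close>. This is how a local ring appears inside the free ring that
  covers it.\<close>

locale locr =
  fixes Z m :: "'r::comm_ring_1 set"
  assumes noe: "noeth Z" and Zid: "idealp Z" and mp: "primep m" and Zm: "Z <= m"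
    and unit: "a \<notin> m ==> \<exists>t. t * a - 1 \<in> Z"
begin

lemma m_ideal: "idealp m" using mp by (simp add: primep_def)

lemma one_m: "1 \<notin> m" using mp idealp_one[of m] by (auto simp: primep_def)

lemma proper_sub_m: assumes "idealp V" "Z <= V" "V \<noteq> UNIV" shows "V <= m"
proof
  fix a assume a: "a \<in> V"
  show "a \<in> m"
  proof (rule ccontr)
    assume "a \<notin> m"
    then obtain t where "t * a - 1 \<in> V" using unit assms by blast
    hence "1 \<in> V" using idealp_cancel'[OF assms(1)] idealp_mult[OF assms(1) a] by blast
    thus False using idealp_one assms by blast
  qed
qed

lemma colen_m: "colen m = 1"
proof -
  have "1 \<in> adj m y" if y: "y \<notin> m" for y
  proof -
    obtain t where "t * y - 1 \<in> m" using unit[OF y] Zm by blast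
    thus ?thesis using idealp_neg[OF m_ideal, of "t * y - 1"] by (auto simp: adj_iff)
  qed
  thus ?thesis using colen_one_iff[OF m_ideal] one_m by blast
qed

text \<open>Let \<open>W\<close> be maximal among the ideals from \<open>V\<close> up to
  \<open>Y\<close> and different from \<open>Y\<close>. If \<open>a * y\<close> were outside
  \<open>W\<close>, then \<open>y\<close> would be a multiple \<open>c * (a * y)\<close> modulo
  \<open>W\<close>, and since \<open>1 - c * a\<close> is a unit, \<open>y\<close> would lie in
  \<open>W\<close>.\<close>

lemma nakayama:
  assumes V: "idealp V" "Z <= V" and Y: "idealp Y" "V <= Y" and gen: "Y <= isum (lcomb as Y) V" and as: "set as <= m"
  shows "Y = V"
proof (rule ccontr)
  assume "Y \<noteq> V"
  let ?S = "{W. idealp W \<and> V <= W \<and> W \<subset> Y}"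
  have ne: "?S \<noteq> {}" using \<open>Y \<noteq> V\<close> V Y by blast
  have "\<exists>W\<in>?S. \<forall>W'\<in>?S. \<not> W \<subset> W'" by (rule noeth_max[OF noe ne]) (use V in blast)
  then obtain W where WS: "W \<in> ?S" and mxS: "\<forall>W'\<in>?S. \<not> W \<subset> W'" by (rule bexE)
  have W: "idealp W" "V <= W" "W \<subset> Y" using WS by auto
  have mx: "\<not> W \<subset> W'" if "idealp W'" "V <= W'" "W' \<subset> Y" for W' using bspec[OF mxS, of W'] that by auto
  have "a * y \<in> W" if a: "a \<in> m" and y: "y \<in> Y" for a y
  proof (rule ccontr)
    assume n: "a * y \<notin> W"
    let ?W = "adj W (a * y)"
    have "W \<subset> ?W" using n adj_subset adj_self[OF W(1)] by blast
    moreover have "?W <= Y" using W y by (intro adj_least Y idealp_mult) auto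
    ultimately have "?W = Y" using mx[of ?W] idealp_adj[OF W(1)] W(2) by blast
    then obtain c where c: "y - c * (a * y) \<in> W" using y by (auto simp: adj_iff)
    have "1 - c * a \<notin> m"
    proof
      assume "1 - c * a \<in> m"
      hence "1 \<in> m" using idealp_cancel[OF m_ideal] idealp_mult[OF m_ideal a] by blast
      thus False using one_m by blast
    qed
    then obtain t where t: "t * (1 - c * a) - 1 \<in> W" using unit V W by blast
    have "t * (y - c * (a * y)) - y * (t * (1 - c * a) - 1) \<in> W" by (intro idealp_diff idealp_mult W c t)
    hence "y \<in> W" by (simp add: algebra_simps)
    thus False using n idealp_mult[OF W(1)] by blast
  qed
  hence "lcomb as Y <= W" using as by (intro lcomb_least W) blast
  hence "Y <= W" using gen isum_least[OF W(1) _ W(2)] by blast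
  thus False using W(3) by blast
qed

text \<open>Artin-Rees is applied to a constant family, the intersection \<open>Y\<close> of all
  \<open>V + G n\<close>. Its conclusion says that \<open>Y\<close> is generated over itself by
  \<open>as\<close> modulo \<open>V\<close>, and Nakayama's lemma finishes.\<close>

lemma krull_intersection:
  assumes G: "filt G" and gen: "\<And>n. G (Suc n) <= isum (lcomb as (G n)) Z" and as: "set as <= G 1" "G 1 <= m"
    and V: "idealp V" "Z <= V" and f: "\<And>n. f \<in> isum V (G n)"
  shows "f \<in> V"
proof -
  define U where "U n = isum V (G n)" for n
  define Y where "Y = (\<Inter>n. U n)"
  have idU: "idealp (U n)" for n unfolding U_def by (rule idealp_isum[OF V(1) filt_ideal[OF G]])
  have idY: "idealp Y" using idU unfolding Y_def idealp_def by auto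
  have VU: "V <= U n" for n unfolding U_def by (rule isum_subset1[OF filt_ideal[OF G]])
  have VY: "V <= Y" using VU by (auto simp: Y_def)
  have "\<exists>n1. \<forall>n\<ge>n1. (\<lambda>_. Y) (Suc n) <= isum (lcomb as ((\<lambda>_. Y) n)) ((\<lambda>_. V) (Suc n))"
  proof (rule artin_rees[where U = U and ?n0.0 = 0])
    fix a n x assume a: "a \<in> set as" "x \<in> U n"
    then obtain v g where x: "x = v + g" "v \<in> V" "g \<in> G n" by (auto simp: U_def isum_def)
    have "a * g \<in> G (Suc n)" using filt_mult[OF G, of a 1 g n] a as x by auto
    hence "a * v + a * g \<in> U (Suc n)" unfolding U_def using idealp_mult[OF V(1) x(2)] by (rule_tac isumI)
    thus "a * x \<in> U (Suc n)" by (simp add: x distrib_left)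
  next
    fix n
    have "V <= isum (lcomb as (U n)) V" by (rule isum_subset2[OF idealp_lcomb[OF idU]])
    moreover have "G (Suc n) <= isum (lcomb as (U n)) V"
      using gen[of n] isum_mono[OF lcomb_mono[of "G n" "U n" as] V(2)] isum_subset2[OF V(1), of "G n"] unfolding U_def by blast
    ultimately show "U (Suc n) <= isum (lcomb as (U n)) V"
      unfolding U_def[of "Suc n"] by (intro isum_least idealp_isum idealp_lcomb idU V)
  next
    fix n and H :: "nat => 'r set" assume "\<And>i. idealp (H i)" "\<And>i. V <= H i" "\<And>i. H i <= H (Suc i)"
    thus "\<exists>k. \<forall>j. H j <= H k" using V(2) by (intro noethD[OF noe]) blast+
  qed (use idU idY V VY in \<open>auto simp: Y_def intro: idealp_mult\<close>)
  hence "Y <= isum (lcomb as Y) V" by blast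
  hence "Y = V" using as by (intro nakayama[OF V idY VY]) auto
  thus ?thesis using f by (auto simp: Y_def U_def)
qed

end

section \<open>Translation from carrier-based rings\<close>

lemma rseq_nth: "rseq B xs \<longleftrightarrow> (\<forall>i<length xs. nzd (adjs B (take i xs)) (xs ! i))"
proof (induction xs arbitrary: B)
  case (Cons x xs)
  show ?case unfolding rseq.simps Cons.IH by (auto simp: All_less_Suc2)
qed simp

lemma adjs_mult_lcomb:
  assumes "idealp Z" "idealp S" "a \<in> adjs Z as" "b \<in> S" shows "a * b \<in> isum (lcomb as S) Z"
proof -
  let ?T = "isum (lcomb as S) Z"
  have T: "idealp ?T" by (intro idealp_isum idealp_lcomb assms)
  have "adjs Z as <= colon ?T b"
  proof (rule adjs_least[OF idealp_colon[OF T]])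
    show "Z <= colon ?T b"
      using isum_subset2[OF idealp_lcomb[OF assms(2)], of Z as] idealp_mult2[OF assms(1)] by (auto simp: colon_def)
    show "set as <= colon ?T b"
      using isum_subset1[OF assms(1), of "lcomb as S"] lcomb_mem[OF assms(2) _ assms(4)] by (auto simp: colon_def)
  qed
  thus ?thesis using assms(3) by (auto simp: colon_def)
qed

context cring
begin

text \<open>Preimages under \<open>cov\<close> identify the ideals of \<open>R\<close> with the
  ideals of the free ring above the kernel; lengths, primes and regular sequences are transported
  along this bijection.\<close>

definition pb :: "'a set => 'a fr set" where "pb K = {x. cov R x \<in> K}"
abbreviation kr :: "'a fr set" where "kr \<equiv> pb {\<zero>}"

lemma cov_diff: "cov R (x - y) = cov R x \<ominus> cov R y"
  using cov_hom(1)[of x "- y"] by (simp add: cov_hom(5) minus_eq)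

lemma pb_ideal: assumes "ideal K R" shows "idealp (pb K)" "kr <= pb K"
proof -
  interpret ideal K R by fact
  show "idealp (pb K)" by (rule idealpI) (auto simp: pb_def cov_hom cov_closed I_l_closed)
  show "kr <= pb K" by (auto simp: pb_def)
qed

lemma im_ideal: assumes "idealp V" shows "ideal (cov R ` V) R"
proof (rule idealI[OF ring_axioms])
  show "subgroup (cov R ` V) (add_monoid R)"
  proof (rule add.subgroupI)
    show "cov R ` V <= carrier R" using cov_closed by auto
    show "cov R ` V \<noteq> {}" using idealp_zero[OF assms] by auto
    show "\<And>a. a \<in> cov R ` V ==> \<ominus> a \<in> cov R ` V" using idealp_neg[OF assms] by (auto simp: cov_hom(5)[symmetric])
    show "\<And>a b. a \<in> cov R ` V ==> b \<in> cov R ` V ==> a \<oplus> b \<in> cov R ` V"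
      using idealp_add[OF assms] by (auto simp: cov_hom(1)[symmetric])
  qed
  fix a x assume a: "a \<in> cov R ` V" "x \<in> carrier R"
  then obtain v r where "v \<in> V" "a = cov R v" "x = cov R r" using cov_surj by blast
  hence "x \<otimes> a = cov R (r * v)" "r * v \<in> V" using idealp_mult[OF assms] by (auto simp: cov_hom)
  thus "x \<otimes> a \<in> cov R ` V" by blast
  thus "a \<otimes> x \<in> cov R ` V" using a cov_closed m_comm by auto
qed

lemma pb_im: assumes "idealp V" "kr <= V" shows "pb (cov R ` V) = V"
proof -
  have "x \<in> V" if "cov R x = cov R v" "v \<in> V" for x v
  proof -
    have "cov R (x - v) = \<zero>" using that cov_closed[of v] by (simp add: cov_diff)
    hence "x - v \<in> V" using assms(2) by (auto simp: pb_def)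
    thus ?thesis using idealp_cancel[OF assms(1)] that(2) by blast
  qed
  thus ?thesis by (auto simp: pb_def)
qed

lemma im_pb: assumes "K <= carrier R" shows "cov R ` pb K = K"
proof
  show "K <= cov R ` pb K"
  proof
    fix a assume a: "a \<in> K"
    then obtain x where "cov R x = a" using cov_surj assms by blast
    thus "a \<in> cov R ` pb K" using a by (auto simp: pb_def)
  qed
qed (auto simp: pb_def)

lemma ideal_carr: "ideal K R ==> K <= carrier R" using ideal.Icarr by fast

lemma pb_carrier: "pb (carrier R) = UNIV" by (simp add: pb_def cov_closed)

lemma pb_mono: "K <= L ==> pb K <= pb L" by (auto simp: pb_def)

lemma pb_strict: assumes "ideal K R" "ideal L R" "K \<subset> L" shows "pb K \<subset> pb L"
proof -
  have "pb K \<noteq> pb L"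
  proof
    assume "pb K = pb L"
    hence "cov R ` pb K = cov R ` pb L" by simp
    thus False using im_pb[OF ideal_carr] assms by simp
  qed
  thus ?thesis using pb_mono[of K L] assms(3) by blast
qed

lemma im_strict:
  assumes "idealp V" "idealp W" "kr <= V" "kr <= W" "V \<subset> W" shows "cov R ` V \<subset> cov R ` W"
proof -
  have "cov R ` V \<noteq> cov R ` W"
  proof
    assume "cov R ` V = cov R ` W"
    hence "pb (cov R ` V) = pb (cov R ` W)" by simp
    thus False using pb_im assms by simp
  qed
  thus ?thesis using assms(5) by blast
qed

lemma im_UNIV: "cov R ` UNIV = carrier R" using im_pb[of "carrier R"] by (simp add: pb_carrier)

lemma kr_ideal: "idealp kr" using pb_ideal(1)[OF zeroideal] .

lemma im_prime: assumes "primep V" "kr <= V" shows "primeideal (cov R ` V) R"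
proof (rule primeidealI)
  have V: "idealp V" "V \<noteq> UNIV" using assms by (auto simp: primep_def)
  show "ideal (cov R ` V) R" by (rule im_ideal[OF V(1)])
  show "carrier R \<noteq> cov R ` V" using pb_im[OF V(1) assms(2)] V(2) pb_carrier by metis
  fix a b assume ab: "a \<in> carrier R" "b \<in> carrier R" "a \<otimes> b \<in> cov R ` V"
  then obtain x y where xy: "a = cov R x" "b = cov R y" using cov_surj by metis
  hence "x * y \<in> V" using ab(3) pb_im[OF V(1) assms(2)] by (auto simp: pb_def cov_hom[symmetric])
  thus "a \<in> cov R ` V \<or> b \<in> cov R ` V" using assms(1) xy unfolding primep_def by blast
qed (rule is_cring)

lemma pb_prime: assumes "primeideal P R" shows "primep (pb P)"
proof -
  interpret primeideal P R by fact
  have "pb P \<noteq> UNIV" using im_pb[OF ideal_carr[OF ideal_axioms]] im_UNIV I_notcarr by metis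
  moreover have "a \<in> pb P \<or> b \<in> pb P" if "a * b \<in> pb P" for a b
    using that I_prime[of "cov R a" "cov R b"] by (auto simp: pb_def cov_hom cov_closed)
  ultimately show ?thesis using pb_ideal[OF ideal_axioms] unfolding primep_def by blast
qed

lemma noeth_kr: assumes "noetherian_ring R" shows "noeth kr"
  unfolding noeth_def
proof (intro allI impI)
  fix H :: "nat => 'a fr set" assume H: "\<forall>i. idealp (H i) \<and> kr <= H i \<and> H i <= H (Suc i)"
  have mono: "H i <= H j" if "i \<le> j" for i j using lift_Suc_mono_le[of H i j] H that by blast
  let ?C = "range (\<lambda>i. cov R ` H i)"
  have "\<Union>?C \<in> ?C"
  proof (rule noetherian_ring.ideal_chain_is_trivial[OF assms])
    show "subset.chain {I. ideal I R} ?C"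
      unfolding pred_on.chain_def
    proof (intro conjI ballI)
      show "?C <= {I. ideal I R}" using im_ideal H by auto
      fix x y assume "x \<in> ?C" "y \<in> ?C"
      then obtain i j where "x = cov R ` H i" "y = cov R ` H j" by blast
      thus "(\<subset>)\<^sup>=\<^sup>= x y \<or> (\<subset>)\<^sup>=\<^sup>= y x" using mono[of i j] mono[of j i] by (cases "i \<le> j") auto
    qed
  qed simp
  then obtain k where k: "\<Union>?C = cov R ` H k" by blast
  have "H j <= H k" for j
  proof -
    have "cov R ` H j <= cov R ` H k" using k by blast
    thus ?thesis using pb_mono[of "cov R ` H j" "cov R ` H k"] pb_im H by simp
  qed
  thus "\<exists>k. \<forall>j. H j <= H k" by blast
qed

lemma quotient_length_pb:
  assumes K: "ideal K R" shows "quotient_length R K = colen (pb K)"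
proof -
  have "(\<exists>C. C 0 = K \<and> C n = carrier R \<and> (\<forall>i\<le>n. ideal (C i) R) \<and> (\<forall>i<n. C i \<subset> C (Suc i))) \<longleftrightarrow> (\<exists>C. ichain (pb K) UNIV n C)" for n
  proof
    assume "\<exists>C. C 0 = K \<and> C n = carrier R \<and> (\<forall>i\<le>n. ideal (C i) R) \<and> (\<forall>i<n. C i \<subset> C (Suc i))"
    then obtain C where C: "C 0 = K" "C n = carrier R" "\<forall>i\<le>n. ideal (C i) R" "\<forall>i<n. C i \<subset> C (Suc i)" by blast
    have "ichain (pb K) UNIV n (\<lambda>i. pb (C i))"
      unfolding ichain_def using C pb_carrier pb_ideal(1) pb_strict by simp
    thus "\<exists>C. ichain (pb K) UNIV n C" by blast
  next
    assume "\<exists>C. ichain (pb K) UNIV n C"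
    then obtain C where C: "C 0 = pb K" "C n = UNIV" "\<forall>i\<le>n. idealp (C i)" "\<forall>i<n. C i \<subset> C (Suc i)" unfolding ichain_def by blast
    have sub: "kr <= C i" if "i \<le> n" for i
      using that
    proof (induction i)
      case 0 thus ?case using C(1) pb_ideal(2)[OF K] by simp
    next
      case (Suc i) thus ?case using C(4)[THEN spec, of i] by auto
    qed
    have 1: "cov R ` C 0 = K" using C(1) im_pb[OF ideal_carr[OF K]] by simp
    have 2: "cov R ` C n = carrier R" using C(2) im_UNIV by simp
    have 3: "\<forall>i\<le>n. ideal (cov R ` C i) R" using C(3) im_ideal by blast
    have 4: "\<forall>i<n. cov R ` C i \<subset> cov R ` C (Suc i)"
    proof (intro allI impI)
      fix i assume "i < n"
      thus "cov R ` C i \<subset> cov R ` C (Suc i)" using C sub by (intro im_strict) auto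
    qed
    show "\<exists>C. C 0 = K \<and> C n = carrier R \<and> (\<forall>i\<le>n. ideal (C i) R) \<and> (\<forall>i<n. C i \<subset> C (Suc i))"
      by (rule exI[of _ "\<lambda>i. cov R ` C i"]) (use 1 2 3 4 in blast)
  qed
  thus ?thesis unfolding quotient_length_def ilen_def by simp
qed

lemma pb_Idl: "pb (Idl (cov R ` set xs)) = adjs kr xs"
proof (rule subset_antisym)
  have c: "cov R ` set xs <= carrier R" using cov_closed by auto
  have id: "idealp (adjs kr xs)" by (rule idealp_adjs[OF kr_ideal])
  have "Idl (cov R ` set xs) <= cov R ` adjs kr xs"
    using adjs_mem[OF kr_ideal, of _ xs] by (intro genideal_minimal im_ideal id) auto
  thus "pb (Idl (cov R ` set xs)) <= adjs kr xs"
    using pb_mono pb_im[OF id adjs_subset] by blast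
  show "adjs kr xs <= pb (Idl (cov R ` set xs))"
    using genideal_self[OF c] by (intro adjs_least pb_ideal genideal_ideal c) (auto simp: pb_def)
qed

lemma regular_seq_cov:
  "regular_seq R M (map (cov R) xs) \<longleftrightarrow> set xs <= pb M \<and> rseq kr xs \<and> adjs kr xs \<noteq> UNIV"
proof -
  have I: "cov R f \<in> Idl (set (take i (map (cov R) xs))) \<longleftrightarrow> f \<in> adjs kr (take i xs)" for f i
    using pb_Idl[of "take i xs"] by (auto simp: pb_def take_map)
  have "(\<forall>y\<in>carrier R. map (cov R) xs ! i \<otimes> y \<in> Idl (set (take i (map (cov R) xs))) --> y \<in> Idl (set (take i (map (cov R) xs))))
      \<longleftrightarrow> nzd (adjs kr (take i xs)) (xs ! i)" if "i < length xs" for i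
  proof -
    have *: "map (cov R) xs ! i \<otimes> cov R f = cov R (xs ! i * f)" for f using that by (simp add: cov_hom)
    have "(\<forall>y\<in>carrier R. P y) \<longleftrightarrow> (\<forall>f. P (cov R f))" for P using cov_surj cov_closed by metis
    thus ?thesis by (simp only: * I)
  qed
  moreover have "Idl (set (map (cov R) xs)) = carrier R \<longleftrightarrow> adjs kr xs = UNIV"
  proof -
    have "ideal (Idl (cov R ` set xs)) R" by (rule genideal_ideal) (use cov_closed in auto)
    thus ?thesis using pb_Idl[of xs] im_pb[OF ideal_carr] im_UNIV pb_carrier by (metis list.set_map)
  qed
  moreover have "set (map (cov R) xs) <= M \<longleftrightarrow> set xs <= pb M" by (auto simp: pb_def)
  ultimately show ?thesis unfolding regular_seq_def rseq_nth by auto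
qed

text \<open>A supremum that is at least \<open>n\<close> is witnessed by a sequence of length at
  least \<open>n\<close>, which is truncated. Properness of the ideal it generates comes from its
  containment in \<open>M\<close>.\<close>

lemma grade_dpt:
  assumes M: "ideal M R" "M \<noteq> carrier R"
  shows "enat n \<le> grade R M \<longleftrightarrow> dpt (pb M) kr n"
proof
  have pM: "idealp (pb M)" "kr <= pb M" "pb M \<noteq> UNIV"
    using pb_ideal[OF M(1)] im_pb[OF ideal_carr[OF M(1)]] M(2) im_UNIV by auto
  {
    assume "enat n \<le> grade R M"
    hence "\<exists>k\<in>length ` {xs. regular_seq R M xs}. n \<le> k"
      unfolding grade_def image_image[symmetric, of enat length]
    proof (rule enat_le_SUP)
      have "regular_seq R M (map (cov R) [])" unfolding regular_seq_cov using pM by auto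
      thus "length ` {xs. regular_seq R M xs} \<noteq> {}" by blast
    qed
    then obtain ys where ys: "regular_seq R M ys" "n \<le> length ys" by blast
    have "set ys <= carrier R" using ys(1) ideal_carr[OF M(1)] unfolding regular_seq_def by blast
    hence "\<forall>y\<in>set ys. \<exists>x. cov R x = y" using cov_surj by blast
    then obtain f where f: "\<forall>y\<in>set ys. cov R (f y) = y" by metis
    define xs where "xs = map f ys"
    have "ys = map (cov R) xs" using f by (simp add: xs_def map_idI)
    hence "set xs <= pb M" "rseq kr xs" using ys(1) regular_seq_cov by auto
    hence "set (take n xs) <= pb M" "rseq kr (take n xs)"
      using rseq_append[of kr "take n xs" "drop n xs"] set_take_subset[of n xs] by auto
    moreover have "length (take n xs) = n" using ys(2) by (simp add: xs_def)
    ultimately show "dpt (pb M) kr n" unfolding dpt_def by blast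
  next
    assume "dpt (pb M) kr n"
    then obtain xs where xs: "length xs = n" "set xs <= pb M" "rseq kr xs" unfolding dpt_def by blast
    have "adjs kr xs <= pb M" by (rule adjs_least[OF pM(1,2) xs(2)])
    hence "regular_seq R M (map (cov R) xs)" using regular_seq_cov xs pM by blast
    hence "enat (length (map (cov R) xs)) \<le> grade R M" unfolding grade_def by (intro SUP_upper) simp
    thus "enat n \<le> grade R M" using xs(1) by simp
  }
qed

lemma primep_chain_height:
  assumes "\<And>i. i \<le> n ==> primep (C i) \<and> kr <= C i" "\<And>i. i < n ==> C i \<subset> C (Suc i)"
  shows "enat n \<le> krull_dim R" "C n = pb Q ==> Q <= carrier R ==> enat n \<le> ideal_height R Q"
proof -
  have P1: "\<forall>i\<le>n. primeideal (cov R ` C i) R" using assms im_prime by blast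
  have "cov R ` C i \<subset> cov R ` C (Suc i)" if "i < n" for i
    using assms(1)[of i] assms(1)[of "Suc i"] assms(2)[OF that] that by (intro im_strict) (auto simp: primep_def)
  note P = P1 this
  show "enat n \<le> krull_dim R" unfolding krull_dim_def using P
    by (intro SUP_upper CollectI exI[of _ "\<lambda>i. cov R ` C i"]) blast
  assume "C n = pb Q" "Q <= carrier R"
  hence "cov R ` C n = Q" using im_pb by simp
  thus "enat n \<le> ideal_height R Q" using P unfolding ideal_height_def
    by (intro SUP_upper CollectI exI[of _ "\<lambda>i. cov R ` C i"]) blast
qed

text \<open>An element outside the only maximal ideal generates the unit ideal modulo the kernel:
  otherwise the chain condition yields a maximal ideal above it.\<close>

lemma local_locr:
  assumes loc: "local_ring R m" shows "locr kr (pb m)"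
proof -
  have noe: "noeth kr" using loc noeth_kr by (simp add: local_ring_def)
  have m: "maximalideal m R" "\<And>M. maximalideal M R ==> M = m" using loc by (auto simp: local_ring_def)
  have mi: "ideal m R" using m(1) maximalideal.axioms(1) by blast
  have mp: "primep (pb m)" by (rule pb_prime[OF maximalideal_prime[OF m(1)]])
  show ?thesis
  proof (unfold_locales)
    fix a assume a: "a \<notin> pb m"
    have "adj kr a = UNIV"
    proof (rule ccontr)
      assume n: "adj kr a \<noteq> UNIV"
      let ?S = "{V. idealp V \<and> adj kr a <= V \<and> V \<noteq> UNIV}"
      have ne: "?S \<noteq> {}" using n idealp_adj[OF kr_ideal] by blast
      have "\<exists>V\<in>?S. \<forall>W\<in>?S. \<not> V \<subset> W" by (rule noeth_max[OF noe ne]) (use adj_subset[of kr a] in blast)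
      then obtain V where VS: "V \<in> ?S" and mxS: "\<forall>W\<in>?S. \<not> V \<subset> W" by (rule bexE)
      have V: "idealp V" "adj kr a <= V" "V \<noteq> UNIV" using VS by auto
      have kV: "kr <= V" using V(2) adj_subset by blast
      have "maximalideal (cov R ` V) R"
      proof (rule maximalidealI[OF im_ideal[OF V(1)]])
        show "carrier R \<noteq> cov R ` V" using pb_im[OF V(1) kV] V(3) pb_carrier by metis
        fix L assume L: "ideal L R" "cov R ` V <= L" "L <= carrier R"
        have "V <= pb L" using L(2) by (auto simp: pb_def)
        hence "pb L = V \<or> pb L = UNIV" using bspec[OF mxS, of "pb L"] pb_ideal(1)[OF L(1)] V(2) by auto
        thus "L = cov R ` V \<or> L = carrier R" using im_pb[OF L(3)] im_UNIV by metis
      qed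
      hence "pb m = V" using m(2) pb_im[OF V(1) kV] by metis
      thus False using a V(2) adj_self[OF kr_ideal, of a] by blast
    qed
    hence "1 \<in> adj kr a" by simp
    then obtain t where "1 - t * a \<in> kr" by (auto simp: adj_iff)
    thus "\<exists>t. t * a - 1 \<in> kr" using idealp_neg[OF kr_ideal, of "1 - t * a"] by auto
  qed (use noe kr_ideal mp pb_ideal(2)[OF mi] in auto)
qed

lemma ideal_pow_ideal: "ideal I R ==> ideal (ideal_pow R I n) R"
  by (induction n) (auto simp: oneideal ideal_prod_is_ideal)

lemma pb_prod:
  assumes "ideal I R" "ideal K R" "pb I = adjs kr as"
  shows "pb (ideal_prod R I K) = isum (lcomb as (pb K)) kr"
proof (rule subset_antisym)
  let ?T = "isum (lcomb as (pb K)) kr"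
  have T: "idealp ?T" by (intro idealp_isum idealp_lcomb pb_ideal kr_ideal assms)
  have kT: "kr <= ?T" by (rule isum_subset2[OF idealp_lcomb[OF pb_ideal(1)[OF assms(2)]]])
  have "x \<in> cov R ` ?T" if "x \<in> ideal_prod R I K" for x
    using that
  proof (induction rule: ideal_prod.induct)
    case (prod i j)
    then obtain a b where ab: "i = cov R a" "j = cov R b" using cov_surj ideal_carr assms(1,2) by (metis subsetD)
    hence "a * b \<in> ?T" using prod assms(3) by (intro adjs_mult_lcomb kr_ideal pb_ideal assms) (auto simp: pb_def)
    thus ?case unfolding ab cov_hom(2)[symmetric] by (rule imageI)
  next
    case (sum s t) thus ?case using idealp_add[OF T] by (auto simp: cov_hom(1)[symmetric])
  qed
  thus "pb (ideal_prod R I K) <= ?T" using pb_im[OF T kT] pb_mono by blast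
  have P: "idealp (pb (ideal_prod R I K))" "kr <= pb (ideal_prod R I K)" using pb_ideal[OF ideal_prod_is_ideal[OF assms(1,2)]] by auto
  have "a * s \<in> pb (ideal_prod R I K)" if "a \<in> set as" "s \<in> pb K" for a s
  proof -
    have "a \<in> pb I" using that assms(3) adjs_mem[OF kr_ideal] by auto
    thus ?thesis using that ideal_prod.prod[of "cov R a" I "cov R s" K R] by (auto simp: pb_def cov_hom)
  qed
  thus "?T <= pb (ideal_prod R I K)" by (intro isum_least lcomb_least P) auto
qed

lemma pb_pow_Suc:
  assumes "ideal I R" "pb I = adjs kr as"
  shows "pb (ideal_pow R I (Suc n)) = isum (lcomb as (pb (ideal_pow R I n))) kr"
  using pb_prod[OF assms(1) ideal_pow_ideal[OF assms(1)] assms(2)] by simp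

lemma ideal_gens: "noetherian_ring R ==> ideal I R ==> \<exists>as. pb I = adjs kr as"
  using noeth_fg[OF noeth_kr kr_ideal pb_ideal] by blast

lemma filt_pow:
  assumes "noetherian_ring R" "ideal I R" shows "filt (\<lambda>n. pb (ideal_pow R I n))"
proof -
  obtain as where as: "pb I = adjs kr as" using ideal_gens[OF assms] by blast
  let ?G = "\<lambda>n. pb (ideal_pow R I n)"
  note S = pb_pow_Suc[OF assms(2) as]
  have id: "idealp (?G n)" "kr <= ?G n" for n using pb_ideal[OF ideal_pow_ideal[OF assms(2)]] by auto
  have "?G (Suc n) <= ?G n" for n unfolding S by (intro isum_least lcomb_least id) (auto intro: idealp_mult id)
  moreover have "x * y \<in> ?G (m + n)" if "x \<in> ?G m" "y \<in> ?G n" for m n x y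
    using that(1)
  proof (induction m arbitrary: x)
    case 0 thus ?case using that(2) idealp_mult[OF id(1)] by simp
  next
    case (Suc m)
    have "?G (Suc m) <= colon (?G (Suc m + n)) y"
      unfolding S[of m]
    proof (intro isum_least lcomb_least idealp_colon id)
      show "kr <= colon (?G (Suc m + n)) y" using id(2)[of "Suc m + n"] idealp_mult2[OF kr_ideal] by (auto simp: colon_def)
      fix a s assume as: "a \<in> set as" "s \<in> ?G m"
      have "a * (s * y) \<in> lcomb as (?G (m + n))" by (rule lcomb_mem[OF id(1) as(1) Suc.IH[OF as(2)]])
      hence "a * (s * y) \<in> ?G (Suc (m + n))" unfolding S using isum_subset1[OF kr_ideal] by blast
      thus "a * s \<in> colon (?G (Suc m + n)) y" by (simp add: colon_def mult.assoc del: ideal_pow.simps)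
    qed
    thus ?case using Suc.prems by (auto simp: colon_def simp del: ideal_pow.simps)
  qed
  ultimately show ?thesis unfolding filt_def using id pb_carrier by auto
qed

lemma pb_pow_1: assumes "ideal I R" shows "pb (ideal_pow R I 1) = pb I"
proof -
  have "ideal_prod R I (carrier R) = I"
  proof (rule subset_antisym)
    show "ideal_prod R I (carrier R) <= I" using ideal_prod_inter[OF assms oneideal] by blast
    show "I <= ideal_prod R I (carrier R)"
    proof
      fix x assume x: "x \<in> I"
      thus "x \<in> ideal_prod R I (carrier R)" using ideal_prod.prod[OF x one_closed, of R] ideal.Icarr[OF assms x] by simp
    qed
  qed
  thus ?thesis by simp
qed

end

section \<open>Homogeneous regular sequences in the associated graded ring\<close>

text \<open>\<open>co w k f\<close>: the element \<open>f\<close> of \<open>G k\<close> represents the component of degree \<open>k\<close> of the element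
  \<open>w\<close> of (a cover of) the associated graded ring of \<open>G\<close>.\<close>

locale grc =
  fixes G :: "nat => 'r::comm_ring_1 set" and co :: "'g::comm_ring_1 => nat => 'r => bool" and Zg :: "'g set"
  assumes G: "filt G" and Zg: "noeth Zg" "idealp Zg"
    and co_ex: "\<exists>f. co w k f"
    and co_cong: "co w k f ==> co w k f' \<longleftrightarrow> f - f' \<in> G (Suc k)"
    and co_G: "co w k f ==> f \<in> G k"
    and co_add: "co w k f ==> co w' k f' ==> co (w + w') k (f + f')"
    and co_mult: "(\<And>i. i \<le> k ==> co w i (p i)) ==> (\<And>i. i \<le> k ==> co w' i (q i)) ==> co (w * w') k (\<Sum>i\<le>k. p i * q (k - i))"
    and co_hom: "f \<in> G n ==> \<exists>w. co w n f \<and> (\<forall>k. k \<noteq> n --> co w k 0)"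
    and co_fin: "\<exists>K. \<forall>k\<ge>K. co w k 0"
    and co_zero: "w \<in> Zg \<longleftrightarrow> (\<forall>k. co w k 0)"
    and co_1: "co 1 k (if k = 0 then 1 else 0)"
begin

lemma co_0: "co 0 k 0" using co_zero idealp_zero[OF Zg(2)] by blast

lemma co_neg: assumes "co w k f" shows "co (- w) k (- f)"
proof -
  obtain h where h: "co (- w) k h" using co_ex by blast
  have "co 0 k (f + h)" using co_add[OF assms h] by simp
  hence "f + h \<in> G (Suc k)" using co_cong[of 0 k "f + h" 0] co_0 by simp
  thus ?thesis using co_cong[OF h, of "- f"] by (simp add: add.commute)
qed

lemma co_diff: "co w k f ==> co w' k f' ==> co (w - w') k (f - f')"
  using co_add[of w k f "- w'" "- f'"] co_neg[of w' k f'] by simp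

text \<open>The homogeneous ideal with pieces \<open>Q k\<close>. It quantifies over all
  representatives of all components; under \<open>famok\<close> one representative of each component
  suffices (\<open>FI_iff\<close>).\<close>

definition FI :: "(nat => 'r set) => 'g set" where "FI Q = {w. \<forall>k f. co w k f --> f \<in> Q k}"

definition famok :: "(nat => 'r set) => bool" where
  "famok Q \<longleftrightarrow> (\<forall>k. idealp (Q k) \<and> G (Suc k) <= Q k) \<and> (\<forall>j k a b. a \<in> G j --> b \<in> Q k --> a * b \<in> Q (j + k))"

lemma FI_iff: assumes "famok Q" "\<And>k. co w k (p k)" shows "w \<in> FI Q \<longleftrightarrow> (\<forall>k. p k \<in> Q k)"
proof -
  have "f \<in> Q k" if "p k \<in> Q k" "co w k f" for k f
  proof -
    have "p k - f \<in> Q k" using co_cong[OF assms(2)] that(2) assms(1) unfolding famok_def by blast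
    thus ?thesis using idealp_cancel'[of "Q k" "p k" f] that(1) assms(1) by (auto simp: famok_def)
  qed
  thus ?thesis using assms(2) unfolding FI_def by blast
qed

lemma idealp_FI: assumes Q: "famok Q" shows "idealp (FI Q)" "Zg <= FI Q"
proof -
  have id: "idealp (Q k)" for k using Q by (simp add: famok_def)
  show "Zg <= FI Q" using FI_iff[OF Q, of _ "\<lambda>_. 0"] co_zero idealp_zero[OF id] by blast
  have ex: "\<exists>p. \<forall>k. co w k (p k)" for w using choice[of "co w"] co_ex by blast
  show "idealp (FI Q)"
  proof (rule idealpI)
    show "0 \<in> FI Q" using FI_iff[OF Q, of 0 "\<lambda>_. 0"] co_0 idealp_zero[OF id] by blast
  next
    fix v w assume vw: "v \<in> FI Q" "w \<in> FI Q"
    obtain p q where p: "\<And>k. co v k (p k)" "\<And>k. co w k (q k)" using ex by metis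
    have "\<And>k. p k \<in> Q k" "\<And>k. q k \<in> Q k" using FI_iff[OF Q p(1)] FI_iff[OF Q p(2)] vw by blast+
    thus "v + w \<in> FI Q" using FI_iff[OF Q, of "v + w" "\<lambda>k. p k + q k"] co_add[OF p] idealp_add[OF id] by blast
  next
    fix v w assume w: "w \<in> FI Q"
    obtain p q where p: "\<And>k. co v k (p k)" "\<And>k. co w k (q k)" using ex by metis
    have q: "q k \<in> Q k" for k using FI_iff[OF Q p(2)] w by blast
    have "p i * q (k - i) \<in> Q k" if "i \<le> k" for i k
    proof -
      have "p i * q (k - i) \<in> Q (i + (k - i))" using Q q co_G[OF p(1)] unfolding famok_def by blast
      thus ?thesis using that by simp
    qed
    hence "(\<Sum>i\<le>k. p i * q (k - i)) \<in> Q k" for k by (intro idealp_sum id) auto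
    thus "v * w \<in> FI Q" using FI_iff[OF Q, of "v * w" "\<lambda>k. \<Sum>i\<le>k. p i * q (k - i)"] co_mult[OF p] by blast
  qed
qed

definition hg :: "'g => nat => 'r => bool" where "hg w n f \<longleftrightarrow> co w n f \<and> (\<forall>k. k \<noteq> n --> co w k 0)"
definition hm :: "nat => 'r => 'g" where "hm n f = (SOME w. hg w n f)"

lemma hg_hm: "f \<in> G n ==> hg (hm n f) n f"
  unfolding hm_def hg_def by (rule someI_ex[OF co_hom])

lemma hg_mult:
  assumes w: "hg w n f" and v: "\<And>k. co v k (q k)"
  shows "co (w * v) k (if n \<le> k then f * q (k - n) else 0)"
proof -
  have "co (w * v) k (\<Sum>i\<le>k. (if i = n then f else 0) * q (k - i))"
    by (rule co_mult) (use w v in \<open>auto simp: hg_def\<close>)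
  also have "(\<Sum>i\<le>k. (if i = n then f else 0) * q (k - i)) = (\<Sum>i\<le>k. if i = n then f * q (k - n) else 0)"
    by (rule sum.cong) auto
  finally show ?thesis by (simp add: sum.delta)
qed

lemma hg_mult_hg: assumes "hg w n f" "hg v k g" shows "hg (w * v) (n + k) (f * g)"
proof -
  have v: "co v j (if j = k then g else 0)" for j using assms(2) by (auto simp: hg_def)
  have "co (w * v) j (if n \<le> j then f * (if j - n = k then g else 0) else 0)" for j by (rule hg_mult[OF assms(1) v])
  moreover have "(if n \<le> j then f * (if j - n = k then g else 0) else 0) = (if j = n + k then f * g else 0)" for j by auto
  ultimately have "co (w * v) j (if j = n + k then f * g else 0)" for j by metis
  thus ?thesis unfolding hg_def by metis
qed

lemma hg_FI: assumes Q: "famok Q" "hg w n f" shows "w \<in> FI Q \<longleftrightarrow> f \<in> Q n"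
proof -
  have "w \<in> FI Q \<longleftrightarrow> (\<forall>k. (if k = n then f else 0) \<in> Q k)"
    by (rule FI_iff[OF Q(1)]) (use Q(2) in \<open>auto simp: hg_def\<close>)
  also have "\<dots> \<longleftrightarrow> f \<in> Q n" using Q(1) idealp_zero by (auto simp: famok_def split: if_splits)
  finally show ?thesis .
qed

lemma co_poly: "(\<And>j. c j \<in> G j) ==> \<exists>r. \<forall>j. co r j (if j < K then c j else 0)"
proof (induction K)
  case 0 thus ?case using co_0 by auto
next
  case (Suc K)
  then obtain r where r: "\<And>j. co r j (if j < K then c j else 0)" by blast
  have h: "co (hm K (c K)) j (if j = K then c K else 0)" for j using hg_hm[OF Suc.prems] by (auto simp: hg_def)
  have "co (r + hm K (c K)) j (if j < Suc K then c j else 0)" for j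
    using co_add[OF r h, of j] by (cases "j < K"; cases "j = K") auto
  thus ?case by blast
qed

text \<open>The kernel of the map from the graded ring of \<open>G\<close> to that of a larger
  filtration \<open>U\<close>; when \<open>U\<close> arises from \<open>G\<close> by adding an
  ideal, this is the ideal of initial forms.\<close>

definition BU :: "(nat => 'r set) => 'g set" where "BU U = FI (\<lambda>k. U (Suc k))"

lemma famok_U: assumes U: "filt U" "\<And>n. G n <= U n" shows "famok (\<lambda>k. U (Suc k))"
  unfolding famok_def
proof (intro conjI allI impI)
  show "a * b \<in> U (Suc (j + k))" if "a \<in> G j" "b \<in> U (Suc k)" for j k a b
    using filt_mult[OF U(1), of a j b "Suc k"] U(2) that by auto
qed (use filt_ideal[OF U(1)] U(2) in auto)

lemma BU_G: "BU G = Zg"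
proof -
  have "w \<in> BU G \<longleftrightarrow> w \<in> Zg" for w
  proof
    assume w: "w \<in> BU G"
    have "co w k 0" for k
    proof -
      obtain f where f: "co w k f" using co_ex by blast
      hence "f \<in> G (Suc k)" using w by (auto simp: BU_def FI_def)
      thus ?thesis using co_cong[OF f, of 0] by simp
    qed
    thus "w \<in> Zg" using co_zero by blast
  next
    assume "w \<in> Zg" thus "w \<in> BU G" unfolding BU_def using idealp_FI(2)[OF famok_U[OF G]] by blast
  qed
  thus ?thesis by blast
qed

lemma BU_nzd:
  assumes U: "filt U" "\<And>n. G n <= U n" and w: "hg w e x" and R: "Reg U x e"
  shows "nzd (BU U) w"
proof (intro allI impI)
  fix v assume v: "w * v \<in> BU U"
  obtain q where q: "\<And>k. co v k (q k)" using choice[of "co v"] co_ex by blast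
  note ok = famok_U[OF U]
  have "q k \<in> U (Suc k)" for k
  proof -
    have "(if e \<le> k + e then x * q (k + e - e) else 0) \<in> U (Suc (k + e))"
      using v FI_iff[OF ok hg_mult[OF w q]] unfolding BU_def by blast
    thus ?thesis using RegD[OF R, of "q k" "Suc k"] by simp
  qed
  thus "v \<in> BU U" unfolding BU_def using FI_iff[OF ok q] by blast
qed

text \<open>For \<open>x\<close> regular on \<open>U\<close>, adding \<open>x\<close> to the
  filtration adds exactly its class to the initial ideal. Components are treated one by one:
  regularity brings the coefficient of \<open>x\<close> into degree \<open>j\<close>, and finite
  support of \<open>v\<close> lets the coefficients be assembled into one element
  \<open>r\<close>.\<close>

lemma BU_adj:
  assumes V: "idealp V" and U: "\<And>n. U n = isum V (G n)" "filt U" and x: "x \<in> G e" and w: "hg w e x" and R: "Reg U x e"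
  shows "BU (fadj U x) = adj (BU U) w"
proof (rule subset_antisym)
  have GU: "G n <= U n" for n unfolding U(1) by (rule isum_subset2[OF V])
  have VU: "V <= U n" for n unfolding U(1) by (rule isum_subset1[OF filt_ideal[OF G]])
  have GU': "G n <= fadj U x n" for n using GU fadj_sub[of U n x] by blast
  note ok = famok_U[OF U(2) GU] and ok' = famok_U[OF filt_fadj[OF U(2)] GU']
  note idU = filt_ideal[OF U(2)]
  show "adj (BU U) w <= BU (fadj U x)"
  proof (rule adj_least)
    show "BU U <= BU (fadj U x)" using fadj_sub[of U _ x] unfolding BU_def FI_def by blast
    show "w \<in> BU (fadj U x)" unfolding BU_def hg_FI[OF ok' w] by (simp add: fadj_def adj_self idU)
  qed (use idealp_FI(1)[OF ok'] in \<open>simp add: BU_def\<close>)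
  show "BU (fadj U x) <= adj (BU U) w"
  proof
    fix v assume v: "v \<in> BU (fadj U x)"
    obtain K where K: "\<And>k. k \<ge> K ==> co v k 0" using co_fin by blast
    obtain q0 where q0: "\<And>k. co v k (q0 k)" using choice[of "co v"] co_ex by blast
    define q where "q k = (if k \<ge> K then 0 else q0 k)" for k
    have q: "co v k (q k)" for k using q0 K by (simp add: q_def)
    have qU: "q k \<in> adj (U (Suc k)) x" for k using v FI_iff[OF ok' q] unfolding BU_def fadj_def by blast
    have "\<exists>c. c \<in> G j \<and> q (j + e) - x * c \<in> U (Suc (j + e)) \<and> (j \<ge> K --> c = 0)" for j
    proof (cases "j \<ge> K")
      case True
      hence "q (j + e) = 0" by (simp add: q_def)
      thus ?thesis using idealp_zero[OF filt_ideal[OF G]] idealp_zero[OF idU] by (intro exI[of _ 0]) auto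
    next
      case False
      obtain c where c: "q (j + e) - c * x \<in> U (Suc (j + e))" using qU[of "j + e"] by (auto simp: adj_iff)
      have "q (j + e) - c * x \<in> U (j + e)" by (rule filt_down[OF U(2) c]) simp
      hence "c * x \<in> U (j + e)" using idealp_cancel'[OF idU] GU co_G[OF q] by blast
      hence "c \<in> U j" using RegD[OF R, of c j] by (simp add: mult.commute)
      then obtain t g where tg: "c = t + g" "t \<in> V" "g \<in> G j" unfolding U(1) by (auto simp: isum_def)
      have "t * x \<in> U (Suc (j + e))" using VU idealp_mult2[OF V tg(2)] by blast
      hence "(q (j + e) - c * x) + t * x \<in> U (Suc (j + e))" by (rule idealp_add[OF idU c])
      hence "q (j + e) - x * g \<in> U (Suc (j + e))" by (simp add: tg algebra_simps)
      thus ?thesis using tg(3) False by blast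
    qed
    from choice[OF allI[OF this]] obtain c where c: "\<forall>j. c j \<in> G j \<and> q (j + e) - x * c j \<in> U (Suc (j + e)) \<and> (j \<ge> K --> c j = 0)" ..
    obtain r where r0: "\<And>j. co r j (if j < K then c j else 0)" using co_poly[of c K] c by blast
    have r: "co r j (c j)" for j using r0[of j] spec[OF c, of j] by (cases "j < K") auto
    have "v - w * r \<in> BU U"
      unfolding BU_def FI_iff[OF ok co_diff[OF q hg_mult[OF w r]]]
    proof
      fix k
      show "q k - (if e \<le> k then x * c (k - e) else 0) \<in> U (Suc k)"
      proof (cases "e \<le> k")
        case True
        thus ?thesis using spec[OF c, of "k - e"] by simp
      next
        case False
        obtain d where d: "q k - d * x \<in> U (Suc k)" using qU[of k] by (auto simp: adj_iff)
        have "x \<in> U (Suc k)" using filt_down[OF U(2), of x e "Suc k"] GU x False by auto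
        hence "q k \<in> U (Suc k)" using idealp_cancel[OF idU d] idealp_mult[OF idU] by blast
        thus ?thesis using False by simp
      qed
    qed
    thus "v \<in> adj (BU U) w" by (auto simp: adj_iff mult.commute)
  qed
qed

text \<open>Homogeneous prime avoidance is applied to the annihilators of nonzero homogeneous
  classes in the graded ring of \<open>U\<close>; by \<open>soc\<close> none of them contains
  everything of positive degree.\<close>

lemma exists_homogeneous_Reg:
  assumes V: "idealp V" and U: "\<And>n. U n = isum V (G n)" "filt U"
    and soc: "\<And>n f. f \<in> G n ==> f \<notin> U (Suc n) ==> \<exists>L>0. \<exists>a\<in>G L. a * f \<notin> U (Suc (n + L))"
  shows "\<exists>e>0. \<exists>x\<in>G e. Reg U x e"
proof -
  have GU: "G n <= U n" for n unfolding U(1) by (rule isum_subset2[OF V])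
  have VU: "V <= U n" for n unfolding U(1) by (rule isum_subset1[OF filt_ideal[OF G]])
  note ok = famok_U[OF U(2) GU]
  note idU = filt_ideal[OF U(2)] and idG = filt_ideal[OF G]
  interpret S: scal G by unfold_locales (use filt_0[OF G] idG filt_mult[OF G] in auto)
  \<comment> \<open>The pair \<open>s\<close> consists of a degree and an element of that degree;
    \<open>q s\<close> is the annihilator of its class.\<close>
  define q where "q s k = {a \<in> G k. a * snd s \<in> U (Suc (fst s + k))}" for s :: "nat \<times> 'r" and k
  define N where "N = {s. snd s \<in> G (fst s) \<and> snd s \<notin> U (Suc (fst s))}"
  have qok: "famok (q s)" if s: "s \<in> N" for s
    unfolding famok_def
  proof (intro conjI allI impI)
    fix k
    have "q s k = G k \<inter> colon (U (Suc (fst s + k))) (snd s)" by (auto simp: q_def colon_def)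
    thus "idealp (q s k)" using idealp_Int[OF idG idealp_colon[OF idU]] by simp
    show "G (Suc k) <= q s k"
    proof
      fix a assume a: "a \<in> G (Suc k)"
      have "a * snd s \<in> G (Suc k + fst s)" by (rule filt_mult[OF G a]) (use s in \<open>simp add: N_def\<close>)
      thus "a \<in> q s k" using GU filt_down[OF G a, of k] by (auto simp: q_def add.commute)
    qed
    fix j a b assume ab: "a \<in> G j" "b \<in> q s k"
    have "a * (b * snd s) \<in> U (j + Suc (fst s + k))" by (rule filt_mult[OF U(2)]) (use ab GU in \<open>auto simp: q_def\<close>)
    thus "a * b \<in> q s (j + k)" using ab filt_mult[OF G] by (auto simp: q_def mult.assoc add_ac)
  qed
  have "\<exists>\<Q>. finite \<Q> \<and> (\<forall>P\<in>\<Q>. pfam G P) \<and> (\<forall>Q\<in>q ` N. \<exists>P\<in>\<Q>. Q \<le> P)"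
  proof (rule S.finite_primes)
    fix Q a j assume Q: "Q \<in> q ` N" "a \<in> G j" "a \<notin> Q j"
    then obtain s where s: "s \<in> N" "Q = q s" by blast
    let ?s = "(fst s + j, a * snd s)"
    have "a * snd s \<in> G (j + fst s)" using Q s filt_mult[OF G] by (auto simp: N_def)
    hence "?s \<in> N" using Q s by (auto simp: N_def q_def add_ac)
    moreover have "(\<lambda>k. {b \<in> G k. a * b \<in> Q (j + k)}) = q ?s"
      unfolding s(2) q_def using filt_mult[OF G Q(2)] by (intro ext Collect_cong) (auto simp: mult_ac add_ac)
    ultimately show "(\<lambda>k. {b \<in> G k. a * b \<in> Q (j + k)}) \<in> q ` N" by simp
  next
    fix p :: "nat => nat => 'r set" assume p: "\<And>i. p i \<in> q ` N" "\<And>i. p i \<le> p (Suc i)"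
    have pok: "famok (p i)" for i by (rule imageE[OF p(1)[of i]]) (simp add: qok)
    have "\<exists>i. \<forall>j. FI (p j) <= FI (p i)"
    proof (rule noethD[OF Zg(1)])
      show "FI (p i) <= FI (p (Suc i))" for i using le_funD[OF p(2)[of i]] unfolding FI_def by blast
    qed (use idealp_FI[OF pok] in auto)
    then obtain i where i: "FI (p (Suc i)) <= FI (p i)" by blast
    have "p (Suc i) k <= p i k" for k
    proof
      fix a assume a: "a \<in> p (Suc i) k"
      have "a \<in> G k" using a p(1)[of "Suc i"] by (auto simp: q_def)
      hence "hg (hm k a) k a" by (rule hg_hm)
      thus "a \<in> p i k" using hg_FI[OF pok, of "hm k a" k a] a i by blast
    qed
    thus "\<exists>i. p (Suc i) \<le> p i" unfolding le_fun_def by blast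
  next
    fix p :: "nat => nat => 'r set" assume p: "\<And>i. p i \<in> q ` N"
    have "\<forall>i. \<exists>s. s \<in> N \<and> p i = q s" using p by blast
    from choice[OF this] obtain s where ss: "\<forall>i. s i \<in> N \<and> p i = q (s i)" ..
    have s: "s i \<in> N" "p i = q (s i)" for i using spec[OF ss, of i] by simp_all
    define h where "h i = hm (fst (s i)) (snd (s i))" for i
    have hh: "hg (h i) (fst (s i)) (snd (s i))" for i unfolding h_def by (rule hg_hm) (use s(1)[of i] in \<open>simp add: N_def\<close>)
    define H where "H i = adjs (BU U) (map h [0..<i])" for i
    have idB: "idealp (BU U)" "Zg <= BU U" using idealp_FI[OF ok] by (auto simp: BU_def)
    have "\<exists>i. \<forall>j. H j <= H i"
    proof (rule noethD[OF Zg(1)])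
      show "idealp (H i)" for i unfolding H_def by (rule idealp_adjs[OF idB(1)])
      show "Zg <= H i" for i unfolding H_def using idB adjs_subset by blast
      show "H i <= H (Suc i)" for i by (simp add: H_def adjs_append adj_subset)
    qed
    then obtain i where "H (Suc i) <= H i" by blast
    moreover have "h i \<in> H (Suc i)" unfolding H_def by (rule adjs_mem[OF idB(1)]) simp
    ultimately have hi: "h i \<in> H i" by blast
    have "a \<in> q (s i) k" if a: "a \<in> G k" "\<forall>j<i. a \<in> q (s j) k" for a k
    proof -
      have ha: "hg (hm k a) k a" by (rule hg_hm[OF a(1)])
      have BUq: "h j * hm k a \<in> BU U \<longleftrightarrow> a \<in> q (s j) k" for j
        unfolding BU_def hg_FI[OF ok hg_mult_hg[OF hh ha]] using a(1) by (simp add: q_def mult.commute)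
      have "H i <= colon (BU U) (hm k a)" unfolding H_def
        by (rule adjs_least[OF idealp_colon[OF idB(1)]]) (use a(2) idealp_mult2[OF idB(1)] BUq in \<open>auto simp: colon_def\<close>)
      thus ?thesis using hi BUq[of i] by (auto simp: colon_def)
    qed
    thus "\<exists>i. \<forall>k. \<forall>a\<in>G k. (\<forall>j<i. a \<in> p j k) --> a \<in> p i k" unfolding s(2) by blast
  next
    fix Q k assume "Q \<in> q ` N"
    then obtain s where s: "s \<in> N" "Q = q s" by blast
    show "idealp (Q k) \<and> Q k <= G k" using qok[OF s(1)] unfolding s(2) famok_def by (auto simp: q_def)
    fix j a b assume "a \<in> Q j" "b \<in> G k"
    thus "a * b \<in> Q (j + k)" using qok[OF s(1)] unfolding s(2) famok_def by (metis mult.commute add.commute)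
  next
    fix Q assume "Q \<in> q ` N"
    then obtain s where s: "s \<in> N" "Q = q s" by blast
    thus "\<exists>L>0. \<not> G L <= Q L" using soc[of "snd s" "fst s"] by (auto simp: N_def q_def)
  qed
  then obtain \<Q> where Q: "finite \<Q>" "\<And>P. P \<in> \<Q> ==> pfam G P" "\<forall>Q\<in>q ` N. \<exists>P\<in>\<Q>. Q \<le> P" by blast
  obtain e x where x: "0 < e" "x \<in> G e" "\<forall>Q\<in>\<Q>. x \<notin> Q e" using S.graded_avoidance[OF Q(1,2)] by blast
  \<comment> \<open>Avoidance concerns elements of \<open>G n\<close>. As \<open>U n\<close> is
    \<open>V\<close> plus \<open>G n\<close>, an element \<open>f\<close> of \<open>U n\<close> is
    first freed from its part in \<open>V\<close>, which lies in every step of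
    \<open>U\<close>.\<close>
  have step: "f \<in> U (Suc n)" if f: "f \<in> U n" "x * f \<in> U (Suc (n + e))" for n f
  proof (rule ccontr)
    assume nf: "f \<notin> U (Suc n)"
    obtain t g where tg: "f = t + g" "t \<in> V" "g \<in> G n" using f(1) unfolding U(1) by (auto simp: isum_def)
    have "g \<notin> U (Suc n)" using nf tg VU idealp_add[OF idU] by blast
    hence N: "(n, g) \<in> N" using tg by (simp add: N_def)
    have "x * f - x * t \<in> U (Suc (n + e))" using idealp_mult[OF V tg(2)] VU by (intro idealp_diff[OF idU f(2)]) blast
    hence "x \<in> q (n, g) e" using x(2) by (simp add: q_def tg algebra_simps)
    moreover obtain P where "P \<in> \<Q>" "q (n, g) \<le> P" using Q(3) N by blast
    ultimately show False using x(3) le_funD[of "q (n, g)" P e] by blast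
  qed
  have "x * f \<in> U (n + e) ==> f \<in> U n" for n f
  proof (induction n)
    case 0 thus ?case using filt_0[OF U(2)] by simp
  next
    case (Suc n)
    have "x * f \<in> U (n + e)" by (rule filt_down[OF U(2) Suc.prems]) simp
    thus ?case using step[OF Suc.IH] Suc.prems by simp
  qed
  thus ?thesis using x unfolding Reg_def by blast
qed

end

locale grc_loc = grc G co Zg + locr Z m for G :: "nat => 'r::comm_ring_1 set" and co :: "'g::comm_ring_1 => nat => 'r => bool" and Zg Z m +
  fixes as :: "'r list"
  assumes ZG: "Z <= G n" and Gm: "G 1 <= m" and asG: "set as <= G 1" and gen: "G (Suc n) <= isum (lcomb as (G n)) Z"
    and nil: "z \<in> m ==> \<exists>N. z ^ N \<in> G 1"
begin

text \<open>The homogeneous maximal ideal of the graded ring: \<open>m\<close> in degree 0 and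
  everything in positive degree.\<close>

definition M where "M = {w. \<forall>f. co w 0 f --> f \<in> m}"

lemma M_iff: assumes "co w 0 f" shows "w \<in> M \<longleftrightarrow> f \<in> m"
proof -
  have "f' \<in> m" if "f \<in> m" "co w 0 f'" for f'
  proof -
    have "f - f' \<in> m" using co_cong[OF assms] that(2) Gm by auto
    thus ?thesis using idealp_cancel'[OF m_ideal] that(1) by blast
  qed
  thus ?thesis using assms unfolding M_def by blast
qed

lemma co_mult0: "co v 0 f ==> co w 0 g ==> co (v * w) 0 (f * g)"
  using co_mult[of 0 v "\<lambda>_. f" w "\<lambda>_. g"] by simp

lemma M_prime: "primep M"
  unfolding primep_def
proof (intro conjI allI impI)
  show "idealp M"
  proof (rule idealpI)
    show "0 \<in> M" using M_iff[OF co_0] idealp_zero[OF m_ideal] by simp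
    show "v + w \<in> M" if vw: "v \<in> M" "w \<in> M" for v w
    proof -
      obtain f g where fg: "co v 0 f" "co w 0 g" using co_ex by metis
      thus ?thesis using vw M_iff[OF fg(1)] M_iff[OF fg(2)] M_iff[OF co_add[OF fg]] idealp_add[OF m_ideal] by blast
    qed
    show "v * w \<in> M" if vw: "w \<in> M" for v w
    proof -
      obtain f g where fg: "co v 0 f" "co w 0 g" using co_ex by metis
      thus ?thesis using vw M_iff[OF fg(2)] M_iff[OF co_mult0[OF fg]] idealp_mult[OF m_ideal] by blast
    qed
  qed
  have "co 1 0 1" using co_1[of 0] by simp
  thus "M \<noteq> UNIV" using M_iff[of 1 1] one_m by blast
  fix v w assume vw: "v * w \<in> M"
  obtain f g where fg: "co v 0 f" "co w 0 g" using co_ex by metis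
  hence "f * g \<in> m" using vw M_iff[OF co_mult0[OF fg]] by blast
  thus "v \<in> M \<or> w \<in> M" using mp M_iff[OF fg(1)] M_iff[OF fg(2)] unfolding primep_def by blast
qed

lemma ZgM: "Zg <= M"
  using co_zero M_iff[of _ 0] idealp_zero[OF m_ideal] by blast

lemma hg_M: assumes "hg w e x" "0 < e" shows "w \<in> M"
  using M_iff[of w 0] assms idealp_zero[OF m_ideal] by (auto simp: hg_def)

lemma M_maximal: assumes L: "idealp L" "M \<subset> L" shows "L = UNIV"
proof -
  obtain w where w: "w \<in> L" "w \<notin> M" using L(2) by blast
  obtain f where f: "co w 0 f" using co_ex by blast
  obtain t where t: "t * f - 1 \<in> Z" using unit w(2) M_iff[OF f] by blast
  have "t \<in> G 0" using filt_0[OF G] by simp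
  hence "co (hm 0 t) 0 t" using hg_hm by (auto simp: hg_def)
  hence "co (hm 0 t * w - 1) 0 (t * f - 1)" using co_diff[OF co_mult0[OF _ f] co_1[of 0]] by simp
  hence "hm 0 t * w - 1 \<in> L" using M_iff t Zm L(2) by blast
  hence "1 \<in> L" using idealp_cancel'[OF L(1)] idealp_mult[OF L(1) w(1)] by blast
  thus ?thesis using idealp_one[OF L(1)] by blast
qed

definition xm :: "('r \<times> nat) list => 'r set" where "xm ps = adjs Z (map fst ps)"

lemma xm_ideal: "idealp (xm ps)" "Z <= xm ps" unfolding xm_def by (auto intro: idealp_adjs[OF Zid] subsetD[OF adjs_subset])

lemma adjs_isum: "idealp W ==> idealp V ==> adjs (isum V W) xs = isum (adjs V xs) W"
proof (induction xs arbitrary: V)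
  case (Cons x xs)
  have "adj (isum V W) x = isum (adj V x) W"
  proof (rule subset_antisym)
    show "adj (isum V W) x <= isum (adj V x) W"
      using isum_mono[OF adj_subset order_refl, of V W x] isum_subset1[OF Cons.prems(1), of "adj V x"] adj_self[OF Cons.prems(2), of x]
      by (intro adj_least idealp_isum idealp_adj Cons.prems) auto
    show "isum (adj V x) W <= adj (isum V W) x"
      by (intro isum_least idealp_adj idealp_isum Cons.prems adj_mono isum_subset1 order_trans[OF isum_subset2[OF Cons.prems(2)] adj_subset])
  qed
  thus ?case using Cons by (simp add: idealp_adj)
qed simp

lemma fadjs_isum: "fadjs G ps n = isum (xm ps) (G n)"
proof -
  have "isum Z (G n) = G n"
    using isum_least[OF filt_ideal[OF G] ZG order_refl] isum_subset2[OF Zid] by blast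
  thus ?thesis using adjs_isum[OF filt_ideal[OF G] Zid, of n "map fst ps"] by (simp add: fadjs_adjs xm_def)
qed

definition hms :: "('r \<times> nat) list => 'g list" where "hms ps = map (\<lambda>p. hm (snd p) (fst p)) ps"

text \<open>A homogeneous regular sequence lifts to the local ring: if \<open>x * f\<close> lies in
  \<open>xm ps\<close>, then \<open>f\<close> lies in \<open>xm ps + G n\<close> for every
  \<open>n\<close>, and the intersection theorem applies. Simultaneously the initial ideal is
  generated by the initial forms, so depths can be compared in both rings.\<close>

lemma regs_invariants:
  "in_filt G ps ==> regs G ps ==> rseq Z (map fst ps) \<and> rseq Zg (hms ps) \<and> BU (fadjs G ps) = adjs Zg (hms ps) \<and> set (hms ps) <= M"
proof (induction ps rule: rev_induct)
  case Nil thus ?case by (simp add: hms_def BU_G)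
next
  case (snoc p ps)
  obtain x e where p: "p = (x, e)" by force
  have x: "x \<in> G e" "0 < e" "Reg (fadjs G ps) x e" and IH: "rseq Z (map fst ps)" "rseq Zg (hms ps)" "BU (fadjs G ps) = adjs Zg (hms ps)" "set (hms ps) <= M"
    using snoc p by (auto simp: regs_append)
  have fU: "filt (fadjs G ps)" by (rule filt_fadjs[OF G])
  have h: "hg (hm e x) e x" by (rule hg_hm[OF x(1)])
  have "nzd (xm ps) x"
  proof (intro allI impI)
    fix f assume f: "x * f \<in> xm ps"
    have "f \<in> isum (xm ps) (G n)" for n
    proof -
      have "x * f \<in> fadjs G ps (n + e)" using f isum_subset1[OF filt_ideal[OF G]] unfolding fadjs_isum by blast
      thus ?thesis using RegD[OF x(3)] fadjs_isum by metis
    qed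
    thus "f \<in> xm ps" by (rule krull_intersection[OF G gen asG Gm xm_ideal])
  qed
  moreover have "nzd (BU (fadjs G ps)) (hm e x)" by (rule BU_nzd[OF fU fadjs_sub h x(3)])
  moreover have "BU (fadj (fadjs G ps) x) = adj (BU (fadjs G ps)) (hm e x)"
    by (rule BU_adj[OF xm_ideal(1) fadjs_isum fU x(1) h x(3)])
  moreover have "fadjs G (ps @ [p]) = fadj (fadjs G ps) x"
    by (rule ext) (simp add: fadjs_adjs fadj_def adjs_append p)
  moreover have "hms (ps @ [p]) = hms ps @ [hm e x]" by (simp add: hms_def p)
  ultimately show ?case using IH hg_M[OF h x(2)] by (simp add: rseq_append adjs_append p xm_def)
qed

lemma m_nil_colen: "colen (G n) \<noteq> \<infinity>"
proof (rule nil_colen_finite[OF noe m_ideal])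
  show "colen m \<noteq> \<infinity>" using colen_m by (simp add: one_enat_def)
  fix z assume "z \<in> m"
  then obtain N where "z ^ N \<in> G 1" using nil by blast
  hence "(z ^ N) ^ n \<in> G (n * 1)" by (rule filt_pow[OF G])
  thus "\<exists>N. z ^ N \<in> G n" by (auto simp: power_mult[symmetric])
qed (use filt_ideal[OF G] ZG in auto)

lemma stage_GG: "stage G G as 0 0"
proof unfold_locales
  show "G (Suc n) <= isum (lcomb as (G n)) (G (Suc (Suc n)))" for n
    using gen[of n] isum_mono[OF order_refl ZG] by blast
  thus "G (Suc n) <= isum (lcomb as (G n)) (G (Suc (Suc n)))" for n .
qed (use G asG m_nil_colen in auto)

lemma nzd_pow: assumes "nzd B y" "y ^ N * s \<in> B" shows "s \<in> B"
  using assms(2)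
proof (induction N)
  case (Suc N)
  hence "y * (y ^ N * s) \<in> B" by (simp add: mult_ac)
  thus ?case using assms(1) Suc.IH by blast
qed simp

end

text \<open>Cohen-Macaulayness of the graded ring enters as \<open>cm\<close>: a chain of primes of
  length \<open>n\<close> ending in \<open>M\<close> yields a regular sequence of length
  \<open>n\<close> in \<open>M\<close>. The depth of the local ring itself enters as
  \<open>dA\<close>.\<close>

locale grc_local = grc_loc G co Zg Z m as for G :: "nat => 'r::comm_ring_1 set" and co :: "'g::comm_ring_1 => nat => 'r => bool" and Zg Z m as +
  fixes d :: nat
  assumes dA: "dpt m Z d"
    and cm: "(\<And>i. i \<le> n ==> primep (C i) \<and> Zg <= C i) ==> (\<And>i. i < n ==> C i \<subset> C (Suc i)) ==> C n = M ==> dpt M Zg n"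
begin

text \<open>If \<open>ps\<close> cannot be extended, some nonzero homogeneous class is killed by
  everything of positive degree, so the graded ring modulo the initial forms has depth 0 at
  \<open>M\<close>. By \<open>cm\<close> the only prime there inside \<open>M\<close> is
  \<open>M\<close> itself, so elements of positive degree are nilpotent, and some
  \<open>G L0\<close> lies in \<open>xm ps\<close>. This contradicts the positive depth that the
  local ring still has modulo \<open>xm ps\<close>.\<close>

lemma extend_regs:
  assumes ps: "in_filt G ps" "regs G ps" "length ps < d"
  shows "\<exists>x e. in_filt G (ps @ [(x, e)]) \<and> regs G (ps @ [(x, e)])"
proof -
  define U where "U = fadjs G ps"
  have fU: "filt U" unfolding U_def by (rule filt_fadjs[OF G])
  have GU: "G n <= U n" for n unfolding U_def by (rule fadjs_sub)
  have Ui: "U n = isum (xm ps) (G n)" for n unfolding U_def by (rule fadjs_isum)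
  note ok = famok_U[OF fU GU] and idU = filt_ideal[OF fU]
  note inv = regs_invariants[OF ps(1,2), folded U_def]
  have idB: "idealp (BU U)" "Zg <= BU U" using idealp_FI[OF ok] by (auto simp: BU_def)
  have idM: "idealp M" using M_prime by (simp add: primep_def)
  have BM: "BU U <= M" using inv adjs_least[OF idM ZgM] by simp
  have "\<exists>e>0. \<exists>x\<in>G e. Reg U x e"
  proof (rule ccontr)
    assume nex: "\<not> ?thesis"
    have "\<exists>n f. f \<in> G n \<and> f \<notin> U (Suc n) \<and> (\<forall>L>0. \<forall>a\<in>G L. a * f \<in> U (Suc (n + L)))"
    proof (rule ccontr)
      assume n: "\<not> ?thesis"
      have "\<exists>e>0. \<exists>x\<in>G e. Reg U x e" by (rule exists_homogeneous_Reg[OF xm_ideal(1) Ui fU]) (use n in blast)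
      thus False using nex by blast
    qed
    then obtain n f where f: "f \<in> G n" "f \<notin> U (Suc n)" "\<And>L a. 0 < L ==> a \<in> G L ==> a * f \<in> U (Suc (n + L))" by blast
    have hf: "hg (hm n f) n f" by (rule hg_hm[OF f(1)])
    \<comment> \<open>A suitable power of an element of \<open>M\<close> has its degree 0 component
      in \<open>G 1\<close>, so only components of positive degree are left, and these kill the
      class of \<open>f\<close>.\<close>
    have nd: "\<not> dpt M (BU U) (Suc 0)"
    proof
      assume "dpt M (BU U) (Suc 0)"
      then obtain z where z: "z \<in> M" "nzd (BU U) z" unfolding dpt_Suc by blast
      obtain z0 where z0: "co z 0 z0" using co_ex by blast
      have "z0 \<in> m" using z(1) M_iff[OF z0] by blast
      then obtain N where N: "z0 ^ N \<in> G 1" using nil by blast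
      have "co (z ^ N) 0 (z0 ^ N)" using z0 co_1[of 0] by (induction N) (auto simp: co_mult0)
      hence c0: "co (z ^ N) 0 0" using co_cong[of "z ^ N" 0 "z0 ^ N" 0] N by simp
      obtain q where q: "\<And>k. co (z ^ N) k (q k)" using choice[of "co (z ^ N)"] co_ex by blast
      have "hm n f * z ^ N \<in> BU U" unfolding BU_def FI_iff[OF ok hg_mult[OF hf q]]
      proof
        fix k
        show "(if n \<le> k then f * q (k - n) else 0) \<in> U (Suc k)"
        proof (cases "n \<le> k")
          case True
          show ?thesis
          proof (cases "k = n")
            case T: True
            have "q 0 \<in> G 1" using co_cong[OF q[of 0], of 0] c0 by simp
            hence "f * q 0 \<in> G (n + 1)" by (rule filt_mult[OF G f(1)])
            thus ?thesis using GU T by auto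
          next
            case False
            hence "0 < k - n" using True by simp
            hence "q (k - n) * f \<in> U (Suc (n + (k - n)))" by (rule f(3)[OF _ co_G[OF q]])
            thus ?thesis using True by (simp add: mult.commute)
          qed
        qed (use idealp_zero[OF idU] in simp)
      qed
      hence "z ^ N * hm n f \<in> BU U" by (simp add: mult.commute)
      hence "hm n f \<in> BU U" by (rule nzd_pow[OF z(2)])
      thus False using hg_FI[OF ok hf] f(2) by (simp add: BU_def)
    qed
    have nd': "\<not> dpt M Zg (Suc (length ps))"
    proof
      assume "dpt M Zg (Suc (length ps))"
      hence "dpt M Zg (length (hms ps) + Suc 0)" by (simp add: hms_def)
      hence "dpt M (adjs Zg (hms ps)) (Suc 0)" by (intro depth_exchange_list[OF Zg(1) idM Zg(2) order_refl]) (use inv in auto)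
      thus False using nd inv by simp
    qed
    \<comment> \<open>A smaller prime, prolonged by \<open>M\<close>, would give a chain longer than
      the sequence and hence, by \<open>cm\<close>, one more regular element.\<close>
    have onlyM: "P = M" if P: "primep P" "BU U <= P" "P <= M" for P
    proof (rule ccontr)
      assume "P \<noteq> M"
      have ZP: "Zg <= P" using idB P by blast
      have hP: "set (hms ps) <= P" using inv P(2) adjs_mem[OF Zg(2), of _ "hms ps"] by auto
      obtain C where C: "\<forall>i\<le>length (hms ps). primep (C i) \<and> Zg <= C i" "\<forall>i<length (hms ps). C i \<subset> C (Suc i)" "C (length (hms ps)) = P"
        using rseq_prime_chain[OF Zg(1) Zg(2) order_refl _ P(1) ZP hP] inv by blast
      let ?C = "C(Suc (length (hms ps)) := M)"
      have "dpt M Zg (Suc (length (hms ps)))"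
      proof (rule cm[where C = ?C])
        show "primep (?C i) \<and> Zg <= ?C i" if "i \<le> Suc (length (hms ps))" for i
          using that C(1) M_prime ZgM by (cases "i = Suc (length (hms ps))") auto
        show "?C i \<subset> ?C (Suc i)" if "i < Suc (length (hms ps))" for i
          using that C(2,3) P(3) \<open>P \<noteq> M\<close> by (cases "i = length (hms ps)") auto
      qed simp
      thus False using nd' by (simp add: hms_def)
    qed
    \<comment> \<open>Nilpotency is obtained by localizing at \<open>M\<close>: otherwise a prime
      inside \<open>M\<close> would avoid all powers of the class of \<open>a\<close>. A denominator
      outside \<open>M\<close> has a degree 0 component that is a unit, which removes it.\<close>
    have "\<exists>N. a ^ N * 1 \<in> U (1 + N)" if a: "a \<in> set as" for a
    proof (rule ccontr)
      assume na: "\<not> ?thesis"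
      have aG: "a \<in> G 1" using a asG by blast
      define w where "w = hm 1 a"
      have hw: "hg w 1 a" unfolding w_def by (rule hg_hm[OF aG])
      have hwk: "hg (w ^ k) k (a ^ k)" for k
      proof (induction k)
        case 0
        have "co 1 k 0" if "k \<noteq> 0" for k using co_1[of k] that by simp
        thus ?case using co_1[of 0] by (simp add: hg_def)
      next
        case (Suc k) show ?case using hg_mult_hg[OF hw Suc] by simp
      qed
      let ?S = "{s * w ^ k | s k. s \<notin> M}"
      have M1: "1 \<notin> M" using M_prime idealp_one[of M] by (auto simp: primep_def)
      have "\<exists>P. primep P \<and> BU U <= P \<and> P \<inter> ?S = {}"
      proof (rule prime_avoiding[OF Zg(1) idB])
        show "1 \<in> ?S" using M1 by (intro CollectI exI[of _ 1] exI[of _ 0]) auto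
        fix u v assume "u \<in> ?S" "v \<in> ?S"
        then obtain s k t j where st: "u = s * w ^ k" "s \<notin> M" "v = t * w ^ j" "t \<notin> M" by blast
        have "u * v = (s * t) * w ^ (k + j)" by (simp add: st power_add mult_ac)
        moreover have "s * t \<notin> M" using M_prime st unfolding primep_def by blast
        ultimately show "u * v \<in> ?S" by blast
      next
        have no: False if sk: "s \<notin> M" "s * w ^ k \<in> BU U" for s k
        proof -
          obtain q where q: "\<And>j. co s j (q j)" using choice[of "co s"] co_ex by blast
          have "(if k \<le> k then a ^ k * q (k - k) else 0) \<in> U (Suc k)"
            using sk(2) FI_iff[OF ok hg_mult[OF hwk q], of k] unfolding BU_def mult.commute[of s] by blast
          hence 1: "a ^ k * q 0 \<in> U (Suc k)" by simp
          have "q 0 \<notin> m" using sk(1) M_iff[OF q] by blast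
          then obtain t where t: "t * q 0 - 1 \<in> U (Suc k)" using unit ZG GU by blast
          have "t * (a ^ k * q 0) - a ^ k * (t * q 0 - 1) \<in> U (Suc k)" by (intro idealp_diff idealp_mult idU 1 t)
          hence "a ^ k * 1 \<in> U (1 + k)" by (simp add: algebra_simps)
          thus False using na by blast
        qed
        show "BU U \<inter> ?S = {}"
        proof (rule ccontr)
          assume "BU U \<inter> ?S \<noteq> {}"
          then obtain s k where "s \<notin> M" "s * w ^ k \<in> BU U" by blast
          thus False by (rule no)
        qed
      qed
      then obtain P where P: "primep P" "BU U <= P" "P \<inter> ?S = {}" by blast
      have "P <= M"
      proof
        fix s assume s: "s \<in> P"
        show "s \<in> M"
        proof (rule ccontr)
          assume "s \<notin> M"
          hence "s * w ^ 0 \<in> ?S" by blast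
          thus False using s P(3) by auto
        qed
      qed
      hence "P = M" by (rule onlyM[OF P(1,2)])
      moreover have "1 * w ^ 1 \<in> ?S" using M1 by blast
      ultimately show False using P(3) hg_M[OF hw] by auto
    qed
    \<comment> \<open>Torsion of the element 1 relative to degree 1 means that \<open>G L\<close>
      lies in \<open>U (Suc L)\<close> for all large \<open>L\<close>.\<close>
    hence "tors G U 1 1" using stage.tors_of_pow[OF stage_GG fU GU, of 1 1] by blast
    then obtain L0 where L0: "\<And>L g. L \<ge> L0 ==> g \<in> G L ==> g \<in> U (Suc L)" unfolding tors_def by (auto simp: add.commute)
    have GX: "g \<in> xm ps" if g: "g \<in> G L0" for g
    proof (rule krull_intersection[OF G gen asG Gm xm_ideal])
      have "G L0 <= U (L0 + n)" for n
      proof (induction n)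
        case 0 thus ?case using GU by simp
      next
        case (Suc n)
        have "G (L0 + n) <= U (Suc (L0 + n))" using L0 by auto
        moreover have "xm ps <= U (Suc (L0 + n))" unfolding Ui by (rule isum_subset1[OF filt_ideal[OF G]])
        ultimately have "U (L0 + n) <= U (Suc (L0 + n))" unfolding Ui[of "L0 + n"] by (rule_tac isum_least[OF idU])
        thus ?case using Suc by simp
      qed
      thus "g \<in> isum (xm ps) (G n)" for n using g filt_antimono[OF fU, of n "L0 + n"] Ui by (metis subsetD le_add2)
    qed
    \<comment> \<open>The sequence \<open>ps\<close> uses up only part of the depth
      \<open>d\<close>, so a nonzerodivisor \<open>y\<close> modulo \<open>xm ps\<close> remains,
      although a power of it lies in \<open>xm ps\<close>.\<close>
    have "dpt m Z (length (map fst ps) + Suc (d - Suc (length ps)))" using dA ps(3) by simp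
    moreover have "set (map fst ps) <= m"
    proof
      fix x assume "x \<in> set (map fst ps)"
      then obtain e where "(x, e) \<in> set ps" by force
      hence "x \<in> G e" "1 \<le> e" using ps(1) unfolding in_filt_def by fastforce+
      thus "x \<in> m" using filt_down[OF G, of x e 1] Gm by blast
    qed
    ultimately have "dpt m (adjs Z (map fst ps)) (Suc (d - Suc (length ps)))"
      by (rule_tac depth_exchange_list[OF noe m_ideal Zid order_refl]) (use inv in auto)
    then obtain y where y: "y \<in> m" "nzd (xm ps) y" unfolding dpt_Suc xm_def by blast
    obtain N where "y ^ N \<in> G 1" using nil[OF y(1)] by blast
    hence "(y ^ N) ^ L0 \<in> G (L0 * 1)" by (rule filt_pow[OF G])
    hence "y ^ (N * L0) * 1 \<in> xm ps" using GX by (simp add: power_mult)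
    hence "1 \<in> xm ps" by (rule nzd_pow[OF y(2)])
    moreover have "xm ps <= m" unfolding xm_def by (rule adjs_least[OF m_ideal Zm]) fact
    ultimately show False using one_m by blast
  qed
  thus ?thesis using ps unfolding U_def by (auto simp: regs_append)
qed

theorem exists_regs: "\<exists>ps. length ps = d \<and> in_filt G ps \<and> regs G ps"
proof -
  have "k \<le> d ==> \<exists>ps. length ps = k \<and> in_filt G ps \<and> regs G ps" for k
  proof (induction k)
    case 0 thus ?case by (intro exI[of _ "[]"]) simp
  next
    case (Suc k)
    then obtain ps where ps: "length ps = k" "in_filt G ps" "regs G ps" by auto
    obtain x e where "in_filt G (ps @ [(x, e)])" "regs G (ps @ [(x, e)])" using extend_regs[OF ps(2,3)] ps(1) Suc.prems by auto
    thus ?case using ps(1) by (intro exI[of _ "ps @ [(x, e)]"]) auto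
  qed
  thus ?thesis by blast
qed

end

section \<open>The associated graded ring of the powers of an ideal\<close>

context cring
begin

lemma cov_sum: "finite S ==> cov R (\<Sum>i\<in>S. f i) = (\<Oplus>i\<in>S. cov R (f i))"
  by (induction S rule: finite_induct) (simp_all add: cov_hom cov_closed finsum_insert Pi_def)

lemma cov_pow: "cov R (x ^ k) = cov R x [^] k"
  by (induction k) (simp_all add: cov_hom cov_closed m_comm)

lemma coset_mem:
  assumes "ideal H R" "a \<in> carrier R" "y \<in> carrier R" shows "y \<in> H +> a \<longleftrightarrow> y \<ominus> a \<in> H"
proof -
  interpret ideal H R by fact
  show ?thesis by (rule a_rcos_module_minus[OF ring_axioms assms(2,3)])
qed

lemma coset_cov: "ideal H R ==> cov R y \<in> H +> cov R a \<longleftrightarrow> y - a \<in> pb H"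
  using coset_mem[OF _ cov_closed cov_closed] by (simp add: pb_def cov_diff)

end

locale assoc = cring R + gr: cring "assoc_graded R I" for R :: "('a, 'b) ring_scheme" (structure) and I +
  assumes noeR: "noetherian_ring R" and noeG: "noetherian_ring (assoc_graded R I)" and idI: "ideal I R"
begin

abbreviation "\<Gamma> \<equiv> assoc_graded R I"
definition GI :: "nat => 'a fr set" where "GI n = pb (ideal_pow R I n)"
definition cog :: "(nat => 'a set) fr => nat => 'a fr => bool" where
  "cog w k f \<longleftrightarrow> f \<in> GI k \<and> cov R f \<in> cov \<Gamma> w k"

lemma filtGI: "filt GI" using filt_pow[OF noeR idI] unfolding GI_def[abs_def] .

lemma pow_ideal: "ideal (ideal_pow R I n) R" by (rule ideal_pow_ideal[OF idI])

lemma comp_coset: "\<exists>a\<in>GI k. cov \<Gamma> w k = ideal_pow R I (Suc k) +> cov R a"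
proof -
  have "cov \<Gamma> w \<in> carrier \<Gamma>" by (rule gr.cov_closed)
  hence "cov \<Gamma> w k \<in> (\<lambda>x. ideal_pow R I (Suc k) +> x) ` ideal_pow R I k" unfolding assoc_graded_def by simp
  then obtain b where b: "b \<in> ideal_pow R I k" "cov \<Gamma> w k = ideal_pow R I (Suc k) +> b" by blast
  then obtain a where "cov R a = b" using cov_surj ideal_carr[OF pow_ideal] by blast
  thus ?thesis using b by (intro bexI[of _ a]) (simp_all add: GI_def pb_def)
qed

lemma cog_iff:
  assumes "a \<in> GI k" "cov \<Gamma> w k = ideal_pow R I (Suc k) +> cov R a"
  shows "cog w k f \<longleftrightarrow> f - a \<in> GI (Suc k)"
proof -
  have "f - a \<in> GI (Suc k) ==> f \<in> GI k"
    using filt_down[OF filtGI, of "f - a" "Suc k" k] idealp_cancel[OF filt_ideal[OF filtGI] _ assms(1)] by simp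
  thus ?thesis unfolding cog_def assms(2) coset_cov[OF pow_ideal] GI_def[symmetric] by blast
qed

lemma cog_ex: "\<exists>f. cog w k f"
proof -
  obtain a where a: "a \<in> GI k" "cov \<Gamma> w k = ideal_pow R I (Suc k) +> cov R a" using comp_coset by blast
  thus ?thesis using cog_iff[OF a, of a] idealp_zero[OF filt_ideal[OF filtGI]] by auto
qed

lemma cog_cong: assumes "cog w k f" shows "cog w k f' \<longleftrightarrow> f - f' \<in> GI (Suc k)"
proof -
  note id = filt_ideal[OF filtGI, of "Suc k"]
  obtain a where a: "a \<in> GI k" "cov \<Gamma> w k = ideal_pow R I (Suc k) +> cov R a" using comp_coset by blast
  have f: "f - a \<in> GI (Suc k)" using assms cog_iff[OF a] by blast
  have "f' - a \<in> GI (Suc k) \<longleftrightarrow> f - f' \<in> GI (Suc k)"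
    using idealp_diff[OF id f, of "f' - a"] idealp_diff[OF id f, of "f - f'"] by auto
  thus ?thesis using cog_iff[OF a] by blast
qed

lemma cog_add: assumes "cog w k f" "cog w' k f'" shows "cog (w + w') k (f + f')"
proof -
  have "cov \<Gamma> (w + w') k = cov \<Gamma> w k <+> cov \<Gamma> w' k" unfolding gr.cov_hom by (simp add: assoc_graded_def)
  moreover have "cov R f \<oplus> cov R f' \<in> cov \<Gamma> w k <+> cov \<Gamma> w' k" using assms unfolding set_add_def' cog_def by blast
  ultimately show ?thesis using assms idealp_add[OF filt_ideal[OF filtGI]] by (simp add: cog_def cov_hom)
qed

lemma cog_rep: "\<exists>f. cog w k f \<and> cov R f = gr_rep (cov \<Gamma> w k)"
proof -
  obtain a where a: "a \<in> GI k" "cov \<Gamma> w k = ideal_pow R I (Suc k) +> cov R a" using comp_coset by blast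
  have "cog w k a" using cog_iff[OF a, of a] idealp_zero[OF filt_ideal[OF filtGI]] by simp
  hence "cov R a \<in> cov \<Gamma> w k" by (simp add: cog_def)
  hence g: "gr_rep (cov \<Gamma> w k) \<in> cov \<Gamma> w k" unfolding gr_rep_def by (rule someI)
  have "cov \<Gamma> w k <= carrier R"
    unfolding a(2) by (rule a_r_coset_subset_G[OF ideal_carr[OF pow_ideal] cov_closed])
  then obtain f where f: "cov R f = gr_rep (cov \<Gamma> w k)" using g cov_surj by blast
  hence "f - a \<in> GI (Suc k)" using g unfolding a(2) GI_def coset_cov[OF pow_ideal, symmetric] by (simp only: f)
  thus ?thesis using f cog_iff[OF a] by blast
qed

text \<open>Multiplication is defined through the representatives picked by \<open>gr_rep\<close>;
  replacing them by others changes each summand by an element of the next power.\<close>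

lemma cog_mult:
  assumes p: "\<And>i. i \<le> k ==> cog w i (p i)" and q: "\<And>i. i \<le> k ==> cog w' i (q i)"
  shows "cog (w * w') k (\<Sum>i\<le>k. p i * q (k - i))"
proof -
  note id = filt_ideal[OF filtGI]
  have "\<forall>i. \<exists>f. cog w i f \<and> cov R f = gr_rep (cov \<Gamma> w i)" using cog_rep by blast
  from choice[OF this] obtain p' where p': "\<And>i. cog w i (p' i)" "\<And>i. cov R (p' i) = gr_rep (cov \<Gamma> w i)" by blast
  have "\<forall>i. \<exists>f. cog w' i f \<and> cov R f = gr_rep (cov \<Gamma> w' i)" using cog_rep by blast
  from choice[OF this] obtain q' where q': "\<And>i. cog w' i (q' i)" "\<And>i. cov R (q' i) = gr_rep (cov \<Gamma> w' i)" by blast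
  let ?s = "\<Sum>i\<le>k. p' i * q' (k - i)"
  have G: "cog v i f ==> f \<in> GI i" for v i f by (simp add: cog_def)
  have c: "cov \<Gamma> (w * w') k = ideal_pow R I (Suc k) +> cov R ?s"
    unfolding gr.cov_hom by (simp add: assoc_graded_def cov_sum cov_hom p'(2) q'(2))
  have trm: "a * b \<in> GI k" if "i \<le> k" "a \<in> GI i" "b \<in> GI (k - i)" for a b i using filt_mult[OF filtGI that(2,3)] that(1) by simp
  have s: "?s \<in> GI k" by (rule idealp_sum[OF id], rule trm[OF _ G[OF p'(1)] G[OF q'(1)]]) simp
  have "(\<Sum>i\<le>k. p i * q (k - i)) - ?s = (\<Sum>i\<le>k. p i * (q (k - i) - q' (k - i)) + (p i - p' i) * q' (k - i))"
    by (simp add: sum_subtractf[symmetric] algebra_simps)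
  also have "\<dots> \<in> GI (Suc k)"
  proof (rule idealp_sum[OF id], rule idealp_add[OF id])
    fix i assume "i \<in> {..k}" hence i: "i \<le> k" "k - i \<le> k" by auto
    have 1: "q (k - i) - q' (k - i) \<in> GI (Suc (k - i))" using cog_cong[OF q[OF i(2)]] q'(1) by blast
    have 2: "p i - p' i \<in> GI (Suc i)" using cog_cong[OF p[OF i(1)]] p'(1) by blast
    show "p i * (q (k - i) - q' (k - i)) \<in> GI (Suc k)" using filt_mult[OF filtGI G[OF p[OF i(1)]] 1] i by simp
    show "(p i - p' i) * q' (k - i) \<in> GI (Suc k)" using filt_mult[OF filtGI 2 G[OF q'(1)[of "k - i"]]] i by simp
  qed
  finally show ?thesis using cog_iff[OF s c] by blast
qed

lemma pow_coset_zero: "ideal_pow R I n +> \<zero> = ideal_pow R I n"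
  using abelian_subgroup.a_rcos_const[OF abelian_subgroupI3[OF ideal.axioms(1)[OF pow_ideal] is_abelian_group]] additive_subgroup.zero_closed[OF ideal.axioms(1)[OF pow_ideal]] by blast

lemma cog_0: "cov \<Gamma> w k = ideal_pow R I (Suc k) \<longleftrightarrow> cog w k 0"
proof
  assume c: "cov \<Gamma> w k = ideal_pow R I (Suc k)"
  have "cov \<Gamma> w k = ideal_pow R I (Suc k) +> cov R 0" unfolding c cov_hom pow_coset_zero ..
  thus "cog w k 0" using cog_iff[of 0 k w 0] idealp_zero[OF filt_ideal[OF filtGI]] by simp
next
  assume "cog w k 0"
  obtain a where a: "a \<in> GI k" "cov \<Gamma> w k = ideal_pow R I (Suc k) +> cov R a" using comp_coset by blast
  have "- a \<in> GI (Suc k)" using cog_iff[OF a, of 0] \<open>cog w k 0\<close> by simp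
  hence "a \<in> GI (Suc k)" using idealp_neg[OF filt_ideal[OF filtGI], of "- a"] by simp
  hence "cov R a \<in> ideal_pow R I (Suc k)" by (simp add: GI_def pb_def del: ideal_pow.simps)
  thus "cov \<Gamma> w k = ideal_pow R I (Suc k)" unfolding a(2)
    using abelian_subgroup.a_rcos_const[OF abelian_subgroupI3[OF ideal.axioms(1)[OF pow_ideal] is_abelian_group]] by blast
qed

lemma grc_assoc: "grc GI cog gr.kr"
proof
  show "noeth gr.kr" by (rule gr.noeth_kr[OF noeG])
  show "idealp gr.kr" by (rule gr.kr_ideal)
  show "\<exists>w. cog w n f \<and> (\<forall>k. k \<noteq> n --> cog w k 0)" if f: "f \<in> GI n" for f n
  proof -
    define z where "z k = ideal_pow R I (Suc k) +> (if k = n then cov R f else \<zero>)" for k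
    have "z \<in> carrier \<Gamma>"
    proof -
      have "z k \<in> (\<lambda>x. ideal_pow R I (Suc k) +> x) ` ideal_pow R I k" for k
        unfolding z_def using f additive_subgroup.zero_closed[OF ideal.axioms(1)[OF pow_ideal, of k]] by (auto simp: GI_def pb_def)
      moreover have "z k = ideal_pow R I (Suc k)" if "k \<noteq> n" for k using that by (simp add: z_def pow_coset_zero del: ideal_pow.simps)
      hence "{k. z k \<noteq> ideal_pow R I (Suc k)} <= {n}" by blast
      hence "finite {k. z k \<noteq> ideal_pow R I (Suc k)}" by (rule finite_subset) simp
      ultimately show ?thesis unfolding assoc_graded_def by simp
    qed
    then obtain w where w: "cov \<Gamma> w = z" using gr.cov_surj by blast
    have "cov \<Gamma> w n = ideal_pow R I (Suc n) +> cov R f" by (simp add: w z_def)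
    hence "cog w n f" using cog_iff[OF f] idealp_zero[OF filt_ideal[OF filtGI]] by simp
    moreover have "cog w k 0" if "k \<noteq> n" for k
      using cog_0[of w k] that pow_coset_zero[of "Suc k"] by (simp add: w z_def del: ideal_pow.simps)
    ultimately show ?thesis by blast
  qed
  show "\<exists>K. \<forall>k\<ge>K. cog w k 0" for w
  proof -
    have "cov \<Gamma> w \<in> carrier \<Gamma>" by (rule gr.cov_closed)
    hence "finite {n. cov \<Gamma> w n \<noteq> ideal_pow R I (Suc n)}" unfolding assoc_graded_def by simp
    then obtain K where "\<forall>n\<in>{n. cov \<Gamma> w n \<noteq> ideal_pow R I (Suc n)}. n < K" using finite_nat_set_iff_bounded by blast
    thus ?thesis using cog_0 by (intro exI[of _ K]) (auto simp del: ideal_pow.simps simp: not_less[symmetric])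
  qed
  show "w \<in> gr.kr \<longleftrightarrow> (\<forall>k. cog w k 0)" for w
  proof -
    have "\<zero>\<^bsub>\<Gamma>\<^esub> = (\<lambda>n. ideal_pow R I (Suc n))" by (simp add: assoc_graded_def)
    thus ?thesis using cog_0[of w] by (auto simp: gr.pb_def fun_eq_iff)
  qed
  show "cog 1 k (if k = 0 then 1 else 0)" for k
  proof -
    have "cov \<Gamma> 1 k = ideal_pow R I (Suc k) +> cov R (if k = 0 then 1 else 0)"
      unfolding gr.cov_hom by (simp add: assoc_graded_def cov_hom)
    moreover have "(if k = 0 then 1 else 0) \<in> GI k" using filt_0[OF filtGI] idealp_zero[OF filt_ideal[OF filtGI]] by auto
    ultimately show ?thesis using cog_iff idealp_zero[OF filt_ideal[OF filtGI]] by simp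
  qed
  show "cog (w * w') k (\<Sum>i\<le>k. p i * q (k - i))"
    if "\<And>i. i \<le> k ==> cog w i (p i)" "\<And>i. i \<le> k ==> cog w' i (q i)" for w w' k p q using that by (rule cog_mult)
  show "cog w k f ==> f \<in> GI k" for w k f by (simp add: cog_def)
qed (fact filtGI cog_ex cog_cong cog_add)+

end

section \<open>Growth, integral closure and Hilbert coefficients\<close>

text \<open>A regular sequence of length \<open>d\<close> is a system of parameters, as a prime
  above it other than \<open>m\<close> would produce too long a chain. With \<open>y ^ N\<close> in
  \<open>G 1\<close> the powers \<open>y ^ (N * n)\<close> lie in \<open>G n\<close>, and their
  colength is at most \<open>(N * n) ^ d\<close> times that of the parameters.\<close>

lemma (in grc_loc) growth:
  assumes dA: "dpt m Z d"
    and dim: "\<And>n C. (\<And>i. i \<le> n ==> primep (C i) \<and> Z <= C i) ==> (\<And>i. i < n ==> C i \<subset> C (Suc i)) ==> n \<le> d"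
  shows "\<exists>C\<ge>0. \<forall>n. hl G n \<le> C * int (Suc n) ^ d"
proof -
  obtain ys where ys: "length ys = d" "set ys <= m" "rseq Z ys" using dA unfolding dpt_def by blast
  define Y where "Y = adjs Z ys"
  have Y: "idealp Y" "Z <= Y" unfolding Y_def by (rule idealp_adjs[OF Zid], rule adjs_subset)
  have only: "P = m" if P: "primep P" "Y <= P" for P
  proof (rule ccontr)
    assume ne: "P \<noteq> m"
    have ZP: "Z <= P" "set ys <= P" using P Y adjs_mem[OF Zid, of _ ys] by (auto simp: Y_def)
    have Pm: "P <= m" using P ZP by (intro proper_sub_m) (auto simp: primep_def)
    obtain C where C: "\<forall>i\<le>length ys. primep (C i) \<and> Z <= C i" "\<forall>i<length ys. C i \<subset> C (Suc i)" "C (length ys) = P"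
      using rseq_prime_chain[OF noe Zid order_refl ys(3) P(1) ZP] by blast
    let ?C = "C(Suc d := m)"
    have "Suc d \<le> d"
    proof (rule dim[where C = ?C])
      show "primep (?C i) \<and> Z <= ?C i" if "i \<le> Suc d" for i using that C(1) mp Zm ys(1) by (cases "i = Suc d") auto
      show "?C i \<subset> ?C (Suc i)" if "i < Suc d" for i using that C(2,3) Pm ne ys(1) by (cases "i = d") auto
    qed
    thus False by simp
  qed
  have nilY: "\<exists>N. z ^ N \<in> Y" if z: "z \<in> m" for z
  proof (rule ccontr)
    assume n: "\<not> ?thesis"
    have "\<exists>P. primep P \<and> Y <= P \<and> P \<inter> range (\<lambda>k. z ^ k) = {}"
    proof (rule prime_avoiding[OF noe Y])
      show "1 \<in> range (\<lambda>k. z ^ k)" by (rule range_eqI[of _ _ 0]) simp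
      show "a * b \<in> range (\<lambda>k. z ^ k)" if "a \<in> range (\<lambda>k. z ^ k)" "b \<in> range (\<lambda>k. z ^ k)" for a b
        using that by (auto simp: power_add[symmetric])
    qed (use n in blast)
    then obtain P where P: "primep P" "Y <= P" "P \<inter> range (\<lambda>k. z ^ k) = {}" by blast
    have "z ^ 1 \<in> range (\<lambda>k. z ^ k)" by blast
    thus False using P(3) only[OF P(1,2)] z by auto
  qed
  have finY: "colen Y \<noteq> \<infinity>" by (rule nil_colen_finite[OF noe m_ideal _ Y nilY]) (simp_all add: colen_m one_enat_def)
  have "\<exists>N. \<forall>y\<in>set ys. y ^ N \<in> G 1"
    using ys(2)
  proof (induction ys)
    case (Cons y ys)
    then obtain N where N: "\<forall>y\<in>set ys. y ^ N \<in> G 1" by auto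
    obtain N' where N': "y ^ N' \<in> G 1" using nil Cons.prems by auto
    have "z ^ (N + N') \<in> G 1" if "z \<in> set (y # ys)" for z
      using that N N' idealp_mult[OF filt_ideal[OF G]] idealp_mult2[OF filt_ideal[OF G]] by (auto simp: power_add)
    thus ?case by blast
  qed simp
  then obtain N where N: "\<And>y. y \<in> set ys ==> y ^ N \<in> G 1" by blast
  obtain B where B: "colen Y = enat B" using finY by auto
  have "hl G n \<le> int (B * N ^ d) * int (Suc n) ^ d" for n
  proof -
    let ?V = "adjs Z (map (\<lambda>y. y ^ (N * n)) ys)"
    have "y ^ (N * n) \<in> G n" if "y \<in> set ys" for y
      using filt_pow[OF G N[OF that], of n] by (simp add: power_mult)
    hence "?V <= G n" by (intro adjs_least filt_ideal[OF G] ZG) auto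
    hence "colen (G n) \<le> colen ?V" by (intro colen_antimono idealp_adjs Zid filt_ideal[OF G])
    moreover have "colen ?V \<le> enat ((N * n) ^ d) * enat B" using colen_adjs_pow[OF Zid, of "N * n" ys] ys(1) B unfolding Y_def by simp
    ultimately have "colen (G n) \<le> enat ((N * n) ^ d * B)" by (metis order_trans times_enat_simps(1))
    moreover obtain h where h: "colen (G n) = enat h" using m_nil_colen[of n] by auto
    ultimately have "h \<le> (N * n) ^ d * B" by simp
    hence "hl G n \<le> int ((N * n) ^ d * B)" unfolding hl_def h by (simp only: the_enat.simps of_nat_le_iff)
    moreover have "(N * n) ^ d * B \<le> (B * N ^ d) * Suc n ^ d"
      using power_mono[of n "Suc n" d] by (simp add: power_mult_distrib mult_ac del: power_Suc)
    ultimately have "hl G n \<le> int ((B * N ^ d) * Suc n ^ d)" by linarith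
    thus ?thesis by simp
  qed
  thus ?thesis by (intro exI[of _ "int (B * N ^ d)"]) simp
qed

context cring
begin

lemma ideal_pow_add: assumes "ideal J R" shows "ideal_prod R (ideal_pow R J n) (ideal_pow R J k) = ideal_pow R J (n + k)"
proof (induction n)
  case 0 show ?case using ideal_prod_one[OF ideal_pow_ideal[OF assms]] ideal_prod_commute[OF oneideal ideal_pow_ideal[OF assms]] by simp
next
  case (Suc n)
  thus ?case using ideal_prod_assoc[OF assms ideal_pow_ideal[OF assms] ideal_pow_ideal[OF assms], of n k] by simp
qed

lemma ideal_pow_mult: assumes "ideal J R" shows "ideal_pow R (ideal_pow R J n) i = ideal_pow R J (n * i)"
  by (induction i) (simp_all add: ideal_pow_add[OF assms])

text \<open>A nonzerodivisor \<open>c\<close> of degree \<open>C\<close> turns the hypothesis into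
  \<open>c * f ^ i \<in> U i\<close>. Thus \<open>c\<close> times the polynomials in
  \<open>f\<close> forms a submodule of the Rees algebra, where Artin-Rees bounds the degree in
  \<open>f\<close>; cancelling \<open>c\<close> leaves an equation of integral dependence.\<close>

lemma closedf_of_integrally_closed:
  assumes noe: "noetherian_ring R" and J: "ideal J R"
    and ic: "\<And>n. n \<ge> n1 ==> integrally_closed_ideal R (ideal_pow R J n)"
    and reg: "\<And>C. \<exists>c. c \<in> pb (ideal_pow R J C) \<and> nzd kr c"
  shows "closedf (\<lambda>n. pb (ideal_pow R J n)) n1"
  unfolding closedf_def
proof (intro allI impI)
  define F where "F n = pb (ideal_pow R J n)" for n
  have F: "filt F" using filt_pow[OF noe J] unfolding F_def[abs_def] .
  note idF = filt_ideal[OF F]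
  have krF: "kr <= F n" for n unfolding F_def by (rule pb_ideal(2)[OF ideal_pow_ideal[OF J]])
  fix n f C assume n: "n1 \<le> n" and f: "\<forall>m. f ^ m \<in> pb (ideal_pow R J (n * m - C))"
  obtain c where c: "c \<in> F C" "nzd kr c" using reg[of C] by (auto simp: F_def)
  define U where "U k = F (n * k)" for k
  have idU: "idealp (U k)" for k unfolding U_def by (rule idF)
  have cU: "c * f ^ i \<in> U i" for i
  proof -
    have "c * f ^ i \<in> F (C + (n * i - C))" using f filt_mult[OF F c(1)] by (auto simp: F_def)
    thus ?thesis unfolding U_def by (rule filt_down[OF F]) simp
  qed
  obtain bs where bs: "pb (ideal_pow R J n) = adjs kr bs" using ideal_gens[OF noe ideal_pow_ideal[OF J]] by blast
  have bsF: "b \<in> F n" if "b \<in> set bs" for b unfolding F_def bs by (rule adjs_mem[OF kr_ideal that])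
  have bU: "b * x \<in> U (Suc k)" if "b \<in> set bs" "x \<in> U k" for b x k
    using filt_mult[OF F bsF[OF that(1)], of x "n * k"] that(2) by (simp add: U_def)
  have genU: "U (Suc k) = isum (lcomb bs (U k)) kr" for k
    using pb_prod[OF ideal_pow_ideal[OF J] ideal_pow_ideal[OF J] bs, of "n * k"] unfolding ideal_pow_add[OF J] by (simp add: U_def F_def)
  \<comment> \<open>Multiples by \<open>c\<close> of polynomials in \<open>f\<close> of degree below
    \<open>j\<close>. In degree \<open>k\<close> the natural bound is \<open>j = Suc k\<close>, and
    Artin-Rees will save one power of \<open>f\<close>.\<close>
  define E where "E j k = isum ((\<lambda>x. c * x) ` low f U j k) kr" for j k
  have idc: "idealp ((\<lambda>x. c * x) ` low f U j k)" for j k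
  proof (rule idealpI)
    note id = idealp_low[of U f j k, OF idU]
    show "0 \<in> (\<lambda>x. c * x) ` low f U j k" using idealp_zero[OF id] by force
    show "x + y \<in> (\<lambda>x. c * x) ` low f U j k" if "x \<in> (\<lambda>x. c * x) ` low f U j k" "y \<in> (\<lambda>x. c * x) ` low f U j k" for x y
      using that idealp_add[OF id] by (auto simp: distrib_left[symmetric])
    show "r * x \<in> (\<lambda>x. c * x) ` low f U j k" if "x \<in> (\<lambda>x. c * x) ` low f U j k" for r x
      using that idealp_mult[OF id, of _ r] by (auto simp: mult.left_commute)
  qed
  have idE: "idealp (E j k)" for j k unfolding E_def by (rule idealp_isum[OF idc kr_ideal])
  have krE: "kr <= E j k" for j k unfolding E_def by (rule isum_subset2[OF idc])
  have bE: "b * x \<in> E (Suc k) (Suc k)" if b: "b \<in> set bs" and x: "x \<in> E (Suc k) k" for b x k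
  proof -
    obtain y z where yz: "x = c * y + z" "y \<in> low f U (Suc k) k" "z \<in> kr" using x by (auto simp: E_def isum_def)
    have "b * y \<in> low f U (Suc k) (Suc k)" by (rule low_mult_a[OF yz(2)]) (use bU[OF b] in auto)
    hence "c * (b * y) + b * z \<in> E (Suc k) (Suc k)" unfolding E_def using idealp_mult[OF kr_ideal yz(3)] by (intro isumI imageI)
    thus ?thesis by (simp add: yz algebra_simps)
  qed
  have EE: "E (Suc k) (Suc k) <= E (Suc (Suc k)) (Suc k)" for k
    unfolding E_def using low_mono_j[of U "Suc k" "Suc (Suc k)" f "Suc k", OF idU] by (intro isum_mono image_mono) auto
  have EU: "E (Suc k) k <= U k" for k
    unfolding E_def
  proof (rule isum_least[OF idU])
    show "kr <= U k" using krF by (simp add: U_def)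
    show "(\<lambda>x. c * x) ` low f U (Suc k) k <= U k"
    proof
      fix x assume "x \<in> (\<lambda>x. c * x) ` low f U (Suc k) k"
      then obtain u where u: "x = c * (\<Sum>i<Suc k. f ^ i * u i)" "\<forall>i<Suc k. u i \<in> U (k - i)" by (auto simp: low_def)
      have "x = (\<Sum>i<Suc k. (c * f ^ i) * u i)" unfolding u(1) sum_distrib_left by (simp only: mult.assoc)
      also have "\<dots> \<in> U k"
      proof (rule idealp_sum[OF idU])
        fix i assume i: "i \<in> {..<Suc k}"
        hence "(c * f ^ i) * u i \<in> F (n * i + n * (k - i))" using cU[of i] u(2) by (intro filt_mult[OF F]) (auto simp: U_def)
        moreover have "n * i + n * (k - i) = n * k" using i by (simp add: add_mult_distrib2[symmetric])
        ultimately show "(c * f ^ i) * u i \<in> U k" by (simp add: U_def)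
      qed
      finally show "x \<in> U k" .
    qed
  qed
  have "\<exists>k1. \<forall>k\<ge>k1. E (Suc (Suc k)) (Suc k) <= isum (lcomb bs (E (Suc k) k)) kr"
  proof (rule artin_rees[where U = U and V = "\<lambda>_. kr" and E = "\<lambda>k. E (Suc k) k" and ?n0.0 = 0])
    show "\<And>a k x. a \<in> set bs ==> x \<in> E (Suc k) k ==> a * x \<in> E (Suc (Suc k)) (Suc k)" using bE EE by blast
    show "\<And>a k x. a \<in> set bs ==> x \<in> kr ==> a * x \<in> kr" by (rule idealp_mult[OF kr_ideal])
    show "\<And>k. U (Suc k) <= isum (lcomb bs (U k)) kr" using genU by simp
    show "\<And>k H. (\<And>i::nat. idealp (H i)) ==> (\<And>i. kr <= H i) ==> (\<And>i. H i <= U k) ==> (\<And>i. H i <= H (Suc i)) ==> \<exists>k. \<forall>j. H j <= H k"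
      by (rule noethD[OF noeth_kr[OF noe]])
  qed (use idU idE kr_ideal krE EU bU in auto)
  then obtain k where "E (Suc (Suc k)) (Suc k) <= isum (lcomb bs (E (Suc k) k)) kr" by blast
  also have "\<dots> <= E (Suc k) (Suc k)" using bE by (intro isum_least lcomb_least idE krE)
  finally have EEE: "E (Suc (Suc k)) (Suc k) <= E (Suc k) (Suc k)" .
  have "f ^ Suc k * 1 + 0 \<in> low f U (Suc (Suc k)) (Suc k)"
  proof (rule low_SucI)
    show "0 \<in> low f U (Suc k) (Suc k)" by (rule idealp_zero[OF idealp_low[OF idU]])
    show "1 \<in> U (Suc k - Suc k)" by (simp add: U_def filt_0[OF F])
  qed
  hence "c * f ^ Suc k + 0 \<in> E (Suc (Suc k)) (Suc k)" unfolding E_def using idealp_zero[OF kr_ideal] by (intro isumI) auto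
  hence "c * f ^ Suc k + 0 \<in> E (Suc k) (Suc k)" by (rule subsetD[OF EEE])
  then obtain x z where x: "c * f ^ Suc k = c * x + z" "x \<in> low f U (Suc k) (Suc k)" "z \<in> kr"
    unfolding E_def isum_def by auto
  have "c * (f ^ Suc k - x) \<in> kr" using x(1,3) by (simp add: right_diff_distrib)
  hence fx: "f ^ Suc k - x \<in> kr" using c(2) by blast
  obtain u where u: "x = (\<Sum>i<Suc k. f ^ i * u i)" "\<forall>i<Suc k. u i \<in> U (Suc k - i)" using x(2) by (auto simp: low_def)
  \<comment> \<open>The coefficients are re-indexed, since an equation of integral dependence counts
    them from the top power downwards.\<close>
  define a where "a i = cov R (- u (Suc k - i))" for i
  have "integral_over_ideal R (ideal_pow R J n) (cov R f)"
    unfolding integral_over_ideal_def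
  proof (intro conjI exI[of _ "Suc k"] exI[of _ a])
    show "cov R f \<in> carrier R" by (rule cov_closed)
    show "\<forall>i\<in>{1..Suc k}. a i \<in> ideal_pow R (ideal_pow R J n) i"
    proof
      fix i assume i: "i \<in> {1..Suc k}"
      hence "u (Suc k - i) \<in> U (Suc k - (Suc k - i))" by (intro u(2)[rule_format]) auto
      hence "- u (Suc k - i) \<in> U i" using i idealp_neg[OF idU] by simp
      thus "a i \<in> ideal_pow R (ideal_pow R J n) i" by (simp add: a_def ideal_pow_mult[OF J] U_def F_def pb_def)
    qed
    have "(\<Sum>i\<in>{1..Suc k}. - u (Suc k - i) * f ^ (Suc k - i)) = (\<Sum>i<Suc k. - u i * f ^ i)"
      by (rule sum.reindex_bij_witness[of _ "\<lambda>i. Suc k - i" "\<lambda>i. Suc k - i"]) auto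
    moreover have "(\<Sum>i<Suc k. - u i * f ^ i) = - x"
      unfolding u(1) by (simp add: sum_negf mult.commute del: sum.lessThan_Suc)
    ultimately have "f ^ Suc k + (\<Sum>i\<in>{1..Suc k}. - u (Suc k - i) * f ^ (Suc k - i)) = f ^ Suc k - x"
      by (simp only: add_uminus_conv_diff)
    hence "cov R (f ^ Suc k + (\<Sum>i\<in>{1..Suc k}. - u (Suc k - i) * f ^ (Suc k - i))) = \<zero>" using fx by (simp only: pb_def mem_Collect_eq singleton_iff)
    moreover have "cov R (f ^ Suc k + (\<Sum>i\<in>{1..Suc k}. - u (Suc k - i) * f ^ (Suc k - i)))
        = cov R f [^] Suc k \<oplus> (\<Oplus>i\<in>{1..Suc k}. a i \<otimes> cov R f [^] (Suc k - i))"
      unfolding cov_hom(1) cov_sum[OF finite_atLeastAtMost] cov_hom(2) cov_pow a_def ..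
    ultimately show "cov R f [^] Suc k \<oplus> (\<Oplus>i\<in>{1..Suc k}. a i \<otimes> cov R f [^] (Suc k - i)) = \<zero>" by (simp only:)
  qed simp
  hence "cov R f \<in> ideal_pow R J n" using ic[OF n] unfolding integrally_closed_ideal_def by blast
  thus "f \<in> pb (ideal_pow R J n)" by (simp add: pb_def)
qed

end

section \<open>Hilbert coefficients and binomial sums\<close>

definition bsum :: "(nat => int) => nat => nat => int" where
  "bsum e d n = (\<Sum>i\<le>d. (-1) ^ i * e i * int ((n + d - i) choose (d - i)))"

lemma bsum_Suc: "bsum e (Suc d) n = (\<Sum>i\<le>d. (-1) ^ i * e i * int ((n + Suc d - i) choose (Suc d - i))) + (-1) ^ Suc d * e (Suc d)"
  by (simp add: bsum_def)

text \<open>By Pascal's rule a difference drops the last coefficient and keeps the others, so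
  differences of the Hilbert function have the same leading coefficients.\<close>

lemma bsum_diff: "bsum e (Suc d) (Suc n) - bsum e (Suc d) n = bsum e d (Suc n)"
proof -
  have "int ((Suc n + Suc d - i) choose (Suc d - i)) - int ((n + Suc d - i) choose (Suc d - i)) = int ((Suc n + d - i) choose (d - i))" if "i \<le> d" for i
  proof -
    have "Suc n + Suc d - i = Suc (n + Suc d - i)" "Suc d - i = Suc (d - i)" "n + Suc d - i = Suc n + d - i" using that by auto
    thus ?thesis by simp
  qed
  hence *: "(-1) ^ i * e i * int ((Suc n + Suc d - i) choose (Suc d - i)) - (-1) ^ i * e i * int ((n + Suc d - i) choose (Suc d - i))
      = (-1) ^ i * e i * int ((Suc n + d - i) choose (d - i))" if "i \<le> d" for i using that by (simp only: right_diff_distrib[symmetric])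
  show ?thesis unfolding bsum_Suc bsum_def[of e d]
    by (simp only: add_diff_cancel_right sum_subtractf[symmetric]) (rule sum.cong, simp_all only: atMost_iff *)
qed

lemma bsum_zero: "(\<And>n. n \<ge> N ==> bsum e d n = 0) ==> i \<le> d ==> e i = 0"
proof (induction d arbitrary: N i)
  case 0
  have "bsum e 0 N = e 0" by (simp add: bsum_def)
  thus ?case using 0 by auto
next
  case (Suc d)
  have "bsum e d n = 0" if "n \<ge> Suc N" for n
    using bsum_diff[of e d "n - 1"] Suc.prems(1)[of n] Suc.prems(1)[of "n - 1"] that by simp
  hence z: "e i = 0" if "i \<le> d" for i using Suc.IH that by blast
  hence "bsum e (Suc d) N = (-1) ^ Suc d * e (Suc d)" by (simp add: bsum_Suc)
  hence "e (Suc d) = 0" using Suc.prems(1)[of N] by simp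
  thus ?case using z Suc.prems(2) by (cases "i = Suc d") auto
qed

text \<open>The expansion of the difference is summed up, and the constant of summation becomes the
  new last coefficient with its sign. The length at \<open>Suc n\<close> is expanded at
  \<open>n\<close>, in accordance with the definition of the Hilbert coefficients.\<close>

lemma binomial_expansion_exists:
  "ev_const ((dl ^^ d) f) k ==> \<exists>e. e 0 = k \<and> (\<forall>i>d. e i = 0) \<and> (\<exists>N. \<forall>n\<ge>N. f (Suc n) = bsum e d n)"
proof (induction d arbitrary: f)
  case 0
  then obtain N where "\<And>n. n \<ge> N ==> f n = k" by (auto simp: ev_const_def)
  hence "\<forall>n\<ge>N. f (Suc n) = bsum (\<lambda>i. if i = 0 then k else 0) 0 n" by (simp add: bsum_def)
  thus ?case by (intro exI[of _ "\<lambda>i. if i = 0 then k else 0"]) auto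
next
  case (Suc d)
  define f' where "f' n = dl f (n - 1)" for n
  obtain M where M: "\<And>n. n \<ge> M ==> (dl ^^ d) (dl f) n = k" using Suc.prems unfolding ev_const_def dl_Suc by blast
  have "(dl ^^ d) f' n = k" if "Suc M \<le> n" for n
  proof -
    have "(\<lambda>n. f' (n + 1)) = dl f" by (rule ext) (simp add: f'_def)
    hence "(dl ^^ d) (dl f) (n - 1) = (dl ^^ d) f' (n - 1 + 1)" using dl_shift[of d f' 1 "n - 1"] by (simp only:)
    thus ?thesis using M[of "n - 1"] that by simp
  qed
  hence "ev_const ((dl ^^ d) f') k" unfolding ev_const_def by blast
  then obtain e N where e: "e 0 = k" "\<And>i. i > d ==> e i = 0" "\<And>n. n \<ge> N ==> f' (Suc n) = bsum e d n" using Suc.IH by blast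
  have step: "f (Suc (Suc n)) - bsum e (Suc d) (Suc n) = f (Suc n) - bsum e (Suc d) n" if "n \<ge> N" for n
    using bsum_diff[of e d n] e(3)[of "Suc n"] that by (simp add: f'_def dl_def)
  define c where "c = f (Suc N) - bsum e (Suc d) N"
  have const: "f (Suc (N + j)) - bsum e (Suc d) (N + j) = c" for j
    by (induction j) (use step in \<open>auto simp: c_def\<close>)
  let ?e = "e(Suc d := (-1) ^ Suc d * c)"
  have "bsum ?e (Suc d) n = bsum e (Suc d) n + c" for n
  proof -
    have "(-1) ^ Suc d * ((-1) ^ Suc d * c) = c" by (simp add: mult.assoc[symmetric] power_mult_distrib[symmetric])
    moreover have "e (Suc d) = 0" using e(2) by simp
    ultimately show ?thesis unfolding bsum_Suc by simp
  qed
  hence "f (Suc n) = bsum ?e (Suc d) n" if "n \<ge> N" for n using const[of "n - N"] that by simp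
  hence "\<exists>N. \<forall>n\<ge>N. f (Suc n) = bsum ?e (Suc d) n" by blast
  moreover have "?e 0 = k" "\<forall>i>Suc d. ?e i = 0" using e(1,2) by auto
  ultimately show ?case by blast
qed

text \<open>After \<open>i\<close> backward differences the coefficients up to \<open>e d\<close>
  are unchanged; so the third coefficient survives all cuts down to dimension three.\<close>

lemma nb_bsum:
  "(\<And>n. n \<ge> N ==> f (Suc n) = bsum e (i + d) n) ==> \<exists>N. \<forall>n\<ge>N. (nb ^^ i) f (Suc n) = bsum e d n"
proof (induction i arbitrary: f N)
  case (Suc i)
  have "nb f (Suc n) = bsum e (i + d) n" if nN: "n \<ge> Suc N" for n
  proof -
    obtain k where k: "n = Suc k" "N \<le> k" using nN by (cases n) auto
    thus ?thesis using Suc.prems[of n] Suc.prems[of k] bsum_diff[of e "i + d" k] by (simp add: nb_def)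
  qed
  hence "\<exists>N. \<forall>n\<ge>N. (nb ^^ i) (nb f) (Suc n) = bsum e d n" by (rule Suc.IH)
  thus ?case by (simp add: funpow_swap1)
qed auto

lemma bsum_three:
  assumes "e 0 = 0" shows "bsum e 3 n = - (e 1 * (int (Suc n) * (int (Suc n) + 1) div 2)) + e 2 * int (Suc n) - e 3"
proof -
  have "int ((n + 2) choose 2) = int (Suc n) * (int (Suc n) + 1) div 2"
    by (simp add: choose_two zdiv_int algebra_simps)
  thus ?thesis using assms by (simp add: bsum_def numeral_3_eq_3 numeral_2_eq_2)
qed

lemma bsum_minus: "bsum e d n - bsum e' d n = bsum (\<lambda>i. e i - e' i) d n"
  unfolding bsum_def by (simp add: sum_subtractf[symmetric] algebra_simps)

text \<open>The coefficients are a definite description, so uniqueness accompanies existence; it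
  follows from \<open>bsum_zero\<close> and from the convention that coefficients beyond
  \<open>d\<close> vanish.\<close>

lemma (in cring) hilbert_coeff_eq:
  assumes d: "krull_dim R = enat d" and K: "ideal K R" and fin: "\<And>n. colen (pb (ideal_pow R K n)) \<noteq> \<infinity>"
    and e: "\<forall>i>d. e i = 0" "\<And>n. n \<ge> N ==> hl (\<lambda>n. pb (ideal_pow R K n)) (Suc n) = bsum e d n"
  shows "hilbert_coeff R K = e"
proof -
  have "(\<exists>l. quotient_length R (ideal_pow R K (Suc n)) = enat l \<and> int l = x) \<longleftrightarrow> hl (\<lambda>n. pb (ideal_pow R K n)) (Suc n) = x" for n x
  proof -
    obtain l where "colen (pb (ideal_pow R K (Suc n))) = enat l" using fin[of "Suc n"] by blast
    thus ?thesis using quotient_length_pb[OF ideal_pow_ideal[OF K], of "Suc n"] by (simp add: hl_def del: ideal_pow.simps)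
  qed
  hence seq: "hilbert_coeff_seq R K e' \<longleftrightarrow> (\<forall>i>d. e' i = 0) \<and> (\<exists>N. \<forall>n\<ge>N. hl (\<lambda>n. pb (ideal_pow R K n)) (Suc n) = bsum e' d n)" for e'
    unfolding hilbert_coeff_seq_def d Let_def the_enat.simps bsum_def[symmetric] eventually_sequentially by (simp only:)
  have "(THE e'. hilbert_coeff_seq R K e') = e"
  proof (rule the_equality)
    show "hilbert_coeff_seq R K e" unfolding seq using e by blast
    fix e' assume "hilbert_coeff_seq R K e'"
    then obtain N' where e': "\<forall>i>d. e' i = 0" "\<And>n. n \<ge> N' ==> hl (\<lambda>n. pb (ideal_pow R K n)) (Suc n) = bsum e' d n" unfolding seq by blast
    have "bsum (\<lambda>i. e' i - e i) d n = 0" if "n \<ge> max N N'" for n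
      using e(2)[of n] e'(2)[of n] that bsum_minus[of e' d n e] by simp
    hence "e' i - e i = 0" if "i \<le> d" for i using bsum_zero[of "max N N'" "\<lambda>i. e' i - e i" d i] that by blast
    thus "e' = e" using e(1) e'(1) by (intro ext) (metis eq_iff_diff_eq_0 not_less)
  qed
  thus ?thesis by (auto simp: hilbert_coeff_def)
qed

text \<open>With \<open>e 0 = 0\<close> there is no cubic term. The combination 1, -3, 3 kills the
  linear and the quadratic term and keeps the constant one, which is \<open>- e 3\<close>.\<close>

lemma bsum_three_step:
  assumes e0: "e 0 = 0" and g: "\<And>n. n \<ge> N ==> g (Suc n) = bsum e 3 n" and r: "Suc N \<le> r"
  shows "g (3 * r) - 3 * g (2 * r) + 3 * g r = - e 3"
proof -
  define a where "a j = (int (j * r) * (int (j * r) + 1)) div 2" for j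
  have a: "2 * a j = int (j * r) * (int (j * r) + 1)" for j
  proof -
    have "even (int (j * r) * (int (j * r) + 1))" by (simp only: even_mult_iff even_plus_one_iff) blast
    thus ?thesis unfolding a_def by (rule dvd_mult_div_cancel)
  qed
  have gj: "g (j * r) = - (e 1 * a j) + e 2 * int (j * r) - e 3" if "1 \<le> j" for j
  proof -
    have "Suc N \<le> j * r" using r mult_le_mono1[OF that, of r] by linarith
    then obtain n where n: "j * r = Suc n" "N \<le> n" by (cases "j * r") auto
    thus ?thesis using g[of n] bsum_three[of e n, OF e0] by (simp only: a_def)
  qed
  have 0: "a 3 - 3 * a 2 + 3 * a 1 = 0"
  proof -
    have "2 * (a 3 - 3 * a 2 + 3 * a 1) = 0" using a[of 3] a[of 2] a[of 1] by (simp add: algebra_simps)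
    thus ?thesis by (simp only: mult_eq_0_iff) simp
  qed
  have "g (3 * r) - 3 * g (2 * r) + 3 * g (1 * r) = - (e 1 * (a 3 - 3 * a 2 + 3 * a 1)) - e 3"
    using gj[of 3] gj[of 2] gj[of 1] by (simp add: algebra_simps)
  thus ?thesis unfolding 0 by simp
qed

theorem theorem4p1:
  fixes A :: "'a ring" and m I J :: "'a set"
  assumes "cm_local A m"
    and "krull_dim A \<ge> 3"
    and "m_primary A m I" and "m_primary A m J"
    and "I \<subseteq> J"
    and "is_reduction A I J"
    and "cohen_macaulay_ring (assoc_graded A I)"
    and "asymptotically_normal A J"
  shows "hilbert_coeff A J 3 \<ge> hilbert_coeff A I 3"
proof -
  let ?Gr = "assoc_graded A I"
  have loc: "local_ring A m" and gradeA: "grade A m = krull_dim A" using assms(1) by (auto simp: cm_local_def)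
  interpret A: cring A using loc by (simp add: local_ring_def)
  have noeA: "noetherian_ring A" and maxm: "maximalideal m A" using loc by (auto simp: local_ring_def)
  have idm: "ideal m A" "m \<noteq> carrier A" using maxm maximalideal.axioms(1) maximalideal.I_notcarr by blast+
  have idI: "ideal I A" and idJ: "ideal J A" and radI: "ideal_radical A I = m"
    using assms(3,4) by (auto simp: m_primary_def primary_ideal_def)
  have Im: "I <= m"
  proof
    fix x assume x: "x \<in> I"
    hence "x \<in> carrier A" using A.ideal_carr[OF idI] by blast
    thus "x \<in> m" unfolding radI[symmetric] ideal_radical_def using x by (auto intro!: exI[of _ "1::nat"])
  qed
  have cG: "cring ?Gr" "noetherian_ring ?Gr"
    and cmG: "\<And>M. maximalideal M ?Gr ==> grade ?Gr M = ideal_height ?Gr M"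
    using assms(7) by (auto simp: cohen_macaulay_ring_def)
  interpret S: assoc A I
    by (intro assoc.intro assoc_axioms.intro A.is_cring cG noeA idI)
  obtain as where as: "A.pb I = adjs A.kr as" using A.ideal_gens[OF noeA idI] by blast
  have GI1: "S.GI 1 = A.pb I" unfolding S.GI_def by (rule A.pb_pow_1[OF idI])
  interpret L: locr A.kr "A.pb m" by (rule A.local_locr[OF loc])
  have asG: "set as <= S.GI 1" unfolding GI1 as using adjs_mem[OF A.kr_ideal] by blast
  have genG: "S.GI (Suc n) = isum (lcomb as (S.GI n)) A.kr" for n unfolding S.GI_def by (rule A.pb_pow_Suc[OF idI as])
  interpret g: grc_loc S.GI S.cog S.gr.kr A.kr "A.pb m" as
  proof (intro grc_loc.intro grc_loc_axioms.intro S.grc_assoc L.locr_axioms)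
    show "A.kr <= S.GI n" for n unfolding S.GI_def by (rule A.pb_ideal(2)[OF S.pow_ideal])
    show "S.GI 1 <= A.pb m" unfolding GI1 by (rule A.pb_mono[OF Im])
    show "set as <= S.GI 1" by (rule asG)
    show "S.GI (Suc n) <= isum (lcomb as (S.GI n)) A.kr" for n by (simp add: genG)
    show "\<exists>N. z ^ N \<in> S.GI 1" if "z \<in> A.pb m" for z
      using that unfolding GI1 by (auto simp: A.pb_def A.cov_pow radI[symmetric] ideal_radical_def)
  qed
  \<comment> \<open>Depth is bounded before the dimension is known to be finite; as the grade equals
    the dimension, this bounds the dimension too.\<close>
  obtain n0 where "\<not> dpt (A.pb m) A.kr n0"
    using depth_finite[OF L.noe L.Zid L.m_ideal L.Zm] L.one_m by blast
  hence "\<not> enat n0 \<le> krull_dim A" using A.grade_dpt[OF idm] gradeA by simp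
  then obtain d where d: "krull_dim A = enat d" by (cases "krull_dim A") auto
  have d3: "3 \<le> d" using assms(2) d by (simp add: numeral_eq_enat)
  have dA: "dpt (A.pb m) A.kr d" using A.grade_dpt[OF idm, of d] gradeA d by simp
  have MQ: "S.gr.pb (cov ?Gr ` g.M) = g.M"
    by (rule S.gr.pb_im) (use g.M_prime g.ZgM in \<open>auto simp: primep_def\<close>)
  have idM: "idealp g.M" "g.M \<noteq> UNIV" using g.M_prime by (auto simp: primep_def)
  have Mmax: "maximalideal (cov ?Gr ` g.M) ?Gr"
  proof (rule maximalidealI[OF S.gr.im_ideal[OF idM(1)]])
    show "carrier ?Gr \<noteq> cov ?Gr ` g.M" using MQ S.gr.pb_carrier idM(2) by metis
    fix L assume L: "ideal L ?Gr" "cov ?Gr ` g.M <= L" "L <= carrier ?Gr"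
    have MsubL: "g.M <= S.gr.pb L" using S.gr.pb_mono[OF L(2)] MQ by simp
    show "L = cov ?Gr ` g.M \<or> L = carrier ?Gr"
    proof (cases "S.gr.pb L = g.M")
      case True thus ?thesis using S.gr.im_pb[OF L(3)] by simp
    next
      case False
      hence "S.gr.pb L = UNIV" using MsubL S.gr.pb_ideal(1)[OF L(1)] by (intro g.M_maximal) auto
      thus ?thesis using S.gr.im_pb[OF L(3)] S.gr.im_UNIV by simp
    qed
  qed
  interpret g: grc_local S.GI S.cog S.gr.kr A.kr "A.pb m" as d
  proof (intro grc_local.intro grc_local_axioms.intro g.grc_loc_axioms dA)
    \<comment> \<open>A chain of primes ending in \<open>g.M\<close> bounds the height from below,
      and at this maximal ideal the height equals the grade.\<close>
    fix n C assume C: "\<And>i. i \<le> n ==> primep (C i) \<and> S.gr.kr <= C i" "\<And>i. i < n ==> C i \<subset> C (Suc i)" "C n = g.M"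
    have Qc: "cov ?Gr ` g.M <= carrier ?Gr" using S.gr.cov_closed by auto
    have "enat n \<le> ideal_height ?Gr (cov ?Gr ` g.M)"
      using S.gr.primep_chain_height(2)[of n C "cov ?Gr ` g.M"] C MQ Qc by auto
    hence "enat n \<le> grade ?Gr (cov ?Gr ` g.M)" using cmG[OF Mmax] by simp
    moreover have "ideal (cov ?Gr ` g.M) ?Gr" "cov ?Gr ` g.M \<noteq> carrier ?Gr"
      using Mmax maximalideal.axioms(1) maximalideal.I_notcarr by blast+
    ultimately show "dpt g.M S.gr.kr n" using S.gr.grade_dpt MQ by metis
  qed
  obtain ps where ps: "length ps = d" "in_filt S.GI ps" "regs S.GI ps" using g.exists_regs by blast
  have "n \<le> d" if "\<And>i. i \<le> n ==> primep (C i) \<and> A.kr <= C i" "\<And>i. i < n ==> C i \<subset> C (Suc i)" for n C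
    using A.primep_chain_height(1)[of n C, OF that] d by simp
  then obtain B where B: "0 \<le> B" "\<And>n. hl S.GI n \<le> B * int (Suc n) ^ d" using g.growth[OF dA] by blast
  define F where "F n = A.pb (ideal_pow A J n)" for n
  have fF: "filt F" using A.filt_pow[OF noeA idJ] unfolding F_def[abs_def] .
  have krF: "A.kr <= F n" for n unfolding F_def by (rule A.pb_ideal(2)[OF A.ideal_pow_ideal[OF idJ]])
  have F1: "S.GI 1 <= F 1" unfolding F_def A.pb_pow_1[OF idJ] GI1 by (rule A.pb_mono[OF assms(5)])
  \<comment> \<open>The reduction exponent \<open>c\<close> is both the shift between the two
    filtrations and the degree from which \<open>as\<close> generates \<open>F\<close>.\<close>
  obtain c where c: "\<And>n. c \<le> n ==> ideal_prod A I (ideal_pow A J n) = ideal_pow A J (Suc n)"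
    using assms(6) by (auto simp: is_reduction_def eventually_sequentially simp del: ideal_pow.simps)
  have genF: "F (Suc n) = isum (lcomb as (F n)) A.kr" if "c \<le> n" for n
    using A.pb_prod[OF idI A.ideal_pow_ideal[OF idJ] as, of n] c[OF that] by (simp add: F_def del: ideal_pow.simps)
  have GF: "S.GI n <= F n" for n
  proof (induction n)
    case 0 thus ?case using filt_0[OF fF] by simp
  next
    case (Suc n)
    have "a * s \<in> F (Suc n)" if "a \<in> set as" "s \<in> S.GI n" for a s
      using filt_mult[OF fF, of a 1 s n] that asG F1 Suc by auto
    thus ?case unfolding genG by (intro isum_least lcomb_least filt_ideal[OF fF] krF)
  qed
  have FG: "F (n + c) <= S.GI n" for n
  proof (induction n)
    case 0 thus ?case using filt_0[OF S.filtGI] by simp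
  next
    case (Suc n)
    have "F (Suc (n + c)) <= S.GI (Suc n)" unfolding genF[of "n + c", simplified] genG by (rule isum_mono[OF lcomb_mono[OF Suc] order_refl])
    thus ?case by simp
  qed
  have finF: "colen (F n) \<noteq> \<infinity>" for n
    using colen_antimono[OF filt_ideal[OF S.filtGI] filt_ideal[OF fF] GF, of n] g.m_nil_colen[of n] by (intro notI) simp
  have st: "stage F S.GI as c c"
  proof (intro stage.intro fF S.filtGI GF FG asG finF)
    show "S.GI (Suc n) <= isum (lcomb as (S.GI n)) (S.GI (Suc (Suc n)))" for n
      unfolding genG[of n] by (rule isum_mono[OF order_refl g.ZG])
    show "F (Suc n) <= isum (lcomb as (F n)) (F (Suc (Suc n)))" if "c \<le> n" for n
      unfolding genF[OF that] by (rule isum_mono[OF order_refl krF])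
  qed
  obtain n1 where n1: "\<And>n. n \<ge> n1 ==> integrally_closed_ideal A (ideal_pow A J n)"
    using assms(8) by (auto simp: asymptotically_normal_def eventually_sequentially)
  have cl: "closedf F n1" unfolding F_def
  proof (rule A.closedf_of_integrally_closed[OF noeA idJ n1])
    fix C
    \<comment> \<open>Positive dimension provides a nonzerodivisor of the local ring in every power
      of \<open>J\<close>, the element \<open>c\<close> that turns integral closedness into
      \<open>closedf\<close>.\<close>
    obtain d' where "d = Suc d'" using d3 by (cases d) auto
    hence "dpt (A.pb m) A.kr (Suc d')" using dA by simp
    then obtain y where y: "y \<in> A.pb m" "nzd A.kr y" unfolding dpt_Suc by blast
    obtain N where "y ^ N \<in> S.GI 1" using g.nil[OF y(1)] by blast
    hence "(y ^ N) ^ C \<in> F (C * 1)" using F1 by (intro filt_pow[OF fF]) blast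
    moreover have "nzd A.kr ((y ^ N) ^ C)" using g.nzd_pow[OF y(2), of "N * C"] by (simp add: power_mult)
    ultimately show "\<exists>c. c \<in> A.pb (ideal_pow A J C) \<and> nzd A.kr c" by (auto simp: F_def)
  qed
  obtain k where k: "ev_const ((dl ^^ d) (hl S.GI)) k" "ev_const ((dl ^^ d) (hl F)) k"
    using fr.hilbert_leading_coefficient[OF st ps(2,3,1) B(2,1)] by blast
  obtain eI NI where eI: "eI 0 = k" "\<forall>i>d. eI i = 0" "\<And>n. n \<ge> NI ==> hl S.GI (Suc n) = bsum eI d n"
    using binomial_expansion_exists[OF k(1)] by blast
  obtain eJ NJ where eJ: "eJ 0 = k" "\<forall>i>d. eJ i = 0" "\<And>n. n \<ge> NJ ==> hl F (Suc n) = bsum eJ d n"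
    using binomial_expansion_exists[OF k(2)] by blast
  have hI: "hilbert_coeff A I = eI"
    by (rule A.hilbert_coeff_eq[OF d idI _ eI(2) eI(3)[unfolded S.GI_def[abs_def]]]) (use g.m_nil_colen in \<open>simp_all add: S.GI_def\<close>)
  have hJ: "hilbert_coeff A J = eJ"
    by (rule A.hilbert_coeff_eq[OF d idJ _ eJ(2) eJ(3)[unfolded F_def[abs_def]]]) (use finF in \<open>simp_all add: F_def\<close>)
  \<comment> \<open>Both expansions begin with the same \<open>k\<close>, so \<open>e 0\<close>
    vanishes and no cubic term is left after the cuts.\<close>
  define e where "e i = eI i - eJ i" for i
  define i where "i = d - 3"
  have di: "d = i + 3" using d3 by (simp add: i_def)
  have "hl S.GI (Suc n) - hl F (Suc n) = bsum e (i + 3) n" if "n \<ge> max NI NJ" for n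
    using eI(3)[of n] eJ(3)[of n] that bsum_minus[of eI d n eJ] by (simp add: e_def[abs_def] di)
  then obtain N where N: "\<And>n. n \<ge> N ==> (nb ^^ i) (\<lambda>n. hl S.GI n - hl F n) (Suc n) = bsum e 3 n"
    using nb_bsum[of "max NI NJ" "\<lambda>n. hl S.GI n - hl F n" e i 3] by blast
  obtain r where r: "Suc N \<le> r" "let g = (nb ^^ i) (\<lambda>n. hl S.GI n - hl F n) in 0 \<le> g (3 * r) - 3 * g (2 * r) + 3 * g r"
    using fr.iterated_inequality[OF st cl ps(2,3) ps(1)[unfolded di] k(1)[unfolded di], of "Suc N"] by blast
  have "e 0 = 0" using eI(1) eJ(1) by (simp add: e_def)
  hence "0 \<le> - e 3" using bsum_three_step[of e N, OF _ N r(1)] r(2) by (simp add: Let_def)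
  thus ?thesis unfolding hI hJ by (simp add: e_def)
qed

end
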